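(* Every $4$-connected graph $G$ with $|E(G)| \geq 4|V(G)| - 8$ has a $K_7^{\vee}$-minor, unless $G \simeq K_{2,2,2,2}$.
   Context: Graphs are finite and simple. $K_7^{\vee}$ denotes the graph obtained from the complete graph $K_7$ on seven vertices by deleting two edges with a common end. A graph $H$ is a minor of $G$ (equivalently, $G$ has an $H$-minor) if a graph isomorphic to $H$ can be obtained from a subgraph of $G$ by contracting edges. $K_{2,2,2,2}$ is the complete $4$-partite graph with all parts of size two, i.e. $K_8$ minus a perfect matching. $G \simeq H$ means that $G$ and $H$ are isomorphic. A graph is $4$-connected if it has at least $5$ vertices and deleting any set of fewer than $4$ vertices leaves a connected graph. *)

theory Defs
  imports "Graph_Theory.Graph_Theory"
begin

text \<open>
  A finite simple graph is a \<^locale>\<open>pair_graph\<close>: a finite, loop-free, symmetric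
  digraph without parallel arcs. An undirected edge \<open>uv\<close> is represented by the two
  arcs \<open>(u, v)\<close> and \<open>(v, u)\<close>, so edges are counted as unordered pairs.
\<close>

definition edges :: "'a pair_pre_digraph \<Rightarrow> 'a set set" where
  "edges G = {{u, v} | u v. (u, v) \<in> parcs G}"

definition k_connected :: "nat \<Rightarrow> 'a pair_pre_digraph \<Rightarrow> bool" where
  "k_connected k G \<longleftrightarrow> k + 1 \<le> card (pverts G) \<and>
     (\<forall>S \<subseteq> pverts G. card S < k \<longrightarrow>
        Digraph_Component.connected (with_proj G \<restriction> (pverts G - S)))"

text \<open>
  Contracting the edge \<open>uv\<close> keeps the name \<open>u\<close> for the merged vertex; the loop that arises
  is removed, and parallel edges are identified because the arcs form a set.
\<close>

definition contract_edge :: "'a \<Rightarrow> 'a \<Rightarrow> 'a pair_pre_digraph \<Rightarrow> 'a pair_pre_digraph" where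
  "contract_edge u v G =
     (let f = (\<lambda>w. if w = v then u else w)
      in \<lparr> pverts = f ` pverts G, parcs = map_prod f f ` parcs G - Id \<rparr>)"

definition contraction_step :: "'a pair_pre_digraph \<Rightarrow> 'a pair_pre_digraph \<Rightarrow> bool" where
  "contraction_step G H \<longleftrightarrow> (\<exists>u v. (u, v) \<in> parcs G \<and> H = contract_edge u v G)"

text \<open>
  A digraph-subgraph of a symmetric digraph need not be symmetric, hence the explicit
  \<^term>\<open>pair_graph K\<close>.
\<close>

definition has_minor :: "'a pair_pre_digraph \<Rightarrow> 'b pair_pre_digraph \<Rightarrow> bool" where
  "has_minor G H \<longleftrightarrow>
     (\<exists>K L. pair_graph K \<and> subgraph (with_proj K) (with_proj G) \<and>
            contraction_step\<^sup>*\<^sup>* K L \<and> digraph_iso (with_proj L) (with_proj H))"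

definition complete_graph :: "'a set \<Rightarrow> 'a pair_pre_digraph" where
  "complete_graph V = \<lparr> pverts = V, parcs = V \<times> V - Id \<rparr>"

definition delete_edges :: "'a pair_pre_digraph \<Rightarrow> 'a set set \<Rightarrow> 'a pair_pre_digraph" where
  "delete_edges G F = \<lparr> pverts = pverts G, parcs = {(u, v) \<in> parcs G. {u, v} \<notin> F} \<rparr>"

definition K7_vee :: "nat pair_pre_digraph" where
  "K7_vee = delete_edges (complete_graph {..<7}) {{0, 1}, {0, 2}}"

text \<open>The vertex \<open>(i, j)\<close> is the \<open>j\<close>-th vertex of the \<open>i\<close>-th part.\<close>

definition K_2222 :: "(nat \<times> nat) pair_pre_digraph" where
  "K_2222 = \<lparr> pverts = {..<4} \<times> {..<2},
      parcs = {(x, y) \<in> ({..<4} \<times> {..<2}) \<times> ({..<4} \<times> {..<2}). fst x \<noteq> fst y} \<rparr>"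

end

theory Submission
  imports Defs
begin

text \<open>
  Call a graph dense if \<open>|E| \<ge> 4|V| - 8\<close>. The core is \<open>dense_four_connected\<close>: a dense 4-connected graph
  contains \<open>K\<^sub>7\<close> minus a cherry as a minor or is \<open>K\<^sub>2\<^sub>,\<^sub>2\<^sub>,\<^sub>2\<^sub>,\<^sub>2\<close>. Graphs are given there by a finite vertex set and an adjacency
  predicate, minors by branch sets, and connectivity by the sizes of vertex boundaries. The proof is by induction on
  the number of vertices. Two operations produce smaller dense graphs: contracting an edge in at most three triangles, and
  replacing one side of a 4-cut by a clique on the cut, provided that many edges are on the other side. The second one gives a
  minor if the replaced side contains the clique rooted at the cut (\<open>heavy_side\<close>). A minimum counterexample therefore resists both of them.

  Suppose that the minimum degree is at least five. An edge in few triangles can only be uncontractible because it lies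
  in a 4-cut, and a minimum fragment \<open>F\<close> of such a cut meets no such edge (\<open>atom_heavy\<close>); if there is no 4-cut, then \<open>F\<close> is the
  whole graph. So every edge at \<open>F\<close> is in four triangles, and the neighbourhoods of vertices of small degree in \<open>F\<close> are nearly complete. Since
  the graph with the other side of \<open>F\<close> contracted to a star on the cut is 4-connected as well, it cannot be too dense, and hence
  the degrees in \<open>F\<close> are below eight on average (\<open>low_part\<close>). A vertex of degree five or seven yields the minor at once, and so
  does one of degree six unless its neighbourhood is an octahedron. So there are two octahedral
  vertices, and these yield the minor whether or not they are adjacent; in the second case four disjoint paths
  between the neighbourhoods are used (\<open>octa_nonadjacent\<close>).

  Suppose that some vertex \<open>v\<close> has degree four. Contracting \<open>v\<close> into a suitable neighbour \<open>t\<close> preserves density but only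
  3-connectivity. Splitting the result along 3-cuts, one arrives at eight vertices \<open>X\<close> that span \<open>K\<^sub>2\<^sub>,\<^sub>2\<^sub>,\<^sub>2\<^sub>,\<^sub>2\<close> once the
  attachments of the components beyond \<open>X\<close> are made complete (\<open>piece_exists\<close>). Either all these edges are present already, and
  the rest of the graph attaches to enough vertices of \<open>X\<close> to give the minor (\<open>cocktail_attach\<close>), or some component has many
  edges. In the second case its boundary is a 4-cut that contains \<open>v\<close> and \<open>t\<close>, the other side contains a clique rooted at
  this cut (\<open>clique_supply\<close>), and replacing the other side by the clique would have to give \<open>K\<^sub>2\<^sub>,\<^sub>2\<^sub>,\<^sub>2\<^sub>,\<^sub>2\<close>, which has too few edges.
\<close>

section \<open>Simple graphs, boundaries and connected sets\<close>

definition ugraph :: "'a set \<Rightarrow> ('a \<Rightarrow> 'a \<Rightarrow> bool) \<Rightarrow> bool" where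
  "ugraph V E \<longleftrightarrow> finite V \<and> (\<forall>x y. E x y \<longrightarrow> x \<in> V \<and> y \<in> V \<and> x \<noteq> y \<and> E y x)"

definition nbh :: "('a \<Rightarrow> 'a \<Rightarrow> bool) \<Rightarrow> 'a set \<Rightarrow> 'a set" where
  "nbh E C = {y. y \<notin> C \<and> (\<exists>x\<in>C. E x y)}"

definition touches :: "('a \<Rightarrow> 'a \<Rightarrow> bool) \<Rightarrow> 'a set \<Rightarrow> 'a set \<Rightarrow> bool" where
  "touches E A B \<longleftrightarrow> (\<exists>a\<in>A. \<exists>b\<in>B. E a b)"

text \<open>Connectedness by cuts instead of paths: every proper nonempty part touches the rest.\<close>
definition conn_set :: "('a \<Rightarrow> 'a \<Rightarrow> bool) \<Rightarrow> 'a set \<Rightarrow> bool" where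
  "conn_set E S \<longleftrightarrow> S \<noteq> {} \<and> (\<forall>A. A \<subseteq> S \<and> A \<noteq> {} \<and> A \<noteq> S \<longrightarrow> touches E A (S - A))"

text \<open>Empty if \<open>x\<close> is not in \<open>U\<close>.\<close>
definition component :: "('a \<Rightarrow> 'a \<Rightarrow> bool) \<Rightarrow> 'a set \<Rightarrow> 'a \<Rightarrow> 'a set" where
  "component E U x = \<Union>{S. S \<subseteq> U \<and> x \<in> S \<and> conn_set E S}"

text \<open>
  Small separators are excluded as boundaries: \<open>C \<union> nbh E C \<noteq> V\<close> says that some vertex lies beyond the boundary of \<open>C\<close>.
\<close>
definition k_conn :: "nat \<Rightarrow> 'a set \<Rightarrow> ('a \<Rightarrow> 'a \<Rightarrow> bool) \<Rightarrow> bool" where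
  "k_conn k V E \<longleftrightarrow> k < card V \<and>
     (\<forall>C. C \<subseteq> V \<and> C \<noteq> {} \<and> C \<union> nbh E C \<noteq> V \<longrightarrow> k \<le> card (nbh E C))"

lemma ugraph_sym: "ugraph V E \<Longrightarrow> E x y \<Longrightarrow> E y x"
  by (auto simp: ugraph_def)

lemma ugraph_symp: "ugraph V E \<Longrightarrow> symp E"
  by (auto simp: ugraph_def intro: sympI)

lemma ugraph_in: "ugraph V E \<Longrightarrow> E x y \<Longrightarrow> x \<in> V \<and> y \<in> V \<and> x \<noteq> y"
  by (auto simp: ugraph_def)

lemma ugraph_finite: "ugraph V E \<Longrightarrow> finite V"
  by (auto simp: ugraph_def)

lemma nbh_subset: "ugraph V E \<Longrightarrow> nbh E C \<subseteq> V"
  by (auto simp: ugraph_def nbh_def)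

lemma finite_nbh: "ugraph V E \<Longrightarrow> finite (nbh E C)"
  by (meson finite_subset nbh_subset ugraph_finite)

lemma nbh_disjoint: "C \<inter> nbh E C = {}"
  by (auto simp: nbh_def)

lemma touches_sym: "symp E \<Longrightarrow> touches E A B \<longleftrightarrow> touches E B A"
  by (auto simp: touches_def dest: sympD)

lemma touches_mono: "touches E A B \<Longrightarrow> A \<subseteq> A' \<Longrightarrow> B \<subseteq> B' \<Longrightarrow> touches E A' B'"
  by (auto simp: touches_def)

lemma touches_simps [simp]:
  "\<not> touches E {} B" "\<not> touches E A {}"
  "touches E (insert a A) B \<longleftrightarrow> (\<exists>b\<in>B. E a b) \<or> touches E A B"
  "touches E (A \<union> A') B \<longleftrightarrow> touches E A B \<or> touches E A' B"
  "touches E A (B \<union> B') \<longleftrightarrow> touches E A B \<or> touches E A B'"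
  by (auto simp: touches_def)

lemma touches_insert_right:
  "touches E A (insert b B) \<longleftrightarrow> (\<exists>a\<in>A. E a b) \<or> touches E A B"
  by (auto simp: touches_def)

lemma conn_set_singleton [simp]: "conn_set E {x}"
  by (auto simp: conn_set_def)

lemma conn_set_nonempty: "conn_set E S \<Longrightarrow> S \<noteq> {}"
  by (auto simp: conn_set_def)

lemma conn_set_Un:
  assumes "symp E" "conn_set E A" "conn_set E B" "A \<inter> B \<noteq> {} \<or> touches E A B"
  shows "conn_set E (A \<union> B)"
  unfolding conn_set_def
proof (intro conjI allI impI)
  show "A \<union> B \<noteq> {}" using assms by (auto simp: conn_set_def)
  fix X assume X: "X \<subseteq> A \<union> B \<and> X \<noteq> {} \<and> X \<noteq> A \<union> B"
  have ta: "touches E X (A \<union> B - X)" if "X \<inter> A \<noteq> {}" "X \<inter> A \<noteq> A"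
  proof -
    have "touches E (X \<inter> A) (A - X \<inter> A)" using assms(2) that by (auto simp: conn_set_def)
    then show ?thesis by (rule touches_mono) auto
  qed
  have tb: "touches E X (A \<union> B - X)" if "X \<inter> B \<noteq> {}" "X \<inter> B \<noteq> B"
  proof -
    have "touches E (X \<inter> B) (B - X \<inter> B)" using assms(3) that by (auto simp: conn_set_def)
    then show ?thesis by (rule touches_mono) auto
  qed
  consider "X \<inter> A \<noteq> {}" "X \<inter> A \<noteq> A" | "X \<inter> B \<noteq> {}" "X \<inter> B \<noteq> B"
    | "A \<subseteq> X" "X \<inter> B = {}" | "B \<subseteq> X" "X \<inter> A = {}"
    using X by blast
  then show "touches E X (A \<union> B - X)"
  proof cases
    case 3
    then have "A \<inter> B = {}" by auto
    then have "touches E A B" using assms by auto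
    then show ?thesis by (rule touches_mono) (use 3 in auto)
  next
    case 4
    then have "A \<inter> B = {}" by auto
    then have "touches E B A" using assms touches_sym by auto
    then show ?thesis by (rule touches_mono) (use 4 in auto)
  qed (use ta tb in auto)
qed

lemma conn_set_insert:
  assumes "symp E" "conn_set E A" "a \<in> A" "E a b \<or> E b a"
  shows "conn_set E (insert b A)"
proof -
  have "E a b" using assms by (auto dest: sympD)
  then have "conn_set E (A \<union> {b})"
    using assms by (intro conn_set_Un) (auto simp: touches_def)
  then show ?thesis by simp
qed

lemma conn_set_pair: "symp E \<Longrightarrow> E a b \<Longrightarrow> conn_set E {a, b}"
  using conn_set_insert[of E "{b}" b a] by (auto dest: sympD)

lemma conn_set_Union:
  assumes "symp E" "\<And>S. S \<in> F \<Longrightarrow> conn_set E S \<and> x \<in> S" "F \<noteq> {}"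
  shows "conn_set E (\<Union>F)"
  unfolding conn_set_def
proof (intro conjI allI impI)
  show "\<Union>F \<noteq> {}" using assms by blast
  fix X assume X: "X \<subseteq> \<Union>F \<and> X \<noteq> {} \<and> X \<noteq> \<Union>F"
  have key: "touches E X (\<Union>F - X)" if S: "S \<in> F" "S \<inter> X \<noteq> {}" "S \<inter> X \<noteq> S" for S
  proof -
    have "touches E (S \<inter> X) (S - S \<inter> X)"
      using assms(2)[OF S(1)] S by (auto simp: conn_set_def)
    then show ?thesis by (rule touches_mono) (use S in auto)
  qed
  show "touches E X (\<Union>F - X)"
  proof (cases "x \<in> X")
    case True
    obtain y S where "y \<in> S" "S \<in> F" "y \<notin> X" using X by blast
    then show ?thesis using key[of S] True assms(2) by blast
  next
    case False
    obtain y S where "y \<in> S" "S \<in> F" "y \<in> X" using X by blast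
    then show ?thesis using key[of S] False assms(2) by blast
  qed
qed

lemma component_props:
  assumes "symp E" "x \<in> U"
  shows "conn_set E (component E U x)" "x \<in> component E U x" "component E U x \<subseteq> U"
    "nbh E (component E U x) \<inter> U = {}"
proof -
  have F: "{S. S \<subseteq> U \<and> x \<in> S \<and> conn_set E S} \<noteq> {}"
    using assms by (auto intro!: exI[of _ "{x}"])
  show c: "conn_set E (component E U x)"
    unfolding component_def using conn_set_Union[OF assms(1) _ F, of x] by auto
  show x: "x \<in> component E U x"
    unfolding component_def using assms by (auto intro!: exI[of _ "{x}"])
  show s: "component E U x \<subseteq> U" by (auto simp: component_def)
  show "nbh E (component E U x) \<inter> U = {}"
  proof (rule ccontr)
    assume "nbh E (component E U x) \<inter> U \<noteq> {}"
    then obtain a b where ab: "a \<in> component E U x" "E a b" "b \<in> U" "b \<notin> component E U x"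
      by (auto simp: nbh_def)
    have "conn_set E (insert b (component E U x))"
      using conn_set_insert[OF assms(1) c ab(1)] ab by auto
    then have "insert b (component E U x) \<in> {S. S \<subseteq> U \<and> x \<in> S \<and> conn_set E S}"
      using x s ab(3) by simp
    then have "insert b (component E U x) \<subseteq> component E U x"
      unfolding component_def by (rule Union_upper)
    then show False using ab(4) by simp
  qed
qed

text \<open>
  A set without neighbours in \<open>U\<close> swallows every connected part of \<open>U\<close> that it meets, which identifies components.
\<close>
lemma conn_set_absorb:
  assumes "conn_set E K" "K \<subseteq> U" "K \<inter> D \<noteq> {}" "nbh E D \<inter> U = {}"
  shows "K \<subseteq> D"
proof (rule ccontr)
  assume "\<not> K \<subseteq> D"
  then have "touches E (K \<inter> D) (K - K \<inter> D)" using assms by (auto simp: conn_set_def)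
  then show False using assms by (auto simp: touches_def nbh_def)
qed

lemma nbh_component:
  assumes "ugraph V E" "x \<in> V - S"
  shows "nbh E (component E (V - S) x) \<subseteq> S"
  using component_props(4)[OF ugraph_symp[OF assms(1)] assms(2)] nbh_subset[OF assms(1)] by blast

section \<open>Minor models\<close>

definition minor_model ::
  "'a set \<Rightarrow> ('a \<Rightarrow> 'a \<Rightarrow> bool) \<Rightarrow> 'i set \<Rightarrow> ('i \<Rightarrow> 'i \<Rightarrow> bool) \<Rightarrow> ('i \<Rightarrow> 'a set) \<Rightarrow> bool" where
  "minor_model V E I R B \<longleftrightarrow>
     (\<forall>i\<in>I. B i \<subseteq> V \<and> conn_set E (B i)) \<and>
     (\<forall>i\<in>I. \<forall>j\<in>I. i \<noteq> j \<longrightarrow> B i \<inter> B j = {}) \<and>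
     (\<forall>i\<in>I. \<forall>j\<in>I. R i j \<longrightarrow> touches E (B i) (B j))"

definition vee_adj :: "nat \<Rightarrow> nat \<Rightarrow> bool" where
  "vee_adj i j \<longleftrightarrow> i < 7 \<and> j < 7 \<and> i \<noteq> j \<and> {i, j} \<noteq> {0, 1} \<and> {i, j} \<noteq> {0, 2}"

definition K7v_minor :: "'a set \<Rightarrow> ('a \<Rightarrow> 'a \<Rightarrow> bool) \<Rightarrow> bool" where
  "K7v_minor V E \<longleftrightarrow> (\<exists>B. minor_model V E {..<7} vee_adj B)"

lemma conn_set_UN:
  assumes "symp E" "conn_set F S" "\<And>u. u \<in> S \<Longrightarrow> conn_set E (B u)"
    "\<And>u w. u \<in> S \<Longrightarrow> w \<in> S \<Longrightarrow> F u w \<Longrightarrow> touches E (B u) (B w)"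
  shows "conn_set E (\<Union>u\<in>S. B u)"
  unfolding conn_set_def
proof (intro conjI allI impI)
  show "(\<Union>u\<in>S. B u) \<noteq> {}"
    using conn_set_nonempty[OF assms(2)] assms(3) by (auto simp: conn_set_def)
  fix X assume X: "X \<subseteq> (\<Union>u\<in>S. B u) \<and> X \<noteq> {} \<and> X \<noteq> (\<Union>u\<in>S. B u)"
  show "touches E X ((\<Union>u\<in>S. B u) - X)"
  proof (cases "\<exists>u\<in>S. B u \<inter> X \<noteq> {} \<and> \<not> B u \<subseteq> X")
    case True
    then obtain u where u: "u \<in> S" "B u \<inter> X \<noteq> {}" "\<not> B u \<subseteq> X" by blast
    have "touches E (B u \<inter> X) (B u - B u \<inter> X)"
      using assms(3)[OF u(1)] u by (auto simp: conn_set_def)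
    then show ?thesis by (rule touches_mono) (use u(1) in blast)+
  next
    case False
    define T where "T = {u\<in>S. B u \<subseteq> X}"
    obtain a b where ab: "a \<in> X" "b \<in> (\<Union>u\<in>S. B u)" "b \<notin> X" using X by blast
    obtain u where "u \<in> S" "a \<in> B u" using ab(1) X by blast
    then have "u \<in> T" using False ab(1) by (auto simp: T_def)
    moreover obtain w where "w \<in> S" "b \<in> B w" using ab(2) by blast
    then have "w \<in> S - T" using ab(3) by (auto simp: T_def)
    ultimately have "T \<noteq> {}" "T \<noteq> S" by auto
    then have "touches F T (S - T)" using assms(2) by (auto simp: conn_set_def T_def)
    then obtain u w where uw: "u \<in> T" "w \<in> S - T" "F u w" by (auto simp: touches_def)
    have "touches E (B u) (B w)" using assms(4) uw by (auto simp: T_def)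
    then show ?thesis by (rule touches_mono) (use uw False in \<open>auto simp: T_def\<close>)
  qed
qed

lemma minor_model_trans:
  assumes "symp E" "minor_model V E U F B" "minor_model U F I R B'"
  shows "minor_model V E I R (\<lambda>i. \<Union>u\<in>B' i. B u)"
  unfolding minor_model_def
proof (intro conjI ballI impI)
  fix i assume i: "i \<in> I"
  have sub: "B' i \<subseteq> U" using assms(3) i by (auto simp: minor_model_def)
  show "(\<Union>u\<in>B' i. B u) \<subseteq> V" using assms(2) sub by (auto simp: minor_model_def)
  show "conn_set E (\<Union>u\<in>B' i. B u)"
  proof (rule conn_set_UN[OF assms(1)])
    show "conn_set F (B' i)" using assms(3) i by (auto simp: minor_model_def)
    show "conn_set E (B u)" if "u \<in> B' i" for u using assms(2) that sub by (auto simp: minor_model_def)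
    show "touches E (B u) (B w)" if "u \<in> B' i" "w \<in> B' i" "F u w" for u w
      using assms(2) that sub unfolding minor_model_def by (meson subsetD)
  qed
  fix j assume j: "j \<in> I"
  have sub': "B' j \<subseteq> U" using assms(3) j by (auto simp: minor_model_def)
  { assume "i \<noteq> j"
    then have "B' i \<inter> B' j = {}" using assms(3) i j by (auto simp: minor_model_def)
    then have "B u \<inter> B w = {}" if "u \<in> B' i" "w \<in> B' j" for u w
      using assms(2) sub sub' that unfolding minor_model_def by (metis disjoint_iff subsetD)
    then show "(\<Union>u\<in>B' i. B u) \<inter> (\<Union>u\<in>B' j. B u) = {}" by blast }
  { assume "R i j"
    then obtain a b where "a \<in> B' i" "b \<in> B' j" "F a b"
      using assms(3) i j unfolding minor_model_def touches_def by meson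
    then have "touches E (B a) (B b)" using assms(2) sub sub' unfolding minor_model_def by (meson subsetD)
    then show "touches E (\<Union>u\<in>B' i. B u) (\<Union>u\<in>B' j. B u)"
      by (rule touches_mono) (use \<open>a \<in> B' i\<close> \<open>b \<in> B' j\<close> in auto) }
qed

lemma K7v_minor_trans:
  "symp E \<Longrightarrow> minor_model V E U F B \<Longrightarrow> K7v_minor U F \<Longrightarrow> K7v_minor V E"
  unfolding K7v_minor_def using minor_model_trans by blast

lemma K7v_minor_mono:
  assumes "K7v_minor U F" "U \<subseteq> V" "\<And>x y. x \<in> U \<Longrightarrow> y \<in> U \<Longrightarrow> F x y \<Longrightarrow> E x y" "symp E"
  shows "K7v_minor V E"
proof -
  have "minor_model V E U F (\<lambda>u. {u})"
    using assms by (auto simp: minor_model_def)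
  then show ?thesis using K7v_minor_trans assms by blast
qed

text \<open>
  The branch sets are named after their role in \<open>K\<^sub>7\<close> minus a cherry: \<open>Z\<close> is the vertex of degree
  four, \<open>X\<close> and \<open>Y\<close> are the two vertices it misses, and the \<open>S\<close>s form the clique on its neighbours.
\<close>
lemma K7v_minorI:
  assumes E: "symp E"
    and c: "conn_set E Z" "conn_set E X" "conn_set E Y" "conn_set E S1" "conn_set E S2" "conn_set E S3"
      "conn_set E S4"
    and V: "Z \<union> X \<union> Y \<union> S1 \<union> S2 \<union> S3 \<union> S4 \<subseteq> V"
    and d: "Z \<inter> (X \<union> Y \<union> S1 \<union> S2 \<union> S3 \<union> S4) = {}" "X \<inter> (Y \<union> S1 \<union> S2 \<union> S3 \<union> S4) = {}"
      "Y \<inter> (S1 \<union> S2 \<union> S3 \<union> S4) = {}" "S1 \<inter> (S2 \<union> S3 \<union> S4) = {}" "S2 \<inter> (S3 \<union> S4) = {}" "S3 \<inter> S4 = {}"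
    and t: "touches E X Y"
      "touches E Z S1" "touches E Z S2" "touches E Z S3" "touches E Z S4"
      "touches E X S1" "touches E X S2" "touches E X S3" "touches E X S4"
      "touches E Y S1" "touches E Y S2" "touches E Y S3" "touches E Y S4"
      "touches E S1 S2" "touches E S1 S3" "touches E S1 S4" "touches E S2 S3" "touches E S2 S4"
      "touches E S3 S4"
  shows "K7v_minor V E"
proof -
  define B where "B = (\<lambda>i. [Z, X, Y, S1, S2, S3, S4] ! i)"
  have lt: "{..<7} = {0, 1, 2, 3, 4, 5, 6::nat}" by auto
  have B: "B 0 = Z" "B 1 = X" "B (Suc 0) = X" "B 2 = Y" "B 3 = S1" "B 4 = S2" "B 5 = S3" "B 6 = S4"
    by (auto simp: B_def)
  have t': "touches E b a" if "touches E a b" for a b using that touches_sym[OF E] by blast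
  have "minor_model V E {..<7} vee_adj B"
    unfolding minor_model_def
  proof (intro conjI)
    show "\<forall>i\<in>{..<7}. B i \<subseteq> V \<and> conn_set E (B i)" unfolding lt using c V by (auto simp: B)
    show "\<forall>i\<in>{..<7}. \<forall>j\<in>{..<7}. i \<noteq> j \<longrightarrow> B i \<inter> B j = {}" unfolding lt 
    proof -
      have "Z \<inter> X = {}" "Z \<inter> Y = {}" "Z \<inter> S1 = {}" "Z \<inter> S2 = {}" "Z \<inter> S3 = {}" "Z \<inter> S4 = {}"
        "X \<inter> Y = {}" "X \<inter> S1 = {}" "X \<inter> S2 = {}" "X \<inter> S3 = {}" "X \<inter> S4 = {}"
        "Y \<inter> S1 = {}" "Y \<inter> S2 = {}" "Y \<inter> S3 = {}" "Y \<inter> S4 = {}"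
        "S1 \<inter> S2 = {}" "S1 \<inter> S3 = {}" "S1 \<inter> S4 = {}" "S2 \<inter> S3 = {}" "S2 \<inter> S4 = {}" "S3 \<inter> S4 = {}"
        using d by auto
      then show "\<forall>i\<in>{0,1,2,3,4,5,6}. \<forall>j\<in>{0,1,2,3,4,5,6}. i \<noteq> j \<longrightarrow> B i \<inter> B j = {}"
        by (simp add: B Int_commute)
    qed

    show "\<forall>i\<in>{..<7}. \<forall>j\<in>{..<7}. vee_adj i j \<longrightarrow> touches E (B i) (B j)" unfolding lt using t t'
      by (simp add: B vee_adj_def doubleton_eq_iff)
  qed
  then show ?thesis unfolding K7v_minor_def by blast
qed

section \<open>Counting edges\<close>

text \<open>Every edge with both ends in \<open>A \<inter> B\<close> is counted twice, so \<open>arcs_between E V V\<close> is twice the number of edges.\<close>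
definition arcs_between :: "('a \<Rightarrow> 'a \<Rightarrow> bool) \<Rightarrow> 'a set \<Rightarrow> 'a set \<Rightarrow> nat" where
  "arcs_between E A B = (\<Sum>x\<in>A. \<Sum>y\<in>B. of_bool (E x y))"

lemma arcs_between_sym: "symp E \<Longrightarrow> arcs_between E A B = arcs_between E B A"
  unfolding arcs_between_def
  by (subst sum.swap) (auto intro!: sum.cong simp: of_bool_def dest: sympD)

lemma arcs_between_Un_left:
  "finite A \<Longrightarrow> finite B \<Longrightarrow> A \<inter> B = {} \<Longrightarrow> arcs_between E (A \<union> B) C = arcs_between E A C + arcs_between E B C"
  by (simp add: arcs_between_def sum.union_disjoint)

lemma arcs_between_Un_right:
  "finite A \<Longrightarrow> finite B \<Longrightarrow> A \<inter> B = {} \<Longrightarrow> arcs_between E C (A \<union> B) = arcs_between E C A + arcs_between E C B"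
  unfolding arcs_between_def by (subst sum.distrib[symmetric]) (intro sum.cong sum.union_disjoint, auto)

lemma arcs_between_eq_sum_card:
  "finite B \<Longrightarrow> arcs_between E A B = (\<Sum>x\<in>A. card {y\<in>B. E x y})"
  unfolding arcs_between_def by (simp add: of_bool_def sum.If_cases Int_def)

lemma arcs_between_eq_0: "(\<And>x y. x \<in> A \<Longrightarrow> y \<in> B \<Longrightarrow> \<not> E x y) \<Longrightarrow> arcs_between E A B = 0"
  by (simp add: arcs_between_def)

lemma arcs_between_cong:
  "(\<And>x y. x \<in> A \<Longrightarrow> y \<in> B \<Longrightarrow> E x y = F x y) \<Longrightarrow> arcs_between E A B = arcs_between F A B"
  by (simp add: arcs_between_def)

lemma arcs_between_mono:
  "(\<And>x y. x \<in> A \<Longrightarrow> y \<in> B \<Longrightarrow> E x y \<Longrightarrow> F x y) \<Longrightarrow> arcs_between E A B \<le> arcs_between F A B"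
  unfolding arcs_between_def by (intro sum_mono) (auto simp: of_bool_def)

lemma arcs_between_split:
  assumes "symp E" "finite A" "finite B" "A \<inter> B = {}"
  shows "arcs_between E (A \<union> B) (A \<union> B) = arcs_between E A A + 2 * arcs_between E A B + arcs_between E B B"
  using assms arcs_between_sym[OF assms(1), of A B]
  by (simp add: arcs_between_Un_left arcs_between_Un_right)

section \<open>Contracting an edge\<close>

definition contract :: "'a \<Rightarrow> 'a \<Rightarrow> ('a \<Rightarrow> 'a \<Rightarrow> bool) \<Rightarrow> 'a \<Rightarrow> 'a \<Rightarrow> bool" where
  "contract x y E u w \<longleftrightarrow>
     u \<noteq> y \<and> w \<noteq> y \<and> u \<noteq> w \<and> (E u w \<or> u = x \<and> E y w \<or> w = x \<and> E u y)"

lemma ugraph_contract: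
  assumes "ugraph V E" "E x y"
  shows "ugraph (V - {y}) (contract x y E)"
  using assms ugraph_in[OF assms(1)] ugraph_sym[OF assms(1)]
  by (auto simp: ugraph_def[of "V - {y}"] ugraph_finite contract_def)

lemma symp_contract: "symp E \<Longrightarrow> symp (contract x y E)"
  unfolding symp_def contract_def by blast

lemma minor_model_contract:
  assumes "ugraph V E" "E x y"
  shows "minor_model V E (V - {y}) (contract x y E) (\<lambda>u. if u = x then {x, y} else {u})"
proof -
  have xy: "x \<in> V" "y \<in> V" "x \<noteq> y" using ugraph_in[OF assms] by auto
  have s: "symp E" by (rule ugraph_symp[OF assms(1)])
  have c: "conn_set E {x, y}" by (rule conn_set_pair[OF s assms(2)])
  show ?thesis unfolding minor_model_def
  proof (intro conjI ballI impI)
    fix u assume u: "u \<in> V - {y}"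
    show "(if u = x then {x, y} else {u}) \<subseteq> V" using u xy by auto
    show "conn_set E (if u = x then {x, y} else {u})" using c by simp
    fix w assume w: "w \<in> V - {y}"
    show "(if u = x then {x, y} else {u}) \<inter> (if w = x then {x, y} else {w}) = {}" if "u \<noteq> w"
      using that u w by auto
    show "touches E (if u = x then {x, y} else {u}) (if w = x then {x, y} else {w})"
      if "contract x y E u w"
      using that u w by (auto simp: contract_def touches_def split: if_splits)
  qed
qed

lemma K7v_contract:
  assumes "ugraph V E" "E x y" "K7v_minor (V - {y}) (contract x y E)"
  shows "K7v_minor V E"
  using K7v_minor_trans[OF ugraph_symp[OF assms(1)] minor_model_contract[OF assms(1,2)] assms(3)] .

text \<open>
  Besides \<open>x y\<close> itself, one edge is lost for every common neighbour of \<open>x\<close> and \<open>y\<close>.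
\<close>
lemma arcs_contract:
  assumes G: "ugraph V E" and xy: "E x y"
  shows "arcs_between E V V = arcs_between (contract x y E) (V - {y}) (V - {y})
    + 2 + 2 * card {z. E x z \<and> E y z}"
proof -
  let ?F = "contract x y E"
  let ?U = "V - {x, y}"
  have s: "symp E" and sF: "symp ?F" and fin: "finite V" "finite ?U"
    using ugraph_symp[OF G] symp_contract ugraph_finite[OF G] by auto
  have xyV: "x \<in> V" "y \<in> V" "x \<noteq> y" using ugraph_in[OF G xy] by auto
  have E: "\<not> E x x" "\<not> E y y" "E y x" using ugraph_in[OF G] ugraph_sym[OF G xy] by blast+
  have V: "V = ?U \<union> {x, y}" and Vy: "V - {y} = ?U \<union> {x}" using xyV by auto
  have "arcs_between E V V = arcs_between E ?U ?U + 2 * arcs_between E ?U {x, y} + arcs_between E {x, y} {x, y}"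
    by (subst V, subst V) (rule arcs_between_split[OF s], use fin in auto)
  moreover have "arcs_between E {x, y} {x, y} = 2"
    using xyV E xy by (simp add: arcs_between_def)
  moreover have "arcs_between E ?U {x, y} = arcs_between E {x, y} ?U"
    using arcs_between_sym[OF s] .
  moreover have "arcs_between E {x, y} ?U = card {z\<in>?U. E x z} + card {z\<in>?U. E y z}"
    using fin xyV by (simp add: arcs_between_eq_sum_card)
  moreover have "arcs_between ?F (V - {y}) (V - {y}) =
      arcs_between ?F ?U ?U + 2 * arcs_between ?F ?U {x} + arcs_between ?F {x} {x}"
    by (subst Vy, subst Vy) (rule arcs_between_split[OF sF], use fin in auto)
  moreover have "arcs_between ?F {x} {x} = 0"
    by (rule arcs_between_eq_0) (auto simp: contract_def)
  moreover have "arcs_between ?F ?U {x} = arcs_between ?F {x} ?U"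
    using arcs_between_sym[OF sF] .
  moreover have "arcs_between ?F {x} ?U = card {z\<in>?U. E x z \<or> E y z}"
  proof -
    have "{z\<in>?U. ?F x z} = {z\<in>?U. E x z \<or> E y z}" using xyV by (auto simp: contract_def)
    then show ?thesis using fin by (simp add: arcs_between_eq_sum_card)
  qed
  moreover have "arcs_between ?F ?U ?U = arcs_between E ?U ?U"
    by (rule arcs_between_cong) (use ugraph_in[OF G] in \<open>auto simp: contract_def\<close>)
  moreover have "card {z\<in>?U. E x z} + card {z\<in>?U. E y z} = card {z\<in>?U. E x z \<or> E y z} + card {z. E x z \<and> E y z}"
  proof -
    have "card {z\<in>?U. E x z} + card {z\<in>?U. E y z} =
        card ({z\<in>?U. E x z} \<union> {z\<in>?U. E y z}) + card ({z\<in>?U. E x z} \<inter> {z\<in>?U. E y z})"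
      by (rule card_Un_Int) (use fin in auto)
    moreover have "{z\<in>?U. E x z} \<union> {z\<in>?U. E y z} = {z\<in>?U. E x z \<or> E y z}" by auto
    moreover have "{z\<in>?U. E x z} \<inter> {z\<in>?U. E y z} = {z. E x z \<and> E y z}"
      using ugraph_in[OF G] E by auto
    ultimately show ?thesis by simp
  qed
  ultimately show ?thesis by linarith
qed

lemma nbh_contract_in:
  assumes "ugraph V E" "E x y" "x \<in> C" "y \<notin> C"
  shows "nbh (contract x y E) C = nbh E (insert y C)"
proof -
  have "x \<noteq> y" using assms(3,4) by auto
  have "(\<exists>u\<in>C. contract x y E u z) \<longleftrightarrow> z \<noteq> y \<and> (\<exists>u\<in>insert y C. E u z)" if "z \<notin> C" for z
    using that assms(3,4) \<open>x \<noteq> y\<close> by (auto simp: contract_def)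
  then show ?thesis unfolding nbh_def by auto
qed

lemma nbh_contract_out:
  assumes "ugraph V E" "E x y" "x \<notin> C" "y \<notin> C"
  shows "nbh (contract x y E) C = (if y \<in> nbh E C then insert x (nbh E C - {y}) else nbh E C)"
proof -
  have "x \<noteq> y" using ugraph_in[OF assms(1,2)] by auto
  then show ?thesis using assms(3,4) unfolding nbh_def contract_def
    by (auto simp: ugraph_sym[OF assms(1)])
qed

lemma k_connD:
  "k_conn k V E \<Longrightarrow> C \<subseteq> V \<Longrightarrow> C \<noteq> {} \<Longrightarrow> C \<union> nbh E C \<noteq> V \<Longrightarrow> k \<le> card (nbh E C)"
  by (auto simp: k_conn_def)

text \<open>
  A boundary of size less than \<open>k\<close> in \<open>G/xy\<close> must contain the new vertex, so it comes from a
  boundary of size \<open>k\<close> in \<open>G\<close> that contains both \<open>x\<close> and \<open>y\<close>.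
\<close>
lemma k_conn_contract:
  assumes G: "ugraph V E" and xy: "E x y" and k: "k_conn k V E" and V: "j < card V - 1" and "j \<le> k"
    and no: "\<And>C. C \<subseteq> V \<Longrightarrow> C \<noteq> {} \<Longrightarrow> C \<union> nbh E C \<noteq> V \<Longrightarrow> x \<in> nbh E C \<Longrightarrow> y \<in> nbh E C \<Longrightarrow>
        j < card (nbh E C)"
  shows "k_conn j (V - {y}) (contract x y E)"
  unfolding k_conn_def
proof (intro conjI allI impI)
  have xyV: "x \<in> V" "y \<in> V" "x \<noteq> y" using ugraph_in[OF G xy] by auto
  show "j < card (V - {y})" using V xyV ugraph_finite[OF G] by simp
  fix C assume "C \<subseteq> V - {y} \<and> C \<noteq> {} \<and> C \<union> nbh (contract x y E) C \<noteq> V - {y}"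
  then have C: "C \<subseteq> V" "y \<notin> C" "C \<noteq> {}" "C \<union> nbh (contract x y E) C \<noteq> V - {y}" by auto
  show "j \<le> card (nbh (contract x y E) C)"
  proof (cases "x \<in> C")
    case True
    have eq: "nbh (contract x y E) C = nbh E (insert y C)"
      using nbh_contract_in[OF G xy True C(2)] .
    have "y \<notin> nbh E (insert y C)" by (auto simp: nbh_def)
    then have "insert y C \<union> nbh E (insert y C) \<noteq> V" using C(2,4) eq by auto
    then show ?thesis using k_connD[OF k, of "insert y C"] C xyV \<open>j \<le> k\<close> eq by auto
  next
    case False
    have eq: "nbh (contract x y E) C = (if y \<in> nbh E C then insert x (nbh E C - {y}) else nbh E C)"
      using nbh_contract_out[OF G xy False C(2)] .
    show ?thesis
    proof (cases "y \<in> nbh E C")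
      case y: True
      have ne: "C \<union> nbh E C \<noteq> V" using C(2,4) eq y xyV False by auto
      show ?thesis
      proof (cases "x \<in> nbh E C")
        case True
        then have "insert x (nbh E C - {y}) = nbh E C - {y}" using xyV by auto
        moreover have "j < card (nbh E C)" using no[OF C(1,3) ne True y] .
        ultimately show ?thesis using eq y finite_nbh[OF G] by simp
      next
        case False
        then have "card (insert x (nbh E C - {y})) = card (nbh E C)"
          using y finite_nbh[OF G, of C] card_gt_0_iff[of "nbh E C"] by (auto simp: card_Diff_singleton)
        then show ?thesis using k_connD[OF k C(1,3) ne] eq y \<open>j \<le> k\<close> by simp
      qed
    next
      case y: False
      then have "C \<union> nbh E C \<noteq> V" using C(2) xyV by auto
      then show ?thesis using k_connD[OF k C(1,3)] eq y \<open>j \<le> k\<close> by simp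
    qed
  qed
qed

section \<open>Graphs on seven and eight vertices\<close>

lemma card_4_obtain:
  assumes "card A = 4"
  obtains a b c d where "A = {a, b, c, d}" "distinct [a, b, c, d]"
proof -
  obtain a B where "A = insert a B" "a \<notin> B" "card B = 3"
    using card_Suc_eq[of A 3] assms by auto
  moreover then obtain b c d where "B = {b, c, d}" "distinct [b, c, d]"
    by (auto simp: card_3_iff)
  ultimately show ?thesis using that[of a b c d] by auto
qed

lemma K7v_seven:
  assumes "symp E" "card U = 7" "{z, x, y} \<subseteq> U" "distinct [z, x, y]"
    and adj: "\<And>a b. a \<in> U \<Longrightarrow> b \<in> U \<Longrightarrow> a \<noteq> b \<Longrightarrow> {a, b} \<noteq> {z, x} \<Longrightarrow> {a, b} \<noteq> {z, y} \<Longrightarrow> E a b"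
  shows "K7v_minor U E"
proof -
  have "finite U" using assms(2) card.infinite by fastforce
  then have "card (U - {z, x, y}) = 4" using assms by (simp add: card_Diff_subset)
  then obtain a b c d where abcd: "U - {z, x, y} = {a, b, c, d}" "distinct [a, b, c, d]"
    by (rule card_4_obtain)
  then have mem: "a \<in> U" "b \<in> U" "c \<in> U" "d \<in> U"
    and ne: "{a, b, c, d} \<inter> {z, x, y} = {}" by auto
  have e: "E p q" if "p \<in> {x, y, a, b, c, d}" "q \<in> {x, y, a, b, c, d}" "p \<noteq> q" for p q
  proof (rule adj)
    show "p \<in> U" "q \<in> U" using that mem assms by auto
  qed (use that ne assms(4) in \<open>auto simp: doubleton_eq_iff\<close>)
  have ez: "E z q" if "q \<in> {a, b, c, d}" for q
  proof (rule adj)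
    show "z \<in> U" "q \<in> U" using that mem assms by auto
  qed (use that ne assms(4) in \<open>auto simp: doubleton_eq_iff\<close>)
  have "{a} \<union> {b} \<union> {c} \<union> {d} \<union> {x, y, z} \<subseteq> U" using mem assms by auto
  then show ?thesis
    by (intro K7v_minorI[OF assms(1), of "{z}" "{x}" "{y}" "{a}" "{b}" "{c}" "{d}"])
      (use abcd(2) ne assms(4) e ez in \<open>auto simp: touches_def\<close>)
qed


lemma K7v_seven_one:
  assumes "symp E" "card U = 7"
    and adj: "\<And>a b. a \<in> U \<Longrightarrow> b \<in> U \<Longrightarrow> a \<noteq> b \<Longrightarrow> {a, b} \<noteq> {p, q} \<Longrightarrow> E a b"
  shows "K7v_minor U E"
proof -
  have fin: "finite U" using assms(2) card.infinite by fastforce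
  have big: "\<exists>y\<in>U. y \<notin> A" if "finite A" "card A < 7" for A
    using that assms(2) by (metis card_mono linorder_not_less subsetI)
  show ?thesis
  proof (cases "p \<in> U \<and> q \<in> U \<and> p \<noteq> q")
    case True
    obtain y where "y \<in> U" "y \<notin> {p, q}" using big[of "{p, q}"] True by auto
    then show ?thesis using K7v_seven[OF assms(1,2), of p q y] True adj by auto
  next
    case False
    then have all: "E a b" if "a \<in> U" "b \<in> U" "a \<noteq> b" for a b
      using adj[OF that] that by (metis doubleton_eq_iff)
    obtain x where "x \<in> U" using big[of "{}"] by auto
    moreover obtain y where "y \<in> U" "y \<notin> {x}" using big[of "{x}"] by auto
    moreover obtain z where "z \<in> U" "z \<notin> {x, y}" using big[of "{x, y}"] card_insert_le_m1[of 2 "{y}" x] by auto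
    ultimately show ?thesis using K7v_seven[OF assms(1,2), of z x y] all by auto
  qed
qed

lemma arcs_between_eq_card:
  assumes "finite A" "finite B"
  shows "arcs_between E A B = card {(a, b). a \<in> A \<and> b \<in> B \<and> E a b}"
proof -
  have "arcs_between E A B = card (SIGMA a:A. {b\<in>B. E a b})"
    using assms by (simp add: arcs_between_eq_sum_card)
  moreover have "(SIGMA a:A. {b\<in>B. E a b}) = {(a, b). a \<in> A \<and> b \<in> B \<and> E a b}" by auto
  ultimately show ?thesis by simp
qed

text \<open>
  Eight vertices and at most four missing edges: if two missing edges share a vertex \<open>z\<close>, deleting
  \<open>z\<close> or contracting one edge leaves a cherry; if the missing edges form a matching that is
  not perfect, contracting an edge between two of them leaves at most one.
\<close>
lemma K7v_eight:
  assumes G: "ugraph U E" and U: "card U = 8" and arcs: "48 \<le> arcs_between E U U"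
    and np: "\<exists>u\<in>U. card {y. E u y} \<noteq> 6"
  shows "K7v_minor U E"
proof (rule ccontr)
  assume noK: "\<not> K7v_minor U E"
  have s: "symp E" and fin: "finite U" using ugraph_symp[OF G] ugraph_finite[OF G] by auto
  define NE where "NE = {(a, b). a \<in> U \<and> b \<in> U \<and> a \<noteq> b \<and> \<not> E a b}"
  have finNE: "finite NE"
    by (rule finite_subset[of _ "U \<times> U"]) (use fin in \<open>auto simp: NE_def\<close>)
  have symNE: "(b, a) \<in> NE" if "(a, b) \<in> NE" for a b
    using that ugraph_sym[OF G] by (auto simp: NE_def)
  have E: "E a b" if "a \<in> U" "b \<in> U" "a \<noteq> b" "(a, b) \<notin> NE" for a b
    using that by (auto simp: NE_def)
  have cardNE: "card NE \<le> 8"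
  proof -
    let ?D = "{(a, b). a \<in> U \<and> b \<in> U \<and> E a b}" and ?I = "(\<lambda>a. (a, a)) ` U"
    have "U \<times> U = ?D \<union> NE \<union> ?I"
    proof (rule set_eqI)
      fix x show "x \<in> U \<times> U \<longleftrightarrow> x \<in> ?D \<union> NE \<union> ?I" by (cases x) (auto simp: NE_def)
    qed
    moreover have "?D \<inter> NE = {}" "(?D \<union> NE) \<inter> ?I = {}" using ugraph_in[OF G] by (auto simp: NE_def)
    moreover have "finite ?D" by (rule finite_subset[of _ "U \<times> U"]) (use fin in auto)
    ultimately have "card (U \<times> U) = card ?D + card NE + card ?I"
      using finNE fin by (metis (no_types, lifting) card_Un_disjoint finite_UnI finite_imageI)
    moreover have "card ?I = 8" using U by (subst card_image) (auto simp: inj_on_def)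
    moreover have "card (U \<times> U) = 64" using U by (simp add: card_cartesian_product)
    ultimately show ?thesis using arcs arcs_between_eq_card[OF fin fin, of E] by simp
  qed
  have full: "NE = {(a, b), (b, a), (c, d), (d, c), (e, f), (f, e), (g, h), (h, g)}"
    if "(a, b) \<in> NE" "(c, d) \<in> NE" "(e, f) \<in> NE" "(g, h) \<in> NE"
      "distinct [{a, b}, {c, d}, {e, f}, {g, h}]" for a b c d e f g h
  proof -
    have ne: "a \<noteq> b" "c \<noteq> d" "e \<noteq> f" "g \<noteq> h" using that by (auto simp: NE_def)
    let ?S = "{(a, b), (b, a), (c, d), (d, c), (e, f), (f, e), (g, h), (h, g)}"
    have "distinct [(a, b), (b, a), (c, d), (d, c), (e, f), (f, e), (g, h), (h, g)]"
      using that(5) ne by (auto simp: doubleton_eq_iff)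
    then have "card ?S = 8" using distinct_card[of "[(a, b), (b, a), (c, d), (d, c), (e, f), (f, e), (g, h), (h, g)]"]
      by simp
    moreover have "?S \<subseteq> NE" using that symNE by auto
    ultimately show ?thesis using cardNE finNE card_seteq[of NE ?S] by auto
  qed
  have del1: "\<exists>a b. (a, b) \<in> NE \<and> a \<noteq> z \<and> b \<noteq> z \<and> {a, b} \<noteq> {p, q}" if "z \<in> U" for z p q
  proof (rule ccontr)
    assume "\<not> ?thesis"
    then have "E a b" if "a \<in> U - {z}" "b \<in> U - {z}" "a \<noteq> b" "{a, b} \<noteq> {p, q}" for a b
      using E[of a b] that by blast
    then have "K7v_minor (U - {z}) E"
      by (intro K7v_seven_one[OF s, of _ p q]) (use U that in auto)
    then show False using K7v_minor_mono[of "U - {z}" E U E] s noK by auto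
  qed
  have del2: False if "z \<in> U" "distinct [z, w, x, y]" "{w, x, y} \<subseteq> U"
    "\<And>a b. (a, b) \<in> NE \<Longrightarrow> a \<noteq> z \<Longrightarrow> b \<noteq> z \<Longrightarrow> {a, b} = {w, x} \<or> {a, b} = {w, y}" for z w x y
  proof -
    have "E a b" if "a \<in> U - {z}" "b \<in> U - {z}" "a \<noteq> b" "{a, b} \<noteq> {w, x}" "{a, b} \<noteq> {w, y}" for a b
      using E[of a b] \<open>\<And>a b. (a, b) \<in> NE \<Longrightarrow> a \<noteq> z \<Longrightarrow> b \<noteq> z \<Longrightarrow> {a, b} = {w, x} \<or> {a, b} = {w, y}\<close>[of a b] that
      by blast
    then have "K7v_minor (U - {z}) E"
      by (intro K7v_seven[OF s, of _ w x y]) (use U that in auto)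
    then show False using K7v_minor_mono[of "U - {z}" E U E] s noK by auto
  qed
  have con1: False if "E x y" "\<And>a b. (a, b) \<in> NE \<Longrightarrow> a \<notin> {x, y} \<Longrightarrow> b \<notin> {x, y} \<Longrightarrow> {a, b} = {p, q}"
    "\<And>a. (x, a) \<in> NE \<Longrightarrow> (y, a) \<in> NE \<Longrightarrow> False" for x y p q
  proof -
    have xy: "x \<in> U" "y \<in> U" "x \<noteq> y" using ugraph_in[OF G that(1)] by auto
    have "K7v_minor (U - {y}) (contract x y E)"
    proof (rule K7v_seven_one[OF symp_contract[OF s]])
      show "card (U - {y}) = 7" using U xy by simp
      fix a b assume ab: "a \<in> U - {y}" "b \<in> U - {y}" "a \<noteq> b" "{a, b} \<noteq> {p, q}"
      consider "a = x" | "b = x" | "a \<noteq> x" "b \<noteq> x" by auto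
      then show "contract x y E a b"
      proof cases
        case 1
        then have "(x, b) \<notin> NE \<or> (y, b) \<notin> NE" using that(3) by blast
        then show ?thesis using 1 ab E[of x b] E[of y b] xy by (auto simp: contract_def)
      next
        case 2
        then have "(x, a) \<notin> NE \<or> (y, a) \<notin> NE" using that(3) by blast
        then show ?thesis using 2 ab E[of x a] E[of y a] xy ugraph_sym[OF G]
          by (auto simp: contract_def)
      next
        case 3
        then have "(a, b) \<notin> NE" using that(2)[of a b] ab by auto
        then show ?thesis using 3 ab E[of a b] by (auto simp: contract_def)
      qed
    qed
    then show False using K7v_contract[OF G that(1)] noK by blast
  qed
  show False
  proof (cases "\<exists>z p q. (z, p) \<in> NE \<and> (z, q) \<in> NE \<and> p \<noteq> q")
    case True
    then obtain z p q where zpq: "(z, p) \<in> NE" "(z, q) \<in> NE" "p \<noteq> q" by blast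
    then have zU: "z \<in> U" "p \<in> U" "q \<in> U" "z \<noteq> p" "z \<noteq> q" by (auto simp: NE_def)
    obtain a b where ab: "(a, b) \<in> NE" "a \<noteq> z" "b \<noteq> z" using del1[OF zU(1)] by blast
    obtain c d where cd: "(c, d) \<in> NE" "c \<noteq> z" "d \<noteq> z" "{c, d} \<noteq> {a, b}"
      using del1[OF zU(1), of a b] by blast
    have ne: "a \<noteq> b" "c \<noteq> d" "a \<in> U" "b \<in> U" "c \<in> U" "d \<in> U" using ab cd by (auto simp: NE_def)
    have NE: "NE = {(z, p), (p, z), (z, q), (q, z), (a, b), (b, a), (c, d), (d, c)}"
      by (rule full) (use zpq ab cd in \<open>auto simp: doubleton_eq_iff\<close>)
    have dis: "{a, b} \<inter> {c, d} = {}"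
    proof (rule ccontr)
      assume "{a, b} \<inter> {c, d} \<noteq> {}"
      then obtain w x y where w: "{a, b} = {w, x}" "{c, d} = {w, y}" by blast
      have "x \<noteq> y" using w cd(4) by auto
      have "w \<noteq> x" "w \<noteq> y" "w \<in> U" "x \<in> U" "y \<in> U" "z \<notin> {w, x, y}"
        using w ne ab(2,3) cd(2,3) by (auto simp: doubleton_eq_iff)
      then show False using \<open>x \<noteq> y\<close> w
        by (intro del2[of z w x y]) (auto simp: NE zU(1) doubleton_eq_iff)
    qed
    \<comment> \<open>A missing edge \<open>ab\<close> away from \<open>p\<close> and \<open>q\<close> is repaired, together with \<open>zp\<close> and \<open>zq\<close>, by contracting \<open>za\<close>.\<close>
    have away: False if "{a', b'} \<inter> {p, q} = {}" "{(a', b'), (c', d')} \<subseteq> NE" "z \<notin> {a', b', c', d'}"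
        "{a', b'} \<inter> {c', d'} = {}" "{{a', b'}, {c', d'}} = {{a, b}, {c, d}}" for a' b' c' d'
    proof -
      have "a' \<in> U" "a' \<noteq> b'" using that(2) by (auto simp: NE_def)
      have NE': "NE = {(z, p), (p, z), (z, q), (q, z), (a', b'), (b', a'), (c', d'), (d', c')}"
        by (rule full) (use zpq that in \<open>auto simp: doubleton_eq_iff\<close>)
      have "(z, a') \<notin> NE" unfolding NE' using that zU by auto
      then have "E z a'" using E[of z a'] zU that \<open>a' \<in> U\<close> by auto
      then show False
        by (rule con1[of _ _ c' d']) (use that zU \<open>a' \<noteq> b'\<close> in \<open>auto simp: NE'\<close>)
    qed
    show False
    proof (cases "{a, b} \<inter> {p, q} = {} \<or> {c, d} \<inter> {p, q} = {}")
      case True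
      then show False using away[of a b c d] away[of c d a b] ab cd dis by auto
    next
      case False
      obtain a' b' where a': "{a, b} = {a', b'}" "a' \<in> {p, q}" using False by blast
      obtain c' d' where c': "{c, d} = {c', d'}" "c' \<in> {p, q}" using False by blast
      have pq: "{a', c'} = {p, q}" using a' c' dis by auto
      have b': "b' \<notin> {p, q}" "d' \<notin> {p, q}" using a' c' pq dis ne by (auto simp: doubleton_eq_iff)
      have mem: "b' \<in> U" "d' \<in> U" "b' \<noteq> d'" "z \<noteq> b'" "z \<noteq> d'" "a' \<noteq> b'" "c' \<noteq> d'" "a' \<noteq> c'" "a' \<noteq> d'" "b' \<noteq> c'"
        "z \<noteq> a'" "z \<noteq> c'" "a' \<in> U" "c' \<in> U"
        using a' c' dis ne ab cd by (auto simp: doubleton_eq_iff)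
      have NE': "NE = {(z, a'), (a', z), (z, c'), (c', z), (a', b'), (b', a'), (c', d'), (d', c')}"
        unfolding NE using a' c' pq by (auto simp: doubleton_eq_iff)
      have "(b', d') \<notin> NE" unfolding NE' using mem by auto
      then have bd: "E b' d'" using E mem by auto
      have "K7v_minor (U - {d'}) (contract b' d' E)"
      proof (rule K7v_seven[OF symp_contract[OF s], of _ z a' c'])
        show "card (U - {d'}) = 7" using U mem by simp
        show "{z, a', c'} \<subseteq> U - {d'}" "distinct [z, a', c']" using mem zU by auto
        fix x y assume xy: "x \<in> U - {d'}" "y \<in> U - {d'}" "x \<noteq> y" "{x, y} \<noteq> {z, a'}" "{x, y} \<noteq> {z, c'}"
        have "(x, y) \<notin> NE \<or> x = b' \<and> (d', y) \<notin> NE \<or> y = b' \<and> (x, d') \<notin> NE"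
          unfolding NE' using xy mem by auto
        then show "contract b' d' E x y" unfolding contract_def
          using xy E[of x y] E[of d' y] E[of x d'] mem by auto
      qed
      then show False using K7v_contract[OF G bd] noK by blast
    qed
  next
    case False
    then have uniq: "p = q" if "(z, p) \<in> NE" "(z, q) \<in> NE" for z p q using that by blast
    obtain z where z: "z \<in> U" using U by fastforce
    obtain a b where ab: "(a, b) \<in> NE" using del1[OF z] by blast
    then have aU: "a \<in> U" "b \<in> U" "a \<noteq> b" by (auto simp: NE_def)
    obtain c d where cd: "(c, d) \<in> NE" "c \<noteq> a" "d \<noteq> a" using del1[OF aU(1)] by blast
    then have cU: "c \<in> U" "d \<in> U" "c \<noteq> d" by (auto simp: NE_def)
    have cb: "c \<noteq> b" "d \<noteq> b" using uniq[of b a d] uniq[of b a c] symNE ab cd by blast+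
    have "E a c" using E[of a c] uniq[OF ab, of c] aU cU cd cb by auto
    obtain e f where ef: "(e, f) \<in> NE" "e \<notin> {a, c}" "f \<notin> {a, c}"
      using con1[OF \<open>E a c\<close>, of a a] uniq ab cd symNE cb by metis
    then have efU: "e \<in> U" "f \<in> U" "e \<noteq> f" by (auto simp: NE_def)
    obtain g h where gh: "(g, h) \<in> NE" "g \<notin> {a, c}" "h \<notin> {a, c}" "{g, h} \<noteq> {e, f}"
      using con1[OF \<open>E a c\<close>, of e f] uniq ab cd symNE cb by metis
    then have ghU: "g \<in> U" "h \<in> U" "g \<noteq> h" by (auto simp: NE_def)
    have sym': "(b, a) \<in> NE" "(d, c) \<in> NE" "(f, e) \<in> NE" "(h, g) \<in> NE"
      using symNE ab cd ef gh by auto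
    have dist: "distinct [a, b, c, d, e, f, g, h]"
      using uniq ab cd ef gh sym' aU cU efU ghU cb by (auto simp: doubleton_eq_iff)
    then have "card {a, b, c, d, e, f, g, h} = 8" using distinct_card[OF dist] by simp
    then have Ueq: "U = {a, b, c, d, e, f, g, h}"
      using card_seteq[of U "{a, b, c, d, e, f, g, h}"] fin U aU cU efU ghU by auto
    obtain u where u: "u \<in> U" "card {y. E u y} \<noteq> 6" using np by blast
    have "\<exists>w. (u, w) \<in> NE" using u(1) ab cd ef gh sym' unfolding Ueq by blast
    then obtain w where w: "(u, w) \<in> NE" by blast
    then have "{y. E u y} = U - {u, w}"
      using uniq[OF w] ugraph_in[OF G] by (auto simp: NE_def)
    moreover have "card (U - {u, w}) = 6" using w U fin by (auto simp: NE_def card_Diff_subset)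
    ultimately show False using u by simp
  qed
qed

section \<open>The neighbourhood of a vertex of degree seven\<close>

lemma all_less_7: "(\<forall>i<7. P i) \<longleftrightarrow> P 0 \<and> P 1 \<and> P 2 \<and> P 3 \<and> P 4 \<and> P 5 \<and> P (6::nat)"
proof -
  have "{..<7} = {0, 1, 2, 3, 4, 5, 6::nat}" by auto
  then have "(\<forall>i\<in>{..<7}. P i) \<longleftrightarrow> (\<forall>i\<in>{0, 1, 2, 3, 4, 5, 6}. P i)" by simp
  moreover have "(\<forall>i<7. P i) \<longleftrightarrow> (\<forall>i\<in>{..<7}. P i)" by auto
  ultimately show ?thesis by simp
qed

lemma ugraph_edge_commute: "ugraph V E \<Longrightarrow> E x y \<longleftrightarrow> E y x"
  using ugraph_sym by metis

locale seven_labels =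
  fixes V :: "'a set" and E and w :: "nat \<Rightarrow> 'a" and v D
  assumes G: "ugraph V E" and inj: "inj_on w {..<7}" and wV: "w ` {..<7} \<subseteq> V" and vV: "v \<in> V"
    and vw: "v \<notin> w ` {..<7}" and Ev: "i < 7 \<Longrightarrow> E v (w i)"
    and D: "conn_set E D" "D \<subseteq> V" "D \<inter> insert v (w ` {..<7}) = {}"
    and touch: "i < 4 \<Longrightarrow> touches E D {w i}"
begin

definition miss :: "nat \<Rightarrow> nat \<Rightarrow> bool" where
  "miss i j \<longleftrightarrow> \<not> E (w (min i j)) (w (max i j))"

definition miss' :: "nat \<Rightarrow> nat \<Rightarrow> nat \<Rightarrow> bool" where
  "miss' a i j \<longleftrightarrow> miss i j \<and> \<not> (i = a \<and> j < 4) \<and> \<not> (j = a \<and> i < 4)"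

lemma miss_iff: "miss i j \<longleftrightarrow> \<not> E (w i) (w j)"
  using ugraph_sym[OF G] by (auto simp: miss_def min_def max_def)

lemma w_eq: "i < 7 \<Longrightarrow> j < 7 \<Longrightarrow> w i = w j \<longleftrightarrow> i = j"
  using inj by (auto simp: inj_on_def)

text \<open>Contract \<open>D\<close> into the attachment \<open>w a\<close>, then the edge between \<open>w p\<close> and \<open>w q\<close>.\<close>
lemma fill_contract:
  assumes lt: "a < 4" "p < 7" "q < 7" "z < 7" "x < 7" "y < 7" "distinct [z, x, y]" "q \<notin> {z, x, y}" "p \<noteq> q"
    and pq: "\<not> miss' a p q"
    and rest: "\<forall>i<7. \<forall>j<7. j < i \<longrightarrow> i \<noteq> q \<longrightarrow> j \<noteq> q \<longrightarrow> {i, j} \<noteq> {z, x} \<longrightarrow> {i, j} \<noteq> {z, y} \<longrightarrow>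
      \<not> miss' a i j \<or> i = p \<and> \<not> miss' a q j \<or> j = p \<and> \<not> miss' a i q"
  shows "K7v_minor V E"
proof -
  have s: "symp E" by (rule ugraph_symp[OF G])
  define U where "U = insert v (w ` {..<7})"
  define F where "F = (\<lambda>u t. u \<in> U \<and> t \<in> U \<and> u \<noteq> t \<and> (E u t \<or> u = w a \<and> t \<in> w ` {..<4} \<or> t = w a \<and> u \<in> w ` {..<4}))"
  have finU: "finite U" by (simp add: U_def)
  have "card (w ` {..<7}) = 7" using inj by (simp add: card_image)
  then have cU: "card U = 8" using vw by (simp add: U_def)
  have UV: "U \<subseteq> V" using wV vV by (auto simp: U_def)
  have GF: "ugraph U F" using finU ugraph_sym[OF G] by (auto simp: ugraph_def F_def)
  have Fw: "F (w i) (w j) \<longleftrightarrow> i \<noteq> j \<and> \<not> miss' a i j" if "i < 7" "j < 7" for i j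
  proof -
    have "w j \<in> w ` {..<4} \<longleftrightarrow> j < 4" if "j < 7" for j
      using inj_on_image_mem_iff[OF inj, of j "{..<4}"] that by auto
    then show ?thesis using that lt(1) by (auto simp: F_def miss'_def miss_iff w_eq U_def)
  qed
  have Fv: "F v (w i)" "F (w i) v" if "i < 7" for i
    using that Ev[OF that] ugraph_sym[OF G] vw by (auto simp: F_def U_def)
  have "minor_model V E U F (\<lambda>u. if u = w a then insert (w a) D else {u})"
    unfolding minor_model_def
  proof (intro conjI ballI impI)
    fix u assume u: "u \<in> U"
    have waU: "w a \<in> U" using lt by (auto simp: U_def)
    show "(if u = w a then insert (w a) D else {u}) \<subseteq> V" using u UV D(2) waU by auto
    obtain d where "d \<in> D" "E d (w a)" using touch[OF lt(1)] by (auto simp: touches_def)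
    then have "conn_set E (insert (w a) D)" using conn_set_insert[OF s D(1)] by blast
    then show "conn_set E (if u = w a then insert (w a) D else {u})" by simp
    fix t assume t: "t \<in> U"
    show "(if u = w a then insert (w a) D else {u}) \<inter> (if t = w a then insert (w a) D else {t}) = {}"
      if "u \<noteq> t" using that u t D(3) by (auto simp: U_def)
    show "touches E (if u = w a then insert (w a) D else {u}) (if t = w a then insert (w a) D else {t})"
      if ut: "F u t"
    proof -
      have tt: "touches E D {x}" "touches E {x} D" if "x \<in> w ` {..<4}" for x
        using touch that touches_sym[OF s] by blast+
      have "E u t \<or> u = w a \<and> t \<in> w ` {..<4} \<or> t = w a \<and> u \<in> w ` {..<4}" "u \<noteq> t"
        using ut by (auto simp: F_def)
      then show ?thesis using tt by (auto simp: touches_def)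
    qed
  qed
  moreover have "K7v_minor U F"
  proof (rule K7v_contract[OF GF, of "w p" "w q"])
    show "F (w p) (w q)" using Fw[of p q] pq lt by auto
    have wqU: "w q \<in> U" using lt by (auto simp: U_def)
    show "K7v_minor (U - {w q}) (contract (w p) (w q) F)"
    proof (rule K7v_seven[OF symp_contract[OF ugraph_symp[OF GF]], of _ "w z" "w x" "w y"])
      show "card (U - {w q}) = 7" using cU wqU by simp
      show "{w z, w x, w y} \<subseteq> U - {w q}" "distinct [w z, w x, w y]"
        using lt by (auto simp: U_def w_eq)
      fix b c assume bc: "b \<in> U - {w q}" "c \<in> U - {w q}" "b \<noteq> c" "{b, c} \<noteq> {w z, w x}" "{b, c} \<noteq> {w z, w y}"
      have key: "contract (w p) (w q) F (w i) (w j)" if "i < 7" "j < 7" "j < i" "i \<noteq> q" "j \<noteq> q"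
          "{i, j} \<noteq> {z, x}" "{i, j} \<noteq> {z, y}" for i j
      proof -
        have "\<not> miss' a i j \<or> i = p \<and> \<not> miss' a q j \<or> j = p \<and> \<not> miss' a i q"
          using rest that by blast
        then have "F (w i) (w j) \<or> i = p \<and> F (w q) (w j) \<or> j = p \<and> F (w i) (w q)"
          using Fw that lt by blast
        moreover have "w i \<noteq> w q" "w j \<noteq> w q" "w i \<noteq> w j" using w_eq that lt by auto
        ultimately show ?thesis unfolding contract_def by blast
      qed
      consider "b = v" | "c = v" | "b \<in> w ` {..<7}" "c \<in> w ` {..<7}" using bc by (auto simp: U_def)
      then show "contract (w p) (w q) F b c"
      proof cases
        case 1
        then obtain i where i: "c = w i" "i < 7" using bc by (auto simp: U_def)
        show ?thesis using Fv(1)[OF i(2)] 1 i bc(1,2) unfolding contract_def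
          using ugraph_in[OF GF] by blast
      next
        case 2
        then obtain i where i: "b = w i" "i < 7" using bc by (auto simp: U_def)
        show ?thesis using Fv(2)[OF i(2)] 2 i bc(1,2) unfolding contract_def
          using ugraph_in[OF GF] by blast
      next
        case 3
        then obtain i j where ij: "b = w i" "i < 7" "c = w j" "j < 7" by auto
        have "i \<noteq> j" "i \<noteq> q" "j \<noteq> q" using bc ij by auto
        moreover have "{i, j} \<noteq> {z, x}" "{i, j} \<noteq> {z, y}"
          using bc(4,5) ij by (auto simp: doubleton_eq_iff)
        moreover have "{j, i} = {i, j}" by auto
        ultimately have "contract (w p) (w q) F (w i) (w j) \<or> contract (w p) (w q) F (w j) (w i)"
          using key[of i j] key[of j i] ij by (metis linorder_neqE_nat)
        then show ?thesis using ij symp_contract[OF ugraph_symp[OF GF]] by (meson sympD)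
      qed
    qed
  qed
  ultimately show ?thesis using K7v_minor_trans[OF s] by blast
qed

text \<open>
  \<open>w p w q\<close>, \<open>w r w s\<close>, \<open>w x\<close>, \<open>w y\<close>, \<open>w z\<close> and \<open>v\<close> become a \<open>K\<^sub>6\<close>, and \<open>D\<close> sees the first four.
\<close>
lemma two_pairs:
  assumes lt: "p < 4" "r < 4" "x < 4" "y < 4" "q < 7" "s < 7" "z < 7" "distinct [p, q, r, s, x, y, z]"
    and adj: "\<not> miss p q" "\<not> miss r s" "\<not> miss x y" "\<not> miss x z" "\<not> miss y z"
      "\<not> miss p x \<or> \<not> miss q x" "\<not> miss p y \<or> \<not> miss q y" "\<not> miss p z \<or> \<not> miss q z"
      "\<not> miss r x \<or> \<not> miss s x" "\<not> miss r y \<or> \<not> miss s y" "\<not> miss r z \<or> \<not> miss s z"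
      "\<not> miss p r \<or> \<not> miss p s \<or> \<not> miss q r \<or> \<not> miss q s"
  shows "K7v_minor V E"
proof (rule K7v_minorI[where Z = D and X = "{v}" and Y = "{w z}" and ?S1.0 = "{w p, w q}"
      and ?S2.0 = "{w r, w s}" and ?S3.0 = "{w x}" and ?S4.0 = "{w y}"])
  show sy: "symp E" by (rule ugraph_symp[OF G])
  have lt7: "p < 7" "r < 7" "x < 7" "y < 7" using lt by auto
  have e: "E (w i) (w j)" "E (w j) (w i)" if "\<not> miss i j" for i j
    using that ugraph_sym[OF G] by (auto simp: miss_iff)
  note adj' = adj[unfolded miss_iff, simplified] adj(1-5)[unfolded miss_iff, simplified, THEN ugraph_sym[OF G]]
    adj(8,11)[unfolded miss_iff not_not ugraph_edge_commute[OF G, of "w p" "w z"]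
      ugraph_edge_commute[OF G, of "w q" "w z"] ugraph_edge_commute[OF G, of "w r" "w z"]
      ugraph_edge_commute[OF G, of "w s" "w z"]]
  have ev: "E v (w i)" "E (w i) v" if "i < 7" for i using Ev[OF that] ugraph_sym[OF G] by auto
  show "conn_set E {w p, w q}" "conn_set E {w r, w s}" using conn_set_pair[OF sy] e adj by auto
  show "D \<union> {v} \<union> {w z} \<union> {w p, w q} \<union> {w r, w s} \<union> {w x} \<union> {w y} \<subseteq> V"
    using D wV vV lt lt7 by auto
  have "w i \<notin> D" "v \<noteq> w i" if "i < 7" for i using D vw that by auto
  moreover have "v \<notin> D" using D by auto
  ultimately show "D \<inter> ({v} \<union> {w z} \<union> {w p, w q} \<union> {w r, w s} \<union> {w x} \<union> {w y}) = {}"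
    "{v} \<inter> ({w z} \<union> {w p, w q} \<union> {w r, w s} \<union> {w x} \<union> {w y}) = {}"
    "{w z} \<inter> ({w p, w q} \<union> {w r, w s} \<union> {w x} \<union> {w y}) = {}"
    "{w p, w q} \<inter> ({w r, w s} \<union> {w x} \<union> {w y}) = {}"
    "{w r, w s} \<inter> ({w x} \<union> {w y}) = {}" "{w x} \<inter> {w y} = {}"
    using lt lt7 by (auto simp: w_eq)
  show "touches E D {w p, w q}" "touches E D {w r, w s}" "touches E D {w x}" "touches E D {w y}"
    using touch lt by (auto simp: touches_def)
  show "touches E {v} {w z}" "touches E {v} {w p, w q}" "touches E {v} {w r, w s}" "touches E {v} {w x}"
    "touches E {v} {w y}" using ev lt lt7 by (auto simp: touches_def)
  show "touches E {w z} {w p, w q}" "touches E {w z} {w r, w s}" "touches E {w z} {w x}" "touches E {w z} {w y}"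
    "touches E {w p, w q} {w r, w s}" "touches E {w p, w q} {w x}" "touches E {w p, w q} {w y}"
    "touches E {w r, w s} {w x}" "touches E {w r, w s} {w y}" "touches E {w x} {w y}"
    using adj' by (simp_all add: touches_insert_right) blast+
qed (use D in auto)

text \<open>
  The two constructions are tried for the listed labels. That one of them always applies is a
  propositional statement about the 21 pairs of labels.
\<close>
lemma K7v_labelled:
  assumes deg: "\<And>i j k l. i < 7 \<Longrightarrow> j < 7 \<Longrightarrow> k < 7 \<Longrightarrow> l < 7 \<Longrightarrow> distinct [i, j, k, l] \<Longrightarrow>
      \<not> (miss i j \<and> miss i k \<and> miss i l)"
    and m01: "miss 0 1"
    and not_pentagon: "\<And>p q r. {p, q, r} = {4, 5, 6} \<Longrightarrow>
      \<not> (miss 2 p \<and> miss p 3 \<and> miss 3 r \<and> miss r q \<and> miss q 2)"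
  shows "K7v_minor V E"
proof (rule ccontr)
  assume no: "\<not> K7v_minor V E"
  let ?T1 = "[
     (0,4,1,5,2,3,6), (1,5,2,6,0,3,4), (2,4,1,5,0,3,6), (3,4,0,6,1,2,5)] ::
      (nat \<times> nat \<times> nat \<times> nat \<times> nat \<times> nat \<times> nat) list" and ?T2 = "[
     (0,1,3,4,2,6), (0,2,3,4,5,6), (0,2,3,5,4,6), (0,2,4,5,0,6), (0,2,4,5,1,6), (0,2,4,5,3,6),
     (0,2,5,3,1,6), (0,2,6,4,0,5), (0,2,6,4,3,5), (0,2,6,5,0,4), (0,4,5,6,1,2), (0,4,5,6,1,3),
     (0,4,5,6,2,3), (0,4,6,2,3,5), (0,4,6,3,2,5), (0,4,6,5,0,2), (0,5,6,2,4,5), (0,5,6,3,2,4),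
     (1,2,4,6,0,5), (1,2,6,4,1,3), (1,3,6,5,1,4), (1,4,5,2,3,6), (1,4,5,3,2,6), (1,4,5,6,0,2),
     (1,4,6,5,0,3), (1,4,6,5,1,2), (1,4,6,5,1,3), (1,4,6,5,2,3), (1,5,6,2,0,4), (1,5,6,2,3,4),
     (1,5,6,4,2,3), (2,0,6,4,3,5), (2,0,6,5,2,4), (2,1,4,5,0,6), (2,1,4,5,3,6), (2,1,6,5,3,4),
     (2,4,6,1,0,5), (3,0,6,2,4,5), (3,1,4,5,2,6), (3,1,6,4,2,5)] :: (nat \<times> nat \<times> nat \<times> nat \<times> nat \<times> nat) list"
  have lt1: "\<forall>(p, q, r, s, x, y, z)\<in>set ?T1. p < 4 \<and> r < 4 \<and> x < 4 \<and> y < 4 \<and> q < 7 \<and> s < 7 \<and> z < 7 \<and>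
      distinct [p, q, r, s, x, y, z]"
    by simp
  have lt2: "\<forall>(a, p, q, z, x, y)\<in>set ?T2. a < 4 \<and> p < 7 \<and> q < 7 \<and> z < 7 \<and> x < 7 \<and> y < 7 \<and>
      distinct [z, x, y] \<and> q \<notin> {z, x, y} \<and> p \<noteq> q"
    by simp
  have 1: "\<forall>(p, q, r, s, x, y, z)\<in>set ?T1. miss p q \<or> miss r s \<or> miss x y \<or> miss x z \<or> miss y z \<or>
      miss p x \<and> miss q x \<or> miss p y \<and> miss q y \<or> miss p z \<and> miss q z \<or>
      miss r x \<and> miss s x \<or> miss r y \<and> miss s y \<or> miss r z \<and> miss s z \<or>
      miss p r \<and> miss p s \<and> miss q r \<and> miss q s"
  proof
    fix t assume "t \<in> set ?T1"
    with lt1 have lt: "case t of (p, q, r, s, x, y, z) \<Rightarrow> p < 4 \<and> r < 4 \<and> x < 4 \<and> y < 4 \<and> q < 7 \<and> s < 7 \<and> z < 7 \<and>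
      distinct [p, q, r, s, x, y, z]" by (rule bspec)
    obtain p q r s x y z where t: "t = (p, q, r, s, x, y, z)" by (cases t)
    show "case t of (p, q, r, s, x, y, z) \<Rightarrow> miss p q \<or> miss r s \<or> miss x y \<or> miss x z \<or> miss y z \<or>
      miss p x \<and> miss q x \<or> miss p y \<and> miss q y \<or> miss p z \<and> miss q z \<or>
      miss r x \<and> miss s x \<or> miss r y \<and> miss s y \<or> miss r z \<and> miss s z \<or>
      miss p r \<and> miss p s \<and> miss q r \<and> miss q s"
      using lt no two_pairs[of p r x y q s z] unfolding t prod.case by satx
  qed
  have 2: "\<forall>(a, p, q, z, x, y)\<in>set ?T2. miss' a p q \<or>
      \<not> (\<forall>i<7. \<forall>j<7. j < i \<longrightarrow> i \<noteq> q \<longrightarrow> j \<noteq> q \<longrightarrow> {i, j} \<noteq> {z, x} \<longrightarrow> {i, j} \<noteq> {z, y} \<longrightarrow>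
        \<not> miss' a i j \<or> i = p \<and> \<not> miss' a q j \<or> j = p \<and> \<not> miss' a i q)"
  proof
    fix t assume "t \<in> set ?T2"
    with lt2 have lt: "case t of (a, p, q, z, x, y) \<Rightarrow> a < 4 \<and> p < 7 \<and> q < 7 \<and> z < 7 \<and> x < 7 \<and> y < 7 \<and>
      distinct [z, x, y] \<and> q \<notin> {z, x, y} \<and> p \<noteq> q" by (rule bspec)
    obtain a p q z x y where t: "t = (a, p, q, z, x, y)" by (cases t)
    show "case t of (a, p, q, z, x, y) \<Rightarrow> miss' a p q \<or>
      \<not> (\<forall>i<7. \<forall>j<7. j < i \<longrightarrow> i \<noteq> q \<longrightarrow> j \<noteq> q \<longrightarrow> {i, j} \<noteq> {z, x} \<longrightarrow> {i, j} \<noteq> {z, y} \<longrightarrow>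
        \<not> miss' a i j \<or> i = p \<and> \<not> miss' a q j \<or> j = p \<and> \<not> miss' a i q)"
      using lt no fill_contract[of a p q z x y] unfolding t prod.case by satx
  qed
  have 3: "\<forall>i<7. \<forall>j<7. \<forall>k<7. \<forall>l<7. j < k \<longrightarrow> k < l \<longrightarrow> i \<noteq> j \<longrightarrow> i \<noteq> k \<longrightarrow> i \<noteq> l \<longrightarrow>
      \<not> (miss i j \<and> miss i k \<and> miss i l)"
  proof (intro allI impI)
    fix i j k l :: nat
    assume "i < 7" "j < 7" "k < 7" "l < 7" "j < k" "k < l" "i \<noteq> j" "i \<noteq> k" "i \<noteq> l"
    then show "\<not> (miss i j \<and> miss i k \<and> miss i l)" by (intro deg) simp_all
  qed
  have 4: "\<forall>(p, q, r)\<in>{(4,5,6), (4,6,5), (5,4,6), (5,6,4), (6,4,5), (6,5,4)}.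
      \<not> (miss 2 p \<and> miss p 3 \<and> miss 3 r \<and> miss r q \<and> miss q 2)"
    using not_pentagon by auto
  note h1 = 1[simplified, unfolded miss_def, simplified]
  note h2 = 2[simplified all_less_7 doubleton_eq_iff, simplified, unfolded miss'_def miss_def, simplified]
  note h3 = 3[unfolded all_less_7, simplified, unfolded miss_def, simplified]
  note h4 = 4[simplified, unfolded miss_def, simplified]
  note h5 = m01[unfolded miss_def, simplified]
  define e01 e02 e03 e04 e05 e06 e12 e13 e14 e15 e16 e23 e24 e25 e26 e34 e35 e36 e45 e46 e56 where
    "e01 = E (w 0) (w 1)" and "e02 = E (w 0) (w 2)" and "e03 = E (w 0) (w 3)" and
    "e04 = E (w 0) (w 4)" and "e05 = E (w 0) (w 5)" and "e06 = E (w 0) (w 6)" and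
    "e12 = E (w (Suc 0)) (w (Suc (Suc 0)))" and "e13 = E (w 1) (w 3)" and "e14 = E (w 1) (w 4)" and
    "e15 = E (w 1) (w 5)" and "e16 = E (w 1) (w 6)" and "e23 = E (w 2) (w 3)" and
    "e24 = E (w 2) (w 4)" and "e25 = E (w 2) (w 5)" and "e26 = E (w 2) (w 6)" and
    "e34 = E (w 3) (w 4)" and "e35 = E (w 3) (w 5)" and "e36 = E (w 3) (w 6)" and
    "e45 = E (w 4) (w 5)" and "e46 = E (w 4) (w 6)" and "e56 = E (w 5) (w 6)"
  note folds =
    e01_def e02_def e03_def e04_def e05_def e06_def e12_def e13_def e14_def e15_def e16_def
    e23_def e24_def e25_def e26_def e34_def e35_def e36_def e45_def e46_def e56_def
  show False
    using h1[folded folds[unfolded One_nat_def]] h2[folded folds[unfolded One_nat_def]] h3[folded folds[unfolded One_nat_def]]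
      h4[folded folds[unfolded One_nat_def]] h5[folded folds[unfolded One_nat_def]]
    by (smt (z3))
qed

end

section \<open>Replacing one side of a separation by a clique\<close>

text \<open>The bound \<open>|E| \<ge> 4|V| - 8\<close>, doubled because arcs are counted.\<close>
definition dense :: "'a set \<Rightarrow> ('a \<Rightarrow> 'a \<Rightarrow> bool) \<Rightarrow> bool" where
  "dense V E \<longleftrightarrow> 8 * card V \<le> arcs_between E V V + 16"

text \<open>Eight vertices of degree six: the complement is a perfect matching, so this is \<open>K\<^sub>2\<^sub>,\<^sub>2\<^sub>,\<^sub>2\<^sub>,\<^sub>2\<close>.\<close>
definition cocktail :: "'a set \<Rightarrow> ('a \<Rightarrow> 'a \<Rightarrow> bool) \<Rightarrow> bool" where
  "cocktail V E \<longleftrightarrow> ugraph V E \<and> card V = 8 \<and> (\<forall>u\<in>V. card {y. E u y} = 6)"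

text \<open>The subgraph induced by \<open>C \<union> T\<close>, made complete on \<open>T\<close>.\<close>
definition fill :: "'a set \<Rightarrow> 'a set \<Rightarrow> ('a \<Rightarrow> 'a \<Rightarrow> bool) \<Rightarrow> 'a \<Rightarrow> 'a \<Rightarrow> bool" where
  "fill T C E x y \<longleftrightarrow> x \<in> C \<union> T \<and> y \<in> C \<union> T \<and> x \<noteq> y \<and> (E x y \<or> x \<in> T \<and> y \<in> T)"

definition rooted_clique :: "('a \<Rightarrow> 'a \<Rightarrow> bool) \<Rightarrow> 'a set \<Rightarrow> 'a set \<Rightarrow> ('a \<Rightarrow> 'a set) \<Rightarrow> bool" where
  "rooted_clique E W T L \<longleftrightarrow>
     (\<forall>s\<in>T. s \<in> L s \<and> L s \<subseteq> W \<and> conn_set E (L s)) \<and>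
     (\<forall>s\<in>T. \<forall>t\<in>T. s \<noteq> t \<longrightarrow> L s \<inter> L t = {} \<and> touches E (L s) (L t))"

lemma ugraph_fill: "ugraph V E \<Longrightarrow> C \<union> T \<subseteq> V \<Longrightarrow> ugraph (C \<union> T) (fill T C E)"
  unfolding ugraph_def fill_def using finite_subset by blast

lemma nbh_rest: "ugraph V E \<Longrightarrow> nbh E (V - C - nbh E C) \<subseteq> nbh E C"
  unfolding nbh_def using ugraph_in ugraph_sym by fastforce

text \<open>
  As \<open>T\<close> is complete, a vertex set avoids \<open>T\<close> or has all of \<open>T\<close> in itself and its boundary. In the first case its boundary in the
  original graph is the same, in the second case this holds after the vertices outside \<open>C \<union> T\<close> are added.
\<close>
lemma k_conn_fill:
  assumes G: "ugraph V E" and k: "k_conn k V E" and C: "C \<union> T \<subseteq> V" "C \<union> T \<noteq> V" "nbh E C \<subseteq> T"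
    and card: "k < card (C \<union> T)"
  shows "k_conn k (C \<union> T) (fill T C E)"
  unfolding k_conn_def
proof (intro conjI allI impI card)
  let ?F = "fill T C E"
  have GF: "ugraph (C \<union> T) ?F" using ugraph_fill[OF G C(1)] .
  fix D assume D: "D \<subseteq> C \<union> T \<and> D \<noteq> {} \<and> D \<union> nbh ?F D \<noteq> C \<union> T"
  let ?R = "nbh ?F D"
  have R: "?R \<subseteq> C \<union> T" using nbh_subset[OF GF] .
  show "k \<le> card ?R"
  proof (cases "D \<inter> T = {}")
    case True
    then have DC: "D \<subseteq> C" using D by auto
    have "nbh E D \<subseteq> ?R"
    proof
      fix y assume "y \<in> nbh E D"
      then obtain x where x: "x \<in> D" "E x y" "y \<notin> D" by (auto simp: nbh_def)
      then have "y \<in> C \<union> T" using DC C(3) by (auto simp: nbh_def)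
      then show "y \<in> ?R" using x DC ugraph_in[OF G x(2)] by (auto simp: nbh_def fill_def)
    qed
    moreover have "D \<union> nbh E D \<noteq> V" using calculation R D C by blast
    ultimately show ?thesis using k_connD[OF k, of D] D C(1) finite_nbh[OF GF]
      by (meson card_mono dual_order.trans le_sup_iff subset_trans DC)
  next
    case False
    then have TD: "T \<subseteq> D \<union> ?R" using D by (auto simp: nbh_def fill_def)
    define D2 where "D2 = (C \<union> T) - D - ?R"
    have D2: "D2 \<noteq> {}" "D2 \<subseteq> C" using D R TD by (auto simp: D2_def)
    have "nbh E D2 \<subseteq> ?R"
    proof
      fix y assume "y \<in> nbh E D2"
      then obtain x where x: "x \<in> D2" "E x y" "y \<notin> D2" by (auto simp: nbh_def)
      then have y: "y \<in> C \<union> T" using D2 C(3) by (auto simp: nbh_def)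
      then have "?F y x" using x D2 ugraph_in[OF G x(2)] ugraph_sym[OF G x(2)] by (auto simp: fill_def)
      then have "y \<notin> D" using x(1) by (auto simp: D2_def nbh_def)
      then show "y \<in> ?R" using x(3) y by (auto simp: D2_def)
    qed
    moreover have "D2 \<union> nbh E D2 \<noteq> V" using calculation R D2 C by blast
    ultimately show ?thesis using k_connD[OF k, of D2] D2 C(1) finite_nbh[OF GF]
      by (meson card_mono dual_order.trans le_sup_iff subset_trans)
  qed
qed

lemma minor_model_fill:
  assumes G: "ugraph V E" and C: "C \<union> T \<subseteq> V" "C \<inter> T = {}" and L: "rooted_clique E (V - C) T L"
  shows "minor_model V E (C \<union> T) (fill T C E) (\<lambda>u. if u \<in> T then L u else {u})"
  unfolding minor_model_def
proof (intro conjI ballI impI)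
  have L': "s \<in> L s" "L s \<subseteq> V - C" "conn_set E (L s)" if "s \<in> T" for s
    using L that by (auto simp: rooted_clique_def)
  have Lt: "L s \<inter> L t = {}" "touches E (L s) (L t)" if "s \<in> T" "t \<in> T" "s \<noteq> t" for s t
    using L that by (auto simp: rooted_clique_def)
  fix u assume u: "u \<in> C \<union> T"
  show "(if u \<in> T then L u else {u}) \<subseteq> V" "conn_set E (if u \<in> T then L u else {u})"
    using u L' C by auto
  fix w assume w: "w \<in> C \<union> T"
  show "(if u \<in> T then L u else {u}) \<inter> (if w \<in> T then L w else {w}) = {}" if "u \<noteq> w"
    using that u w L' Lt by (auto simp: disjoint_iff)
  show "touches E (if u \<in> T then L u else {u}) (if w \<in> T then L w else {w})" if F: "fill T C E u w"
  proof (cases "u \<in> T \<and> w \<in> T")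
    case True then show ?thesis using Lt F by (auto simp: fill_def)
  next
    case False
    then have "E u w" using F by (auto simp: fill_def)
    moreover have "u \<in> (if u \<in> T then L u else {u})" "w \<in> (if w \<in> T then L w else {w})" using L' by auto
    ultimately show ?thesis unfolding touches_def by blast
  qed
qed

lemma arcs_fill:
  assumes G: "ugraph V E" and C: "C \<union> T \<subseteq> V" "C \<inter> T = {}"
  shows "arcs_between (fill T C E) (C \<union> T) (C \<union> T) =
    arcs_between E C C + 2 * arcs_between E C T + card T * (card T - 1)"
proof -
  let ?F = "fill T C E"
  have fin: "finite C" "finite T" using C finite_subset[OF _ ugraph_finite[OF G]] by auto
  have sF: "symp ?F" using ugraph_symp[OF ugraph_fill[OF G C(1)]] .
  have "arcs_between ?F (C \<union> T) (C \<union> T) = arcs_between ?F C C + 2 * arcs_between ?F C T + arcs_between ?F T T"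
    by (rule arcs_between_split[OF sF fin C(2)])
  moreover have "arcs_between ?F C C = arcs_between E C C"
    by (rule arcs_between_cong) (use C ugraph_in[OF G] in \<open>auto simp: fill_def\<close>)
  moreover have "arcs_between ?F C T = arcs_between E C T"
    by (rule arcs_between_cong) (use C ugraph_in[OF G] in \<open>auto simp: fill_def\<close>)
  moreover have "arcs_between ?F T T = card T * (card T - 1)"
  proof -
    have "{y\<in>T. ?F x y} = T - {x}" if "x \<in> T" for x using that by (auto simp: fill_def)
    then have "arcs_between ?F T T = (\<Sum>x\<in>T. card (T - {x}))"
      using fin by (simp add: arcs_between_eq_sum_card)
    also have "\<dots> = (\<Sum>x\<in>T. card T - 1)" by (intro sum.cong) auto
    finally show ?thesis by simp
  qed
  ultimately show ?thesis by simp
qed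

text \<open>The induction hypothesis. The type argument fixes the type of the vertices, which a number alone would not determine.\<close>
definition holds_below :: "'a itself \<Rightarrow> nat \<Rightarrow> bool" where
  "holds_below _ n \<longleftrightarrow> (\<forall>(V :: 'a set) E. ugraph V E \<longrightarrow> card V < n \<longrightarrow> k_conn 4 V E \<longrightarrow> dense V E \<longrightarrow>
     K7v_minor V E \<or> cocktail V E)"

text \<open>
  The rooted clique makes the filled side a minor with fewer vertices, and the last assumption says that it is dense.
\<close>
lemma heavy_side:
  fixes V :: "'a set"
  assumes IH: "holds_below TYPE('a) (card V)"
    and G: "ugraph V E" and k: "k_conn 4 V E" and noK: "\<not> K7v_minor V E"
    and C: "C \<subseteq> V" "C \<noteq> {}" "nbh E C = T" "card T = 4" "C \<union> T \<noteq> V"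
    and L: "rooted_clique E (V - C) T L"
    and heavy: "8 * card C + 4 \<le> arcs_between E C C + 2 * arcs_between E C T"
  shows "cocktail (C \<union> T) (fill T C E)"
proof -
  have T: "T \<subseteq> V" "C \<inter> T = {}" using C nbh_subset[OF G] nbh_disjoint[of C E] by auto
  have fin: "finite V" "finite C" "finite T"
    using ugraph_finite[OF G] finite_subset C(1) T(1) by blast+
  have c: "card (C \<union> T) = card C + 4" using card_Un_disjoint[OF fin(2,3) T(2)] C by simp
  have "0 < card C" using C(2) fin by (simp add: card_gt_0_iff)
  have lt: "card (C \<union> T) < card V" using C T fin by (intro psubset_card_mono) auto
  have k': "k_conn 4 (C \<union> T) (fill T C E)"
    by (rule k_conn_fill[OF G k]) (use C T c \<open>0 < card C\<close> in auto)
  have "dense (C \<union> T) (fill T C E)"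
    unfolding dense_def using arcs_fill[OF G, of C T] C T c heavy by simp
  then have "K7v_minor (C \<union> T) (fill T C E) \<or> cocktail (C \<union> T) (fill T C E)"
    using IH lt k' ugraph_fill[OF G, of C T] C T unfolding holds_below_def by blast
  then show ?thesis
    using K7v_minor_trans[OF ugraph_symp[OF G] minor_model_fill[OF G _ T(2) L]] noK C T by blast
qed

lemma cocktail_unique_nonneighbour:
  assumes "cocktail V E" "x \<in> V"
  shows "\<exists>m\<in>V. m \<noteq> x \<and> \<not> E x m \<and> (\<forall>y\<in>V. y \<noteq> x \<longrightarrow> y \<noteq> m \<longrightarrow> E x y)"
proof -
  have G: "ugraph V E" and c: "card V = 8" "card {y. E x y} = 6" using assms by (auto simp: cocktail_def)
  have sub: "insert x {y. E x y} \<subseteq> V" "x \<notin> {y. E x y}" using ugraph_in[OF G] assms by auto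
  have fin: "finite V" "finite {y. E x y}" using ugraph_finite[OF G] sub finite_subset by auto
  have "card (V - insert x {y. E x y}) = 1"
    using sub c fin card_Diff_subset[of "insert x {y. E x y}" V] by simp
  then obtain m where "V - insert x {y. E x y} = {m}" by (auto simp: card_1_singleton_iff)
  then show ?thesis by blast
qed

text \<open>
  If the filled graph is \<open>K\<^sub>2\<^sub>,\<^sub>2\<^sub>,\<^sub>2\<^sub>,\<^sub>2\<close> then \<open>C\<close> is the clique of the four opposite vertices, and two
  disjoint pairs of them are adjacent to everything in \<open>T\<close>.
\<close>
lemma cocktail_fill_pairs:
  assumes co: "cocktail (C \<union> T) (fill T C E)" and G: "ugraph V E" "C \<union> T \<subseteq> V" and T: "card T = 4" "C \<inter> T = {}"
  shows "\<exists>X Y. X \<union> Y \<subseteq> C \<and> X \<inter> Y = {} \<and> conn_set E X \<and> conn_set E Y \<and> touches E X Y \<and>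
    (\<forall>t\<in>T. touches E X {t} \<and> touches E Y {t}) \<and> (\<forall>t\<in>T. card {y\<in>C. E t y} = 3)"
proof -
  let ?F = "fill T C E"
  have s: "symp E" by (rule ugraph_symp[OF G(1)])
  have fin: "finite C" "finite T" using G(2) finite_subset[OF _ ugraph_finite[OF G(1)]] by auto
  have GF: "ugraph (C \<union> T) ?F" using ugraph_fill[OF G] .
  have cC: "card C = 4" using co T fin by (simp add: cocktail_def card_Un_disjoint)
  have FE: "?F x y \<longleftrightarrow> E x y" if "x \<in> C" "y \<in> C \<union> T" for x y
    using that T ugraph_in[OF G(1)] by (auto simp: fill_def)
  have mateT: "\<exists>m\<in>C. \<not> E t m \<and> (\<forall>y\<in>C. y \<noteq> m \<longrightarrow> E t y)" if t: "t \<in> T" for t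
  proof -
    obtain m where m: "m \<in> C \<union> T" "m \<noteq> t" "\<not> ?F t m" "\<forall>y\<in>C \<union> T. y \<noteq> t \<longrightarrow> y \<noteq> m \<longrightarrow> ?F t y"
      using cocktail_unique_nonneighbour[OF co, of t] t by blast
    then have "m \<in> C" using t by (auto simp: fill_def)
    moreover have "E t y" if "y \<in> C" "y \<noteq> m" for y
      using m(4) that t T by (auto simp: fill_def)
    ultimately show ?thesis using m(3) t m(2) by (auto simp: fill_def)
  qed
  have uniqC: "t = t'" if hyps: "x \<in> C" "t \<in> C \<union> T" "t' \<in> C \<union> T" "t \<noteq> x" "t' \<noteq> x" "\<not> E x t" "\<not> E x t'" for x t t'
  proof -
    obtain m where "\<forall>y\<in>C \<union> T. y \<noteq> x \<longrightarrow> y \<noteq> m \<longrightarrow> ?F x y"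
      using cocktail_unique_nonneighbour[OF co, of x] hyps(1) by blast
    then show ?thesis using FE hyps by metis
  qed
  obtain mt where mt: "\<And>t. t \<in> T \<Longrightarrow> mt t \<in> C \<and> \<not> E t (mt t) \<and> (\<forall>y\<in>C. y \<noteq> mt t \<longrightarrow> E t y)"
    using mateT by metis
  have es: "E x y \<longleftrightarrow> E y x" for x y using ugraph_edge_commute[OF G(1)] .
  have inj: "inj_on mt T"
  proof (rule inj_onI)
    fix t t' assume t: "t \<in> T" "t' \<in> T" "mt t = mt t'"
    have "mt t \<in> C" "\<not> E (mt t) t" "\<not> E (mt t) t'"
      using mt[OF t(1)] mt[OF t(2)] t(3) ugraph_sym[OF G(1)] by metis+
    moreover have "t \<noteq> mt t" "t' \<noteq> mt t" using calculation(1) t T(2) by auto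
    ultimately show "t = t'" using uniqC[of "mt t" t t'] t by blast
  qed
  have "mt ` T \<subseteq> C" using mt by auto
  then have im: "mt ` T = C" using card_subset_eq[OF fin(1)] card_image[OF inj] T cC by simp
  have clq: "E x y" if xy: "x \<in> C" "y \<in> C" "x \<noteq> y" for x y
  proof (rule ccontr)
    assume no: "\<not> E x y"
    obtain t where t: "t \<in> T" "x = mt t" using xy im by auto
    have "\<not> E x t" "t \<noteq> x" using mt[OF t(1)] t xy(1) T(2) ugraph_sym[OF G(1)] by auto
    then have "t = y" using uniqC[of x t y] no xy t by auto
    then show False using t xy T by auto
  qed
  obtain a b c d where abcd: "C = {a, b, c, d}" "distinct [a, b, c, d]" using card_4_obtain[OF cC] .
  show ?thesis
  proof (rule exI[of _ "{a, b}"], rule exI[of _ "{c, d}"], intro conjI ballI)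
    show "conn_set E {a, b}" "conn_set E {c, d}" using conn_set_pair[OF s] clq abcd by auto
    show "touches E {a, b} {c, d}" using clq[of a c] abcd by (auto simp: touches_def)
    fix t assume t: "t \<in> T"
    have "E t a \<or> E t b" "E t c \<or> E t d" using mt[OF t] abcd by auto
    then show "touches E {a, b} {t}" "touches E {c, d} {t}" using es by (auto simp: touches_def)
    have "{y\<in>C. E t y} = C - {mt t}" using mt[OF t] by auto
    then show "card {y\<in>C. E t y} = 3" using mt[OF t] cC fin by simp
  qed (use abcd in auto)
qed

text \<open>
  The filled side is \<open>K\<^sub>2\<^sub>,\<^sub>2\<^sub>,\<^sub>2\<^sub>,\<^sub>2\<close>, so \<open>C\<close> contains two disjoint connected sets that touch each other and all of \<open>T\<close>. They are the two
  branch sets that \<open>Z\<close> may miss.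
\<close>
lemma heavy_side_apex:
  fixes V :: "'a set"
  assumes IH: "holds_below TYPE('a) (card V)"
    and G: "ugraph V E" and k: "k_conn 4 V E"
    and C: "C \<subseteq> V" "C \<noteq> {}" "nbh E C = T" "card T = 4" "C \<union> T \<noteq> V"
    and L: "rooted_clique E (V - C) T L"
    and Z: "conn_set E Z" "Z \<subseteq> V - C" "\<And>t. t \<in> T \<Longrightarrow> Z \<inter> L t = {} \<and> touches E Z (L t)"
    and heavy: "8 * card C + 4 \<le> arcs_between E C C + 2 * arcs_between E C T"
  shows "K7v_minor V E"
proof (rule ccontr)
  assume noK: "\<not> K7v_minor V E"
  have co: "cocktail (C \<union> T) (fill T C E)" by (rule heavy_side[OF IH G k noK C L heavy])
  have T: "C \<union> T \<subseteq> V" "C \<inter> T = {}" using C nbh_subset[OF G] nbh_disjoint[of C E] by auto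
  obtain X Y where XY: "X \<union> Y \<subseteq> C" "X \<inter> Y = {}" "conn_set E X" "conn_set E Y" "touches E X Y"
      "\<forall>t\<in>T. touches E X {t} \<and> touches E Y {t}"
    using cocktail_fill_pairs[OF co G T(1) C(4) T(2)] by blast
  obtain a b c d where abcd: "T = {a, b, c, d}" "distinct [a, b, c, d]" using card_4_obtain[OF C(4)] .
  have L': "s \<in> L s" "L s \<subseteq> V - C" "conn_set E (L s)" if "s \<in> T" for s
    using L that by (auto simp: rooted_clique_def)
  have Lt: "L s \<inter> L t = {}" "touches E (L s) (L t)" if "s \<in> T" "t \<in> T" "s \<noteq> t" for s t
    using L that by (auto simp: rooted_clique_def)
  have XT: "touches E X (L t)" "touches E Y (L t)" if "t \<in> T" for t
    using XY(6) that L'(1)[OF that] touches_mono[of E _ "{t}" _ "L t"] by auto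
  have XL: "X \<inter> L t = {}" "Y \<inter> L t = {}" if "t \<in> T" for t
    using XY(1) L'(2)[OF that] by auto
  have mem: "a \<in> T" "b \<in> T" "c \<in> T" "d \<in> T" using abcd by auto
  have "K7v_minor V E"
  proof (rule K7v_minorI[of E Z X Y "L a" "L b" "L c" "L d"])
    show "symp E" by (rule ugraph_symp[OF G])
    show "Z \<union> X \<union> Y \<union> L a \<union> L b \<union> L c \<union> L d \<subseteq> V" using Z(2) XY(1) C(1) L'(2) mem by blast
    show "Z \<inter> (X \<union> Y \<union> L a \<union> L b \<union> L c \<union> L d) = {}"
      using Z(2) XY(1) Z(3) mem by (auto simp: disjoint_iff)
    show "X \<inter> (Y \<union> L a \<union> L b \<union> L c \<union> L d) = {}" "Y \<inter> (L a \<union> L b \<union> L c \<union> L d) = {}"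
      using XY(2) XL mem by (simp_all add: Int_Un_distrib)
    show "L a \<inter> (L b \<union> L c \<union> L d) = {}" "L b \<inter> (L c \<union> L d) = {}" "L c \<inter> L d = {}"
      using Lt mem abcd(2) by (simp_all add: Int_Un_distrib)
  qed (use XY Z XT Lt L' mem abcd(2) in auto)
  then show False using noK by simp
qed

section \<open>Neighbourhoods of vertices all of whose edges lie in four triangles\<close>

definition dg :: "('a \<Rightarrow> 'a \<Rightarrow> bool) \<Rightarrow> 'a \<Rightarrow> nat" where
  "dg E x = card {y. E x y}"

text \<open>
  For adjacent \<open>x\<close> and \<open>y\<close> this is the number of triangles on the edge \<open>x y\<close>.
\<close>
definition codeg :: "('a \<Rightarrow> 'a \<Rightarrow> bool) \<Rightarrow> 'a \<Rightarrow> 'a \<Rightarrow> nat" where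
  "codeg E x y = card {z. E x z \<and> E y z}"

lemma finite_edges_at: "ugraph V E \<Longrightarrow> finite {y. E x y}"
  using ugraph_finite finite_subset[of "{y. E x y}" V] ugraph_in by fastforce

text \<open>The boundary of the component consists of neighbours of \<open>v\<close>, and \<open>v\<close> lies beyond it, so 4-connectivity applies.\<close>
lemma component_attachments:
  assumes G: "ugraph V E" and k: "k_conn 4 V E" and v: "v \<in> V" and u: "u \<in> V" "u \<noteq> v" "\<not> E v u"
  defines "D \<equiv> component E (V - insert v {y. E v y}) u"
  shows "conn_set E D" "u \<in> D" "D \<subseteq> V - insert v {y. E v y}" "nbh E D \<subseteq> {y. E v y}" "4 \<le> card (nbh E D)"
proof -
  let ?U = "V - insert v {y. E v y}"
  have uU: "u \<in> ?U" using u by auto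
  note c = component_props[OF ugraph_symp[OF G] uU, folded D_def]
  show "conn_set E D" "u \<in> D" "D \<subseteq> ?U" by (rule c(1), rule c(2), rule c(3))
  have vD: "v \<notin> D" using c(3) by auto
  have "y \<noteq> v" if "y \<in> nbh E D" for y
  proof
    assume "y = v"
    then obtain x where "x \<in> D" "E x v" using \<open>y \<in> nbh E D\<close> by (auto simp: nbh_def)
    then show False using c(3) ugraph_sym[OF G] by blast
  qed
  then show sub: "nbh E D \<subseteq> {y. E v y}" using c(4) nbh_subset[OF G, of D] by blast
  have "v \<notin> D \<union> nbh E D" using sub vD ugraph_in[OF G] by blast
  then show "4 \<le> card (nbh E D)"
    using k_connD[OF k, of D] c(2,3) v by blast
qed

lemma touches_nbh: "symp E \<Longrightarrow> y \<in> nbh E D \<Longrightarrow> touches E D {y} \<and> touches E {y} D"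
  using touches_sym[of E D "{y}"] by (auto simp: nbh_def touches_def)

lemma obtain_4_subset:
  assumes "4 \<le> card A"
  obtains a b c d where "{a, b, c, d} \<subseteq> A" "distinct [a, b, c, d]"
proof -
  obtain B where "B \<subseteq> A" "card B = 4" using obtain_subset_with_card_n[OF assms] by metis
  moreover then obtain a b c d where "B = {a, b, c, d}" "distinct [a, b, c, d]" using card_4_obtain by metis
  ultimately show ?thesis using that by auto
qed

text \<open>The sets \<open>D\<close>, \<open>{v}\<close> and \<open>Y\<close> all touch the clique, and \<open>v\<close> sees \<open>Y\<close>, so \<open>D\<close> is the vertex of degree four.\<close>
lemma K7v_clique_in_nbhd:
  assumes G: "ugraph V E" and S: "{a, b, c, d} \<subseteq> nbh E D" "distinct [a, b, c, d]"
    and clq: "\<And>x y. x \<in> {a, b, c, d} \<Longrightarrow> y \<in> {a, b, c, d} \<Longrightarrow> x \<noteq> y \<Longrightarrow> E x y"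
    and D: "conn_set E D" "D \<subseteq> V - insert v {y. E v y}" and Sv: "{a, b, c, d} \<subseteq> {y. E v y}"
    and Y: "conn_set E Y" "Y \<subseteq> {y. E v y} - {a, b, c, d}" "\<And>s. s \<in> {a, b, c, d} \<Longrightarrow> touches E Y {s}"
  shows "K7v_minor V E"
proof (rule K7v_minorI[of E D "{v}" Y "{a}" "{b}" "{c}" "{d}"])
  show s: "symp E" by (rule ugraph_symp[OF G])
  obtain y where y: "y \<in> Y" "E v y" using Y(1,2) conn_set_nonempty by blast
  then have v: "v \<in> V" "v \<notin> Y" using ugraph_in[OF G] Y(2) by blast+
  then show "D \<union> {v} \<union> Y \<union> {a} \<union> {b} \<union> {c} \<union> {d} \<subseteq> V"
    using D(2) Y(2) Sv ugraph_in[OF G] by blast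
  have va: "v \<notin> {a, b, c, d}" using Sv ugraph_in[OF G] by blast
  show "D \<inter> ({v} \<union> Y \<union> {a} \<union> {b} \<union> {c} \<union> {d}) = {}" using D(2) Y(2) Sv by blast
  show "{v} \<inter> (Y \<union> {a} \<union> {b} \<union> {c} \<union> {d}) = {}" using v va by auto
  show "Y \<inter> ({a} \<union> {b} \<union> {c} \<union> {d}) = {}" using Y(2) by auto
  show "touches E {v} Y" using y by (auto simp: touches_def)
  show "touches E D {a}" "touches E D {b}" "touches E D {c}" "touches E D {d}"
    using touches_nbh[OF s, of _ D] S(1) by auto
  show "touches E {v} {a}" "touches E {v} {b}" "touches E {v} {c}" "touches E {v} {d}"
    using Sv by (auto simp: touches_def)
  show "touches E Y {a}" "touches E Y {b}" "touches E Y {c}" "touches E Y {d}" using Y(3) by auto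
  show "touches E {a} {b}" "touches E {a} {c}" "touches E {a} {d}" "touches E {b} {c}" "touches E {b} {d}"
    "touches E {c} {d}" using clq S(2) by (auto simp: touches_def)
qed (use D Y S in auto)

lemma nonneighbours_bound:
  assumes G: "ugraph V E" and x: "E v x" and c: "4 \<le> codeg E v x"
  shows "card {z. E v z \<and> z \<noteq> x \<and> \<not> E x z} \<le> dg E v - 5"
proof -
  have fin: "finite {y. E v y}" by (rule finite_edges_at[OF G])
  define A where "A = {z. E v z \<and> E x z}"
  define B where "B = {z. E v z \<and> z \<noteq> x \<and> \<not> E x z}"
  have AB: "finite A" "finite B" "A \<inter> B = {}" "x \<notin> A \<union> B"
    using fin ugraph_in[OF G] by (auto simp: A_def B_def)
  have "{y. E v y} = insert x (A \<union> B)" using x by (auto simp: A_def B_def)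
  then have "dg E v = Suc (card A + card B)"
    using AB card_Un_disjoint[of A B] by (simp add: dg_def)
  then have "dg E v = Suc (codeg E v x + card {z. E v z \<and> z \<noteq> x \<and> \<not> E x z})"
    by (simp add: codeg_def A_def B_def)
  then show ?thesis using c by simp
qed

text \<open>
  The neighbourhood is complete, so together with \<open>v\<close> it is \<open>K\<^sub>6\<close>, and a component beyond it sees four of its vertices.
\<close>
lemma degree_five:
  assumes G: "ugraph V E" and k: "k_conn 4 V E" and V: "9 \<le> card V" and v: "v \<in> V"
    and c: "\<And>x. E v x \<Longrightarrow> 4 \<le> codeg E v x" and d: "dg E v \<le> 5"
  shows "K7v_minor V E"
proof -
  have fin: "finite {y. E v y}" by (rule finite_edges_at[OF G])
  have all: "E x z" if "E v x" "E v z" "x \<noteq> z" for x z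
  proof -
    have "card {z. E v z \<and> z \<noteq> x \<and> \<not> E x z} = 0" using nonneighbours_bound[OF G that(1) c[OF that(1)]] d by simp
    moreover have "finite {z. E v z \<and> z \<noteq> x \<and> \<not> E x z}" using fin by (auto intro: finite_subset)
    ultimately show ?thesis using that by auto
  qed
  have "card (insert v {y. E v y}) \<le> 6" using d fin by (simp add: dg_def card_insert_if)
  then have "\<not> V \<subseteq> insert v {y. E v y}" using V card_mono[of "insert v {y. E v y}" V] fin by auto
  then obtain u where u: "u \<in> V" "u \<noteq> v" "\<not> E v u" by auto
  let ?D = "component E (V - insert v {y. E v y}) u"
  note D = component_attachments[OF G k v u]
  obtain a b c' e where S: "{a, b, c', e} \<subseteq> nbh E ?D" "distinct [a, b, c', e]"
    using obtain_4_subset[OF D(5)] .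
  have "4 \<le> codeg E v a" "E v a" using c S D(4) by auto
  then have "5 \<le> dg E v"
  proof -
    define A where "A = {z. E v z \<and> E a z}"
    have A: "finite A" "a \<notin> A" "insert a A \<subseteq> {y. E v y}"
      using fin ugraph_in[OF G] \<open>E v a\<close> by (auto simp: A_def)
    have "Suc (card A) \<le> dg E v" using card_mono[OF fin A(3)] A(1,2) by (simp add: dg_def)
    then have "Suc (codeg E v a) \<le> dg E v" by (simp add: A_def codeg_def)
    then show ?thesis using \<open>4 \<le> codeg E v a\<close> by simp
  qed
  then obtain y where y: "E v y" "y \<notin> {a, b, c', e}"
  proof -
    have "card {a, b, c', e} = 4" using S(2) by simp
    then have "\<not> {y. E v y} \<subseteq> {a, b, c', e}" using \<open>5 \<le> dg E v\<close> card_mono[of "{a, b, c', e}" "{y. E v y}"]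
      by (auto simp: dg_def)
    then show ?thesis using that by auto
  qed
  show ?thesis
  proof (rule K7v_clique_in_nbhd[OF G S _ D(1,3), of "{y}"])
    show "{a, b, c', e} \<subseteq> {y. E v y}" using S D by auto
    then show "E x z" if "x \<in> {a, b, c', e}" "z \<in> {a, b, c', e}" "x \<noteq> z" for x z using all that by auto
    show "touches E {y} {s}" if "s \<in> {a, b, c', e}" for s
      using all[OF y(1), of s] that y(2) S D(4) by (auto simp: touches_def)
  qed (use y in auto)
qed

text \<open>
  The edges missing in the neighbourhood of a vertex of degree six form a matching. If a vertex of the
  neighbourhood is in no missing edge, at most two are missing: filling one of them from outside
  leaves at most one; and if no missing edge can be filled, the attachments contain a clique.
\<close>
lemma degree_six:
  assumes G: "ugraph V E" and k: "k_conn 4 V E" and V: "9 \<le> card V" and v: "v \<in> V"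
    and c: "\<And>x. E v x \<Longrightarrow> 4 \<le> codeg E v x" and d: "dg E v = 6" and x: "E v x" "5 \<le> codeg E v x"
  shows "K7v_minor V E"
proof -
  let ?N = "{y. E v y}"
  have s: "symp E" by (rule ugraph_symp[OF G])
  have fin: "finite ?N" by (rule finite_edges_at[OF G])
  have uniq: "y = z" if "E v w" "E v y" "E v z" "y \<noteq> w" "z \<noteq> w" "\<not> E w y" "\<not> E w z" for w y z
  proof -
    define B where "B = {z. E v z \<and> z \<noteq> w \<and> \<not> E w z}"
    have "card B \<le> Suc 0"
      using nonneighbours_bound[OF G that(1) c[OF that(1)]] d by (simp add: B_def)
    moreover have "finite B" unfolding B_def using fin by (auto intro: finite_subset)
    ultimately have "y = z" if "y \<in> B" "z \<in> B" using that card_le_Suc0_iff_eq[of B] by blast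
    then show ?thesis using that by (simp add: B_def)
  qed
  have share: "{w, y} = {z, t}"
    if h: "E v w" "E v y" "E v z" "E v t" "w \<noteq> y" "z \<noteq> t" "\<not> E w y" "\<not> E z t" "{w, y} \<inter> {z, t} \<noteq> {}" for w y z t
  proof -
    have sy: "\<not> E y w" "\<not> E t z" using h ugraph_sym[OF G] by blast+
    consider "w = z" | "w = t" | "y = z" | "y = t" using h(9) by blast
    then show ?thesis
    proof cases
      case 1 then show ?thesis using uniq[of w y t] h by simp
    next
      case 2 then show ?thesis using uniq[of w y z] h sy by auto
    next
      case 3 then show ?thesis using uniq[of y w t] h sy by auto
    next
      case 4 then show ?thesis using uniq[of y w z] h sy by simp
    qed
  qed
  have xall: "E x y" if "E v y" "y \<noteq> x" for y
  proof -
    have "card {z. E v z \<and> E x z} = card (?N - {x})" using x d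
    proof -
      have sub: "{z. E v z \<and> E x z} \<subseteq> ?N - {x}" using ugraph_in[OF G] by auto
      have "card (?N - {x}) = 5" using d x(1) by (simp add: dg_def)
      then show ?thesis using x(2) card_mono[OF _ sub] fin by (simp add: codeg_def)
    qed
    moreover have "{z. E v z \<and> E x z} \<subseteq> ?N - {x}" using ugraph_in[OF G] by auto
    ultimately have "{z. E v z \<and> E x z} = ?N - {x}" using card_subset_eq fin by (metis finite_Diff)
    then show ?thesis using that by blast
  qed
  have "card (insert v ?N) \<le> 7" using d fin by (simp add: dg_def card_insert_if)
  then have "\<not> V \<subseteq> insert v ?N" using V card_mono[of "insert v ?N" V] fin by auto
  then obtain u where u: "u \<in> V" "u \<noteq> v" "\<not> E v u" by auto
  let ?D = "component E (V - insert v ?N) u"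
  note D = component_attachments[OF G k v u]
  show ?thesis
  proof (cases "\<exists>p q. p \<in> nbh E ?D \<and> q \<in> nbh E ?D \<and> p \<noteq> q \<and> \<not> E p q")
    case True
    then obtain p q where pq: "p \<in> nbh E ?D" "q \<in> nbh E ?D" "p \<noteq> q" "\<not> E p q" by blast
    have pqN: "E v p" "E v q" using pq D(4) by auto
    let ?U = "insert v ?N"
    define F where "F = (\<lambda>a b. E a b \<or> a = p \<and> b = q \<or> a = q \<and> b = p)"
    have sF: "symp F" using s by (auto simp: F_def symp_def)
    have vN: "v \<notin> ?N" using ugraph_in[OF G] by blast
    have "minor_model V E ?U F (\<lambda>w. if w = p then insert p ?D else {w})"
      unfolding minor_model_def
    proof (intro conjI ballI impI)
      have pD: "p \<notin> ?D" using pq(1) by (auto simp: nbh_def)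
      have cD: "conn_set E (insert p ?D)"
      proof -
        obtain e where "e \<in> ?D" "E e p" using pq(1) by (auto simp: nbh_def)
        then show ?thesis using conn_set_insert[OF s D(1)] by blast
      qed
      fix a assume a: "a \<in> ?U"
      show "(if a = p then insert p ?D else {a}) \<subseteq> V" using a D(3) v ugraph_in[OF G] pqN by auto
      show "conn_set E (if a = p then insert p ?D else {a})" using cD by simp
      fix b assume b: "b \<in> ?U"
      show "(if a = p then insert p ?D else {a}) \<inter> (if b = p then insert p ?D else {b}) = {}" if "a \<noteq> b"
        using that a b D(3) by auto
      show "touches E (if a = p then insert p ?D else {a}) (if b = p then insert p ?D else {b})" if "F a b"
        using that touches_nbh[OF s pq(2)] pq(3) by (auto simp: F_def touches_def)
    qed
    moreover have "K7v_minor ?U F"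
    proof -
      have c7: "card ?U = 7" using d fin vN by (simp add: dg_def)
      have FE: "F a b" if "a \<in> ?U" "b \<in> ?U" "a \<noteq> b" "E a b \<or> {a, b} = {p, q}" for a b
        using that by (auto simp: F_def doubleton_eq_iff)
      have vall: "F v a" "F a v" if "a \<in> ?N" for a using that ugraph_sym[OF G] by (auto simp: F_def)
      show ?thesis
      proof (cases "\<exists>a b. a \<in> ?N \<and> b \<in> ?N \<and> a \<noteq> b \<and> \<not> E a b \<and> {a, b} \<noteq> {p, q}")
        case True
        then obtain a b where ab: "a \<in> ?N" "b \<in> ?N" "a \<noteq> b" "\<not> E a b" "{a, b} \<noteq> {p, q}" by blast
        have dis: "a \<notin> {p, q}" "b \<notin> {p, q}"
          using share[of a b p q] ab pq(3,4) pqN by blast+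
        have "F y z" if yz: "y \<in> ?U" "z \<in> ?U" "y \<noteq> z" "{y, z} \<noteq> {a, b}" for y z
        proof (rule ccontr)
          assume nF: "\<not> F y z"
          then have yzN: "y \<in> ?N" "z \<in> ?N" using vall yz by auto
          have nE: "\<not> E y z" "{y, z} \<noteq> {p, q}" using nF by (auto simp: F_def doubleton_eq_iff)
          have 1: "y \<notin> {p, q}" "z \<notin> {p, q}"
            using share[of y z p q] nE yzN yz(3) pq(3,4) pqN by blast+
          have 2: "y \<notin> {a, b}" "z \<notin> {a, b}"
            using share[of y z a b] nE yzN yz(3,4) ab by blast+
          have "card {p, q, a, b, y, z} = 6" using 1 2 dis pq(3) ab(3) yz(3) by auto
          then have "{p, q, a, b, y, z} = ?N"
            using card_subset_eq[OF fin, of "{p, q, a, b, y, z}"] d pqN ab yzN by (auto simp: dg_def)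
          then have "x \<in> {p, q, a, b, y, z}" using x(1) by auto
          then obtain t where "t \<in> {p, q, a, b, y, z}" "t \<noteq> x" "\<not> E x t"
            using pq(3,4) ab(3,4) nE(1) yz(3) ugraph_sym[OF G] by blast
          then show False using xall[of t] pqN ab(1,2) yzN by auto
        qed
        then show ?thesis using K7v_seven_one[OF sF c7, of a b] by blast
      next
        case False
        then have "F y z" if "y \<in> ?U" "z \<in> ?U" "y \<noteq> z" for y z
          using that vall FE[of y z] by blast
        then show ?thesis using K7v_seven_one[OF sF c7, of v v] by blast
      qed
    qed
    ultimately show ?thesis using K7v_minor_trans[OF s] by blast
  next
    case False
    obtain a b c' e where S: "{a, b, c', e} \<subseteq> nbh E ?D" "distinct [a, b, c', e]"
      using obtain_4_subset[OF D(5)] .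
    have SN: "{a, b, c', e} \<subseteq> ?N" using S D(4) by blast
    have "card (?N - {a, b, c', e}) = 2"
      using card_Diff_subset[of "{a, b, c', e}" ?N] SN S(2) d by (simp add: dg_def)
    then obtain y z where yz: "?N - {a, b, c', e} = {y, z}" "y \<noteq> z" by (auto simp: card_2_iff)
    then have yzN: "E v y" "E v z" "y \<notin> {a, b, c', e}" "z \<notin> {a, b, c', e}" by auto
    define Y where "Y = (if E y z then {y, z} else {y})"
    show ?thesis
    proof (rule K7v_clique_in_nbhd[OF G S _ D(1,3) SN, of Y])
      show "E p q" if "p \<in> {a, b, c', e}" "q \<in> {a, b, c', e}" "p \<noteq> q" for p q
        using False that S(1) by blast
      show "conn_set E Y" using conn_set_pair[OF s] by (auto simp: Y_def)
      show "Y \<subseteq> ?N - {a, b, c', e}" using yz by (auto simp: Y_def)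
      fix t assume t: "t \<in> {a, b, c', e}"
      then have tN: "E v t" "t \<noteq> y" "t \<noteq> z" using SN yzN by auto
      show "touches E Y {t}"
      proof (cases "E y z")
        case True
        have "E t y \<or> E t z" using uniq[of t y z] tN yzN yz(2) by auto
        then show ?thesis using True ugraph_sym[OF G] by (auto simp: Y_def touches_def)
      next
        case nyz: False
        have "E y t" using uniq[of y z t] nyz tN yzN yz(2) by auto
        then show ?thesis using nyz by (auto simp: Y_def touches_def)
      qed
    qed
  qed
qed

text \<open>
  The exceptional neighbourhood of a vertex of degree seven: apart from the isolated missing edge \<open>a b\<close>, the missing edges form
  the pentagon \<open>c p d r q\<close>.
\<close>
definition pentagon :: "('a \<Rightarrow> 'a \<Rightarrow> bool) \<Rightarrow> 'a \<Rightarrow> 'a \<Rightarrow> 'a \<Rightarrow> 'a \<Rightarrow> 'a \<Rightarrow> 'a \<Rightarrow> 'a \<Rightarrow> 'a \<Rightarrow> bool" where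
  "pentagon E v a b c d p q r \<longleftrightarrow> {y. E v y} = {a, b, c, d, p, q, r} \<and> distinct [a, b, c, d, p, q, r] \<and>
     \<not> E a b \<and> \<not> E c p \<and> \<not> E p d \<and> \<not> E d r \<and> \<not> E r q \<and> \<not> E q c"

context
  fixes V :: "'a set" and E v
  assumes G: "ugraph V E" and v: "v \<in> V" and d7: "dg E v = 7"
    and c: "\<forall>x. E v x \<longrightarrow> 4 \<le> codeg E v x"
begin

text \<open>
  Only two of the six other neighbours of \<open>v\<close> can be missed, as four of them are common neighbours of \<open>v\<close> and \<open>w\<close>.
\<close>
lemma seven_three:
  assumes "E v w" "E v x" "E v y" "E v z" "distinct [w, x, y, z]"
  shows "E w x \<or> E w y \<or> E w z"
proof (rule ccontr)
  assume no: "\<not> ?thesis"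
  define B where "B = {z. E v z \<and> z \<noteq> w \<and> \<not> E w z}"
  have "card B \<le> 2" using nonneighbours_bound[OF G assms(1)] c assms(1) d7 by (simp add: B_def)
  moreover have "finite B" unfolding B_def using finite_edges_at[OF G, of v] by (auto intro: finite_subset)
  moreover have "{x, y, z} \<subseteq> B" using no assms by (auto simp: B_def)
  ultimately have "card {x, y, z} \<le> 2" using card_mono[of B "{x, y, z}"] by linarith
  then show False using assms(5) by simp
qed

text \<open>
  The remaining three neighbours of \<open>v\<close> form the branch set that touches the whole clique; if they are not connected, then one of
  them is isolated among them and already touches the clique by itself.
\<close>
lemma seven_clique:
  assumes D: "conn_set E D" "D \<subseteq> V - insert v {y. E v y}"
    and S: "{s1, s2, s3, s4} \<subseteq> nbh E D" "distinct [s1, s2, s3, s4]" "nbh E D \<subseteq> {y. E v y}"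
    and clq: "\<And>x y. x \<in> {s1, s2, s3, s4} \<Longrightarrow> y \<in> {s1, s2, s3, s4} \<Longrightarrow> x \<noteq> y \<Longrightarrow> E x y"
  shows "K7v_minor V E"
proof -
  let ?N = "{y. E v y}" and ?S = "{s1, s2, s3, s4}"
  have fin: "finite ?N" by (rule finite_edges_at[OF G])
  have SN: "?S \<subseteq> ?N" using S by blast
  have "card (?N - ?S) = 3" using card_Diff_subset[of ?S ?N] SN S(2) d7 by (simp add: dg_def)
  then obtain p q r where pqr: "?N - ?S = {p, q, r}" "p \<noteq> q" "p \<noteq> r" "q \<noteq> r" by (auto simp: card_3_iff)
  then have mem: "E v p" "E v q" "E v r" "p \<notin> ?S" "q \<notin> ?S" "r \<notin> ?S" by auto
  have es: "E y z \<longleftrightarrow> E z y" for y z using ugraph_edge_commute[OF G] .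
  show ?thesis
  proof (cases "conn_set E {p, q, r}")
    case True
    show ?thesis
    proof (rule K7v_clique_in_nbhd[OF G S(1,2) clq D SN True])
      show "{p, q, r} \<subseteq> ?N - ?S" using pqr by auto
      fix t assume t: "t \<in> ?S"
      have "E t p \<or> E t q \<or> E t r" by (rule seven_three) (use t SN mem pqr in auto)
      then show "touches E {p, q, r} {t}" using es[of t] by (auto simp: touches_def)
    qed
  next
    case False
    \<comment> \<open>Two edges among \<open>p, q, r\<close> would connect them, so one of them is isolated.\<close>
    have two: "\<not> (E y x \<and> E y z)" if "{p, q, r} = {x, y, z}" for x y z
    proof
      assume "E y x \<and> E y z"
      then have "conn_set E {y, x}" "E y z" using conn_set_pair[OF ugraph_symp[OF G]] by auto
      then have "conn_set E (insert z {y, x})" using conn_set_insert[OF ugraph_symp[OF G], of "{y, x}" y z] by simp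
      then show False using False that by (simp add: insert_commute)
    qed
    have "\<not> (E p q \<and> E p r)" "\<not> (E q p \<and> E q r)" "\<not> (E r p \<and> E r q)"
      using two[of q p r] two[of p q r] two[of p r q] by auto
    then have "\<exists>t\<in>{p, q, r}. \<forall>z\<in>{p, q, r}. z \<noteq> t \<longrightarrow> \<not> E t z"
      using es[of p q] es[of p r] es[of q r] by simp satx
    then obtain t where t: "t \<in> {p, q, r}" "\<And>z. z \<in> {p, q, r} \<Longrightarrow> z \<noteq> t \<Longrightarrow> \<not> E t z" by blast
    have tS: "E t s" if s: "s \<in> ?S" for s
    proof -
      obtain y z where yz: "{p, q, r} = {t, y, z}" "distinct [t, y, z]" using t(1) pqr(2-4) by auto
      have "E t s \<or> E t y \<or> E t z"
        by (rule seven_three) (use s SN mem yz pqr in auto)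
      then show ?thesis using t(2)[of y] t(2)[of z] yz by auto
    qed
    show ?thesis
    proof (rule K7v_clique_in_nbhd[OF G S(1,2) clq D SN, of "{t}"])
      show "{t} \<subseteq> ?N - ?S" using t(1) pqr(1) by auto
      show "touches E {t} {s}" if "s \<in> ?S" for s using tS[OF that] by (simp add: touches_def)
    qed auto
  qed
qed

text \<open>
  The attachments come first among the labels, and the only configuration without the minor is the pentagon.
\<close>
lemma seven_pentagon:
  assumes D: "conn_set E D" "D \<subseteq> V - insert v {y. E v y}"
    and S: "{s0, s1, s2, s3} \<subseteq> nbh E D" "distinct [s0, s1, s2, s3]" "nbh E D \<subseteq> {y. E v y}" "\<not> E s0 s1"
    and noK: "\<not> K7v_minor V E"
  shows "\<exists>p q r. pentagon E v s0 s1 s2 s3 p q r"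
proof -
  let ?N = "{y. E v y}" and ?S = "{s0, s1, s2, s3}"
  have SN: "?S \<subseteq> ?N" using S by blast
  have "card (?N - ?S) = 3" using card_Diff_subset[of ?S ?N] SN S(2) d7 by (simp add: dg_def)
  then obtain t0 t1 t2 where t: "?N - ?S = {t0, t1, t2}" "t0 \<noteq> t1" "t0 \<noteq> t2" "t1 \<noteq> t2" by (auto simp: card_3_iff)
  define w where "w = (\<lambda>i. [s0, s1, s2, s3, t0, t1, t2] ! i)"
  have w: "w 0 = s0" "w 1 = s1" "w (Suc 0) = s1" "w 2 = s2" "w 3 = s3" "w 4 = t0" "w 5 = t1" "w 6 = t2" by (auto simp: w_def)
  have dist: "distinct [s0, s1, s2, s3, t0, t1, t2]" using S(2) t by auto
  have lt: "{..<7} = {0, 1, 2, 3, 4, 5, 6::nat}" by auto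
  have inj: "inj_on w {..<7}"
    unfolding w_def using inj_on_nth[OF dist] by simp
  have im: "w ` {..<7} = ?N" unfolding lt using t(1) SN by (auto simp: w)
  have es: "E y z \<longleftrightarrow> E z y" for y z using ugraph_edge_commute[OF G] .
  interpret seven_labels V E w v D
  proof
    show "ugraph V E" by (rule G)
    show "inj_on w {..<7}" by (rule inj)
    show "w ` {..<7} \<subseteq> V" "v \<notin> w ` {..<7}" unfolding im using ugraph_in[OF G] by blast+
    show "E v (w i)" if "i < 7" for i using that im by blast
    show "D \<inter> insert v (w ` {..<7}) = {}" unfolding im using D(2) by blast
    show "touches E D {w i}" if "i < 4" for i
    proof -
      have "w i \<in> ?S" using that by (auto simp: w numeral_eq_Suc less_Suc_eq w_def)
      then show ?thesis using touches_nbh[OF ugraph_symp[OF G]] S(1) by blast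
    qed
  qed (use v D in auto)
  have "\<exists>p q r. {p, q, r} = {4, 5, 6} \<and> miss 2 p \<and> miss p 3 \<and> miss 3 r \<and> miss r q \<and> miss q 2"
  proof (rule ccontr)
    assume no: "\<not> ?thesis"
    have "K7v_minor V E"
    proof (rule K7v_labelled)
      show "\<not> (miss i j \<and> miss i k \<and> miss i l)" if "i < 7" "j < 7" "k < 7" "l < 7" "distinct [i, j, k, l]" for i j k l
      proof -
        have "E (w i) (w j) \<or> E (w i) (w k) \<or> E (w i) (w l)"
          by (rule seven_three) (use that im inj in \<open>auto simp: inj_on_def\<close>)
        then show ?thesis by (auto simp: miss_iff)
      qed
      show "miss 0 1" using S(4) by (simp add: miss_iff w)
    qed (use no in blast)
    then show False using noK by simp
  qed
  then obtain p q r where pqr: "{p, q, r} = {4, 5, 6::nat}"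
    and m: "miss 2 p" "miss p 3" "miss 3 r" "miss r q" "miss q 2" by blast
  have "card {p, q, r} = 3" using pqr by simp
  then have ne: "p \<noteq> q" "p \<noteq> r" "q \<noteq> r" by (auto simp: card_insert_if split: if_splits)
  have "w ` {p, q, r} = {t0, t1, t2}" unfolding pqr by (simp add: w)
  then have wt: "{w p, w q, w r} = {t0, t1, t2}" by simp
  have "p \<in> {4, 5, 6}" "q \<in> {4, 5, 6}" "r \<in> {4, 5, 6}" using pqr by blast+
  then have lt7: "p < 7" "q < 7" "r < 7" by auto
  have "pentagon E v s0 s1 s2 s3 (w p) (w q) (w r)"
    unfolding pentagon_def
  proof (intro conjI)
    show "?N = {s0, s1, s2, s3, w p, w q, w r}" using t(1) SN wt by blast
    have "w p \<noteq> w q" "w p \<noteq> w r" "w q \<noteq> w r" using w_eq lt7 ne by auto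
    moreover have "{w p, w q, w r} \<inter> ?S = {}" unfolding wt t(1)[symmetric] by blast
    ultimately show "distinct [s0, s1, s2, s3, w p, w q, w r]" using S(2) by auto
  qed (use m[unfolded miss_iff w] S(4) in simp_all)
  then show ?thesis by blast
qed

text \<open>
  A vertex of the pentagon misses two others already, so it sees all further neighbours of \<open>v\<close>.
\<close>
lemma pentagon_edges:
  assumes "pentagon E v a b c d p q r"
  shows "E a c" "E a d" "E a p" "E a q" "E a r" "E b c" "E b d" "E b p" "E b q" "E b r"
    "E c d" "E c r" "E d q" "E p q" "E p r"
proof -
  have N: "E v x" if "x \<in> {a, b, c, d, p, q, r}" for x using assms that unfolding pentagon_def by blast
  have dist: "distinct [a, b, c, d, p, q, r]"
    and no: "\<not> E c p" "\<not> E p d" "\<not> E d r" "\<not> E r q" "\<not> E q c"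
    "\<not> E p c" "\<not> E d p" "\<not> E r d" "\<not> E q r" "\<not> E c q"
    using assms ugraph_sym[OF G] by (auto simp: pentagon_def)
  have dist': "distinct [r, q, p, d, c, b, a]" using dist by auto
  have e: "E y x" if "\<not> E x y1" "\<not> E x y2" "{x, y, y1, y2} \<subseteq> {a, b, c, d, p, q, r}" "distinct [x, y, y1, y2]" for x y y1 y2
  proof -
    have "E x y \<or> E x y1 \<or> E x y2" by (rule seven_three) (use that N in auto)
    then show ?thesis using that ugraph_sym[OF G] by blast
  qed
  show "E a c" by (rule e[of c p q]; use no dist dist' in simp)
  show "E b c" by (rule e[of c p q]; use no dist dist' in simp)
  show "E a d" by (rule e[of d p r]; use no dist dist' in simp)
  show "E b d" by (rule e[of d p r]; use no dist dist' in simp)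
  show "E c d" by (rule e[of d p r]; use no dist dist' in simp)
  show "E a p" by (rule e[of p c d]; use no dist dist' in simp)
  show "E b p" by (rule e[of p c d]; use no dist dist' in simp)
  show "E a q" by (rule e[of q r c]; use no dist dist' in simp)
  show "E b q" by (rule e[of q r c]; use no dist dist' in simp)
  show "E d q" by (rule e[of q r c]; use no dist dist' in simp)
  show "E p q" by (rule e[of q r c]; use no dist dist' in simp)
  show "E a r" by (rule e[of r d q]; use no dist dist' in simp)
  show "E b r" by (rule e[of r d q]; use no dist dist' in simp)
  show "E c r" by (rule e[of r d q]; use no dist dist' in simp)
  show "E p r" by (rule e[of r d q]; use no dist dist' in simp)
qed

end

text \<open>
  In the pentagon configuration the outside \<open>D\<close> is connected: a second component would have the same missing edge between
  its attachments, and one component fills it while the other one is the vertex of degree four. Therefore \<open>D\<close> is a heavy side, and \<open>v\<close> is the apex over its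
  four attachments.
\<close>
lemma degree_seven:
  fixes V :: "'a set"
  assumes IH: "holds_below TYPE('a) (card V)"
    and G: "ugraph V E" and k: "k_conn 4 V E" and dense: "dense V E" and V: "9 \<le> card V" and v: "v \<in> V"
    and c: "\<And>x. E v x \<Longrightarrow> 4 \<le> codeg E v x" and d: "dg E v = 7"
  shows "K7v_minor V E"
proof (rule ccontr)
  assume noK: "\<not> K7v_minor V E"
  let ?N = "{y. E v y}"
  let ?U = "V - insert v ?N"
  have s: "symp E" by (rule ugraph_symp[OF G])
  have fin: "finite ?N" by (rule finite_edges_at[OF G])
  have vN: "v \<notin> ?N" using ugraph_in[OF G] by blast
  have es: "E y z \<longleftrightarrow> E z y" for y z using ugraph_edge_commute[OF G] .
  have c4: "\<forall>x. E v x \<longrightarrow> 4 \<le> codeg E v x" using c by blast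
  note pent = seven_pentagon[OF G v d c4] and clq = seven_clique[OF G v d c4] and edges = pentagon_edges[OF G v d c4]
  note pdef = pentagon_def[of E v]
  have pex: "\<exists>a b c' d' p q r. pentagon E v a b c' d' p q r \<and> {a, b, c', d'} \<subseteq> nbh E D"
    if D: "conn_set E D" "D \<subseteq> ?U" "nbh E D \<subseteq> ?N" "4 \<le> card (nbh E D)" for D
  proof -
    obtain x1 x2 x3 x4 where S: "{x1, x2, x3, x4} \<subseteq> nbh E D" "distinct [x1, x2, x3, x4]"
      using obtain_4_subset[OF D(4)] .
    \<comment> \<open>Four attachments that form a clique would give the minor.\<close>
    have "\<exists>y z. y \<in> {x1, x2, x3, x4} \<and> z \<in> {x1, x2, x3, x4} \<and> y \<noteq> z \<and> \<not> E y z"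
      using clq[OF D(1,2) S D(3)] noK by blast
    then obtain y z where yz: "y \<in> {x1, x2, x3, x4}" "z \<in> {x1, x2, x3, x4}" "y \<noteq> z" "\<not> E y z" by blast
    have "card ({x1, x2, x3, x4} - {y, z}) = 2"
      using card_Diff_subset[of "{y, z}" "{x1, x2, x3, x4}"] yz S(2) by simp
    then obtain t u where tu: "{x1, x2, x3, x4} - {y, z} = {t, u}" "t \<noteq> u" by (auto simp: card_2_iff)
    have "t \<in> {x1, x2, x3, x4} - {y, z}" "u \<in> {x1, x2, x3, x4} - {y, z}" unfolding tu(1) by auto
    then have tu': "t \<in> {x1, x2, x3, x4}" "u \<in> {x1, x2, x3, x4}" "y \<noteq> t" "y \<noteq> u" "z \<noteq> t" "z \<noteq> u" by blast+
    have sub: "{y, z, t, u} \<subseteq> nbh E D"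
      using subsetD[OF S(1) yz(1)] subsetD[OF S(1) yz(2)] subsetD[OF S(1) tu'(1)] subsetD[OF S(1) tu'(2)] by simp
    have "distinct [y, z, t, u]" using tu'(3-6) yz(3) tu(2) by simp
    from pent[OF D(1,2) sub this D(3) yz(4) noK] sub show ?thesis by metis
  qed
  have "card (insert v ?N) \<le> 8" using d fin by (simp add: dg_def card_insert_if)
  then have "\<not> V \<subseteq> insert v ?N" using V card_mono[of "insert v ?N" V] fin by auto
  then obtain u where u: "u \<in> V" "u \<noteq> v" "\<not> E v u" by auto
  define D where "D = component E ?U u"
  note D = component_attachments[OF G k v u, folded D_def]
  obtain a b c' d' p q r where P: "pentagon E v a b c' d' p q r" and at: "{a, b, c', d'} \<subseteq> nbh E D"
    using pex[OF D(1,3,4,5)] by metis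
  have N: "?N = {a, b, c', d', p, q, r}" and dist: "distinct [a, b, c', d', p, q, r]"
    and no: "\<not> E a b" "\<not> E c' p" "\<not> E p d'" "\<not> E d' r" "\<not> E r q" "\<not> E q c'"
    using P unfolding pdef by simp_all
  note ed = edges[OF P]
  have ed': "E b a \<Longrightarrow> False" "E c' a" "E d' a" "E p a" "E q a" "E r a" "E c' b" "E d' b" "E p b" "E q b" "E r b"
    "E d' c'" "E r c'" "E q d'" "E q p" "E r p"
    using ed no ugraph_sym[OF G] by blast+
  have nbhD: "nbh E D = {a, b, c', d'}"
  proof (rule ccontr)
    assume "nbh E D \<noteq> {a, b, c', d'}"
    then obtain y where y: "y \<in> nbh E D" "y \<in> {p, q, r}" using at D(4) N by blast
    have *: False if x: "x \<in> {c', d'}" "\<And>z. z \<in> {c', d', p, q, r} \<Longrightarrow> z \<noteq> x \<Longrightarrow> z \<noteq> y \<Longrightarrow> E x z \<or> E z y" for x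
    proof -
      have "{a, b, x, y} \<subseteq> nbh E D" "distinct [a, b, x, y]" using x(1) y at dist by auto
      then obtain p' q' r' where P': "pentagon E v a b x y p' q' r'"
        using pent[OF D(1,3) _ _ D(4) no(1) noK, of x y] by blast
      then have "p' \<in> ?N" "p' \<notin> {a, b}" "p' \<noteq> x" "p' \<noteq> y" "\<not> E x p'" "\<not> E p' y" unfolding pdef by auto
      then show False using x(2)[of p'] N by blast
    qed
    show False using y(2) *[of c'] *[of d'] ed ed' dist by auto
  qed
  have DU: "D = ?U"
  proof (rule ccontr)
    assume "D \<noteq> ?U"
    then obtain u2 where u2: "u2 \<in> ?U" "u2 \<notin> D" using D(3) by blast
    then have u2': "u2 \<in> V" "u2 \<noteq> v" "\<not> E v u2" by auto
    define D2 where "D2 = component E ?U u2"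
    note D2 = component_attachments[OF G k v u2', folded D2_def]
    have disj: "D \<inter> D2 = {}"
    proof (rule ccontr)
      assume "D \<inter> D2 \<noteq> {}"
      then have "D2 \<subseteq> D" using conn_set_absorb[OF D2(1,3), of D] D(4) nbhD N by blast
      then show False using D2(2) u2(2) by blast
    qed
    obtain a2 b2 c2 d2 p2 q2 r2 where P2: "pentagon E v a2 b2 c2 d2 p2 q2 r2" and at2: "{a2, b2, c2, d2} \<subseteq> nbh E D2"
      using pex[OF D2(1,3,4,5)] by metis
    have N2: "?N = {a2, b2, c2, d2, p2, q2, r2}" and dist2: "distinct [a2, b2, c2, d2, p2, q2, r2]"
      and no2: "\<not> E a2 b2" "\<not> E c2 p2" "\<not> E p2 d2" "\<not> E d2 r2" "\<not> E r2 q2" "\<not> E q2 c2"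
      using P2 unfolding pdef by auto
    note ed2 = edges[OF P2]
    \<comment> \<open>Only the ends of the isolated missing edge miss a single neighbour of \<open>v\<close>.\<close>
    have two: "x \<in> {a, b}" if x: "x \<in> {a2, b2}" for x
    proof (rule ccontr)
      assume nx: "x \<notin> {a, b}"
      have xN: "x \<in> {a, b, c', d', p, q, r}" using x N N2 by blast
      have one: False if yz: "y \<in> ?N" "z \<in> ?N" "y \<noteq> x" "z \<noteq> x" "\<not> E x y" "\<not> E x z" "y \<noteq> z" for y z
      proof -
        have y: "y \<in> {a2, b2, c2, d2, p2, q2, r2}" and z: "z \<in> {a2, b2, c2, d2, p2, q2, r2}" using yz(1,2) N2 by blast+
        have a: "E a2 t" if "t \<in> {c2, d2, p2, q2, r2}" for t using that ed2(1-5) by blast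
        have b: "E b2 t" if "t \<in> {c2, d2, p2, q2, r2}" for t using that ed2(6-10) by blast
        show False using x a[of y] a[of z] b[of y] b[of z] y z yz(3-7) by auto
      qed
      have mem: "c' \<in> ?N" "d' \<in> ?N" "p \<in> ?N" "q \<in> ?N" "r \<in> ?N" unfolding N by simp_all
      have no': "\<not> E p c'" "\<not> E d' p" "\<not> E r d'" "\<not> E q r" "\<not> E c' q" using no ugraph_sym[OF G] by blast+
      have dist': "distinct [r, q, p, d', c']" using dist by auto
      have "x = c' \<or> x = d' \<or> x = p \<or> x = q \<or> x = r" using xN nx by blast
      then show False
        using one[of p q] one[of p r] one[of c' d'] one[of r c'] one[of d' q] mem no no' dist dist' by (elim disjE) simp_all
    qed
    have D1t: "touches E D {b2}" "touches E D {a2}"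
      using two[of b2] two[of a2] nbhD touches_nbh[OF s] by blast+
    have "conn_set E (insert a2 D)"
    proof -
      obtain e where "e \<in> D" "E e a2" using D1t(2) by (auto simp: touches_def)
      then show ?thesis using conn_set_insert[OF s D(1)] by blast
    qed
    moreover have "conn_set E {p2, q2, r2}"
    proof -
      have "conn_set E {q2, p2}" using conn_set_pair[OF s] ed2 ugraph_sym[OF G] by blast
      then have "conn_set E (insert r2 {q2, p2})" using conn_set_insert[OF s, of "{q2, p2}" p2 r2] ed2 by blast
      then show ?thesis by (simp add: insert_commute)
    qed
    moreover have mem2: "{a2, b2, c2, d2, p2, q2, r2} \<subseteq> ?N" using N2 by auto
    ultimately have "K7v_minor V E"
    proof (intro K7v_minorI[of E D2 "{v}" "{p2, q2, r2}" "insert a2 D" "{b2}" "{c2}" "{d2}"])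
      show "symp E" by (rule s)
      show "D2 \<union> {v} \<union> {p2, q2, r2} \<union> insert a2 D \<union> {b2} \<union> {c2} \<union> {d2} \<subseteq> V"
        using D2(3) D(3) v mem2 ugraph_in[OF G] by blast
      show "D2 \<inter> ({v} \<union> {p2, q2, r2} \<union> insert a2 D \<union> {b2} \<union> {c2} \<union> {d2}) = {}"
        using D2(3) disj mem2 by blast
      show "{v} \<inter> ({p2, q2, r2} \<union> insert a2 D \<union> {b2} \<union> {c2} \<union> {d2}) = {}"
        using D(3) vN mem2 by blast
      show "{p2, q2, r2} \<inter> (insert a2 D \<union> {b2} \<union> {c2} \<union> {d2}) = {}" using dist2 D(3) mem2 by auto
      show "insert a2 D \<inter> ({b2} \<union> {c2} \<union> {d2}) = {}" using dist2 D(3) mem2 by auto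
      show "touches E D2 (insert a2 D)" "touches E D2 {b2}" "touches E D2 {c2}" "touches E D2 {d2}"
        using touches_nbh[OF s, of _ D2] at2 by (auto intro: touches_mono)
      show "touches E {v} {p2, q2, r2}" "touches E {v} (insert a2 D)" "touches E {v} {b2}" "touches E {v} {c2}"
        "touches E {v} {d2}"
        using mem2 by (auto simp: touches_def)
      show "touches E {p2, q2, r2} (insert a2 D)" "touches E {p2, q2, r2} {b2}" "touches E {p2, q2, r2} {c2}"
        "touches E {p2, q2, r2} {d2}"
        using ed2 ugraph_sym[OF G] unfolding touches_def by blast+
      show "touches E (insert a2 D) {b2}" using D1t(1) by simp
      show "touches E (insert a2 D) {c2}" "touches E (insert a2 D) {d2}" "touches E {b2} {c2}" "touches E {b2} {d2}"
        "touches E {c2} {d2}"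
        using ed2 by (auto simp: touches_def)
    qed (use D2 dist2 in auto)
    then show False using noK by simp
  qed
  \<comment> \<open>The closed neighbourhood of \<open>v\<close> spans 22 edges, so \<open>D\<close> is heavy; \<open>p\<close> supplies the edge that \<open>a\<close> and \<open>b\<close> lack.\<close>
  define L where "L = (\<lambda>x. if x = a then {a, p} else {x})"
  have DV: "D \<subseteq> V" using D(3) by blast
  have NV: "?N \<subseteq> V" using ugraph_in[OF G] by blast
  have VD: "V = D \<union> insert v ?N" using DU NV v by blast
  have Ddis: "D \<inter> insert v ?N = {}" using D(3) by blast
  have "K7v_minor V E"
  proof (rule heavy_side_apex[OF IH G k DV _ nbhD, of L "{v}"])
    show "D \<noteq> {}" using D(2) by blast
    show "card {a, b, c', d'} = 4" using dist by simp
    show "D \<union> {a, b, c', d'} \<noteq> V" using D(3) v vN N by blast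
    have "conn_set E {a, p}" by (rule conn_set_pair[OF s ed(3)])
    moreover have "L a = {a, p}" "L b = {b}" "L c' = {c'}" "L d' = {d'}" using dist by (auto simp: L_def)
    moreover have "{a, p, b, c', d'} \<subseteq> V - D" using N NV Ddis by blast
    ultimately show "rooted_clique E (V - D) {a, b, c', d'} L"
      unfolding rooted_clique_def using dist ed ed' by (simp add: touches_insert_right) blast
    show "{v} \<subseteq> V - D" using v Ddis by blast
    show "{v} \<inter> L t = {} \<and> touches E {v} (L t)" if "t \<in> {a, b, c', d'}" for t
      using that N vN by (auto simp: L_def touches_def)
    show "8 * card D + 4 \<le> arcs_between E D D + 2 * arcs_between E D {a, b, c', d'}"
    proof -
      let ?W = "insert v ?N"
      have finD: "finite D" "finite ?W" using DV ugraph_finite[OF G] fin finite_subset by auto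
      have "arcs_between E V V = arcs_between E D D + 2 * arcs_between E D ?W + arcs_between E ?W ?W"
        using arcs_between_split[OF s finD Ddis] VD by simp
      moreover have "arcs_between E D ?W = arcs_between E D {a, b, c', d'}"
      proof -
        have "arcs_between E D ?W = arcs_between E D {a, b, c', d'} + arcs_between E D (?W - {a, b, c', d'})"
        proof -
          have eq: "{a, b, c', d'} \<union> (?W - {a, b, c', d'}) = ?W" using N by blast
          have "arcs_between E D ({a, b, c', d'} \<union> (?W - {a, b, c', d'})) =
            arcs_between E D {a, b, c', d'} + arcs_between E D (?W - {a, b, c', d'})"
            by (rule arcs_between_Un_right) (use finD in auto)
          then show ?thesis unfolding eq .
        qed
        moreover have "arcs_between E D (?W - {a, b, c', d'}) = 0"
          by (rule arcs_between_eq_0) (use nbhD Ddis in \<open>auto simp: nbh_def\<close>)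
        ultimately show ?thesis by simp
      qed
      moreover have "arcs_between E ?W ?W = 44"
      proof -
        have nr: "\<not> E x x" for x using ugraph_in[OF G] by blast
        have vs: "E v x" "E x v" if "x \<in> {a, b, c', d', p, q, r}" for x
          using that N ugraph_sym[OF G] by blast+
        have no': "\<not> E b a" "\<not> E p c'" "\<not> E d' p" "\<not> E r d'" "\<not> E q r" "\<not> E c' q"
          using no ugraph_sym[OF G] by blast+
        have "?W = {v, a, b, c', d', p, q, r}" using N by auto
        moreover have "v \<notin> {a, b, c', d', p, q, r}" using N vN by auto
        ultimately show ?thesis using dist nr vs no no' ed ed' by (simp add: arcs_between_def)
      qed
      moreover have "card V = card D + 8"
        using card_Un_disjoint[OF finD Ddis] VD d fin vN by (simp add: dg_def)
      ultimately show ?thesis using dense by (simp add: dense_def)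
    qed
  qed auto
  then show False using noK by simp
qed

section \<open>Disjoint connections between two sets\<close>

text \<open>
  Stop at the first vertex of \<open>X\<close>: the component of \<open>a\<close> in \<open>K - X\<close> is joined by a single vertex of \<open>X\<close>.
\<close>
lemma conn_set_trim:
  assumes s: "symp E" and K: "conn_set E K" "a \<in> K" "K \<inter> X \<noteq> {}"
  shows "\<exists>K' x. K' \<subseteq> K \<and> a \<in> K' \<and> conn_set E K' \<and> K' \<inter> X = {x} \<and>
    (K' - X = {} \<or> conn_set E (K' - X) \<and> a \<in> K' - X)"
proof (cases "a \<in> X")
  case True
  then show ?thesis using K(2) by (intro exI[of _ "{a}"] exI[of _ a]) auto
next
  case False
  define C where "C = component E (K - X) a"
  have aU: "a \<in> K - X" using False K by simp
  note C = component_props[OF s aU, folded C_def]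
  have "C \<subseteq> K" "C \<noteq> {}" "C \<noteq> K" using C(2,3) K(3) by auto
  then have "touches E C (K - C)" using K(1) unfolding conn_set_def by blast
  then obtain c x where cx: "c \<in> C" "x \<in> K" "x \<notin> C" "E c x" by (auto simp: touches_def)
  then have "x \<in> nbh E C" by (auto simp: nbh_def)
  then have x: "x \<in> X" using C(4) cx by blast
  have "conn_set E (insert x C)" using conn_set_insert[OF s C(1) cx(1)] cx(4) by blast
  moreover have "insert x C \<inter> X = {x}" "insert x C - X = C" using x C(3) by auto
  ultimately show ?thesis using C cx(2) by (intro exI[of _ "insert x C"] exI[of _ x]) auto
qed

definition separates :: "'a set \<Rightarrow> ('a \<Rightarrow> 'a \<Rightarrow> bool) \<Rightarrow> 'a set \<Rightarrow> 'a set \<Rightarrow> 'a set \<Rightarrow> bool" where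
  "separates V E A B S \<longleftrightarrow> S \<subseteq> V \<and> (\<forall>K. conn_set E K \<and> K \<subseteq> V - S \<longrightarrow> K \<inter> A = {} \<or> K \<inter> B = {})"

text \<open>
  The connections are indexed by their unique vertex in \<open>B\<close>; the last condition says that such a
  connection runs from \<open>A\<close> without meeting \<open>B\<close> and then makes a single step into \<open>B\<close>, as a path would.
\<close>
definition linked :: "'a set \<Rightarrow> ('a \<Rightarrow> 'a \<Rightarrow> bool) \<Rightarrow> 'a set \<Rightarrow> 'a set \<Rightarrow> 'a set \<Rightarrow> ('a \<Rightarrow> 'a set) \<Rightarrow> bool" where
  "linked V E A B I P \<longleftrightarrow> I \<subseteq> B \<and>
     (\<forall>b\<in>I. P b \<subseteq> V \<and> conn_set E (P b) \<and> P b \<inter> B = {b} \<and> P b \<inter> A \<noteq> {} \<and>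
        (P b - B = {} \<or> conn_set E (P b - B) \<and> (P b - B) \<inter> A \<noteq> {})) \<and>
     (\<forall>b\<in>I. \<forall>c\<in>I. b \<noteq> c \<longrightarrow> P b \<inter> P c = {})"

lemma linkedI:
  assumes s: "symp E" and R: "\<forall>i\<in>J. R i \<subseteq> V \<and> conn_set E (R i) \<and> R i \<inter> A \<noteq> {} \<and> R i \<inter> B \<noteq> {}"
    and dis: "\<forall>i\<in>J. \<forall>j\<in>J. i \<noteq> j \<longrightarrow> R i \<inter> R j = {}"
  shows "\<exists>I P. linked V E A B I P \<and> card I = card J"
proof -
  have "\<forall>i\<in>J. \<exists>K x. K \<subseteq> R i \<and> conn_set E K \<and> K \<inter> B = {x} \<and> K \<inter> A \<noteq> {} \<and>
     (K - B = {} \<or> conn_set E (K - B) \<and> (K - B) \<inter> A \<noteq> {})"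
  proof
    fix i assume i: "i \<in> J"
    then obtain a where a: "a \<in> R i" "a \<in> A" using R by blast
    show "\<exists>K x. K \<subseteq> R i \<and> conn_set E K \<and> K \<inter> B = {x} \<and> K \<inter> A \<noteq> {} \<and>
     (K - B = {} \<or> conn_set E (K - B) \<and> (K - B) \<inter> A \<noteq> {})"
      using conn_set_trim[OF s _ a(1), of B] R i a(2) by blast
  qed
  then obtain K x where K: "\<And>i. i \<in> J \<Longrightarrow> K i \<subseteq> R i \<and> conn_set E (K i) \<and> K i \<inter> B = {x i} \<and> K i \<inter> A \<noteq> {} \<and>
     (K i - B = {} \<or> conn_set E (K i - B) \<and> (K i - B) \<inter> A \<noteq> {})" by metis
  have inj: "inj_on x J"
  proof
    fix i j assume ij: "i \<in> J" "j \<in> J" "x i = x j"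
    have "x i \<in> R i" "x j \<in> R j" using K[OF ij(1)] K[OF ij(2)] by blast+
    then have "R i \<inter> R j \<noteq> {}" using ij(3) by auto
    then show "i = j" using dis ij(1,2) by blast
  qed
  define P where "P = (\<lambda>b. K (the_inv_into J x b))"
  have P: "P (x i) = K i" if "i \<in> J" for i using that by (simp add: P_def the_inv_into_f_f[OF inj])
  have "linked V E A B (x ` J) P"
    unfolding linked_def
  proof (intro conjI ballI impI)
    show "x ` J \<subseteq> B" using K by blast
    fix b assume "b \<in> x ` J"
    then obtain i where i: "i \<in> J" "b = x i" by blast
    show "P b \<subseteq> V" using K[OF i(1)] R i by (auto simp: P)
    show "conn_set E (P b)" "P b \<inter> B = {b}" "P b \<inter> A \<noteq> {}"
      "P b - B = {} \<or> conn_set E (P b - B) \<and> (P b - B) \<inter> A \<noteq> {}"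
      using K[OF i(1)] i by (simp_all add: P)
    fix c assume "c \<in> x ` J" "b \<noteq> c"
    then obtain j where j: "j \<in> J" "c = x j" "i \<noteq> j" using i by blast
    have "K i \<subseteq> R i" "K j \<subseteq> R j" "R i \<inter> R j = {}" using K[OF i(1)] K[OF j(1)] dis i(1) j(1,3) by simp_all
    then have "K i \<inter> K j = {}" by blast
    then show "P b \<inter> P c = {}" using i j P by simp
  qed
  then show ?thesis using card_image[OF inj] by blast
qed

text \<open>
  Menger's theorem, by induction on the number of edges. If the deletion of an edge \<open>x y\<close> leaves a separator \<open>S\<close> with
  fewer than \<open>k\<close> vertices, then one end \<open>x\<close> lies on the \<open>A\<close> side of \<open>S\<close> and the other one on the \<open>B\<close> side, and
  connections from \<open>A\<close> to \<open>S \<union> {x}\<close> and from \<open>S \<union> {y}\<close> to \<open>B\<close> can be joined along \<open>S\<close> and \<open>x y\<close>.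
\<close>
lemma menger:
  assumes "ugraph V E" and "\<And>S. separates V E A B S \<Longrightarrow> k \<le> card S" and "A \<subseteq> V" "B \<subseteq> V"
  shows "\<exists>I P. linked V E A B I P \<and> card I = k"
  using assms
proof (induction "card {(x, y). E x y}" arbitrary: E A B rule: less_induct)
  case less
  note G = less.prems(1)
  have s: "symp E" by (rule ugraph_symp[OF G])
  show ?case
  proof (cases "\<exists>x y. E x y")
    case False
    have sing: "\<exists>z. K = {z}" if K: "conn_set E K" for K
    proof -
      obtain z where z: "z \<in> K" using conn_set_nonempty[OF K] by blast
      have "{z} = K" using K z False unfolding conn_set_def touches_def by blast
      then show ?thesis by blast
    qed
    have "separates V E A B (A \<inter> B)"
      unfolding separates_def using sing less.prems(3) by blast
    then have "k \<le> card (A \<inter> B)" by (rule less.prems(2))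
    then obtain J where J: "J \<subseteq> A \<inter> B" "card J = k" using obtain_subset_with_card_n by metis
    have "\<exists>I P. linked V E A B I P \<and> card I = card J"
      by (rule linkedI[OF s, of J "\<lambda>z. {z}"]) (use J less.prems(3) in auto)
    then show ?thesis using J(2) by simp
  next
    case True
    then obtain x0 y0 where xy0: "E x0 y0" by blast
    define F where "F = (\<lambda>a b. E a b \<and> {a, b} \<noteq> {x0, y0})"
    have GF: "ugraph V F" using G by (auto simp: ugraph_def F_def insert_commute)
    have sF: "symp F" by (rule ugraph_symp[OF GF])
    have FE: "E a b" if "F a b" for a b using that by (simp add: F_def)
    have cFE: "conn_set E K" if "conn_set F K" for K
      using that FE unfolding conn_set_def touches_def by meson
    have "finite {(x, y). E x y}"
      by (rule finite_subset[of _ "V \<times> V"]) (use G in \<open>auto simp: ugraph_def\<close>)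
    moreover have "{(x, y). F x y} \<subset> {(x, y). E x y}" using FE xy0 by (auto simp: F_def)
    ultimately have less': "card {(x, y). F x y} < card {(x, y). E x y}" by (rule psubset_card_mono)
    show ?thesis
    proof (cases "\<exists>I P. linked V F A B I P \<and> card I = k")
      case True
      then obtain I P where IP: "linked V F A B I P" "card I = k" by blast
      have h: "P b \<subseteq> V" "conn_set F (P b)" "P b \<inter> B = {b}" "P b \<inter> A \<noteq> {}"
        "P b - B = {} \<or> conn_set F (P b - B) \<and> (P b - B) \<inter> A \<noteq> {}" if "b \<in> I" for b
        using IP(1) that unfolding linked_def by blast+
      have "linked V E A B I P"
        unfolding linked_def
      proof (intro conjI ballI)
        show "I \<subseteq> B" "\<And>b c. b \<in> I \<Longrightarrow> c \<in> I \<Longrightarrow> b \<noteq> c \<longrightarrow> P b \<inter> P c = {}"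
          using IP(1) unfolding linked_def by blast+
        fix b assume b: "b \<in> I"
        show "P b - B = {} \<or> conn_set E (P b - B) \<and> (P b - B) \<inter> A \<noteq> {}" using h(5)[OF b] cFE by blast
      qed (use h(1-4) cFE in simp_all)
      then show ?thesis using IP(2) by blast
    next
      case False
      then obtain S where S: "separates V F A B S" "card S < k"
      proof -
        have "\<not> (\<forall>S. separates V F A B S \<longrightarrow> k \<le> card S)"
          using less.hyps[OF less' GF _ less.prems(3,4)] False by metis
        then show ?thesis using that by (metis linorder_not_less)
      qed
      have finS: "finite S" "S \<subseteq> V" using S(1) finite_subset ugraph_finite[OF G] by (auto simp: separates_def)
      have nS: "\<not> separates V E A B S" using less.prems(2) S(2) linorder_not_less by blast
      then obtain K where K: "conn_set E K" "K \<subseteq> V - S" "K \<inter> A \<noteq> {}" "K \<inter> B \<noteq> {}"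
        using finS(2) unfolding separates_def by blast
      define r where "r = (\<lambda>A z. \<exists>K. conn_set F K \<and> K \<subseteq> V - S \<and> z \<in> K \<and> K \<inter> A \<noteq> {})"
      have notboth: "\<not> (r A z \<and> r B z)" for z
      proof
        assume "r A z \<and> r B z"
        then obtain K1 K2 where K1: "conn_set F K1" "K1 \<subseteq> V - S" "z \<in> K1" "K1 \<inter> A \<noteq> {}"
          and K2: "conn_set F K2" "K2 \<subseteq> V - S" "z \<in> K2" "K2 \<inter> B \<noteq> {}" by (auto simp: r_def)
        have "conn_set F (K1 \<union> K2)" using conn_set_Un[OF sF K1(1) K2(1)] K1 K2 by blast
        then show False using S(1) K1 K2 unfolding separates_def by blast
      qed
      \<comment> \<open>A connected set either stays connected without the edge \<open>x0 y0\<close>, or its pieces contain an end of it.\<close>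
      have piece: "\<exists>D. conn_set F D \<and> D \<subseteq> L \<and> a \<in> D \<and> (D = L \<or> x0 \<in> D \<or> y0 \<in> D)" if L: "conn_set E L" "a \<in> L" for L a
      proof -
        note D = component_props[OF sF L(2)]
        let ?D = "component F L a"
        have "?D = L \<or> x0 \<in> ?D \<or> y0 \<in> ?D"
        proof (rule ccontr)
          assume no: "\<not> ?thesis"
          then have "touches E ?D (L - ?D)" using L(1) D(2,3) unfolding conn_set_def by blast
          then obtain b c where bc: "b \<in> ?D" "c \<in> L" "c \<notin> ?D" "E b c" by (auto simp: touches_def)
          have "F b c" using bc no by (auto simp: F_def doubleton_eq_iff)
          then have "c \<in> nbh F ?D" using bc by (auto simp: nbh_def)
          then show False using D(4) bc by blast
        qed
        then show ?thesis using D by blast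
      qed
      have rA: "r A x0 \<or> r A y0"
      proof -
        obtain a where a: "a \<in> K" "a \<in> A" using K(3) by blast
        obtain D where D: "conn_set F D" "D \<subseteq> K" "a \<in> D" "D = K \<or> x0 \<in> D \<or> y0 \<in> D" using piece[OF K(1) a(1)] by blast
        have "D \<noteq> K" using S(1) D(1) K(2-4) unfolding separates_def by blast
        then show ?thesis using D a K(2) unfolding r_def by blast
      qed
      have rB: "r B x0 \<or> r B y0"
      proof -
        obtain a where a: "a \<in> K" "a \<in> B" using K(4) by blast
        obtain D where D: "conn_set F D" "D \<subseteq> K" "a \<in> D" "D = K \<or> x0 \<in> D \<or> y0 \<in> D" using piece[OF K(1) a(1)] by blast
        have "D \<noteq> K" using S(1) D(1) K(2-4) unfolding separates_def by blast
        then show ?thesis using D a K(2) unfolding r_def by blast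
      qed
      obtain x y where xy: "{x, y} = {x0, y0}" "\<not> r A y" "\<not> r B x"
        using rA rB notboth[of x0] notboth[of y0] by (metis insert_commute)
      have Exy: "E x y" using xy(1) xy0 ugraph_sym[OF G] by (auto simp: doubleton_eq_iff)
      then have xyV: "x \<in> V" "y \<in> V" "x \<noteq> y" using ugraph_in[OF G] by blast+
      have ends: "x0 \<in> D \<or> y0 \<in> D \<Longrightarrow> x \<in> D \<or> y \<in> D" for D
        using xy(1) by (auto simp: doubleton_eq_iff)
      have gen: "\<exists>P. linked V F A' (insert p S) (insert p S) P \<and> card (insert p S) = k"
        if A': "A' \<subseteq> V" and q: "\<not> r A' q" and pq: "p = x \<and> q = y \<or> p = y \<and> q = x"
          and sep: "\<And>T. (\<forall>K. conn_set E K \<and> K \<subseteq> V - T \<longrightarrow> K \<inter> A' = {} \<or> K \<inter> B' = {}) \<Longrightarrow> T \<subseteq> V \<Longrightarrow> k \<le> card T"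
          and S': "\<And>K. conn_set F K \<Longrightarrow> K \<subseteq> V - S \<Longrightarrow> K \<inter> A' = {} \<or> K \<inter> B' = {}"
        for A' B' p q
      proof -
        have pV: "p \<in> V" using pq xyV by blast
        have k: "k \<le> card T" if T: "separates V F A' (insert p S) T" for T
        proof (rule sep)
          show "T \<subseteq> V" using T by (simp add: separates_def)
          have T': "K \<inter> A' = {} \<or> K \<inter> insert p S = {}" if "conn_set F K" "K \<subseteq> V - T" for K
            using T that by (simp add: separates_def)
          show "\<forall>K. conn_set E K \<and> K \<subseteq> V - T \<longrightarrow> K \<inter> A' = {} \<or> K \<inter> B' = {}"
          proof (intro allI impI, rule ccontr)
            fix L assume L: "conn_set E L \<and> L \<subseteq> V - T" and no: "\<not> (L \<inter> A' = {} \<or> L \<inter> B' = {})"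
            obtain a where a: "a \<in> L" "a \<in> A'" using no by blast
            obtain D where D: "conn_set F D" "D \<subseteq> L" "a \<in> D" "D = L \<or> x0 \<in> D \<or> y0 \<in> D" using piece[of L a] L a(1) by blast
            have DT: "D \<subseteq> V - T" using D(2) L by blast
            have dis: "D \<inter> insert p S = {}" using T'[OF D(1) DT] D(3) a(2) by blast
            then have DS: "D \<subseteq> V - S" using DT by blast
            have "q \<notin> D" using q D(1) DS D(3) a(2) unfolding r_def by blast
            then have "D = L" using dis D(4) ends[of D] pq by blast
            then show False using S'[OF D(1) DS] no by blast
          qed
        qed
        obtain I P where IP: "linked V F A' (insert p S) I P" "card I = k"
          using less.hyps[OF less' GF k A'] pV finS by blast
        have "I \<subseteq> insert p S" using IP(1) by (simp add: linked_def)
        moreover have "card (insert p S) \<le> k" using S(2) finS(1) by (simp add: card_insert_if)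
        ultimately have "I = insert p S" using card_seteq[of "insert p S" I] finS(1) IP(2) by simp
        then show ?thesis using IP by blast
      qed
      obtain P where P: "linked V F A (insert x S) (insert x S) P" and cx: "card (insert x S) = k"
      proof -
        have "\<exists>P. linked V F A (insert x S) (insert x S) P \<and> card (insert x S) = k"
        proof (rule gen[OF less.prems(3) xy(2), of x B])
          show "k \<le> card T" if "\<forall>K. conn_set E K \<and> K \<subseteq> V - T \<longrightarrow> K \<inter> A = {} \<or> K \<inter> B = {}" "T \<subseteq> V" for T
            using less.prems(2)[of T] that by (simp add: separates_def)
          show "K \<inter> A = {} \<or> K \<inter> B = {}" if "conn_set F K" "K \<subseteq> V - S" for K
            using S(1) that by (simp add: separates_def)
        qed simp
        then show ?thesis using that by blast
      qed
      obtain Q where Q: "linked V F B (insert y S) (insert y S) Q" and cy: "card (insert y S) = k"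
      proof -
        have "\<exists>P. linked V F B (insert y S) (insert y S) P \<and> card (insert y S) = k"
        proof (rule gen[OF less.prems(4) xy(3), of y A])
          show "k \<le> card T" if "\<forall>K. conn_set E K \<and> K \<subseteq> V - T \<longrightarrow> K \<inter> B = {} \<or> K \<inter> A = {}" "T \<subseteq> V" for T
            using less.prems(2)[of T] that by (auto simp: separates_def)
          show "K \<inter> B = {} \<or> K \<inter> A = {}" if "conn_set F K" "K \<subseteq> V - S" for K
            using S(1) that by (auto simp: separates_def)
        qed auto
        then show ?thesis using that by blast
      qed
      have Pp: "P i \<subseteq> V" "conn_set F (P i)" "P i \<inter> insert x S = {i}" "P i \<inter> A \<noteq> {}"
        "P i - insert x S = {} \<or> conn_set F (P i - insert x S) \<and> (P i - insert x S) \<inter> A \<noteq> {}"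
        if "i \<in> insert x S" for i using P that unfolding linked_def by blast+
      have Qp: "Q i \<subseteq> V" "conn_set F (Q i)" "Q i \<inter> insert y S = {i}" "Q i \<inter> B \<noteq> {}"
        "Q i - insert y S = {} \<or> conn_set F (Q i - insert y S) \<and> (Q i - insert y S) \<inter> B \<noteq> {}"
        if "i \<in> insert y S" for i using Q that unfolding linked_def by blast+
      have Qd: "Q i \<inter> Q j = {}" if "i \<in> insert y S" "j \<in> insert y S" "i \<noteq> j" for i j
        using Q that unfolding linked_def by blast
      have xS: "x \<notin> S" using cx S(2) by (metis insert_absorb nat_neq_iff)
      have PrA: "w \<in> S \<or> r A w \<or> w = x" if "i \<in> insert x S" "w \<in> P i" for i w
        using Pp[OF that(1)] that(2) unfolding r_def by blast
      have yS: "y \<notin> S" using cy S(2) by (metis insert_absorb nat_neq_iff)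
      have QrB: "w \<in> S \<or> r B w \<or> w = y" if "i \<in> insert y S" "w \<in> Q i" for i w
        using Qp[OF that(1)] that(2) unfolding r_def by blast
      have xrA: "\<not> r B x" "\<not> r A y" using xy by auto
      \<comment> \<open>The two systems meet in \<open>S\<close> only.\<close>
      have meet: "w \<in> S" if "i \<in> insert x S" "w \<in> P i" "j \<in> insert y S" "w \<in> Q j" for i j w
        using PrA[OF that(1,2)] QrB[OF that(3,4)] notboth[of w] xrA xyV(3) by blast
      define R where "R = (\<lambda>i. P i \<union> Q (if i = x then y else i))"
      have "\<exists>I P. linked V E A B I P \<and> card I = card (insert x S)"
      proof (rule linkedI[OF s, of "insert x S" R]; intro ballI impI)
        fix i assume i: "i \<in> insert x S"
        have i': "(if i = x then y else i) \<in> insert y S" using i by auto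
        have "conn_set E (R i)"
          unfolding R_def
        proof (rule conn_set_Un[OF s cFE[OF Pp(2)[OF i]] cFE[OF Qp(2)[OF i']]])
          show "P i \<inter> Q (if i = x then y else i) \<noteq> {} \<or> touches E (P i) (Q (if i = x then y else i))"
          proof (cases "i = x")
            case True
            then have "x \<in> P i" "y \<in> Q y" using Pp(3)[OF i] Qp(3)[of y] by auto
            then show ?thesis using Exy True by (auto simp: touches_def)
          next
            case False
            then show ?thesis using Pp(3)[OF i] Qp(3)[OF i'] by auto
          qed
        qed
        then show "R i \<subseteq> V \<and> conn_set E (R i) \<and> R i \<inter> A \<noteq> {} \<and> R i \<inter> B \<noteq> {}"
          using Pp(1,4)[OF i] Qp(1,4)[OF i'] unfolding R_def by blast
        fix j assume j: "j \<in> insert x S" and ne: "i \<noteq> j"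
        have j': "(if j = x then y else j) \<in> insert y S" using j by auto
        let ?i = "if i = x then y else i" and ?j = "if j = x then y else j"
        have ne': "?i \<noteq> ?j" using ne i j yS by auto
        have "P i \<inter> P j = {}" using P i j ne unfolding linked_def by blast
        moreover have "Q ?i \<inter> Q ?j = {}" by (rule Qd[OF i' j' ne'])
        moreover have "P i \<inter> Q ?j = {}"
        proof (rule ccontr)
          assume "P i \<inter> Q ?j \<noteq> {}"
          then obtain w where w: "w \<in> P i" "w \<in> Q ?j" by blast
          have wS: "w \<in> S" by (rule meet[OF i w(1) j' w(2)])
          have "w \<in> P i \<inter> insert x S" "w \<in> Q ?j \<inter> insert y S" using wS w by blast+
          then have "w = i" "w = ?j" unfolding Pp(3)[OF i] Qp(3)[OF j'] by blast+
          then show False using wS ne xS yS by (simp split: if_splits)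
        qed
        moreover have "P j \<inter> Q ?i = {}"
        proof (rule ccontr)
          assume "P j \<inter> Q ?i \<noteq> {}"
          then obtain w where w: "w \<in> P j" "w \<in> Q ?i" by blast
          have wS: "w \<in> S" by (rule meet[OF j w(1) i' w(2)])
          have "w \<in> P j \<inter> insert x S" "w \<in> Q ?i \<inter> insert y S" using wS w by blast+
          then have "w = j" "w = ?i" unfolding Pp(3)[OF j] Qp(3)[OF i'] by blast+
          then show False using wS ne xS yS by (simp split: if_splits)
        qed
        ultimately show "R i \<inter> R j = {}" unfolding R_def by blast
      qed
      then show ?thesis using cx by simp
    qed
  qed
qed

section \<open>Octahedral neighbourhoods\<close>

definition octa :: "('a \<Rightarrow> 'a \<Rightarrow> bool) \<Rightarrow> 'a \<Rightarrow> bool" where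
  "octa E v \<longleftrightarrow> dg E v = 6 \<and> (\<forall>x. E v x \<longrightarrow> codeg E v x = 4)"

text \<open>
  The neighbourhood of \<open>v\<close> is an octahedron with antipodal pairs \<open>p p'\<close>, \<open>x x'\<close> and \<open>y y'\<close>.
\<close>
definition octa_labels :: "('a \<Rightarrow> 'a \<Rightarrow> bool) \<Rightarrow> 'a \<Rightarrow> 'a \<Rightarrow> 'a \<Rightarrow> 'a \<Rightarrow> 'a \<Rightarrow> 'a \<Rightarrow> 'a \<Rightarrow> bool" where
  "octa_labels E v p p' x x' y y' \<longleftrightarrow> {z. E v z} = {p, p', x, x', y, y'} \<and> distinct [p, p', x, x', y, y'] \<and>
     (\<forall>a\<in>{p, p'}. \<forall>b\<in>{x, x', y, y'}. E a b \<and> E b a) \<and> (\<forall>a\<in>{x, x'}. \<forall>b\<in>{y, y'}. E a b \<and> E b a) \<and>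
     \<not> E p p' \<and> \<not> E p' p \<and> \<not> E x x' \<and> \<not> E x' x \<and> \<not> E y y' \<and> \<not> E y' y"

lemma octa_mate:
  assumes G: "ugraph V E" and o: "octa E v" and p: "E v p"
  shows "\<exists>m. E v m \<and> m \<noteq> p \<and> \<not> E p m \<and> (\<forall>z. E v z \<longrightarrow> z \<noteq> p \<longrightarrow> z \<noteq> m \<longrightarrow> E p z)"
proof -
  let ?N = "{z. E v z}"
  have fin: "finite ?N" by (rule finite_edges_at[OF G])
  define A where "A = {z. E v z \<and> E p z}"
  have A: "card A = 4" "A \<subseteq> ?N - {p}" using o p ugraph_in[OF G] by (auto simp: octa_def codeg_def A_def)
  have "card (?N - {p}) = 5" using o p fin by (simp add: octa_def dg_def)
  then have "card (?N - {p} - A) = 1" using card_Diff_subset[of A "?N - {p}"] A fin finite_subset[OF A(2)] by simp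
  then obtain m where "?N - {p} - A = {m}" by (auto simp: card_1_singleton_iff)
  then show ?thesis unfolding A_def by blast
qed

lemma octa_obtain_labels:
  assumes G: "ugraph V E" and o: "octa E v" and p: "E v p"
  shows "\<exists>p' x x' y y'. octa_labels E v p p' x x' y y'"
proof -
  let ?N = "{z. E v z}"
  have fin: "finite ?N" and c6: "card ?N = 6" using finite_edges_at[OF G] o by (auto simp: octa_def dg_def)
  have nr: "\<not> E z z" for z using ugraph_in[OF G] by blast
  obtain p' where p': "E v p'" "p' \<noteq> p" "\<not> E p p'" "\<forall>z. E v z \<longrightarrow> z \<noteq> p \<longrightarrow> z \<noteq> p' \<longrightarrow> E p z"
    using octa_mate[OF G o p] by blast
  have "\<not> ?N \<subseteq> {p, p'}" using c6 card_mono[of "{p, p'}" ?N] p'(2) by auto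
  then obtain x where x: "E v x" "x \<noteq> p" "x \<noteq> p'" by auto
  obtain x' where x': "E v x'" "x' \<noteq> x" "\<not> E x x'" "\<forall>z. E v z \<longrightarrow> z \<noteq> x \<longrightarrow> z \<noteq> x' \<longrightarrow> E x z"
    using octa_mate[OF G o x(1)] by blast
  have sp: "\<not> E p' p" "\<not> E x' x" using p' x' ugraph_sym[OF G] by blast+
  have q: "E p' z" if "E v z" "z \<noteq> p" "z \<noteq> p'" for z using octa_mate[OF G o p'(1)] p sp(1) p'(2) that by metis
  have xx: "E x' z" if "E v z" "z \<noteq> x" "z \<noteq> x'" for z using octa_mate[OF G o x'(1)] x(1) sp(2) x'(2) that by metis
  have x'p: "x' \<noteq> p" "x' \<noteq> p'" using p'(4) q x x'(3) ugraph_sym[OF G] by blast+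
  have "card {p, p', x, x'} = 4" using p'(2) x x'(2) x'p by auto
  then have "\<not> ?N \<subseteq> {p, p', x, x'}" using c6 card_mono[of "{p, p', x, x'}" ?N] by auto
  then obtain y where y: "E v y" "y \<notin> {p, p', x, x'}" by auto
  obtain y' where y': "E v y'" "y' \<noteq> y" "\<not> E y y'" "\<forall>z. E v z \<longrightarrow> z \<noteq> y \<longrightarrow> z \<noteq> y' \<longrightarrow> E y z"
    using octa_mate[OF G o y(1)] by blast
  have sy: "\<not> E y' y" using y' ugraph_sym[OF G] by blast
  have y'n: "y' \<notin> {p, p', x, x'}"
    using p'(4) q x'(4) xx y y'(3) ugraph_sym[OF G] by blast
  have dist: "distinct [p, p', x, x', y, y']" using p'(2) x x'(2) x'p y(2) y'(2) y'n by auto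
  have sub: "{p, p', x, x', y, y'} \<subseteq> ?N" using p p'(1) x(1) x'(1) y(1) y'(1) by auto
  have "{p, p', x, x', y, y'} = ?N"
    by (rule card_subset_eq[OF fin sub]) (use c6 distinct_card[OF dist] in simp)
  moreover have "\<forall>a\<in>{p, p'}. \<forall>b\<in>{x, x', y, y'}. E a b \<and> E b a"
  proof (intro ballI)
    fix a b assume ab: "a \<in> {p, p'}" "b \<in> {x, x', y, y'}"
    have "E v b" "b \<noteq> p" "b \<noteq> p'" using ab(2) sub dist by auto
    then have "E a b" using ab(1) p'(4) q by auto
    then show "E a b \<and> E b a" using ugraph_sym[OF G] by blast
  qed
  moreover have "\<forall>a\<in>{x, x'}. \<forall>b\<in>{y, y'}. E a b \<and> E b a"
  proof (intro ballI)
    fix a b assume ab: "a \<in> {x, x'}" "b \<in> {y, y'}"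
    have "E v b" "b \<noteq> x" "b \<noteq> x'" using ab(2) sub dist by auto
    then have "E a b" using ab(1) x'(4) xx by auto
    then show "E a b \<and> E b a" using ugraph_sym[OF G] by blast
  qed
  ultimately show ?thesis using dist sp p'(3) x'(3) y'(3) sy unfolding octa_labels_def by metis
qed

lemma octa_labels_swap:
  assumes "octa_labels E v p p' x x' y y'"
  shows "octa_labels E v p' p x x' y y'" "octa_labels E v p p' x' x y y'" "octa_labels E v p p' x x' y' y"
    "octa_labels E v p p' y y' x x'" "octa_labels E v x x' p p' y y'"
  using assms unfolding octa_labels_def by auto

text \<open>
  \<open>D1\<close> fills the missing edge \<open>p p'\<close>, by joining \<open>p'\<close>. If \<open>D2\<close> then sees four neighbours of \<open>v\<close>, it either
  fills a second missing edge or sees a transversal together with \<open>p\<close> and \<open>p'\<close>.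
\<close>
lemma octa_two_sets:
  assumes G: "ugraph V E" and o: "octa_labels E v p p' x x' y y'"
    and D1: "conn_set E D1" "D1 \<subseteq> V - insert v {z. E v z}" "touches E D1 {p}" "touches E D1 {p'}"
    and D2: "conn_set E D2" "D2 \<subseteq> V - insert v {z. E v z}" "D1 \<inter> D2 = {}"
    and A: "4 \<le> card A" "A \<subseteq> {z. E v z}" "\<And>a. a \<in> A \<Longrightarrow> touches E D2 {a} \<or> a = p' \<and> touches E D2 D1"
  shows "K7v_minor V E"
proof -
  let ?N = "{z. E v z}"
  have s: "symp E" by (rule ugraph_symp[OF G])
  have N: "?N = {p, p', x, x', y, y'}" and dist: "distinct [p, p', x, x', y, y']"
    and e: "\<And>a b. a \<in> {p, p'} \<Longrightarrow> b \<in> {x, x', y, y'} \<Longrightarrow> E a b \<and> E b a"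
      "\<And>a b. a \<in> {x, x'} \<Longrightarrow> b \<in> {y, y'} \<Longrightarrow> E a b \<and> E b a"
    using o by (auto simp: octa_labels_def)
  have NV: "?N \<subseteq> V" "v \<in> V" "v \<notin> ?N" using ugraph_in[OF G] N by blast+
  have vN: "E v z" if "z \<in> {p, p', x, x', y, y'}" for z using that N by blast
  have D1s: "touches E {p} D1" "touches E {p'} D1" using D1(3,4) touches_sym[OF s] by blast+
  have c1: "conn_set E (insert p' D1)"
  proof -
    obtain d where "d \<in> D1" "E d p'" using D1(4) by (auto simp: touches_def)
    then show ?thesis using conn_set_insert[OF s D1(1)] by blast
  qed
  have pD: "z \<notin> D1" "z \<notin> D2" "z \<noteq> v" if "z \<in> {p, p', x, x', y, y'}" for z
    using that D1(2) D2(2) N NV by blast+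
  have vD: "v \<notin> D1" "v \<notin> D2" using D1(2) D2(2) by auto
  have sub: "D1 \<subseteq> V" "D2 \<subseteq> V" "{p, p', x, x', y, y'} \<subseteq> V" using D1(2) D2(2) NV N by auto
  \<comment> \<open>\<open>D2\<close> joins \<open>a\<close> and fills \<open>a a'\<close>, so only the pair \<open>b b'\<close> is still missing.\<close>
  have both: "K7v_minor V E" if o': "octa_labels E v p p' a a' b b'" and a: "a \<in> A" "a' \<in> A" for a a' b b'
  proof -
    have e': "E r t" "E t r" if "r \<in> {p, p'}" "t \<in> {a, a', b, b'}" for r t using o' that by (auto simp: octa_labels_def)
    have e2: "E r t" "E t r" if "r \<in> {a, a'}" "t \<in> {b, b'}" for r t using o' that by (auto simp: octa_labels_def)
    have N': "?N = {p, p', a, a', b, b'}" and dist': "distinct [p, p', a, a', b, b']"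
      using o' by (auto simp: octa_labels_def)
    have mem: "{a, a', b, b'} \<subseteq> {p, p', x, x', y, y'}" using N N' by blast
    have t2: "touches E D2 {a}" "touches E D2 {a'}" using A(3)[OF a(1)] A(3)[OF a(2)] dist' by auto
    have "conn_set E (insert a D2)"
    proof -
      obtain d where "d \<in> D2" "E d a" using t2(1) by (auto simp: touches_def)
      then show ?thesis using conn_set_insert[OF s D2(1)] by blast
    qed
    moreover have pD': "z \<notin> D1" "z \<notin> D2" "z \<noteq> v" if "z \<in> {p, p', a, a', b, b'}" for z
      using pD[of z] that mem by blast+
    ultimately show ?thesis
    proof (intro K7v_minorI[of E "{b}" "{b'}" "{v}" "{p}" "insert p' D1" "insert a D2" "{a'}"])
      show "symp E" by (rule s)
      show "{b} \<union> {b'} \<union> {v} \<union> {p} \<union> insert p' D1 \<union> insert a D2 \<union> {a'} \<subseteq> V"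
        using sub NV mem by auto
      show "{b} \<inter> ({b'} \<union> {v} \<union> {p} \<union> insert p' D1 \<union> insert a D2 \<union> {a'}) = {}"
        "{b'} \<inter> ({v} \<union> {p} \<union> insert p' D1 \<union> insert a D2 \<union> {a'}) = {}"
        "{v} \<inter> ({p} \<union> insert p' D1 \<union> insert a D2 \<union> {a'}) = {}"
        "{p} \<inter> (insert p' D1 \<union> insert a D2 \<union> {a'}) = {}"
        "insert p' D1 \<inter> (insert a D2 \<union> {a'}) = {}" "insert a D2 \<inter> {a'} = {}"
        using dist' pD' vD D2(3) by auto
      show "touches E {b'} {v}" "touches E {v} {p}" "touches E {v} (insert p' D1)" "touches E {v} (insert a D2)"
        "touches E {v} {a'}"
        using N' ugraph_sym[OF G] by (auto simp: touches_def)
      show "touches E {b} {p}" "touches E {b} (insert p' D1)" "touches E {b} (insert a D2)" "touches E {b} {a'}"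
        "touches E {b'} {p}" "touches E {b'} (insert p' D1)" "touches E {b'} (insert a D2)" "touches E {b'} {a'}"
        "touches E {p} (insert a D2)" "touches E {p} {a'}" "touches E (insert p' D1) (insert a D2)"
        "touches E (insert p' D1) {a'}"
        using e' e2 by (auto simp: touches_def)
      show "touches E {p} (insert p' D1)" using D1s(1) by (auto simp: touches_def)
      show "touches E (insert a D2) {a'}" using t2(2) by simp
    qed (use c1 in auto)
  qed
  show ?thesis
  proof (cases "x \<in> A \<and> x' \<in> A \<or> y \<in> A \<and> y' \<in> A")
    case True
    then show ?thesis using both[OF o] both[OF octa_labels_swap(4)[OF o]] by blast
  next
    case False
    then obtain a a' b b' where o': "octa_labels E v p p' a a' b b'" and no: "a' \<notin> A" "b' \<notin> A"
      using o octa_labels_swap(2,3)[OF o] octa_labels_swap(3)[OF octa_labels_swap(2)[OF o]] by metis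
    have e': "E r t" "E t r" if "r \<in> {p, p'}" "t \<in> {a, a', b, b'}" for r t using o' that by (auto simp: octa_labels_def)
    have e2: "E r t" "E t r" if "r \<in> {a, a'}" "t \<in> {b, b'}" for r t using o' that by (auto simp: octa_labels_def)
    have N': "?N = {p, p', a, a', b, b'}" and dist': "distinct [p, p', a, a', b, b']"
      using o' by (auto simp: octa_labels_def)
    have mem: "{a, a', b, b'} \<subseteq> {p, p', x, x', y, y'}" using N N' by blast
    have pD': "z \<notin> D1" "z \<notin> D2" "z \<noteq> v" if "z \<in> {p, p', a, a', b, b'}" for z
      using pD[of z] that mem by blast+
    have "A \<subseteq> {p, p', a, b}" using A(2) N' no by blast
    moreover have "card {p, p', a, b} = 4" using dist' by simp
    ultimately have AA: "A = {p, p', a, b}" using A(1) card_seteq[of "{p, p', a, b}" A] by simp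
    have t: "touches E D2 {p}" "touches E D2 {a}" "touches E D2 {b}" using A(3) AA dist' by auto
    have t': "touches E D2 (insert p' D1)"
      using A(3)[of p'] AA by (auto elim: touches_mono)
    have "conn_set E {a', b'}" using conn_set_pair[OF s] e2 by auto
    then show ?thesis
    proof (intro K7v_minorI[of E D2 "{v}" "{a', b'}" "{p}" "insert p' D1" "{a}" "{b}"])
      show "D2 \<union> {v} \<union> {a', b'} \<union> {p} \<union> insert p' D1 \<union> {a} \<union> {b} \<subseteq> V" using sub NV mem by auto
      show "D2 \<inter> ({v} \<union> {a', b'} \<union> {p} \<union> insert p' D1 \<union> {a} \<union> {b}) = {}"
        "{v} \<inter> ({a', b'} \<union> {p} \<union> insert p' D1 \<union> {a} \<union> {b}) = {}"
        "{a', b'} \<inter> ({p} \<union> insert p' D1 \<union> {a} \<union> {b}) = {}"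
        "{p} \<inter> (insert p' D1 \<union> {a} \<union> {b}) = {}"
        "insert p' D1 \<inter> ({a} \<union> {b}) = {}" "{a} \<inter> {b} = {}"
        using dist' pD' vD D2(3) by auto
      show "touches E {v} {a', b'}" "touches E {v} {p}" "touches E {v} (insert p' D1)" "touches E {v} {a}"
        "touches E {v} {b}"
        using N' by (auto simp: touches_def)
      show "touches E {a', b'} {p}" "touches E {a', b'} (insert p' D1)" "touches E {a', b'} {a}" "touches E {a', b'} {b}"
        "touches E {p} {a}" "touches E {p} {b}" "touches E (insert p' D1) {a}" "touches E (insert p' D1) {b}"
        "touches E {a} {b}"
        using e' e2 by (auto simp: touches_def)
      show "touches E {p} (insert p' D1)" using D1s(1) by (auto simp: touches_def)
    qed (use s c1 t t' D2 in auto)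
  qed
qed

text \<open>A vertex outside that sees two antipodal pairs: it fills one of them, any other component sees three more.\<close>
lemma octa_far_vertex:
  assumes G: "ugraph V E" and k: "k_conn 4 V E" and V: "9 \<le> card V" and o: "octa_labels E v p p' x x' y y'"
    and d: "d \<in> V" "d \<noteq> v" "\<not> E v d" "E d p" "E d p'" "E d x" "E d x'"
  shows "K7v_minor V E"
proof -
  let ?N = "{z. E v z}"
  have s: "symp E" by (rule ugraph_symp[OF G])
  have N: "?N = {p, p', x, x', y, y'}" and dist: "distinct [p, p', x, x', y, y']"
    using o by (auto simp: octa_labels_def)
  have fin: "finite ?N" by (rule finite_edges_at[OF G])
  have vV: "v \<in> V" using ugraph_in[OF G] N by blast
  have "card (insert d (insert v ?N)) \<le> 8" unfolding N using card_length[of "[d, v, p, p', x, x', y, y']"] by simp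
  then have "\<not> V \<subseteq> insert d (insert v ?N)" using V card_mono[of "insert d (insert v ?N)" V] fin by auto
  then obtain u where u: "u \<in> V - insert d (insert v ?N)" by blast
  let ?U = "V - insert d (insert v ?N)"
  define K where "K = component E ?U u"
  note K = component_props[OF s u, folded K_def]
  have "nbh E K \<subseteq> insert d ?N"
  proof
    fix z assume z: "z \<in> nbh E K"
    then have "z \<in> insert d (insert v ?N)" using K(4) nbh_subset[OF G, of K] by blast
    moreover have "z \<noteq> v"
    proof
      assume "z = v"
      then obtain t where "t \<in> K" "E t v" using z by (auto simp: nbh_def)
      then show False using K(3) ugraph_sym[OF G] by blast
    qed
    ultimately show "z \<in> insert d ?N" by blast
  qed
  moreover have "4 \<le> card (nbh E K)"
  proof (rule k_connD[OF k])
    show "K \<subseteq> V" "K \<noteq> {}" using K(2,3) by auto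
    have "v \<notin> K \<union> nbh E K" using K(3) calculation d ugraph_in[OF G] by blast
    then show "K \<union> nbh E K \<noteq> V" using vV by blast
  qed
  ultimately have nb: "nbh E K \<subseteq> insert d ?N" "4 \<le> card (nbh E K)" by auto
  define A where "A = nbh E K \<inter> ?N"
  have AN: "A \<subseteq> ?N" "\<And>a. a \<in> A \<Longrightarrow> touches E K {a}" using touches_nbh[OF s] by (auto simp: A_def)
  have finA: "finite A" using fin by (simp add: A_def)
  have dN: "d \<notin> ?N" using d by simp
  have dsub: "{d} \<subseteq> V - insert v ?N" "K \<subseteq> V - insert v ?N" "{d} \<inter> K = {}" using d K(3) by auto
  have td: "touches E {d} {p}" "touches E {d} {p'}" "touches E {d} {x}" "touches E {d} {x'}"
    using d by (auto simp: touches_def)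
  show ?thesis
  proof (cases "d \<in> nbh E K")
    case False
    then have "A = nbh E K" using nb(1) by (auto simp: A_def)
    then show ?thesis using octa_two_sets[OF G o _ dsub(1) td(1,2) K(1) dsub(2,3), of A] nb(2) AN by auto
  next
    case True
    then have tK: "touches E K {d}" using touches_nbh[OF s] by blast
    have "nbh E K = insert d A" using nb(1) True by (auto simp: A_def)
    moreover have "card (insert d A) \<le> card A + 1" using finA by (simp add: card_insert_if)
    ultimately have A3: "3 \<le> card A" using nb(2) by simp
    have go: "K7v_minor V E" if o': "octa_labels E v a a' b b' c c'" and ta: "touches E {d} {a}" "touches E {d} {a'}"
      and na: "a' \<notin> A" for a a' b b' c c'
    proof (rule octa_two_sets[OF G o' _ dsub(1) ta K(1) dsub(2,3), of "insert a' A"])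
      show "4 \<le> card (insert a' A)" using A3 na finA by simp
      show "insert a' A \<subseteq> ?N" using AN(1) o' by (auto simp: octa_labels_def)
      show "touches E K {z} \<or> z = a' \<and> touches E K {d}" if "z \<in> insert a' A" for z
        using that AN(2) tK by auto
    qed auto
    have allA: "K7v_minor V E" if "4 \<le> card A"
      using octa_two_sets[OF G o _ dsub(1) td(1,2) K(1) dsub(2,3), of A] that AN by auto
    show ?thesis
    proof (cases "p \<in> A \<and> p' \<in> A \<and> x \<in> A \<and> x' \<in> A")
      case True
      then have "card {p, p', x, x'} \<le> card A" by (intro card_mono finA) auto
      then show ?thesis using allA dist by simp
    next
      case False
      then show ?thesis
        using go[OF o td(1,2)] go[OF octa_labels_swap(1)[OF o] td(2,1)]
          go[OF octa_labels_swap(5)[OF o] td(3,4)] go[OF octa_labels_swap(1)[OF octa_labels_swap(5)[OF o]] td(4,3)]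
        by blast
    qed
  qed
qed

text \<open>
  The vertex antipodal to \<open>v\<close> around \<open>u\<close> is not a neighbour of \<open>v\<close>, and it sees the two antipodal pairs that \<open>u\<close> sees around \<open>v\<close>.
\<close>
lemma octa_adjacent:
  assumes G: "ugraph V E" and k: "k_conn 4 V E" and V: "9 \<le> card V"
    and ov: "octa E v" and ou: "octa E u" and uv: "E v u"
  shows "K7v_minor V E"
proof -
  have vu: "E u v" using ugraph_sym[OF G uv] .
  obtain u' x x' y y' where o: "octa_labels E v u u' x x' y y'" using octa_obtain_labels[OF G ov uv] by blast
  obtain d where d: "E u d" "d \<noteq> v" "\<not> E v d" "\<forall>z. E u z \<longrightarrow> z \<noteq> v \<longrightarrow> z \<noteq> d \<longrightarrow> E v z"
    using octa_mate[OF G ou vu] by blast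
  have N: "{z. E v z} = {u, u', x, x', y, y'}" and dist: "distinct [u, u', x, x', y, y']"
    and e: "E u x" "E u x'" "E u y" "E u y'" "\<not> E x x'" "\<not> E x' x" "\<not> E y y'" "\<not> E y' y"
    using o by (auto simp: octa_labels_def)
  have dN: "d \<notin> {u, u', x, x', y, y'}" using d(3) N by blast
  \<comment> \<open>In \<open>N(u)\<close> the vertex \<open>x\<close> already misses \<open>x'\<close>, so it sees \<open>d\<close>.\<close>
  have see: "E d a" if a: "E u a" "E u a'" "\<not> E a a'" "a \<noteq> a'" "a \<noteq> d" "a' \<noteq> d" for a a'
  proof -
    obtain m where "\<forall>z. E u z \<longrightarrow> z \<noteq> a \<longrightarrow> z \<noteq> m \<longrightarrow> E a z" using octa_mate[OF G ou a(1)] by blast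
    then have "E a d" using a d(1) by metis
    then show ?thesis using ugraph_sym[OF G] by blast
  qed
  have "E d x" "E d x'" "E d y" "E d y'"
    using see[of x x'] see[of x' x] see[of y y'] see[of y' y] e dist dN by auto
  moreover have "d \<in> V" using ugraph_in[OF G d(1)] by blast
  ultimately show ?thesis
    using octa_far_vertex[OF G k V octa_labels_swap(4)[OF octa_labels_swap(5)[OF o], THEN octa_labels_swap(5)], of d] d
      octa_far_vertex[OF G k V, of v x x' y y' u u' d] o by (auto simp: octa_labels_def)
qed


text \<open>The common neighbours are connections by themselves; Menger's theorem supplies the missing ones in their complement.\<close>
lemma four_connections:
  fixes V :: "'a set"
  assumes G: "ugraph V E" and k: "k_conn 4 V E" and uv: "\<not> E u v" "u \<noteq> v" "u \<in> V" "v \<in> V"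
    and c: "card ({z. E u z} \<inter> {z. E v z}) \<le> 4"
  shows "\<exists>B P a. B \<subseteq> {z. E v z} \<and> card B = 4 \<and> {z. E u z} \<inter> {z. E v z} \<subseteq> B \<and>
    (\<forall>b\<in>B. P b \<subseteq> V - {u, v} \<and> conn_set E (P b) \<and> P b \<inter> {z. E v z} = {b} \<and> P b \<inter> {z. E u z} = {a b}) \<and>
    (\<forall>b\<in>B. \<forall>c\<in>B. b \<noteq> c \<longrightarrow> P b \<inter> P c = {})"
proof -
  let ?N = "\<lambda>v. {z. E v z}"
  define C where "C = ?N u \<inter> ?N v"
  define V' where "V' = V - {u, v} - C"
  define F where "F = (\<lambda>x y. E x y \<and> x \<in> V' \<and> y \<in> V')"
  have s: "symp E" by (rule ugraph_symp[OF G])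
  have vu: "\<not> E v u" using uv(1) ugraph_sym[OF G] by blast
  have NV: "?N x \<subseteq> V" "x \<notin> ?N x" for x using ugraph_in[OF G] by blast+
  have fin: "finite (?N x)" for x by (rule finite_edges_at[OF G])
  have finC: "finite C" using fin by (simp add: C_def)
  have GF: "ugraph V' F" using G by (auto simp: ugraph_def F_def V'_def)
  have cFE: "conn_set E K" if "conn_set F K" for K
  proof -
    have "touches E A (K - A)" if "A \<subseteq> K \<and> A \<noteq> {} \<and> A \<noteq> K" for A
      using \<open>conn_set F K\<close> that unfolding conn_set_def touches_def F_def by blast
    then show ?thesis using conn_set_nonempty[OF that] unfolding conn_set_def by blast
  qed
  have sep: "4 - card C \<le> card S" if S: "separates V' F (?N u - C) (?N v - C) S" for S :: "'a set"
  proof -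
    define D where "D = insert u {z. \<exists>K. conn_set F K \<and> K \<subseteq> V' - S \<and> z \<in> K \<and> K \<inter> (?N u - C) \<noteq> {}}"
    have SV: "S \<subseteq> V'" using S by (simp add: separates_def)
    have DV: "D - {u} \<subseteq> V' - S" by (auto simp: D_def)
    have closed: "w \<in> D" if w: "w \<in> V' - S" "z \<in> D" "E z w" for w z
    proof (cases "z = u")
      case True
      then have "conn_set F {w} \<and> {w} \<subseteq> V' - S \<and> w \<in> {w} \<and> {w} \<inter> (?N u - C) \<noteq> {}"
        using w by (auto simp: V'_def)
      then show ?thesis unfolding D_def by blast
    next
      case False
      then obtain K where K: "conn_set F K" "K \<subseteq> V' - S" "z \<in> K" "K \<inter> (?N u - C) \<noteq> {}" using w(2) by (auto simp: D_def)
      have "F z w" using w K by (auto simp: F_def)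
      then have "conn_set F (insert w K)" using conn_set_insert[OF ugraph_symp[OF GF] K(1,3)] by blast
      then show ?thesis using K w(1) unfolding D_def by blast
    qed
    have vn: "\<not> E z v" if z: "z \<in> D" for z
    proof
      assume zv: "E z v"
      then have "z \<noteq> u" using uv by blast
      then obtain K where K: "conn_set F K" "K \<subseteq> V' - S" "z \<in> K" "K \<inter> (?N u - C) \<noteq> {}" using z by (auto simp: D_def)
      have "z \<in> ?N v - C" using zv ugraph_sym[OF G] K(2,3) by (auto simp: V'_def)
      then show False using S K unfolding separates_def by blast
    qed
    have sub: "nbh E D \<subseteq> S \<union> C"
    proof
      fix w assume w: "w \<in> nbh E D"
      then obtain z where z: "z \<in> D" "E z w" "w \<notin> D" by (auto simp: nbh_def)
      have "w \<noteq> v" "w \<noteq> u" "w \<in> V" using vn[OF z(1)] z NV by (auto simp: D_def)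
      then show "w \<in> S \<union> C" using closed[OF _ z(1,2)] z(3) by (auto simp: V'_def)
    qed
    have "4 \<le> card (nbh E D)"
    proof (rule k_connD[OF k])
      show "D \<subseteq> V" "D \<noteq> {}" using DV uv(3) by (auto simp: V'_def D_def)
      have "v \<notin> D" using DV uv(2) by (auto simp: V'_def)
      moreover have "v \<notin> nbh E D" using sub SV NV by (auto simp: V'_def C_def)
      ultimately show "D \<union> nbh E D \<noteq> V" using uv(4) by blast
    qed
    also have "\<dots> \<le> card (S \<union> C)"
      using sub finC SV ugraph_finite[OF GF] by (intro card_mono) (auto intro: finite_subset)
    also have "\<dots> \<le> card S + card C" by (rule card_Un_le)
    finally show ?thesis by simp
  qed
  obtain I P where IP: "linked V' F (?N u - C) (?N v - C) I P" "card I = 4 - card C"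
  proof -
    have "?N u - C \<subseteq> V'" "?N v - C \<subseteq> V'" using NV uv vu by (auto simp: V'_def)
    then show ?thesis using menger[OF GF sep, of "?N u - C" "?N v - C"] that by blast
  qed
  have IV: "I \<subseteq> ?N v - C" using IP(1) by (simp add: linked_def)
  have P: "P b \<subseteq> V'" "conn_set E (P b)" "P b \<inter> (?N v - C) = {b}" "P b \<inter> (?N u - C) \<noteq> {}" if "b \<in> I" for b
    using IP(1) that cFE unfolding linked_def by blast+
  have "\<forall>b\<in>I \<union> C. \<exists>K a. K \<subseteq> V - {u, v} \<and> conn_set E K \<and> K \<inter> ?N v = {b} \<and> K \<inter> ?N u = {a} \<and>
    (b \<in> I \<longrightarrow> K \<subseteq> P b) \<and> (b \<in> C \<longrightarrow> K = {b})"
  proof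
    fix b assume b: "b \<in> I \<union> C"
    show "\<exists>K a. K \<subseteq> V - {u, v} \<and> conn_set E K \<and> K \<inter> ?N v = {b} \<and> K \<inter> ?N u = {a} \<and>
      (b \<in> I \<longrightarrow> K \<subseteq> P b) \<and> (b \<in> C \<longrightarrow> K = {b})"
    proof (cases "b \<in> C")
      case True
      then have "{b} \<subseteq> V - {u, v} \<and> conn_set E {b} \<and> {b} \<inter> ?N v = {b} \<and> {b} \<inter> ?N u = {b} \<and>
        (b \<in> I \<longrightarrow> {b} \<subseteq> P b) \<and> (b \<in> C \<longrightarrow> {b} = {b})"
        using NV IV uv vu by (auto simp: C_def)
      then show ?thesis by (intro exI[where x = "{b}"], intro exI[where x = b])
    next
      case False
      then have bI: "b \<in> I" using b by simp
      have "b \<in> P b" using P(3)[OF bI] by blast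
      moreover have "P b \<inter> ?N u \<noteq> {}" using P(4)[OF bI] by blast
      ultimately obtain K a where K: "K \<subseteq> P b" "b \<in> K" "conn_set E K" "K \<inter> ?N u = {a}"
        using conn_set_trim[OF s P(2)[OF bI], of b "?N u"] by metis
      have "K \<inter> C = {}" using K(1) P(1)[OF bI] by (auto simp: V'_def)
      then have "K \<inter> ?N v = {b}" using K P(3)[OF bI] by blast
      moreover have "K \<subseteq> V - {u, v}" using K(1) P(1)[OF bI] by (auto simp: V'_def)
      ultimately have "K \<subseteq> V - {u, v} \<and> conn_set E K \<and> K \<inter> ?N v = {b} \<and> K \<inter> ?N u = {a} \<and>
        (b \<in> I \<longrightarrow> K \<subseteq> P b) \<and> (b \<in> C \<longrightarrow> K = {b})" using K False by simp
      then show ?thesis by (intro exI[where x = K], intro exI[where x = a])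
    qed
  qed
  then obtain Q a where Q: "\<And>b. b \<in> I \<union> C \<Longrightarrow> Q b \<subseteq> V - {u, v} \<and> conn_set E (Q b) \<and> Q b \<inter> ?N v = {b} \<and> Q b \<inter> ?N u = {a b} \<and>
    (b \<in> I \<longrightarrow> Q b \<subseteq> P b) \<and> (b \<in> C \<longrightarrow> Q b = {b})" by metis
  have dis: "Q b \<inter> Q c = {}" if bc: "b \<in> I \<union> C" "c \<in> I \<union> C" "b \<noteq> c" for b c
  proof -
    have QP: "Q x \<subseteq> P x" if "x \<in> I" for x using Q[of x] that by simp
    have C1: "Q x = {x}" if "x \<in> C" for x using Q[of x] that by simp
    have IC: "Q x \<inter> C = {}" if "x \<in> I" for x using QP[OF that] P(1)[OF that] by (auto simp: V'_def)
    have II: "Q b \<inter> Q c = {}" if "b \<in> I" "c \<in> I"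
    proof -
      have "P b \<inter> P c = {}" using IP(1) that bc(3) unfolding linked_def by blast
      then show ?thesis using QP[OF that(1)] QP[OF that(2)] by blast
    qed
    consider "b \<in> I" "c \<in> I" | "b \<in> C" "c \<in> C" | "b \<in> I" "c \<in> C" | "b \<in> C" "c \<in> I" using bc by blast
    then show ?thesis
    proof cases
      case 1 then show ?thesis by (rule II)
    next
      case 2 then show ?thesis using C1[OF 2(1)] C1[OF 2(2)] bc(3) by simp
    next
      case 3 then show ?thesis using C1[OF 3(2)] IC[OF 3(1)] by auto
    next
      case 4 then show ?thesis using C1[OF 4(1)] IC[OF 4(2)] by auto
    qed
  qed
  have card4: "card (I \<union> C) = 4"
  proof -
    have "finite I" using IV fin finite_subset by blast
    moreover have "I \<inter> C = {}" using IV by blast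
    ultimately show ?thesis using card_Un_disjoint[of I C] finC IP(2) c by (simp add: C_def)
  qed
  moreover have "I \<union> C \<subseteq> ?N v" using IV by (auto simp: C_def)
  note f1 = this
  have "?N u \<inter> ?N v \<subseteq> I \<union> C" by (simp add: C_def)
  moreover have "\<forall>b\<in>I \<union> C. Q b \<subseteq> V - {u, v} \<and> conn_set E (Q b) \<and> Q b \<inter> ?N v = {b} \<and> Q b \<inter> ?N u = {a b}"
    using Q by simp
  moreover have "\<forall>b\<in>I \<union> C. \<forall>c\<in>I \<union> C. b \<noteq> c \<longrightarrow> Q b \<inter> Q c = {}"
    by (intro ballI impI) (rule dis)
  ultimately have "I \<union> C \<subseteq> ?N v \<and> card (I \<union> C) = 4 \<and> ?N u \<inter> ?N v \<subseteq> I \<union> C \<and>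
    (\<forall>b\<in>I \<union> C. Q b \<subseteq> V - {u, v} \<and> conn_set E (Q b) \<and> Q b \<inter> ?N v = {b} \<and> Q b \<inter> ?N u = {a b}) \<and>
    (\<forall>b\<in>I \<union> C. \<forall>c\<in>I \<union> C. b \<noteq> c \<longrightarrow> Q b \<inter> Q c = {})"
    using f1 card4 by (intro conjI)
  then show ?thesis by (rule exI[where x = a, THEN exI[where x = Q], THEN exI[where x = "I \<union> C"]])
qed

text \<open>
  The four connections become the clique: \<open>u\<close> and \<open>v\<close> see all of them, and the two neighbours of \<open>v\<close> left over
  give the seventh branch set and, if they are not adjacent, one of the missing edges. The other missing edge
  is found at \<open>u\<close>, directly or through a neighbour of \<open>u\<close> left over.
\<close>
lemma octa_nonadjacent:
  assumes G: "ugraph V E" and k: "k_conn 4 V E" and V: "9 \<le> card V"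
    and ov: "octa E v" and ou: "octa E u" and uv: "\<not> E u v" "u \<noteq> v"
  shows "K7v_minor V E"
proof (cases "card ({z. E u z} \<inter> {z. E v z}) \<le> 4")
  case False
  let ?N = "\<lambda>v. {z. E v z}"
  have fin: "finite (?N x)" for x by (rule finite_edges_at[OF G])
  have c6: "card (?N v) = 6" "card (?N u) = 6" using ov ou by (auto simp: octa_def dg_def)
  then have "?N v \<noteq> {}" "?N u \<noteq> {}" by (metis card.empty zero_neq_numeral)+
  then obtain p r where p: "E v p" "E u r" by blast
  have uV: "u \<in> V" using ugraph_in[OF G p(2)] by blast
  obtain p' x x' y y' where o: "octa_labels E v p p' x x' y y'" using octa_obtain_labels[OF G ov p(1)] by blast
  have N: "?N v = {p, p', x, x', y, y'}" using o by (simp add: octa_labels_def)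
  have "card (?N v - ?N u) = card (?N v) - card (?N v \<inter> ?N u)" by (rule card_Diff_subset_Int) (use fin in auto)
  then have c1: "card (?N v - ?N u) \<le> 1" using False c6 by (simp add: Int_commute)
  then obtain m where m: "?N v - ?N u \<subseteq> {m}"
    using card_le_Suc0_iff_eq[of "?N v - ?N u"] fin by (metis finite_Diff One_nat_def insertCI subsetI)
  have see: "E u z" if "z \<in> {p, p', x, x', y, y'}" "z \<noteq> m" for z using m that N by blast
  have vu: "\<not> E v u" using uv(1) ugraph_sym[OF G] by blast
  note far = octa_far_vertex[OF G k V _ uV uv(2) vu]
  have dist: "distinct [p, p', x, x', y, y']" using o by (simp add: octa_labels_def)
  consider "m \<notin> {x, x', y, y'}" | "m \<notin> {p, p', y, y'}" | "m \<notin> {p, p', x, x'}" using dist by auto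
  then show ?thesis
  proof cases
    case 1
    have "octa_labels E v x x' y y' p p'" using o by (auto simp: octa_labels_def)
    from far[OF this] show ?thesis using see 1 by auto
  next
    case 2
    have "octa_labels E v p p' y y' x x'" using o by (auto simp: octa_labels_def)
    from far[OF this] show ?thesis using see 2 by auto
  next
    case 3
    from far[OF o] show ?thesis using see 3 by auto
  qed
next
  case True
  let ?N = "\<lambda>v. {z. E v z}"
  have s: "symp E" by (rule ugraph_symp[OF G])
  have fin: "finite (?N x)" for x by (rule finite_edges_at[OF G])
  have c6: "card (?N v) = 6" "card (?N u) = 6" using ov ou by (auto simp: octa_def dg_def)
  then have "?N v \<noteq> {}" "?N u \<noteq> {}" by (metis card.empty zero_neq_numeral)+
  then obtain p r where p: "E v p" "E u r" by blast
  have uV: "u \<in> V" "v \<in> V" using ugraph_in[OF G] p by blast+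
  have NV: "?N x \<subseteq> V" "x \<notin> ?N x" for x using ugraph_in[OF G] by blast+
  have vu: "\<not> E v u" using uv(1) ugraph_sym[OF G] by blast
  obtain B P a where B: "B \<subseteq> ?N v" "card B = 4" "?N u \<inter> ?N v \<subseteq> B"
    and P0: "\<forall>b\<in>B. P b \<subseteq> V - {u, v} \<and> conn_set E (P b) \<and> P b \<inter> {z. E v z} = {b} \<and> P b \<inter> {z. E u z} = {a b}"
    and dis: "\<forall>b\<in>B. \<forall>c\<in>B. b \<noteq> c \<longrightarrow> P b \<inter> P c = {}"
    using four_connections[OF G k uv uV True] by metis
  have P: "P b \<subseteq> V" "u \<notin> P b" "v \<notin> P b" "conn_set E (P b)" "P b \<inter> ?N v = {b}" "P b \<inter> ?N u = {a b}" if "b \<in> B" for b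
    using bspec[OF P0 that] by auto
  have ends: "b \<in> P b" "a b \<in> P b" "E u (a b)" "E v b" if "b \<in> B" for b using P(5,6)[OF that] by blast+
  have finB: "finite B" using B(2) card.infinite by fastforce
  have "card (?N v - B) = 2" using card_Diff_subset[OF finB B(1)] c6(1) B(2) by simp
  then obtain o1 o2 where o12: "?N v - B = {o1, o2}" "o1 \<noteq> o2" by (auto simp: card_2_iff)
  have o: "E v o1" "E v o2" "o1 \<notin> B" "o2 \<notin> B" using o12 by blast+
  have zP: "z \<notin> P b" if "b \<in> B" "E v z" "z \<notin> B" for b z
    using P(5)[OF that(1)] that by (metis IntI mem_Collect_eq singletonD)
  have oP: "o1 \<notin> P b" "o2 \<notin> P b" if "b \<in> B" for b using zP[OF that] o by simp_all
  have ou': "\<not> E u o1" "\<not> E u o2" using o B(3) by blast+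
  have "\<exists>b1 b2 b3 b4 Y R. B = {b1, b2, b3, b4} \<and> distinct [b1, b2, b3, b4] \<and> E b1 b3 \<and> E b1 b4 \<and> E b2 b3 \<and> E b2 b4 \<and>
    Y \<union> R \<subseteq> {o1, o2} \<and> Y \<inter> R = {} \<and> conn_set E Y \<and> (\<forall>b\<in>B. touches E Y {b}) \<and>
    conn_set E (insert b1 R) \<and> touches E (insert b1 R) {b2}"
  proof -
    obtain q x x' y y' where ol: "octa_labels E v o1 q x x' y y'" using octa_obtain_labels[OF G ov o(1)] by blast
    show ?thesis
    proof (cases "o2 = q")
      case True
      have N: "?N v = {o1, o2, x, x', y, y'}" and d: "distinct [o1, o2, x, x', y, y']"
        and e: "\<And>a b. a \<in> {o1, o2} \<Longrightarrow> b \<in> {x, x', y, y'} \<Longrightarrow> E a b \<and> E b a"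
          "\<And>a b. a \<in> {x, x'} \<Longrightarrow> b \<in> {y, y'} \<Longrightarrow> E a b \<and> E b a"
        using ol True by (auto simp: octa_labels_def)
      have B': "B = {x, x', y, y'}"
      proof -
        have "B = ?N v - {o1, o2}" using o12(1) B(1) by blast
        then show ?thesis unfolding N using d by auto
      qed
      have "conn_set E {x, o2}" using conn_set_pair[OF s, of x o2] e(1) by simp
      note c = this
      show ?thesis
        apply (rule exI[of _ x])
        apply (rule exI[of _ x'])
        apply (rule exI[of _ y])
        apply (rule exI[of _ y'])
        apply (rule exI[of _ "{o1}"])
        apply (rule exI[of _ "{o2}"])
        using B' d e o12(2) c by (auto simp: touches_def)
    next
      case False
      have "o2 \<in> {x, x', y, y'}" using ol o(2) o12(2) False by (auto simp: octa_labels_def)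
      then obtain x2 y2 y2' where ol': "octa_labels E v o1 q o2 x2 y2 y2'"
        using ol octa_labels_swap(2)[OF ol] octa_labels_swap(4)[OF ol] octa_labels_swap(2)[OF octa_labels_swap(4)[OF ol]]
        by blast
      have N: "?N v = {o1, q, o2, x2, y2, y2'}" and d: "distinct [o1, q, o2, x2, y2, y2']"
        and e: "\<And>a b. a \<in> {o1, q} \<Longrightarrow> b \<in> {o2, x2, y2, y2'} \<Longrightarrow> E a b \<and> E b a"
          "\<And>a b. a \<in> {o2, x2} \<Longrightarrow> b \<in> {y2, y2'} \<Longrightarrow> E a b \<and> E b a"
        using ol' by (auto simp: octa_labels_def)
      have B': "B = {q, x2, y2, y2'}"
      proof -
        have "B = ?N v - {o1, o2}" using o12(1) B(1) by blast
        then show ?thesis unfolding N using d by auto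
      qed
      have "conn_set E {o1, o2}" using conn_set_pair[OF s, of o1 o2] e(1) by simp
      note c = this
      show ?thesis
        apply (rule exI[of _ q])
        apply (rule exI[of _ x2])
        apply (rule exI[of _ y2])
        apply (rule exI[of _ y2'])
        apply (rule exI[of _ "{o1, o2}"])
        apply (rule exI[of _ "{}"])
        using B' d e o12(2) c by (auto simp: touches_def)
    qed
  qed
  then obtain b1 b2 b3 b4 Y R where B': "B = {b1, b2, b3, b4}" "distinct [b1, b2, b3, b4]"
    and e: "E b1 b3" "E b1 b4" "E b2 b3" "E b2 b4"
    and YR: "Y \<union> R \<subseteq> {o1, o2}" "Y \<inter> R = {}" "conn_set E Y" "\<forall>b\<in>B. touches E Y {b}"
      "conn_set E (insert b1 R)" "touches E (insert b1 R) {b2}" by metis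
  have bB: "b1 \<in> B" "b2 \<in> B" "b3 \<in> B" "b4 \<in> B" unfolding B' by simp_all
  have PP: "P b \<inter> P c = {}" if "b \<in> B" "c \<in> B" "b \<noteq> c" for b c using dis that by blast
  have "card (a ` B) \<le> 4" using card_image_le[OF finB, of a] B(2) by simp
  then have "\<not> ?N u \<subseteq> a ` B" using c6(2) card_mono[of "a ` B" "?N u"] finB by auto
  then obtain w where w: "E u w" "w \<notin> a ` B" by blast
  have wP: "w \<notin> P b" if "b \<in> B" for b
    using P(6)[OF that] w that by (metis IntI imageI mem_Collect_eq singletonD)
  have wv: "\<not> E v w" using B(3) w(1) wP[of w] ends(1)[of w] by blast
  have a34: "a b3 \<noteq> a b4" using PP[OF bB(3,4)] ends(2)[OF bB(3)] ends(2)[OF bB(4)] B'(2) by auto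
  define W where "W = (if E (a b3) (a b4) then {} else {w})"
  have W: "conn_set E (P b3 \<union> W) \<and> touches E (P b3 \<union> W) (P b4)"
  proof (cases "E (a b3) (a b4)")
    case True
    then show ?thesis using P(4)[OF bB(3)] ends(2)[OF bB(3)] ends(2)[OF bB(4)] by (auto simp: W_def touches_def)
  next
    case False
    have wn: "w \<noteq> a b3" "w \<noteq> a b4" using w(2) bB by blast+
    have w3: "E (a b3) w" using octa_mate[OF G ou ends(3)[OF bB(3)]] ends(3)[OF bB(4)] False a34 w(1) wn by metis
    have "\<not> E (a b4) (a b3)" using False ugraph_sym[OF G] by blast
    then have w4: "E (a b4) w" using octa_mate[OF G ou ends(3)[OF bB(4)]] ends(3)[OF bB(3)] a34 w(1) wn by metis
    have "conn_set E (insert w (P b3))" by (rule conn_set_insert[OF s P(4)[OF bB(3)] ends(2)[OF bB(3)]]) (use w3 in simp)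
    moreover have "E w (a b4)" using w4 ugraph_sym[OF G] by blast
    ultimately show ?thesis using False ends(2)[OF bB(4)] by (auto simp: W_def touches_def)
  qed
  have Ww: "W \<subseteq> {w}" by (simp add: W_def)
  have wo: "w \<noteq> o1" "w \<noteq> o2" "w \<noteq> u" "w \<noteq> v" using ou' w(1) uv(1) NV(2) by blast+
  have ouv: "o1 \<noteq> u" "o1 \<noteq> v" "o2 \<noteq> u" "o2 \<noteq> v" using o vu NV(2) by blast+
  have c1: "conn_set E (P b1 \<union> R)"
  proof -
    have "conn_set E (P b1 \<union> insert b1 R)"
      by (rule conn_set_Un[OF s P(4)[OF bB(1)] YR(5)]) (use ends(1)[OF bB(1)] in blast)
    moreover have "P b1 \<union> insert b1 R = P b1 \<union> R" using ends(1)[OF bB(1)] by blast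
    ultimately show ?thesis by simp
  qed
  have tPP: "touches E (P b) (P c)" if "b \<in> B" "c \<in> B" "E b c" for b c
    using ends(1)[OF that(1)] ends(1)[OF that(2)] that(3) by (auto simp: touches_def)
  have tY: "touches E Y (P b)" if "b \<in> B" for b
    using bspec[OF YR(4) that] ends(1)[OF that] by (auto simp: touches_def)
  have tu: "touches E {u} (P b)" "touches E {v} (P b)" if "b \<in> B" for b
    using ends[OF that] by (auto simp: touches_def)
  have RO: "R \<subseteq> {o1, o2}" and YO: "Y \<subseteq> {o1, o2}" using YR(1) by auto
  have oV: "o1 \<in> V" "o2 \<in> V" "w \<in> V" using NV o w(1) by blast+
  have vo: "touches E {v} Y" using o conn_set_nonempty[OF YR(3)] YO by (auto simp: touches_def)
  have d: "b1 \<noteq> b2" "b1 \<noteq> b3" "b1 \<noteq> b4" "b2 \<noteq> b3" "b2 \<noteq> b4" "b3 \<noteq> b4" using B'(2) by auto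
  note Q = PP[OF bB(1,2) d(1)] PP[OF bB(1,3) d(2)] PP[OF bB(1,4) d(3)] PP[OF bB(2,3) d(4)] PP[OF bB(2,4) d(5)] PP[OF bB(3,4) d(6)]
  have YP: "Y \<inter> P b = {}" "R \<inter> P b = {}" "P b \<inter> R = {}" "W \<inter> P b = {}" "P b \<inter> W = {}" if "b \<in> B" for b
    using oP[OF that] wP[OF that] RO YO Ww by blast+
  have YW: "Y \<inter> W = {}" "R \<inter> W = {}" "W \<inter> R = {}" using RO YO Ww wo(1,2) by blast+
  have uvn: "u \<notin> Y" "u \<notin> R" "u \<notin> W" "v \<notin> Y" "v \<notin> R" "v \<notin> W" using RO YO Ww ouv wo(3,4) by blast+
  show ?thesis
  proof (rule K7v_minorI[of E "{u}" "{v}" Y "P b1 \<union> R" "P b2" "P b3 \<union> W" "P b4"])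
    show "{u} \<union> {v} \<union> Y \<union> (P b1 \<union> R) \<union> P b2 \<union> (P b3 \<union> W) \<union> P b4 \<subseteq> V"
      using uV P(1)[OF bB(1)] P(1)[OF bB(2)] P(1)[OF bB(3)] P(1)[OF bB(4)] RO YO Ww oV by blast
    show "{u} \<inter> ({v} \<union> Y \<union> (P b1 \<union> R) \<union> P b2 \<union> (P b3 \<union> W) \<union> P b4) = {}"
      "{v} \<inter> (Y \<union> (P b1 \<union> R) \<union> P b2 \<union> (P b3 \<union> W) \<union> P b4) = {}"
      using uv(2) uvn P(2,3) bB by simp_all
    show "Y \<inter> (P b1 \<union> R \<union> P b2 \<union> (P b3 \<union> W) \<union> P b4) = {}"
      "(P b1 \<union> R) \<inter> (P b2 \<union> (P b3 \<union> W) \<union> P b4) = {}" "P b2 \<inter> (P b3 \<union> W \<union> P b4) = {}"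
      "(P b3 \<union> W) \<inter> P b4 = {}"
      using YP bB YW YR(2) Q by (simp_all add: Int_Un_distrib Int_Un_distrib2)
    show "touches E (P b1 \<union> R) (P b2)"
      using YR(6) ends(1)[OF bB(1)] ends(1)[OF bB(2)] by (auto simp: touches_def)
    show "touches E (P b3 \<union> W) (P b4)" "conn_set E (P b3 \<union> W)" using W by auto
    have m: "touches E X (Y \<union> Z)" if "touches E X Y" for X Y Z using that by (auto simp: touches_def)
    have m': "touches E (X \<union> Z) Y" if "touches E X Y" for X Y Z using that by (auto simp: touches_def)
    show "touches E {v} (P b1 \<union> R)" "touches E {v} (P b2)" "touches E {v} (P b3 \<union> W)" "touches E {v} (P b4)"
      "touches E {u} (P b1 \<union> R)" "touches E {u} (P b2)" "touches E {u} (P b3 \<union> W)" "touches E {u} (P b4)"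
      "touches E Y (P b1 \<union> R)" "touches E Y (P b2)" "touches E Y (P b3 \<union> W)" "touches E Y (P b4)"
      using m tu tY bB by blast+
    show "touches E (P b1 \<union> R) (P b3 \<union> W)" "touches E (P b1 \<union> R) (P b4)"
      "touches E (P b2) (P b3 \<union> W)" "touches E (P b2) (P b4)"
      using m m' tPP bB e by blast+
  qed (use s c1 YR(3) P(4) bB vo in auto)
qed

section \<open>Minimum degree at least five\<close>

lemma cocktail_arcs:
  assumes "cocktail V E"
  shows "arcs_between E V V = 48"
proof -
  have G: "ugraph V E" "card V = 8" and d: "\<And>u. u \<in> V \<Longrightarrow> card {y. E u y} = 6"
    using assms by (auto simp: cocktail_def)
  have "{y \<in> V. E u y} = {y. E u y}" for u using ugraph_in[OF G(1)] by blast
  then have "arcs_between E V V = (\<Sum>u\<in>V. 6)"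
    unfolding arcs_between_eq_sum_card[OF ugraph_finite[OF G(1)]] using d by (intro sum.cong) simp_all
  then show ?thesis using G(2) by simp
qed

lemma arcs_eq_sum_dg:
  assumes "ugraph V E"
  shows "arcs_between E A V = (\<Sum>x\<in>A. dg E x)"
proof -
  have "{y \<in> V. E u y} = {y. E u y}" for u using ugraph_in[OF assms] by blast
  then show ?thesis unfolding arcs_between_eq_sum_card[OF ugraph_finite[OF assms]] by (simp add: dg_def)
qed

text \<open>
  The octahedron \<open>S\<close> with apex \<open>m\<close> is \<open>K\<^sub>2\<^sub>,\<^sub>2\<^sub>,\<^sub>2\<^sub>,\<^sub>2\<close> without a vertex, and \<open>y\<close> sees four vertices of \<open>S\<close>, two of them
  antipodal. Contracting \<open>y\<close> into one of these two loses few edges and yields a vertex of degree seven.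
\<close>
lemma split_cocktail_core:
  assumes G: "ugraph V E" and arcs: "56 \<le> arcs_between E V V"
    and V: "V = {x, y, m} \<union> S" and S: "card S = 6" "S \<inter> {x, y, m} = {}" and d: "distinct [x, y, m]"
    and mate: "\<forall>s\<in>S. \<exists>t\<in>S. t \<noteq> s \<and> \<not> E s t \<and> (\<forall>r\<in>S. r \<noteq> s \<longrightarrow> r \<noteq> t \<longrightarrow> E s r)"
    and m: "\<forall>s\<in>S. E m s" and xy: "E x y" and ym: "\<not> E y m" and dy: "dg E y = 5"
  shows "K7v_minor V E"
proof -
  define B where "B = {z. E y z} - {x}"
  have finS: "finite S" using S(1) card.infinite by fastforce
  have es: "E a b \<Longrightarrow> E b a" for a b using ugraph_sym[OF G] by blast
  have nr: "\<not> E a a" for a using ugraph_in[OF G] by blast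
  have BS: "B \<subseteq> S" using ugraph_in[OF G, of y] V ym nr by (auto simp: B_def)
  have finB: "finite B" using BS finS finite_subset by blast
  have cB: "card B = 4" using dy xy es finite_edges_at[OF G, of y] by (simp add: B_def dg_def)
  obtain mu where mu: "\<And>s. s \<in> S \<Longrightarrow> mu s \<in> S \<and> mu s \<noteq> s \<and> \<not> E s (mu s) \<and> (\<forall>r\<in>S. r \<noteq> s \<longrightarrow> r \<noteq> mu s \<longrightarrow> E s r)"
    using mate by metis
  have invol: "mu (mu s) = s" if s: "s \<in> S" for s
  proof (rule ccontr)
    assume "mu (mu s) \<noteq> s"
    then have "E (mu s) s" using mu[OF s] mu[of "mu s"] s by metis
    then show False using mu[OF s] es by blast
  qed
  obtain b where b: "b \<in> B" "mu b \<in> B"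
  proof (rule ccontr)
    assume "\<not> thesis"
    then have no: "\<And>b. b \<in> B \<Longrightarrow> mu b \<notin> B" using that by blast
    have "inj_on mu B" by (rule inj_on_inverseI[of _ mu]) (use invol BS in blast)
    then have "card (mu ` B) = 4" using cB card_image by metis
    moreover have "mu ` B \<subseteq> S - B" using no mu BS by blast
    moreover have "card (S - B) = 2" using card_Diff_subset[OF finB BS] cB S(1) by simp
    ultimately show False using card_mono[of "S - B" "mu ` B"] finS by simp
  qed
  have bS: "b \<in> S" "mu b \<in> S" using b BS by blast+
  have by': "E b y" using b(1) es by (auto simp: B_def)
  have yV: "y \<in> V" "b \<noteq> y" "b \<noteq> x" "b \<noteq> m" using V S(2) bS by auto
  show ?thesis
  proof (rule K7v_contract[OF G by'], rule K7v_eight)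
    show "ugraph (V - {y}) (contract b y E)" by (rule ugraph_contract[OF G by'])
    have "card V = 9" using V S d finS by (simp add: card_insert_if)
    then show "card (V - {y}) = 8" using yV(1) ugraph_finite[OF G] by simp
    have "{z. E b z \<and> E y z} \<subseteq> insert x (B - {b, mu b})" using mu[OF bS(1)] nr by (auto simp: B_def)
    moreover have "card (insert x (B - {b, mu b})) \<le> 3"
    proof -
      have "card (B - {b, mu b}) = 2" using card_Diff_subset[of "{b, mu b}" B] b cB mu[OF bS(1)]
        by (simp add: card_insert_if eq_commute[of b])
      then show ?thesis using finB by (simp add: card_insert_if)
    qed
    ultimately have "card {z. E b z \<and> E y z} \<le> 3"
      using card_mono[of "insert x (B - {b, mu b})"] finB by (meson finite_Diff finite_insert order.trans)
    then show "48 \<le> arcs_between (contract b y E) (V - {y}) (V - {y})" using arcs_contract[OF G by'] arcs by simp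
    have "insert m (insert x (S - {b})) \<subseteq> {z. contract b y E b z}"
    proof -
      have "contract b y E b m" using m bS(1) es yV d by (auto simp: contract_def)
      moreover have "contract b y E b x" using xy es yV d by (auto simp: contract_def)
      moreover have "contract b y E b z" if z: "z \<in> S" "z \<noteq> b" for z
      proof (cases "z = mu b")
        case True
        then have "E y z" using b(2) by (simp add: B_def)
        then show ?thesis using z yV S(2) by (auto simp: contract_def)
      next
        case False
        then have "E b z" using mu[OF bS(1)] z by blast
        then show ?thesis using z yV S(2) by (auto simp: contract_def)
      qed
      ultimately show ?thesis by blast
    qed
    moreover have "card (insert m (insert x (S - {b}))) = 7"
      using finS bS(1) S d by (auto simp: card_insert_if)
    moreover have "finite {z. contract b y E b z}" by (rule finite_edges_at[OF ugraph_contract[OF G by']])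
    ultimately have "7 \<le> card {z. contract b y E b z}" using card_mono by metis
    then show "\<exists>u\<in>V - {y}. card {z. contract b y E u z} \<noteq> 6"
      using V bS(1) yV by (intro bexI[of _ b]) auto
  qed
qed

text \<open>
  The neighbours of \<open>x\<close> and \<open>y\<close> cover the octahedron and at most three of them are common, so \<open>x\<close> or \<open>y\<close> has degree five.
\<close>
lemma split_cocktail:
  assumes G: "ugraph V E" and dense: "dense V E" and xy: "E x y"
    and d5: "5 \<le> dg E x" "5 \<le> dg E y" and c: "codeg E x y \<le> 3"
    and co: "cocktail (V - {y}) (contract x y E)"
  shows "K7v_minor V E"
proof -
  let ?H = "contract x y E"
  have xyV: "x \<in> V" "y \<in> V" "x \<noteq> y" using ugraph_in[OF G xy] by auto
  have es: "E a b \<Longrightarrow> E b a" for a b using ugraph_sym[OF G] by blast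
  have nr: "\<not> E a a" for a using ugraph_in[OF G] by blast
  have fin: "finite V" by (rule ugraph_finite[OF G])
  have c8: "card (V - {y}) = 8" using co by (simp add: cocktail_def)
  then have c9: "card V = 9" using xyV(2) fin by simp
  obtain m where m: "m \<in> V" "m \<noteq> y" "m \<noteq> x" "\<not> ?H x m" "\<forall>z\<in>V - {y}. z \<noteq> x \<longrightarrow> z \<noteq> m \<longrightarrow> ?H x z"
    using cocktail_unique_nonneighbour[OF co, of x] xyV by blast
  have mn: "\<not> E x m" "\<not> E y m" using m(1-4) xyV(3) by (auto simp: contract_def)
  have Hsym: "?H a b \<Longrightarrow> ?H b a" for a b using es by (auto simp: contract_def)
  have mm: "?H m z" if z: "z \<in> V - {y}" "z \<noteq> m" "z \<noteq> x" for z
  proof -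
    have "m \<in> V - {y}" using m by blast
    from cocktail_unique_nonneighbour[OF co this] obtain m' where
      "\<forall>r\<in>V - {y}. r \<noteq> m \<longrightarrow> r \<noteq> m' \<longrightarrow> ?H m r" by blast
    then have h: "\<And>r. r \<in> V - {y} \<Longrightarrow> r \<noteq> m \<Longrightarrow> r \<noteq> m' \<Longrightarrow> ?H m r" by blast
    have "m' = x" using h[of x] xyV m(3,4) Hsym by blast
    then show ?thesis using h z by blast
  qed
  define S where "S = V - {x, y, m}"
  have V: "V = {x, y, m} \<union> S" "S \<inter> {x, y, m} = {}" using xyV m by (auto simp: S_def)
  have "card {x, y, m} = 3" using xyV(3) m by simp
  then have cS: "card S = 6" using card_Diff_subset[of "{x, y, m}" V] xyV m c9 by (simp add: S_def)
  have HE: "?H s t \<longleftrightarrow> E s t" if "s \<in> S \<union> {m}" "t \<in> S" for s t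
    using that m(2,3) nr by (auto simp: contract_def S_def)
  have mate: "\<forall>s\<in>S. \<exists>t\<in>S. t \<noteq> s \<and> \<not> E s t \<and> (\<forall>r\<in>S. r \<noteq> s \<longrightarrow> r \<noteq> t \<longrightarrow> E s r)"
  proof
    fix s assume s: "s \<in> S"
    then have sV: "s \<in> V - {y}" "s \<noteq> x" "s \<noteq> m" by (auto simp: S_def)
    obtain t where t: "t \<in> V - {y}" "t \<noteq> s" "\<not> ?H s t" "\<forall>r\<in>V - {y}. r \<noteq> s \<longrightarrow> r \<noteq> t \<longrightarrow> ?H s r"
      using cocktail_unique_nonneighbour[OF co sV(1)] by blast
    have "t \<noteq> x" using t(3) m(5) sV Hsym by blast
    moreover have "t \<noteq> m" using t(3) mm[OF sV(1,3,2)] Hsym by blast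
    ultimately have tS: "t \<in> S" using t(1) by (simp add: S_def)
    moreover have "\<not> E s t" using HE[of s t] s tS t(3) by simp
    moreover have "\<forall>r\<in>S. r \<noteq> s \<longrightarrow> r \<noteq> t \<longrightarrow> E s r"
    proof (intro ballI impI)
      fix r assume r: "r \<in> S" "r \<noteq> s" "r \<noteq> t"
      then have "r \<in> V - {y}" by (simp add: S_def)
      then have "?H s r" using t(4) r by blast
      then show "E s r" using HE[of s r] s r by simp
    qed
    ultimately show "\<exists>t\<in>S. t \<noteq> s \<and> \<not> E s t \<and> (\<forall>r\<in>S. r \<noteq> s \<longrightarrow> r \<noteq> t \<longrightarrow> E s r)" using t(2) by blast
  qed
  have mS: "\<forall>s\<in>S. E m s"
  proof
    fix s assume s: "s \<in> S"
    then have "?H m s" using mm[of s] by (simp add: S_def)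
    then show "E m s" using HE[of m s] s by simp
  qed
  have arcs: "56 \<le> arcs_between E V V" using dense c9 by (simp add: dense_def)
  define A where "A = {z. E x z} - {y}"
  define B where "B = {z. E y z} - {x}"
  have fAB: "finite A" "finite B" using finite_edges_at[OF G] by (simp_all add: A_def B_def)
  have "A \<union> B = S"
  proof
    show "A \<union> B \<subseteq> S" using ugraph_in[OF G] mn nr by (auto simp: A_def B_def S_def)
    show "S \<subseteq> A \<union> B"
    proof
      fix s assume "s \<in> S"
      then have "?H x s" "s \<noteq> x" "s \<noteq> y" using m(5) by (auto simp: S_def)
      then show "s \<in> A \<union> B" by (auto simp: contract_def A_def B_def)
    qed
  qed
  moreover have "A \<inter> B = {z. E x z \<and> E y z}" using nr by (auto simp: A_def B_def)
  ultimately have sum: "card A + card B \<le> 9" using card_Un_Int[OF fAB] cS c by (simp add: codeg_def)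
  have dA: "dg E x = card A + 1" "dg E y = card B + 1"
    using xy es finite_edges_at[OF G] card_Suc_Diff1[of "{z. E x z}" y] card_Suc_Diff1[of "{z. E y z}" x]
    by (auto simp: A_def B_def dg_def)
  then have "dg E x = 5 \<or> dg E y = 5" using sum d5 by linarith
  then show ?thesis
  proof
    assume "dg E y = 5"
    with split_cocktail_core[OF G arcs V(1) cS V(2) _ mate mS xy mn(2)] xyV(3) m show ?thesis by auto
  next
    assume dx: "dg E x = 5"
    have V': "V = {y, x, m} \<union> S" "S \<inter> {y, x, m} = {}" using V by (simp_all add: insert_commute)
    show ?thesis
      by (rule split_cocktail_core[OF G arcs V'(1) cS V'(2) _ mate mS es[OF xy] mn(1) dx]) (use xyV(3) m in auto)
  qed
qed

definition fragment :: "'a set \<Rightarrow> ('a \<Rightarrow> 'a \<Rightarrow> bool) \<Rightarrow> 'a set \<Rightarrow> bool" where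
  "fragment V E C \<longleftrightarrow> C \<subseteq> V \<and> C \<noteq> {} \<and> card (nbh E C) = 4 \<and> C \<union> nbh E C \<noteq> V"

locale min_degree_five =
  fixes V :: "'a set" and E
  assumes IH: "holds_below TYPE('a) (card V)"
    and G: "ugraph V E" and k4: "k_conn 4 V E" and dense: "dense V E" and noK: "\<not> K7v_minor V E"
    and V9: "9 \<le> card V" and d5: "\<forall>v\<in>V. 5 \<le> dg E v"
begin

lemma s: "symp E" by (rule ugraph_symp[OF G])
lemma fin: "finite V" by (rule ugraph_finite[OF G])
lemma fin_sub: "A \<subseteq> V \<Longrightarrow> finite A" using fin finite_subset by blast
lemma es: "E a b \<Longrightarrow> E b a" using ugraph_sym[OF G] by blast

lemma contraction_cocktail:
  assumes xy: "E x y" and no: "\<And>C. fragment V E C \<Longrightarrow> x \<in> nbh E C \<Longrightarrow> y \<in> nbh E C \<Longrightarrow> False"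
    and dense': "dense (V - {y}) (contract x y E)"
  shows "cocktail (V - {y}) (contract x y E)"
proof -
  have yV: "y \<in> V" using ugraph_in[OF G xy] by blast
  have c: "card (V - {y}) = card V - 1" "card (V - {y}) < card V" using yV fin V9 by auto
  have "k_conn 4 (V - {y}) (contract x y E)"
  proof (rule k_conn_contract[OF G xy k4])
    fix C assume C: "C \<subseteq> V" "C \<noteq> {}" "C \<union> nbh E C \<noteq> V" "x \<in> nbh E C" "y \<in> nbh E C"
    have "card (nbh E C) \<noteq> 4" using no[of C] C by (auto simp: fragment_def)
    then show "4 < card (nbh E C)" using k_connD[OF k4 C(1-3)] by simp
  qed (use V9 in simp_all)
  then have "K7v_minor (V - {y}) (contract x y E) \<or> cocktail (V - {y}) (contract x y E)"
    using IH ugraph_contract[OF G xy] c(2) dense' unfolding holds_below_def by blast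
  then show ?thesis using noK K7v_contract[OF G xy] by blast
qed

text \<open>Contracting the edge would give a smaller dense graph, so the contraction destroys 4-connectivity.\<close>
lemma light_edge_in_cut:
  assumes xy: "E x y" and c: "codeg E x y \<le> 3"
  shows "\<exists>C. fragment V E C \<and> x \<in> nbh E C \<and> y \<in> nbh E C"
proof (rule ccontr)
  assume no: "\<not> ?thesis"
  have xyV: "x \<in> V" "y \<in> V" using ugraph_in[OF G xy] by auto
  have "dense (V - {y}) (contract x y E)"
    using dense arcs_contract[OF G xy] c V9 xyV fin by (simp add: dense_def codeg_def)
  then have "cocktail (V - {y}) (contract x y E)" using contraction_cocktail[OF xy] no by blast
  then show False using split_cocktail[OF G dense xy _ _ c] d5 xyV noK by blast
qed

text \<open>
  The other side of a fragment is a fragment with the same boundary, because a smaller boundary would be a smaller cut.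
\<close>
lemma fragment_co:
  assumes C: "fragment V E C"
  shows "nbh E (V - C - nbh E C) = nbh E C" "fragment V E (V - C - nbh E C)"
proof -
  let ?D = "V - C - nbh E C"
  have CV: "C \<subseteq> V" "C \<noteq> {}" "card (nbh E C) = 4" "C \<union> nbh E C \<noteq> V" using C by (auto simp: fragment_def)
  have nV: "nbh E C \<subseteq> V" by (rule nbh_subset[OF G])
  have D: "?D \<noteq> {}" using CV nV by blast
  have sub: "nbh E ?D \<subseteq> nbh E C" by (rule nbh_rest[OF G])
  have ne: "?D \<union> nbh E ?D \<noteq> V" using sub CV(1,2) nbh_disjoint[of C E] by blast
  have "4 \<le> card (nbh E ?D)" by (rule k_connD[OF k4 _ D ne]) auto
  then show eq: "nbh E ?D = nbh E C"
    using card_seteq[OF finite_nbh[OF G] sub] CV(3) by simp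
  then show "fragment V E ?D" using D ne CV(3) by (auto simp: fragment_def)
qed

lemma small_boundary:
  assumes "X \<subseteq> V" "X \<noteq> {}" "nbh E X \<subseteq> U" "z \<in> V" "z \<notin> X \<union> U" "finite U"
  shows "4 \<le> card U"
proof -
  have "4 \<le> card (nbh E X)" by (rule k_connD[OF k4 assms(1,2)]) (use assms in blast)
  then show ?thesis using card_mono[OF assms(6,3)] by simp
qed

text \<open>
  A light edge at a minimum fragment \<open>F\<close> lies in the boundary of a second fragment \<open>B\<close>. Comparing the boundaries of the
  four corners with \<open>4\<close>, and the corners inside \<open>F\<close> with \<open>5\<close> by minimality, leaves no room for such a crossing unless
  \<open>F\<close> has at most two vertices and lies in the boundary of \<open>B\<close>, and that is excluded by the minimum degree.
\<close>
lemma atom_heavy: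
  assumes F: "fragment V E F" and min: "\<And>C. fragment V E C \<Longrightarrow> card F \<le> card C"
    and x: "x \<in> F" and xy: "E x y"
  shows "4 \<le> codeg E x y"
proof (rule ccontr)
  assume "\<not> ?thesis"
  then have c: "codeg E x y \<le> 3" by simp
  then obtain B where B: "fragment V E B" "x \<in> nbh E B" "y \<in> nbh E B" using light_edge_in_cut[OF xy] by blast
  define T where "T = nbh E F"
  define F' where "F' = V - F - T"
  define S where "S = nbh E B"
  define B' where "B' = V - B - S"
  note F'f = fragment_co[OF F, folded T_def, folded F'_def]
  note B'f = fragment_co[OF B(1), folded S_def, folded B'_def]
  have sets: "F \<subseteq> V" "T \<subseteq> V" "B \<subseteq> V" "S \<subseteq> V" "F \<inter> T = {}" "B \<inter> S = {}"
    using F B(1) nbh_subset[OF G] nbh_disjoint[of F E] nbh_disjoint[of B E] by (simp_all add: fragment_def T_def S_def)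
  have cT: "card T = 4" "card S = 4" using F B(1) by (auto simp: fragment_def T_def S_def)
  have V1: "F' \<subseteq> V" "B' \<subseteq> V" "F' \<inter> F = {}" "F' \<inter> T = {}" "B' \<inter> B = {}" "B' \<inter> S = {}"
    by (auto simp: F'_def B'_def)
  have cover: "\<And>z. z \<in> V \<Longrightarrow> z \<in> F \<or> z \<in> T \<or> z \<in> F'" "\<And>z. z \<in> V \<Longrightarrow> z \<in> B \<or> z \<in> S \<or> z \<in> B'"
    by (auto simp: F'_def B'_def)
  have ne: "F \<noteq> {}" "F' \<noteq> {}" "B \<noteq> {}" "B' \<noteq> {}" using F F'f(2) B(1) B'f(2) by (auto simp: fragment_def)
  have big: "card F \<le> card F'" "card F \<le> card B" "card F \<le> card B'" using min F'f(2) B(1) B'f(2) by blast+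
  define a b c d e where defs: "a = card (F \<inter> S)" "b = card (F' \<inter> S)" "c = card (T \<inter> S)" "d = card (T \<inter> B)" "e = card (T \<inter> B')"
  note f = fin_sub
  have fS: "finite S" "finite T" "finite F" "finite F'" "finite B" "finite B'" using f sets V1 by blast+
  have abc: "a + b + c = 4"
  proof -
    have "S = (F \<inter> S) \<union> ((F' \<inter> S) \<union> (T \<inter> S))" using cover(1) sets by blast
    moreover have "card ((F \<inter> S) \<union> ((F' \<inter> S) \<union> (T \<inter> S))) = a + (b + c)"
      unfolding defs using fS sets V1 by (subst card_Un_disjoint; (subst card_Un_disjoint)?) auto
    ultimately show ?thesis using cT by simp
  qed
  have cde: "c + d + e = 4"
  proof -
    have "T = (T \<inter> S) \<union> ((T \<inter> B) \<union> (T \<inter> B'))" using cover(2) sets by blast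
    moreover have "card ((T \<inter> S) \<union> ((T \<inter> B) \<union> (T \<inter> B'))) = c + (d + e)"
      unfolding defs using fS sets V1 by (subst card_Un_disjoint; (subst card_Un_disjoint)?) auto
    ultimately show ?thesis using cT by simp
  qed
  \<comment> \<open>\<open>P\<close> is a side of \<open>F\<close>, \<open>Q\<close> a side of \<open>B\<close>, and the boundary of their intersection is bounded.\<close>
  have bd: "nbh E (P \<inter> Q) \<subseteq> (P \<inter> S) \<union> (T \<inter> S) \<union> (T \<inter> Q)" if "nbh E P = T" "nbh E Q = S" for P Q
  proof
    fix z assume "z \<in> nbh E (P \<inter> Q)"
    then obtain u where u: "u \<in> P" "u \<in> Q" "E u z" "z \<notin> P \<inter> Q" by (auto simp: nbh_def)
    have "z \<in> P \<or> z \<in> T" "z \<in> Q \<or> z \<in> S" using u that by (auto simp: nbh_def)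
    then show "z \<in> (P \<inter> S) \<union> (T \<inter> S) \<union> (T \<inter> Q)" using u(4) by blast
  qed
  have un: "card ((P \<inter> S) \<union> (T \<inter> S) \<union> (T \<inter> Q)) \<le> card (P \<inter> S) + c + card (T \<inter> Q)" for P Q
    using card_Un_le[of "(P \<inter> S) \<union> (T \<inter> S)" "T \<inter> Q"] card_Un_le[of "P \<inter> S" "T \<inter> S"] by (simp add: defs)
  have corner: "4 \<le> card (P \<inter> S) + c + card (T \<inter> Q)"
    if h: "nbh E P = T" "nbh E Q = S" "P \<subseteq> V" "P \<inter> Q \<noteq> {}" "R \<noteq> {}" "R \<subseteq> V" "R \<inter> (Q \<union> S) = {}" for P Q R
  proof -
    obtain w where "w \<in> R" using h(5) by blast
    then have w: "w \<in> V" "w \<notin> P \<inter> Q \<union> ((P \<inter> S) \<union> (T \<inter> S) \<union> (T \<inter> Q))" using h(6,7) by blast+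
    have "4 \<le> card ((P \<inter> S) \<union> (T \<inter> S) \<union> (T \<inter> Q))"
      by (rule small_boundary[OF _ h(4) bd[OF h(1,2)] w]) (use h(3) fS in auto)
    then show ?thesis using un[of P Q] by linarith
  qed
  have xS: "x \<in> F \<inter> S" using x B(2) by (simp add: S_def)
  have a1: "1 \<le> a" using card_gt_0_iff[of "F \<inter> S"] xS fS by (auto simp: defs)
  have five: "5 \<le> a + c + card (T \<inter> Q)" if Q: "nbh E Q = S" "F \<inter> Q \<noteq> {}" "R \<noteq> {}" "R \<subseteq> V" "R \<inter> (Q \<union> S) = {}" "Q \<inter> S = {}" for Q R
  proof (rule ccontr)
    assume "\<not> ?thesis"
    then have le: "card (F \<inter> S) + c + card (T \<inter> Q) \<le> 4" by (simp add: defs)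
    have sub: "nbh E (F \<inter> Q) \<subseteq> (F \<inter> S) \<union> (T \<inter> S) \<union> (T \<inter> Q)" using bd[OF _ Q(1), of F] by (simp add: T_def)
    obtain w where w: "w \<in> R" using Q(3) by blast
    have wn: "F \<inter> Q \<union> nbh E (F \<inter> Q) \<noteq> V" using sub w Q(4,5) by blast
    have 4: "4 \<le> card (nbh E (F \<inter> Q))" by (rule k_connD[OF k4 _ Q(2) wn]) (use sets in blast)
    have "card (nbh E (F \<inter> Q)) \<le> 4"
      using card_mono[OF _ sub] un[of F Q] le fS by fastforce
    then have "fragment V E (F \<inter> Q)" using 4 wn Q(2) sets by (auto simp: fragment_def)
    then have "card F \<le> card (F \<inter> Q)" by (rule min)
    moreover have "F \<inter> Q \<subset> F" using xS Q(6) by blast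
    ultimately show False using psubset_card_mono[OF fS(3)] by (meson linorder_not_less)
  qed
  have nb: "nbh E F = T" "nbh E F' = T" "nbh E B = S" "nbh E B' = S" using F'f(1) B'f(1) by (auto simp: T_def S_def)
  have cFB: "5 \<le> a + c + d" if "F \<inter> B \<noteq> {}" unfolding defs(4) using five[OF nb(3) that ne(4)] V1 sets by blast
  have cFB': "5 \<le> a + c + e" if "F \<inter> B' \<noteq> {}" unfolding defs(5) using five[OF nb(4) that ne(3)] V1 sets by blast
  have k1: "4 \<le> b + c + e" if "F' \<inter> B' \<noteq> {}"
    unfolding defs(2,5) by (rule corner[OF nb(2,4) _ that ne(3)]) (use V1 sets in auto)
  have k2: "4 \<le> b + c + d" if "F' \<inter> B \<noteq> {}"
    unfolding defs(2,4) by (rule corner[OF nb(2,3) _ that ne(4)]) (use V1 sets in auto)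
  have FB: "F \<inter> B = {}"
  proof (rule ccontr)
    assume h: "F \<inter> B \<noteq> {}"
    have 1: "F' \<inter> B' = {}" using cFB[OF h] k1 abc cde by fastforce
    show False
    proof (cases "F \<inter> B' = {}")
      case True
      have "B' \<subseteq> T \<inter> B'" using 1 True cover(1) V1 by blast
      then have "card B' \<le> e" unfolding defs using card_mono[of "T \<inter> B'"] fS by blast
      moreover have "a < card F" unfolding defs using psubset_card_mono[OF fS(3), of "F \<inter> S"] h sets by blast
      ultimately show False using big(3) cFB[OF h] cde by linarith
    next
      case False
      have "F' \<inter> B = {}" using cFB'[OF False] k2 abc cde by fastforce
      then have "F' \<subseteq> F' \<inter> S" using 1 cover(2) V1 by blast
      then have "card F' \<le> b" unfolding defs using card_mono[of "F' \<inter> S"] fS by blast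
      moreover have "a < card F" unfolding defs using psubset_card_mono[OF fS(3), of "F \<inter> S"] h sets by blast
      ultimately show False using big(1) cFB[OF h] cFB'[OF False] abc cde by linarith
    qed
  qed
  have FB': "F \<inter> B' = {}"
  proof (rule ccontr)
    assume h: "F \<inter> B' \<noteq> {}"
    have 1: "F' \<inter> B = {}" using cFB'[OF h] k2 abc cde by fastforce
    have "B \<subseteq> T \<inter> B" using 1 FB cover(1) sets by blast
    then have "card B \<le> d" unfolding defs using card_mono[of "T \<inter> B"] fS by blast
    moreover have "a < card F" unfolding defs using psubset_card_mono[OF fS(3), of "F \<inter> S"] h V1 by blast
    ultimately show False using big(2) cFB'[OF h] cde by linarith
  qed
  have "F = F \<inter> S" using FB FB' cover(2) sets by blast
  then have aF: "card F = a" by (simp add: defs)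
  have da: "a \<le> d"
  proof (cases "F' \<inter> B = {}")
    case True
    then have "B \<subseteq> T \<inter> B" using FB cover(1) sets by blast
    then have "card B \<le> d" unfolding defs using card_mono[of "T \<inter> B"] fS by blast
    then show ?thesis using big(2) aF by simp
  next
    case False
    then show ?thesis using k2 abc by fastforce
  qed
  have ea: "a \<le> e"
  proof (cases "F' \<inter> B' = {}")
    case True
    then have "B' \<subseteq> T \<inter> B'" using FB' cover(1) V1 by blast
    then have "card B' \<le> e" unfolding defs using card_mono[of "T \<inter> B'"] fS by blast
    then show ?thesis using big(3) aF by simp
  next
    case False
    then show ?thesis using k1 abc by fastforce
  qed
  have NF: "{z. E u z} \<subseteq> (F - {u}) \<union> T" if "u \<in> F" for u
    using that ugraph_in[OF G] by (auto simp: T_def nbh_def)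
  have d5F: "5 \<le> dg E u" if "u \<in> F" for u using d5 that sets by blast
  have bound: "dg E u \<le> card (F - {u}) + 4" if "u \<in> F" for u
  proof -
    have "dg E u \<le> card ((F - {u}) \<union> T)"
      unfolding dg_def by (rule card_mono[OF _ NF[OF that]]) (use fS in simp)
    also have "\<dots> \<le> card (F - {u}) + card T" by (rule card_Un_le)
    finally show ?thesis using cT by simp
  qed
  have "card F \<noteq> 1"
  proof
    assume "card F = 1"
    then have "card (F - {x}) = 0" using x fS by simp
    then show False using bound[OF x] d5F[OF x] by simp
  qed
  then have a2: "a = 2" "c = 0" using aF da ea cde a1 by linarith+
  then have "T \<inter> S = {}" using fS by (simp add: defs)
  then have yF: "y \<in> F" using NF[OF x] xy B(3) by (auto simp: S_def)
  have xny: "x \<noteq> y" using xy ugraph_in[OF G] by blast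
  have "card {x, y} = 2" using xny by simp
  then have Feq: "F = {x, y}" using card_seteq[of F "{x, y}"] x yF aF a2 fS by auto
  have all: "T \<subseteq> {z. E u z}" if u: "u \<in> F" for u
  proof (rule ccontr)
    assume "\<not> ?thesis"
    then obtain t where t: "t \<in> T" "\<not> E u t" by blast
    have "{z. E u z} \<subseteq> (F - {u}) \<union> (T - {t})" using NF[OF u] t by blast
    then have "dg E u \<le> card ((F - {u}) \<union> (T - {t}))" unfolding dg_def by (rule card_mono[rotated]) (use fS in simp)
    also have "\<dots> \<le> card (F - {u}) + card (T - {t})" by (rule card_Un_le)
    also have "\<dots> = 1 + 3" using t u fS aF a2 cT by simp
    finally show False using d5F[OF u] by simp
  qed
  have "T \<subseteq> {z. E x z \<and> E y z}" using all[OF x] all[OF yF] by blast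
  then have "card T \<le> codeg E x y"
    unfolding codeg_def by (rule card_mono[rotated]) (use finite_edges_at[OF G, of x] in auto)
  then show False using cT \<open>codeg E x y \<le> 3\<close> by simp
qed

text \<open>
  For a minimum fragment \<open>F\<close> with boundary \<open>T\<close> the other side is contracted into a vertex \<open>t\<close> of \<open>T\<close>. The result stays
  4-connected: a smaller cut would separate two vertices of \<open>T\<close>, and then it isolates one of them, which has
  too many neighbours in \<open>F \<union> T\<close>.
\<close>
lemma atom_sparse:
  assumes F: "fragment V E F" and min: "\<And>C. fragment V E C \<Longrightarrow> card F \<le> card C" and T: "T = nbh E F"
  shows "arcs_between E F F + 2 * arcs_between E F T + arcs_between E T T \<le> 8 * card F + 16"
proof (rule ccontr)
  assume "\<not> ?thesis"
  then have heavy: "8 * card F + 17 \<le> arcs_between E F F + 2 * arcs_between E F T + arcs_between E T T" by simp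
  have sets: "F \<subseteq> V" "T \<subseteq> V" "F \<inter> T = {}" "F \<noteq> {}" "card T = 4" "F \<union> T \<noteq> V"
    using F nbh_subset[OF G] nbh_disjoint[of F E] by (simp_all add: fragment_def T)
  have fF: "finite F" "finite T" using sets fin_sub by blast+
  obtain t where t: "t \<in> T" using sets(5) by fastforce
  define W where "W = F \<union> T"
  define H where "H = (\<lambda>u w. u \<in> W \<and> w \<in> W \<and> u \<noteq> w \<and> (E u w \<or> u = t \<and> w \<in> T \<or> w = t \<and> u \<in> T))"
  have GH: "ugraph W H" using fF es by (auto simp: ugraph_def H_def W_def)
  have EH: "H u w" if "E u w" "u \<in> W" "w \<in> W" for u w using that ugraph_in[OF G] by (auto simp: H_def)
  obtain r where r: "r \<in> V" "r \<notin> F \<union> T" using sets by blast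
  have WV: "W \<subseteq> V" using sets by (simp add: W_def)
  have finW: "finite W" using WV fin_sub by blast
  have tdeg: "4 < card {z \<in> W. E u z}" if u: "u \<in> T" for u
  proof -
    obtain x where x: "x \<in> F" "E x u" using u by (auto simp: T nbh_def)
    have "4 \<le> codeg E x u" by (rule atom_heavy[OF F min x])
    moreover have "insert x {z. E x z \<and> E u z} \<subseteq> {z \<in> W. E u z}" using x es by (auto simp: W_def T nbh_def)
    then have "card (insert x {z. E x z \<and> E u z}) \<le> card {z \<in> W. E u z}" by (rule card_mono[rotated]) (use finW in simp)
    moreover have "x \<notin> {z. E x z \<and> E u z}" using ugraph_in[OF G] by blast
    then have "card (insert x {z. E x z \<and> E u z}) = Suc (codeg E x u)"
      using finite_edges_at[OF G, of x] by (simp add: codeg_def)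
    ultimately show ?thesis by linarith
  qed
  have NF: "z \<in> W" if "u \<in> F" "E u z" for u z using that by (auto simp: W_def T nbh_def)
  \<comment> \<open>A cut of \<open>H\<close> with both sides avoiding \<open>t\<close>, where the first side meets \<open>T\<close> in a single vertex.\<close>
  have side: False if C: "C \<subseteq> W" "R \<subseteq> W" "nbh H C \<subseteq> N" "C \<inter> R = {}" "R \<inter> N = {}" "t \<in> N" "card N \<le> 3" "finite N" "R \<inter> T \<noteq> {}" "C \<inter> T = {p}" for C R N p
  proof -
    have p: "p \<in> C" "p \<in> T" using C(10) by blast+
    show False
    proof (cases "C \<inter> F = {}")
      case True
      then have Cp: "C = {p}" using C(1,10) by (auto simp: W_def)
      have "{z \<in> W. E p z} \<subseteq> N"
      proof
        fix z assume z: "z \<in> {z \<in> W. E p z}"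
        then have "z \<in> nbh H C" using EH[of p z] p ugraph_in[OF G, of p z] by (auto simp: nbh_def Cp W_def)
        then show "z \<in> N" using C(3) by blast
      qed
      then have "card {z \<in> W. E p z} \<le> 3" using card_mono[OF C(8)] C(7) by (meson order.trans)
      then show False using tdeg[OF p(2)] by simp
    next
      case False
      have sub: "nbh E (C \<inter> F) \<subseteq> insert p N"
      proof
        fix z assume "z \<in> nbh E (C \<inter> F)"
        then obtain u where u: "u \<in> C" "u \<in> F" "E u z" "z \<notin> C \<inter> F" by (auto simp: nbh_def)
        have zW: "z \<in> W" by (rule NF[OF u(2,3)])
        show "z \<in> insert p N"
        proof (cases "z \<in> C")
          case True
          then show ?thesis using u(4) zW C(10) by (auto simp: W_def)
        next
          case False
          then have "z \<in> nbh H C" using EH[OF u(3) _ zW] u C(1) by (auto simp: nbh_def)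
          then show ?thesis using C(3) by blast
        qed
      qed
      obtain q where q: "q \<in> R" "q \<in> T" using C(9) by blast
      have qn: "q \<notin> C" "q \<notin> N" "q \<noteq> p" using q C(4,5) p by blast+
      have ne: "C \<inter> F \<union> nbh E (C \<inter> F) \<noteq> V" using sub qn q sets(2) by blast
      have "card (nbh E (C \<inter> F)) \<le> 4"
        using card_mono[OF _ sub] C(7,8) card_insert_le_m1[of 4 N p] by (fastforce simp: card_insert_if split: if_splits)
      moreover have "4 \<le> card (nbh E (C \<inter> F))" by (rule k_connD[OF k4 _ False ne]) (use sets in blast)
      ultimately have "fragment V E (C \<inter> F)" using False ne sets by (auto simp: fragment_def)
      then have "card F \<le> card (C \<inter> F)" by (rule min)
      then have "C \<inter> F = F" using card_seteq[OF fF(1), of "C \<inter> F"] by blast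
      then obtain x where x: "x \<in> C" "x \<in> F" "E x q" using q(2) by (auto simp: T nbh_def)
      have "q \<in> nbh H C" using EH[OF x(3)] x q qn by (auto simp: nbh_def W_def)
      then show False using C(3) qn by blast
    qed
  qed
  have kH: "k_conn 4 W H"
    unfolding k_conn_def
  proof (intro conjI allI impI)
    have "1 \<le> card F" using sets(4) fF by (simp add: Suc_le_eq card_gt_0_iff)
    then show "4 < card W" using card_Un_disjoint[OF fF sets(3)] sets(5) by (simp add: W_def)
    fix C assume "C \<subseteq> W \<and> C \<noteq> {} \<and> C \<union> nbh H C \<noteq> W"
    then have C: "C \<subseteq> W" "C \<noteq> {}" "C \<union> nbh H C \<noteq> W" by auto
    define N where "N = nbh H C"
    define R where "R = W - C - N"
    have N: "N \<subseteq> W" "finite N" using nbh_subset[OF GH] finite_nbh[OF GH] by (simp_all add: N_def)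
    have R: "R \<noteq> {}" using C N by (auto simp: R_def N_def)
    have RN: "nbh H R \<subseteq> N" using nbh_rest[OF GH, of C] by (simp add: R_def N_def)
    have CN: "C \<inter> N = {}" using nbh_disjoint by (simp add: N_def)
    have nE: "z \<in> N" if "u \<in> C" "E u z" "z \<in> W" "z \<notin> C" for u z
      using EH[OF that(2) _ that(3)] that C(1) by (auto simp: N_def nbh_def)
    have nR: "z \<in> N" if "u \<in> R" "E u z" "z \<in> W" "z \<notin> R" for u z
      using EH[OF that(2) _ that(3)] that RN by (auto simp: nbh_def R_def)
    obtain w where w: "w \<in> R" using R by blast
    \<comment> \<open>A side containing \<open>t\<close> takes the rest of \<open>G\<close> along.\<close>
    have tside: "4 \<le> card N" if X: "X \<subseteq> W" "X \<noteq> {}" "X \<inter> N = {}" "T \<subseteq> X \<union> N" "z \<in> W" "z \<notin> X \<union> N"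
      "\<And>u z. u \<in> X \<Longrightarrow> E u z \<Longrightarrow> z \<in> W \<Longrightarrow> z \<notin> X \<Longrightarrow> z \<in> N" for X z
    proof (rule small_boundary[of "X \<union> (V - W)" _ z])
      show "nbh E (X \<union> (V - W)) \<subseteq> N"
      proof
        fix y assume "y \<in> nbh E (X \<union> (V - W))"
        then obtain u where u: "u \<in> X \<or> u \<in> V - W" "E u y" "y \<notin> X" "y \<notin> V - W" by (auto simp: nbh_def)
        have yW: "y \<in> W" using u ugraph_in[OF G] by blast
        show "y \<in> N"
        proof (cases "u \<in> X")
          case True
          then show ?thesis using X(7) u yW by blast
        next
          case False
          then have "u \<notin> W" using u by blast
          then have "y \<notin> F" using NF[of y u] u(2) es by blast
          then show ?thesis using yW X(4) u(3) by (auto simp: W_def)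
        qed
      qed
    qed (use X WV N in auto)
    \<comment> \<open>A side inside \<open>F\<close> is cut off in \<open>G\<close> as well.\<close>
    have inF: "4 \<le> card N" if X: "X \<subseteq> F" "X \<noteq> {}" "X \<inter> N = {}"
      "\<And>u z. u \<in> X \<Longrightarrow> E u z \<Longrightarrow> z \<in> W \<Longrightarrow> z \<notin> X \<Longrightarrow> z \<in> N" for X
    proof (rule small_boundary[of X _ r])
      show "nbh E X \<subseteq> N" using X(1,4) NF by (auto simp: nbh_def)
    qed (use X sets r N WV in \<open>auto simp: W_def\<close>)
    have tT: "T \<subseteq> X \<union> nbh H X" if "t \<in> X" for X
      using that t by (auto simp: nbh_def H_def W_def)
    show "4 \<le> card (nbh H C)"
    proof (rule ccontr)
      assume "\<not> ?thesis"
      then have N3: "card N \<le> 3" by (simp add: N_def)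
      have tC: "t \<notin> C"
      proof
        assume "t \<in> C"
        then have "4 \<le> card N" using tside[of C w] tT[of C] C CN w nE by (auto simp: N_def R_def)
        then show False using N3 by simp
      qed
      have tR: "t \<notin> R"
      proof
        assume tR: "t \<in> R"
        obtain z where z: "z \<in> C" using C(2) by blast
        have "4 \<le> card N"
        proof (rule tside[of R z])
          show "T \<subseteq> R \<union> N" using tT[OF tR] RN by blast
          show "\<And>u z. u \<in> R \<Longrightarrow> E u z \<Longrightarrow> z \<in> W \<Longrightarrow> z \<notin> R \<Longrightarrow> z \<in> N" by (rule nR)
          show "z \<notin> R \<union> N" using z CN by (auto simp: R_def)
        qed (use R z C in \<open>auto simp: R_def\<close>)
        then show False using N3 by simp
      qed
      have tN: "t \<in> N" using tC tR t by (auto simp: R_def W_def)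
      have CT: "C \<inter> T \<noteq> {}"
      proof
        assume "C \<inter> T = {}"
        then have CF: "C \<subseteq> F" using C(1) by (auto simp: W_def)
        have "4 \<le> card N" by (rule inF[OF CF C(2) CN nE])
        then show False using N3 by simp
      qed
      have RT: "R \<inter> T \<noteq> {}"
      proof
        assume "R \<inter> T = {}"
        then have RF: "R \<subseteq> F" by (auto simp: R_def W_def)
        have "R \<inter> N = {}" by (auto simp: R_def)
        then have "4 \<le> card N" by (rule inF[OF RF R _ nR])
        then show False using N3 by simp
      qed
      have disj: "(C \<inter> T) \<inter> (R \<inter> T) = {}" by (auto simp: R_def)
      have "(C \<inter> T) \<union> (R \<inter> T) \<subseteq> T - {t}" using tC tR by blast
      then have "card ((C \<inter> T) \<union> (R \<inter> T)) \<le> card (T - {t})" by (rule card_mono[rotated]) (use fF in simp)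
      moreover have "card (T - {t}) = 3" using t sets(5) fF by simp
      moreover have "card ((C \<inter> T) \<union> (R \<inter> T)) = card (C \<inter> T) + card (R \<inter> T)"
        by (rule card_Un_disjoint[OF _ _ disj]) (use fF in simp_all)
      ultimately have "card (C \<inter> T) + card (R \<inter> T) \<le> 3" by simp
      moreover have "1 \<le> card (C \<inter> T)" "1 \<le> card (R \<inter> T)" using CT RT fF by (simp_all add: Suc_le_eq card_gt_0_iff)
      ultimately have "card (C \<inter> T) = 1 \<or> card (R \<inter> T) = 1" by linarith
      then obtain p where "C \<inter> T = {p} \<or> R \<inter> T = {p}" by (metis card_1_singletonE)
      then show False
      proof
        assume "C \<inter> T = {p}"
        then show False using side[of C R N p] C(1) tN N3 N RT by (auto simp: R_def N_def)
      next
        assume p: "R \<inter> T = {p}"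
        show False by (rule side[of R C N p]) (use p C(1) tN N3 N CT CN RN in \<open>auto simp: R_def\<close>)
      qed
    qed
  qed
  have arcsH: "arcs_between E W W \<le> arcs_between H W W"
    by (rule arcs_between_mono) (use EH in blast)
  have arcsE: "arcs_between E W W = arcs_between E F F + 2 * arcs_between E F T + arcs_between E T T"
    unfolding W_def by (rule arcs_between_split[OF s fF sets(3)])
  have cW: "card W = card F + 4" using card_Un_disjoint[OF fF sets(3)] sets(5) by (simp add: W_def)
  have big: "8 * card W \<le> arcs_between H W W + 15" using heavy arcsE arcsH cW by simp
  have "W \<subset> V" using WV sets(6) by (auto simp: W_def)
  then have less: "card W < card V" by (rule psubset_card_mono[OF fin])
  have "K7v_minor W H \<or> cocktail W H"
    using IH GH less kH big unfolding holds_below_def dense_def by auto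
  moreover have "\<not> cocktail W H"
  proof
    assume co: "cocktail W H"
    then show False using cocktail_arcs[OF co] big by (simp add: cocktail_def)
  qed
  ultimately have KH: "K7v_minor W H" by blast
  define D where "D = component E (V - W) r"
  have rW: "r \<in> V - W" using r by (simp add: W_def)
  note D = component_props[OF s rW, folded D_def]
  have DT: "nbh E D \<subseteq> T"
  proof
    fix z assume z: "z \<in> nbh E D"
    then obtain u where u: "u \<in> D" "E u z" by (auto simp: nbh_def)
    have "z \<in> W" using nbh_component[OF G rW] z by (auto simp: D_def)
    moreover have "z \<notin> F" using NF[of z u] u D(3) es by blast
    ultimately show "z \<in> T" by (simp add: W_def)
  qed
  have "4 \<le> card (nbh E D)"
  proof (rule k_connD[OF k4])
    obtain f where f: "f \<in> F" using sets(4) by blast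
    then have "f \<notin> D" "f \<notin> nbh E D" "f \<in> V" using D(3) DT sets by (auto simp: W_def)
    then show "D \<union> nbh E D \<noteq> V" by blast
  qed (use D in auto)
  then have DT': "nbh E D = T" using card_seteq[OF fF(2) DT] sets(5) by simp
  have mm: "minor_model V E W H (\<lambda>u. if u = t then insert t D else {u})"
    unfolding minor_model_def
  proof (intro conjI ballI impI)
    have "conn_set E (insert t D)"
    proof -
      obtain d where "d \<in> D" "E d t" using t DT' by (auto simp: nbh_def)
      then show ?thesis using conn_set_insert[OF s D(1)] by blast
    qed
    then show "conn_set E (if u = t then insert t D else {u})" for u by simp
    show "(if u = t then insert t D else {u}) \<subseteq> V" if "u \<in> W" for u
      using that WV D(3) t by (auto simp: W_def)
    show "(if u = t then insert t D else {u}) \<inter> (if w = t then insert t D else {w}) = {}"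
      if "u \<in> W" "w \<in> W" "u \<noteq> w" for u w using that D(3) by auto
    have tD: "touches E D {z}" "touches E {z} D" if "z \<in> T" for z
      using touches_nbh[OF s] that DT' by blast+
    show "touches E (if u = t then insert t D else {u}) (if w = t then insert t D else {w})" if "H u w" for u w
    proof -
      have "E u w \<or> u = t \<and> w \<in> T \<or> w = t \<and> u \<in> T" "u \<noteq> w" using that by (auto simp: H_def)
      then show ?thesis using tD[of u] tD[of w] by (auto simp: touches_def)
    qed
  qed
  show False using K7v_minor_trans[OF s mm KH] noK by blast
qed

text \<open>
  Either there is no fragment at all, or \<open>F\<close> is a minimum one. In both cases every edge at \<open>F\<close> is in at least four
  triangles, while the degrees in \<open>F\<close> are smaller than eight on average.
\<close>
lemma low_part:
  "\<exists>F. F \<subseteq> V \<and> (\<forall>x\<in>F. \<forall>y. E x y \<longrightarrow> 4 \<le> codeg E x y) \<and> (\<Sum>x\<in>F. dg E x) + 4 \<le> 8 * card F"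
proof (cases "\<exists>C. fragment V E C")
  case True
  define F where "F = arg_min card (fragment V E)"
  have F: "fragment V E F" and min: "\<And>C. fragment V E C \<Longrightarrow> card F \<le> card C"
    using True arg_min_nat_lemma[of "fragment V E" _ card] unfolding F_def by blast+
  define T where "T = nbh E F"
  have sets: "F \<subseteq> V" "T \<subseteq> V" "F \<inter> T = {}" "card T = 4"
    using F nbh_subset[OF G] nbh_disjoint[of F E] by (simp_all add: fragment_def T_def)
  have fF: "finite F" "finite T" using sets fin_sub by blast+
  have heavy: "\<forall>x\<in>F. \<forall>y. E x y \<longrightarrow> 4 \<le> codeg E x y" using atom_heavy[OF F min] by blast
  have le: "arcs_between E F F + 2 * arcs_between E F T + arcs_between E T T \<le> 8 * card F + 16"
    by (rule atom_sparse[OF F min T_def])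
  have "arcs_between E T (F \<union> T) = (\<Sum>u\<in>T. card {z \<in> F \<union> T. E u z})"
    by (rule arcs_between_eq_sum_card) (use fF in simp)
  moreover have "(\<Sum>u\<in>T. 5) \<le> (\<Sum>u\<in>T. card {z \<in> F \<union> T. E u z})"
  proof (rule sum_mono)
    fix u assume u: "u \<in> T"
    obtain x where x: "x \<in> F" "E x u" using u by (auto simp: T_def nbh_def)
    have "4 \<le> codeg E x u" using heavy x by blast
    moreover have "insert x {z. E x z \<and> E u z} \<subseteq> {z \<in> F \<union> T. E u z}" using x es by (auto simp: T_def nbh_def)
    then have "card (insert x {z. E x z \<and> E u z}) \<le> card {z \<in> F \<union> T. E u z}"
      by (rule card_mono[rotated]) (use fF in simp)
    moreover have "x \<notin> {z. E x z \<and> E u z}" using ugraph_in[OF G] by blast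
    then have "card (insert x {z. E x z \<and> E u z}) = Suc (codeg E x u)"
      using finite_edges_at[OF G, of x] by (simp add: codeg_def)
    ultimately show "5 \<le> card {z \<in> F \<union> T. E u z}" by linarith
  qed
  moreover have "arcs_between E T (F \<union> T) = arcs_between E T F + arcs_between E T T"
    by (rule arcs_between_Un_right[OF fF sets(3)])
  moreover have "arcs_between E T F = arcs_between E F T" by (rule arcs_between_sym[OF s])
  ultimately have ge: "20 \<le> arcs_between E F T + arcs_between E T T" using sets(4) by simp
  have "(\<Sum>x\<in>F. dg E x) = arcs_between E F V" using arcs_eq_sum_dg[OF G] by simp
  also have "\<dots> = arcs_between E F (F \<union> T) + arcs_between E F (V - (F \<union> T))"
  proof -
    have "(F \<union> T) \<union> (V - (F \<union> T)) = V" using sets by blast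
    then show ?thesis using arcs_between_Un_right[of "F \<union> T" "V - (F \<union> T)" E F] fin fF by simp
  qed
  also have "arcs_between E F (V - (F \<union> T)) = 0"
    by (rule arcs_between_eq_0) (auto simp: T_def nbh_def)
  also have "arcs_between E F (F \<union> T) = arcs_between E F F + arcs_between E F T"
    by (rule arcs_between_Un_right[OF fF sets(3)])
  finally have "(\<Sum>x\<in>F. dg E x) = arcs_between E F F + arcs_between E F T" by simp
  then have "(\<Sum>x\<in>F. dg E x) + 4 \<le> 8 * card F" using le ge by linarith
  then show ?thesis using heavy sets(1) by blast
next
  case False
  then have nofrag: "\<not> fragment V E C" for C by blast
  define A where "A = arcs_between E V V"
  have heavy: "\<forall>x\<in>V. \<forall>y. E x y \<longrightarrow> 4 \<le> codeg E x y"
  proof (intro ballI allI impI)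
    fix x y assume xy: "E x y"
    show "4 \<le> codeg E x y"
    proof (rule ccontr)
      assume "\<not> ?thesis"
      then show False using light_edge_in_cut[OF xy] nofrag by force
    qed
  qed
  \<comment> \<open>Contracting any edge keeps 4-connectivity, so the result is sparse or \<open>K\<^sub>2\<^sub>,\<^sub>2\<^sub>,\<^sub>2\<^sub>,\<^sub>2\<close>, and the edge is in many triangles.\<close>
  have edge: "A + 22 \<le> 2 * codeg E x y + 8 * card V" if xy: "E x y" for x y
  proof -
    have yV: "y \<in> V" using ugraph_in[OF G xy] by blast
    have c1: "card (V - {y}) + 1 = card V" using yV fin V9 by simp
    have A': "A = arcs_between (contract x y E) (V - {y}) (V - {y}) + 2 + 2 * codeg E x y"
      using arcs_contract[OF G xy] by (simp add: A_def codeg_def)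
    show ?thesis
    proof (cases "dense (V - {y}) (contract x y E)")
      case True
      then have co: "cocktail (V - {y}) (contract x y E)" using contraction_cocktail[OF xy] nofrag by blast
      then have "card (V - {y}) = 8" by (simp add: cocktail_def)
      then show ?thesis using cocktail_arcs[OF co] A' c1 by simp
    next
      case False
      then show ?thesis using A' c1 by (simp add: dense_def)
    qed
  qed
  have deg: "A + 24 \<le> 2 * dg E x + 8 * card V" if x: "x \<in> V" for x
  proof -
    have "5 \<le> dg E x" using d5 x by blast
    then have "{y. E x y} \<noteq> {}" unfolding dg_def by (metis card.empty not_numeral_le_zero)
    then obtain y where y: "E x y" by blast
    have "{z. E x z \<and> E y z} \<subset> {z. E x z}" using y ugraph_in[OF G] by blast
    then have "codeg E x y < dg E x" unfolding codeg_def dg_def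
      by (rule psubset_card_mono[OF finite_edges_at[OF G]])
    then show ?thesis using edge[OF y] by simp
  qed
  have sum: "(\<Sum>x\<in>V. dg E x) = A" using arcs_eq_sum_dg[OF G, of V] by (simp add: A_def)
  have "A + 4 \<le> 8 * card V"
  proof (rule ccontr)
    assume no: "\<not> ?thesis"
    define n where "n = int (card V)"
    define g where "g = int A - 8 * n"
    have n9: "9 \<le> n" using V9 by (simp add: n_def)
    have g: "-3 \<le> g" using no by (simp add: g_def n_def)
    have "(\<Sum>x\<in>V. A + 24) \<le> (\<Sum>x\<in>V. 2 * dg E x + 8 * card V)" by (rule sum_mono) (rule deg)
    then have "card V * (A + 24) \<le> 2 * A + card V * (8 * card V)"
      using sum by (simp add: sum.distrib sum_distrib_left[symmetric])
    then have "int (card V * (A + 24)) \<le> int (2 * A + card V * (8 * card V))" by linarith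
    then have "n * (int A + 24) \<le> 2 * int A + n * (8 * n)" by (simp add: n_def)
    then have "n * (g + 8 * n + 24) \<le> 2 * (g + 8 * n) + n * (8 * n)" by (simp add: g_def)
    then have "n * (g + 8) \<le> 2 * g" by (simp add: algebra_simps)
    moreover have "9 * (g + 8) \<le> n * (g + 8)" using n9 g by (intro mult_right_mono) auto
    ultimately have "9 * (g + 8) \<le> 2 * g" by (rule order.trans[rotated])
    then show False using g by simp
  qed
  then show ?thesis using heavy sum by (intro exI[of _ V]) simp
qed

text \<open>
  Degrees five and seven, and six without an octahedral neighbourhood, are impossible in the low part. As the degrees there sum to at
  least four less than eight times its size and an octahedral vertex contributes two, there are two octahedral vertices.
\<close>
theorem contradiction: False
proof -
  obtain F where F: "F \<subseteq> V" and heavy: "\<And>x y. x \<in> F \<Longrightarrow> E x y \<Longrightarrow> 4 \<le> codeg E x y"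
    and sum: "(\<Sum>x\<in>F. dg E x) + 4 \<le> 8 * card F" using low_part by blast
  have finF: "finite F" using F fin_sub by blast
  have kinds: "octa E x \<or> 8 \<le> dg E x" if x: "x \<in> F" for x
  proof (rule ccontr)
    assume no: "\<not> ?thesis"
    have xV: "x \<in> V" using x F by blast
    have h: "\<And>y. E x y \<Longrightarrow> 4 \<le> codeg E x y" using heavy x by blast
    have "dg E x = 5 \<or> dg E x = 6 \<or> dg E x = 7" using d5 xV no by force
    then show False
    proof (elim disjE)
      assume "dg E x = 5"
      then show False using degree_five[OF G k4 V9 xV h] noK by simp
    next
      assume d6: "dg E x = 6"
      then obtain y where "E x y" "codeg E x y \<noteq> 4" using no by (auto simp: octa_def)
      then show False using degree_six[OF G k4 V9 xV h d6, of y] h[of y] noK by fastforce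
    next
      assume "dg E x = 7"
      then show False using degree_seven[OF IH G k4 dense V9 xV h] noK by blast
    qed
  qed
  define Oc where "Oc = {x \<in> F. octa E x}"
  have "2 \<le> card Oc"
  proof -
    have fO: "finite Oc" "Oc \<subseteq> F" using finF by (auto simp: Oc_def)
    have "(\<Sum>x\<in>F. 8) \<le> (\<Sum>x\<in>F. dg E x + (if x \<in> Oc then 2 else 0))"
      by (rule sum_mono) (use kinds in \<open>auto simp: Oc_def octa_def\<close>)
    also have "\<dots> = (\<Sum>x\<in>F. dg E x) + (\<Sum>x\<in>F. if x \<in> Oc then 2 else 0)" by (rule sum.distrib)
    also have "(\<Sum>x\<in>F. if x \<in> Oc then 2 else 0) = 2 * card Oc"
      using finF fO(2) by (simp add: sum.If_cases Int_absorb1)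
    finally show ?thesis using sum by simp
  qed
  then obtain U where U: "U \<subseteq> Oc" "card U = 2" using obtain_subset_with_card_n by metis
  then obtain u v where "U = {u, v}" "u \<noteq> v" by (auto simp: card_2_iff)
  then have uv: "u \<in> Oc" "v \<in> Oc" "u \<noteq> v" using U(1) by auto
  then show False
    using octa_adjacent[OF G k4 V9, of v u] octa_nonadjacent[OF G k4 V9, of v u] noK es by (auto simp: Oc_def)
qed

end

section \<open>Three-cuts and dense pieces\<close>

text \<open>A largest connected proper subset misses a single vertex.\<close>
lemma conn_set_remove_vertex:
  assumes s: "symp E" and M: "conn_set E M" "finite M" "2 \<le> card M"
  shows "\<exists>x N. M = insert x N \<and> x \<notin> N \<and> conn_set E N \<and> touches E {x} N"
proof -
  obtain y where y: "y \<in> M" using conn_set_nonempty[OF M(1)] by blast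
  have "{y} \<noteq> M" using M(3) by auto
  then have P: "conn_set E {y} \<and> {y} \<subset> M" using y by auto
  have "\<forall>N. conn_set E N \<and> N \<subset> M \<longrightarrow> card N < card M" using psubset_card_mono[OF M(2)] by blast
  have "\<exists>N. (conn_set E N \<and> N \<subset> M) \<and> (\<forall>N'. conn_set E N' \<and> N' \<subset> M \<longrightarrow> card N' \<le> card N)"
    by (rule ex_has_greatest_nat[where k = "{y}" and b = "card M"]) (rule P, fact)
  then obtain N where N: "conn_set E N" "N \<subset> M" and mx: "\<And>N'. conn_set E N' \<and> N' \<subset> M \<Longrightarrow> card N' \<le> card N" by metis
  have "touches E N (M - N)" using M(1) N conn_set_nonempty[OF N(1)] unfolding conn_set_def by blast
  then obtain n x where nx: "n \<in> N" "x \<in> M" "x \<notin> N" "E n x" by (auto simp: touches_def)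
  have c: "conn_set E (insert x N)" by (rule conn_set_insert[OF s N(1) nx(1)]) (use nx in simp)
  have "finite N" using N(2) M(2) finite_subset by blast
  then have "card (insert x N) = Suc (card N)" using nx(3) by simp
  then have "\<not> insert x N \<subset> M" using mx[of "insert x N"] c by auto
  then have "M = insert x N" using N(2) nx(2) by blast
  moreover have "E x n" using nx(4) s by (auto dest: sympD)
  ultimately show ?thesis using N(1) nx by (auto simp: touches_def)
qed

text \<open>
  A connected set \<open>M\<close> that touches three connected sets contains a branch vertex \<open>z\<close>: remove a vertex of \<open>M\<close>
  that does not disconnect it, and let it join the set that only it touches.
\<close>
lemma tripod:
  assumes s: "symp E" and S: "card S = 3" and M: "conn_set E M" "finite M"
    and P: "\<forall>a\<in>S. conn_set E (P a) \<and> P a \<inter> M = {} \<and> touches E M (P a)"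
      "\<forall>a\<in>S. \<forall>b\<in>S. a \<noteq> b \<longrightarrow> P a \<inter> P b = {}"
  shows "\<exists>z L. z \<in> M \<and> (\<forall>a\<in>S. conn_set E (L a) \<and> P a \<subseteq> L a \<and> L a \<subseteq> P a \<union> M \<and> z \<notin> L a \<and> touches E {z} (L a)) \<and>
    (\<forall>a\<in>S. \<forall>b\<in>S. a \<noteq> b \<longrightarrow> L a \<inter> L b = {})"
  using M P
proof (induction "card M" arbitrary: M P rule: less_induct)
  case less
  have finS: "finite S" using S card.infinite by fastforce
  show ?case
  proof (cases "2 \<le> card M")
    case False
    then have "card M = 1" using conn_set_nonempty[OF less.prems(1)] less.prems(2) card_gt_0_iff[of M] by linarith
    then obtain z where "M = {z}" by (auto simp: card_1_singleton_iff)
    then show ?thesis using less.prems(3,4) by (intro exI[of _ z] exI[of _ P]) auto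
  next
    case True
    then obtain x N where x: "M = insert x N" "x \<notin> N" "conn_set E N" "touches E {x} N"
      using conn_set_remove_vertex[OF s less.prems(1,2)] by blast
    have finN: "finite N" "card N < card M" using less.prems(2) x by auto
    define Miss where "Miss = {a \<in> S. \<not> touches E N (P a)}"
    have xm: "touches E {x} (P a)" if "a \<in> Miss" for a
      using less.prems(3) that x(1) by (auto simp: Miss_def touches_def)
    show ?thesis
    proof (cases "card Miss \<le> 1")
      case True
      define P' where "P' = (\<lambda>a. if a \<in> Miss then insert x (P a) else P a)"
      have sub: "a = b" if "a \<in> Miss" "b \<in> Miss" for a b
      proof -
        have "finite Miss" using finS by (simp add: Miss_def)
        then show ?thesis using True card_le_Suc0_iff_eq[of Miss] that by simp
      qed
      have Nx: "touches E N {x}" using x(4) touches_sym[OF s] by blast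
      have P': "\<forall>a\<in>S. conn_set E (P' a) \<and> P' a \<inter> N = {} \<and> touches E N (P' a)"
      proof
        fix a assume a: "a \<in> S"
        show "conn_set E (P' a) \<and> P' a \<inter> N = {} \<and> touches E N (P' a)"
        proof (cases "a \<in> Miss")
          case True
          obtain y where y: "y \<in> P a" "E x y" using xm[OF True] by (auto simp: touches_def)
          have "conn_set E (insert x (P a))"
            by (rule conn_set_insert[OF s _ y(1)]) (use less.prems(3) a y in auto)
          moreover have "touches E N (insert x (P a))" using Nx by (auto simp: touches_def)
          ultimately show ?thesis using True less.prems(3) a x by (auto simp: P'_def)
        next
          case False
          then show ?thesis using less.prems(3) a x by (auto simp: P'_def Miss_def)
        qed
      qed
      have "\<forall>a\<in>S. \<forall>b\<in>S. a \<noteq> b \<longrightarrow> P' a \<inter> P' b = {}"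
        using less.prems(3,4) sub x(1) by (auto simp: P'_def)
      from less.hyps[OF finN(2) x(3) finN(1) P' this] obtain z L where zL: "z \<in> N"
        and L: "\<forall>a\<in>S. conn_set E (L a) \<and> P' a \<subseteq> L a \<and> L a \<subseteq> P' a \<union> N \<and> z \<notin> L a \<and> touches E {z} (L a)"
          "\<forall>a\<in>S. \<forall>b\<in>S. a \<noteq> b \<longrightarrow> L a \<inter> L b = {}" by blast
      have "P a \<subseteq> P' a" "P' a \<subseteq> P a \<union> M" for a using x(1) by (auto simp: P'_def)
      then have "\<forall>a\<in>S. conn_set E (L a) \<and> P a \<subseteq> L a \<and> L a \<subseteq> P a \<union> M \<and> z \<notin> L a \<and> touches E {z} (L a)"
        using L(1) x(1) by blast
      then show ?thesis using zL x(1) L(2) by blast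
    next
      case False
      define L where "L = (\<lambda>a. if a \<in> Miss then P a else P a \<union> N)"
      have MS: "Miss \<subseteq> S" by (auto simp: Miss_def)
      have one: "a = b" if "a \<in> S - Miss" "b \<in> S - Miss" for a b
      proof -
        have "card (S - Miss) \<le> 1" using card_Diff_subset[OF finite_subset[OF MS finS] MS] S False by simp
        then show ?thesis using card_le_Suc0_iff_eq[of "S - Miss"] finS that by simp
      qed
      have "conn_set E (L a) \<and> P a \<subseteq> L a \<and> L a \<subseteq> P a \<union> M \<and> x \<notin> L a \<and> touches E {x} (L a)" if a: "a \<in> S" for a
      proof (cases "a \<in> Miss")
        case True
        then show ?thesis using less.prems(3) a x(1) xm by (auto simp: L_def)
      next
        case False
        have t: "touches E (P a) N" using False a touches_sym[OF s] by (auto simp: Miss_def)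
        have "conn_set E (P a \<union> N)" by (rule conn_set_Un[OF s _ x(3)]) (use less.prems(3) a t in auto)
        moreover have "touches E {x} (P a \<union> N)" using x(4) by (auto simp: touches_def)
        ultimately show ?thesis using False less.prems(3) a x by (auto simp: L_def)
      qed
      moreover have "\<forall>a\<in>S. \<forall>b\<in>S. a \<noteq> b \<longrightarrow> L a \<inter> L b = {}"
      proof (intro ballI impI)
        fix a b assume ab: "a \<in> S" "b \<in> S" "a \<noteq> b"
        have "P a \<inter> P b = {}" "P a \<inter> N = {}" "P b \<inter> N = {}" using less.prems(3,4) ab x(1) by blast+
        then show "L a \<inter> L b = {}" using one[of a b] ab by (auto simp: L_def)
      qed
      ultimately show ?thesis using x(1) by blast
    qed
  qed
qed

text \<open>
  A vertex of degree three with pairwise nonadjacent neighbours is a side of a 3-cut without a rooted triangle; it is the only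
  such side in a 3-connected graph.
\<close>
definition admissible :: "('a \<Rightarrow> 'a \<Rightarrow> bool) \<Rightarrow> bool" where
  "admissible E \<longleftrightarrow> (\<forall>u. card {y. E u y} = 3 \<longrightarrow> (\<exists>x y. E u x \<and> E u y \<and> E x y))"

text \<open>
  Among all tripods in \<open>U \<union> S\<close> with feet \<open>S\<close> take one whose legs cover as much as possible. If two legs touch, then the
  third one takes the centre \<open>z\<close>. Otherwise, by maximality and 3-connectivity, \<open>z\<close> is all of \<open>U\<close>, and its three neighbours are
  pairwise nonadjacent.
\<close>
lemma rooted_triangle:
  assumes G: "ugraph V E" and k: "k_conn 3 V E" and adm: "admissible E"
    and U: "U \<subseteq> V" "U \<noteq> {}" "nbh E U = S" "card S = 3" "U \<union> S \<noteq> V"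
  shows "\<exists>L. rooted_clique E (U \<union> S) S L"
proof (rule ccontr)
  assume no: "\<not> ?thesis"
  have s: "symp E" by (rule ugraph_symp[OF G])
  have finV: "finite V" by (rule ugraph_finite[OF G])
  have SV: "S \<subseteq> V" "U \<inter> S = {}" using nbh_subset[OF G, of U] nbh_disjoint[of U E] U(3) by auto
  have fUS: "finite (U \<union> S)" "finite S" using U(1) SV finV finite_subset by (blast, blast)
  obtain w where w: "w \<in> V" "w \<notin> U \<union> S" using U(1,5) SV by blast
  have wb: "3 \<le> card W" if "A \<subseteq> U" "A \<noteq> {}" "nbh E A \<subseteq> W" "W \<subseteq> U \<union> S" for A W
  proof -
    have "A \<union> nbh E A \<noteq> V" using that w by blast
    then have "3 \<le> card (nbh E A)" using k_connD[OF k _ that(2)] that(1) U(1) by blast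
    then show ?thesis using card_mono[OF finite_subset[OF that(4) fUS(1)] that(3)] by linarith
  qed
  have NU: "y \<in> U \<union> S" if "u \<in> U" "E u y" for u y using that U(3) by (auto simp: nbh_def)
  define tri where "tri = (\<lambda>(z, L). z \<in> U \<and> (\<forall>a\<in>S. a \<in> L a \<and> L a \<subseteq> U \<union> S \<and> conn_set E (L a) \<and> z \<notin> L a \<and> touches E {z} (L a)) \<and>
    (\<forall>a\<in>S. \<forall>b\<in>S. a \<noteq> b \<longrightarrow> L a \<inter> L b = {}))"
  obtain u where u: "u \<in> U" using U(2) by blast
  define K where "K = component E U u"
  note K = component_props[OF s u, folded K_def]
  have nK: "nbh E K \<subseteq> S" using K(3,4) NU by (fastforce simp: nbh_def)
  have "3 \<le> card (nbh E K)" by (rule wb[OF K(3)]) (use K(2) nK in auto)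
  then have nK': "nbh E K = S" using card_seteq[OF fUS(2) nK] U(4) by simp
  have "\<forall>a\<in>S. conn_set E {a} \<and> {a} \<inter> K = {} \<and> touches E K {a}"
  proof
    fix a assume "a \<in> S"
    then have "a \<in> nbh E K" by (simp add: nK')
    then show "conn_set E {a} \<and> {a} \<inter> K = {} \<and> touches E K {a}"
      using touches_nbh[OF s, of a K] by (simp add: nbh_def)
  qed
  moreover have "\<forall>a\<in>S. \<forall>b\<in>S. a \<noteq> b \<longrightarrow> {a} \<inter> {b} = {}" by simp
  moreover have finK: "finite K" using K(3) fUS finite_subset by blast
  ultimately obtain z0 L0 where zL0: "z0 \<in> K"
    "\<forall>a\<in>S. conn_set E (L0 a) \<and> {a} \<subseteq> L0 a \<and> L0 a \<subseteq> {a} \<union> K \<and> z0 \<notin> L0 a \<and> touches E {z0} (L0 a)"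
    "\<forall>a\<in>S. \<forall>b\<in>S. a \<noteq> b \<longrightarrow> L0 a \<inter> L0 b = {}"
    using tripod[OF s U(4) K(1), of "\<lambda>a. {a}"] by blast
  have "\<forall>a\<in>S. a \<in> L0 a \<and> L0 a \<subseteq> U \<union> S" "z0 \<in> U" using zL0(1,2) K(3) by blast+
  then have "tri (z0, L0)" unfolding tri_def prod.case using zL0(2,3) by blast
  then have "\<exists>p. tri p \<and> (\<forall>p'. tri p' \<longrightarrow> card (\<Union>a\<in>S. snd p' a) \<le> card (\<Union>a\<in>S. snd p a))"
  proof (rule ex_has_greatest_nat[where P = tri and k = "(z0, L0)" and f = "\<lambda>p. card (\<Union>a\<in>S. snd p a)" and b = "Suc (card (U \<union> S))"])
    show "\<forall>p. tri p \<longrightarrow> card (\<Union>a\<in>S. snd p a) < Suc (card (U \<union> S))"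
      unfolding less_Suc_eq_le by (intro allI impI card_mono[OF fUS(1)]) (simp add: tri_def UN_subset_iff split: prod.splits)
  qed
  then obtain p where p: "tri p" "\<And>p'. tri p' \<Longrightarrow> card (\<Union>a\<in>S. snd p' a) \<le> card (\<Union>a\<in>S. snd p a)" by blast
  obtain z L where pz: "p = (z, L)" by (cases p)
  have zU: "z \<in> U" and L: "\<And>a. a \<in> S \<Longrightarrow> a \<in> L a \<and> L a \<subseteq> U \<union> S \<and> conn_set E (L a) \<and> z \<notin> L a \<and> touches E {z} (L a)"
    and Ld: "\<And>a b. a \<in> S \<Longrightarrow> b \<in> S \<Longrightarrow> a \<noteq> b \<Longrightarrow> L a \<inter> L b = {}" using p(1) by (auto simp: tri_def pz)
  have mx: "card (\<Union>a\<in>S. L' a) \<le> card (\<Union>a\<in>S. L a)" if "tri (z', L')" for z' L' using p(2)[OF that] by (simp add: pz)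
  have apart: "\<not> touches E (L a) (L b)" if ab: "a \<in> S" "b \<in> S" "a \<noteq> b" for a b
  proof
    assume t: "touches E (L a) (L b)"
    have "card (S - {a, b}) = 1" using card_Diff_subset[of "{a, b}" S] ab U(4) by simp
    then obtain c where "S - {a, b} = {c}" by (auto simp: card_1_singleton_iff)
    then have c: "S = {a, b, c}" "c \<noteq> a" "c \<noteq> b" using ab by auto
    have "c \<in> S" using c by simp
    define L' where "L' = L(c := insert z (L c))"
    have Lc: "conn_set E (insert z (L c))"
    proof -
      obtain y where "y \<in> L c" "E z y" using L[OF \<open>c \<in> S\<close>] by (auto simp: touches_def)
      then show ?thesis using conn_set_insert[OF s, of "L c" y z] L[OF \<open>c \<in> S\<close>] by blast
    qed
    have tz: "touches E (insert z (L c)) (L d)" "touches E (L d) (insert z (L c))" if "d \<in> {a, b}" for d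
    proof -
      have "touches E {z} (L d)" using L[of d] that c(1) by blast
      then show "touches E (insert z (L c)) (L d)" by (auto simp: touches_def)
      then show "touches E (L d) (insert z (L c))" using touches_sym[OF s] by blast
    qed
    have ta: "touches E (L b) (L a)" using t touches_sym[OF s] by blast
    have zn: "z \<notin> L a" "z \<notin> L b" using L ab by auto
    have Lab: "L a \<inter> L b = {}" "L a \<inter> L c = {}" "L b \<inter> L c = {}" "L b \<inter> L a = {}" "L c \<inter> L a = {}" "L c \<inter> L b = {}"
      using Ld c ab by auto
    have "rooted_clique E (U \<union> S) S L'"
      unfolding rooted_clique_def
    proof (intro conjI ballI impI)
      fix d assume d: "d \<in> S"
      show "d \<in> L' d" "L' d \<subseteq> U \<union> S" "conn_set E (L' d)" using L[OF d] Lc zU by (auto simp: L'_def)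
      fix e assume e: "e \<in> S" "d \<noteq> e"
      show "L' d \<inter> L' e = {}" using d e c zn Lab by (auto simp: L'_def)
      show "touches E (L' d) (L' e)" using d e c(1) c(2,3) tz t ta by (auto simp: L'_def)
    qed
    then show False using no by blast
  qed
  have rest: "U \<union> S = insert z (\<Union>a\<in>S. L a)"
  proof (rule ccontr)
    assume ne: "U \<union> S \<noteq> insert z (\<Union>a\<in>S. L a)"
    let ?Q = "U \<union> S - insert z (\<Union>a\<in>S. L a)"
    obtain r where r: "r \<in> ?Q" using ne L zU by blast
    define R where "R = component E ?Q r"
    note R = component_props[OF s r, folded R_def]
    have RU: "R \<subseteq> U" using R(3) L by blast
    have nR: "nbh E R \<subseteq> insert z (\<Union>a\<in>S. L a)"
    proof
      fix y assume y: "y \<in> nbh E R"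
      then have "y \<in> U \<union> S" using NU RU by (auto simp: nbh_def)
      then show "y \<in> insert z (\<Union>a\<in>S. L a)" using R(4) y by blast
    qed
    have "\<not> nbh E R \<subseteq> {z}"
    proof
      assume "nbh E R \<subseteq> {z}"
      then have "3 \<le> card {z}" using wb[OF RU _ _ , of "{z}"] R(2) zU by auto
      then show False by simp
    qed
    then obtain y a where y: "y \<in> nbh E R" "a \<in> S" "y \<in> L a" using nR by blast
    have La: "conn_set E (L a \<union> R)"
    proof (rule conn_set_Un[OF s _ R(1)])
      show "conn_set E (L a)" using L y by blast
      show "L a \<inter> R \<noteq> {} \<or> touches E (L a) R" using y(1,3) touches_nbh[OF s y(1)] by (auto simp: touches_def)
    qed
    have RL: "R \<inter> L b = {}" if "b \<in> S" for b using R(3) that by blast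
    define L' where "L' = L(a := L a \<union> R)"
    have "\<forall>b\<in>S. b \<in> L' b \<and> L' b \<subseteq> U \<union> S \<and> conn_set E (L' b) \<and> z \<notin> L' b \<and> touches E {z} (L' b)"
    proof
      fix b assume b: "b \<in> S"
      have "z \<notin> R" using R(3) by blast
      then show "b \<in> L' b \<and> L' b \<subseteq> U \<union> S \<and> conn_set E (L' b) \<and> z \<notin> L' b \<and> touches E {z} (L' b)"
        using L[OF b] La RU by (auto simp: touches_def L'_def)
    qed
    moreover have "\<forall>b\<in>S. \<forall>c\<in>S. b \<noteq> c \<longrightarrow> L' b \<inter> L' c = {}"
    proof (intro ballI impI)
      fix b c assume b: "b \<in> S" and c: "c \<in> S" "b \<noteq> c"
      show "L' b \<inter> L' c = {}" using Ld[OF b c] RL[OF b] RL[OF c(1)] c(2) by (auto simp: L'_def)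
    qed
    ultimately have "tri (z, L')" unfolding tri_def prod.case using zU by blast
    then have "card (\<Union>b\<in>S. L' b) \<le> card (\<Union>a\<in>S. L a)" by (rule mx)
    moreover have "(\<Union>a\<in>S. L a) \<subset> (\<Union>b\<in>S. L' b)"
    proof
      show "(\<Union>a\<in>S. L a) \<subseteq> (\<Union>b\<in>S. L' b)" by (auto simp: L'_def)
      have "r \<in> (\<Union>b\<in>S. L' b)" using R(2) y(2) by (auto simp: L'_def)
      then show "(\<Union>a\<in>S. L a) \<noteq> (\<Union>b\<in>S. L' b)" using r by blast
    qed
    moreover have "finite (\<Union>b\<in>S. L' b)"
      by (rule finite_subset[OF _ fUS(1)]) (use L RU in \<open>auto simp: L'_def split: if_splits\<close>)
    ultimately show False using psubset_card_mono by (metis linorder_not_less)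
  qed
  have leg: "L a = {a}" if a: "a \<in> S" for a
  proof (rule ccontr)
    assume ne: "L a \<noteq> {a}"
    have A: "L a - {a} \<noteq> {}" using ne L[OF a] by blast
    have aU: "L a - {a} \<subseteq> U"
    proof
      fix y assume y: "y \<in> L a - {a}"
      then have "y \<in> U \<union> S" using L[OF a] by blast
      moreover have "y \<notin> S" using y L[of y] Ld[OF a, of y] by blast
      ultimately show "y \<in> U" by blast
    qed
    have "nbh E (L a - {a}) \<subseteq> {a, z}"
    proof
      fix y assume "y \<in> nbh E (L a - {a})"
      then obtain x where x: "x \<in> L a - {a}" "E x y" "y \<notin> L a - {a}" by (auto simp: nbh_def)
      have "y \<in> insert z (\<Union>a\<in>S. L a)" using NU[OF _ x(2)] aU x(1) rest by blast
      moreover have "y \<in> L b \<Longrightarrow> b \<in> S \<Longrightarrow> b = a" for b using apart[OF a, of b] x by (auto simp: touches_def)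
      ultimately show "y \<in> {a, z}" using x(3) by blast
    qed
    then have "3 \<le> card {a, z}" by (rule wb[OF aU A]) (use a zU in blast)
    then show False by (simp add: card_insert_if split: if_splits)
  qed
  have Uz: "U = {z}" using rest leg zU SV(2) by auto
  then have "{y. E z y} = S" using U(3) ugraph_in[OF G] by (auto simp: nbh_def)
  then obtain x y where xy: "x \<in> S" "y \<in> S" "E x y" using adm U(4) unfolding admissible_def by blast
  then have "touches E (L x) (L y)" using leg by (auto simp: touches_def)
  then show False using apart[OF xy(1,2)] xy(3) ugraph_in[OF G] by blast
qed

text \<open>
  The members of \<open>\<D>\<close> are unions of components beyond \<open>X\<close>, and each of them makes its attachments complete.
\<close>
definition torso :: "('a \<Rightarrow> 'a \<Rightarrow> bool) \<Rightarrow> 'a set \<Rightarrow> 'a set set \<Rightarrow> 'a \<Rightarrow> 'a \<Rightarrow> bool" where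
  "torso E X \<D> x y \<longleftrightarrow> x \<in> X \<and> y \<in> X \<and> x \<noteq> y \<and> (E x y \<or> (\<exists>D\<in>\<D>. x \<in> nbh E D \<and> y \<in> nbh E D))"

definition piece :: "'a set \<Rightarrow> ('a \<Rightarrow> 'a \<Rightarrow> bool) \<Rightarrow> 'a set \<Rightarrow> 'a set set \<Rightarrow> bool" where
  "piece V E X \<D> \<longleftrightarrow> X \<subseteq> V \<and> \<Union>\<D> = V - X \<and> (\<forall>D\<in>\<D>. nbh E D \<subseteq> X \<and> card (nbh E D) \<le> 3) \<and> cocktail X (torso E X \<D>)"

text \<open>
  The cut \<open>S\<close> is complete in the filled side. Hence either \<open>S\<close> lies in \<open>X\<close>, and the other side becomes a new member with boundary
  \<open>S\<close>, or the members that meet \<open>S\<close> absorb the other side without changing their boundaries.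
\<close>
lemma piece_lift:
  assumes G: "ugraph V E" and C: "C \<subseteq> V" "nbh E C = S" "nbh E (V - C - S) = S" "card S \<le> 3"
    and P: "piece (C \<union> S) (fill S C E) X \<D>"
  shows "\<exists>\<D>'. piece V E X \<D>'"
proof -
  let ?H = "fill S C E" and ?B = "V - C - S"
  have SV: "S \<subseteq> V" "C \<inter> S = {}" using nbh_subset[OF G, of C] nbh_disjoint[of C E] C(2) by auto
  have X: "X \<subseteq> C \<union> S" "\<Union>\<D> = C \<union> S - X" "cocktail X (torso ?H X \<D>)"
    and D: "\<And>D. D \<in> \<D> \<Longrightarrow> nbh ?H D \<subseteq> X \<and> card (nbh ?H D) \<le> 3" using P by (auto simp: piece_def)
  have DX: "D \<subseteq> C \<union> S - X" if "D \<in> \<D>" for D using X(2) that by blast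
  have es: "E x y \<Longrightarrow> E y x" and ev: "E x y \<Longrightarrow> x \<in> V \<and> y \<in> V \<and> x \<noteq> y" for x y using ugraph_sym[OF G] ugraph_in[OF G] by blast+
  have NC: "y \<in> C \<union> S" if "x \<in> C" "E x y" for x y using that C(2) by (auto simp: nbh_def)
  have NB: "y \<in> ?B \<union> S" if "x \<in> ?B" "E x y" for x y using that C(3) unfolding nbh_def by blast
  define g where "g = (\<lambda>D. if D \<inter> S = {} then D else D \<union> ?B)"
  have gn: "nbh E (g D) = nbh ?H D" if DD: "D \<in> \<D>" for D
  proof (cases "D \<inter> S = {}")
    case True
    then have DC: "D \<subseteq> C" using DX[OF DD] by blast
    have "?H x y \<longleftrightarrow> E x y" if "x \<in> D" for x y using that DC True NC[of x y] ev[of x y] by (auto simp: fill_def)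
    then show ?thesis using True by (auto simp: g_def nbh_def)
  next
    case False
    then obtain s0 where s0: "s0 \<in> D" "s0 \<in> S" by blast
    have g: "g D = D \<union> ?B" using False by (simp add: g_def)
    have sH: "y \<in> nbh ?H D" if "y \<in> S" "y \<notin> D" for y
      using that s0 by (auto simp: nbh_def fill_def)
    show ?thesis
      unfolding g
    proof
      show "nbh E (D \<union> ?B) \<subseteq> nbh ?H D"
      proof
        fix y assume "y \<in> nbh E (D \<union> ?B)"
        then obtain x where x: "x \<in> D \<or> x \<in> ?B" "E x y" "y \<notin> D" "y \<notin> ?B" by (auto simp: nbh_def)
        have yV: "y \<in> C \<union> S" using x(4) ev[OF x(2)] by blast
        show "y \<in> nbh ?H D"
        proof (cases "x \<in> D")
          case True
          then have "?H x y" using x(2) yV DX[OF DD] ev[OF x(2)] by (auto simp: fill_def)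
          then show ?thesis using True x(3) by (auto simp: nbh_def)
        next
          case False
          then have "y \<in> S" using NB[of x y] x by blast
          then show ?thesis using sH x(3) by blast
        qed
      qed
      show "nbh ?H D \<subseteq> nbh E (D \<union> ?B)"
      proof
        fix y assume "y \<in> nbh ?H D"
        then obtain x where x: "x \<in> D" "?H x y" "y \<notin> D" by (auto simp: nbh_def)
        have yB: "y \<notin> ?B" using x(2) by (auto simp: fill_def)
        show "y \<in> nbh E (D \<union> ?B)"
        proof (cases "E x y")
          case True
          then show ?thesis using x yB by (auto simp: nbh_def)
        next
          case False
          then have "y \<in> nbh E ?B" using x(2) C(3) by (auto simp: fill_def)
          then show ?thesis using x(3) yB by (auto simp: nbh_def)
        qed
      qed
    qed
  qed
  have HX: "?H x y \<longleftrightarrow> E x y \<or> x \<in> S \<and> y \<in> S" if "x \<in> X" "y \<in> X" "x \<noteq> y" for x y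
    using that X(1) by (auto simp: fill_def)
  show ?thesis
  proof (cases "S \<subseteq> X")
    case True
    have g: "g D = D" if "D \<in> \<D>" for D using DX[OF that] True by (auto simp: g_def)
    have gn': "nbh E D = nbh ?H D" if "D \<in> \<D>" for D using gn[OF that] g[OF that] by simp
    have "torso E X (insert ?B \<D>) = torso ?H X \<D>"
    proof (intro ext)
      fix x y
      show "torso E X (insert ?B \<D>) x y = torso ?H X \<D> x y"
        using HX[of x y] C(3) gn' by (auto simp: torso_def)
    qed
    moreover have "\<Union>(insert ?B \<D>) = V - X" using X(1,2) C(1) SV True by auto
    ultimately have "piece V E X (insert ?B \<D>)"
      unfolding piece_def using X C(1,3,4) SV True D gn' by auto
    then show ?thesis by blast
  next
    case False
    then obtain s0 D0 where s0: "s0 \<in> S" "s0 \<notin> X" "D0 \<in> \<D>" "s0 \<in> D0" using X(2) by blast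
    have tor: "torso E X (g ` \<D>) = torso ?H X \<D>"
    proof (intro ext)
      fix x y
      have "\<exists>D\<in>\<D>. x \<in> nbh ?H D \<and> y \<in> nbh ?H D" if "x \<in> X" "y \<in> X" "x \<in> S" "y \<in> S"
      proof -
        have "x \<notin> D0" "y \<notin> D0" using that(1,2) DX[OF s0(3)] by blast+
        then have "x \<in> nbh ?H D0 \<and> y \<in> nbh ?H D0" using s0 that by (auto simp: nbh_def fill_def)
        then show ?thesis using s0(3) by blast
      qed
      then show "torso E X (g ` \<D>) x y = torso ?H X \<D> x y"
        using HX[of x y] gn by (auto simp: torso_def)
    qed
    have "g D0 = D0 \<union> ?B" using s0 by (auto simp: g_def)
    then have "?B \<subseteq> \<Union>(g ` \<D>)" using s0(3) by blast
    moreover have "\<Union>\<D> \<subseteq> \<Union>(g ` \<D>)" by (auto simp: g_def)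
    moreover have "\<Union>(g ` \<D>) \<subseteq> \<Union>\<D> \<union> ?B" by (auto simp: g_def split: if_splits)
    ultimately have "\<Union>(g ` \<D>) = \<Union>\<D> \<union> ?B" by (intro subset_antisym Un_least)
    also have "\<dots> = V - X" unfolding X(2) using X(1) C(1) SV(1) by blast
    finally have "\<Union>(g ` \<D>) = V - X" .
    then have "piece V E X (g ` \<D>)"
      unfolding piece_def using X C(1) SV D gn tor by auto
    then show ?thesis by blast
  qed
qed

text \<open>Every edge inside \<open>A\<close> gives two arcs.\<close>
lemma even_arcs:
  assumes "ugraph V E" "finite A"
  shows "even (arcs_between E A A)"
  using assms(2)
proof (induction A)
  case empty
  then show ?case by (simp add: arcs_between_def)
next
  case (insert x A)
  have "\<not> E x x" using ugraph_in[OF assms(1)] by blast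
  then have "arcs_between E {x} {x} = 0" by (simp add: arcs_between_def)
  then show ?case
    using arcs_between_split[OF ugraph_symp[OF assms(1)], of "{x}" A] insert by simp
qed

text \<open>
  A 3-connected dense graph without the minor has an octuple of vertices with torso \<open>K\<^sub>2\<^sub>,\<^sub>2\<^sub>,\<^sub>2\<^sub>,\<^sub>2\<close>: the two sides of a 3-cut,
  with a triangle added on the cut, are minors by the rooted triangles of the opposite sides, and together
  they have so many edges that one of them is dense.
\<close>
lemma piece_exists:
  fixes V :: "'a set"
  assumes IH: "holds_below TYPE('a) n"
    and "ugraph V E" "card V < n" "k_conn 3 V E" "admissible E" "dense V E" "\<not> K7v_minor V E"
  shows "\<exists>X \<D>. piece V E X \<D>"
  using assms(2-)
proof (induction "card V" arbitrary: V E rule: less_induct)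
  case less
  note G = less.prems(1) and k = less.prems(3) and adm = less.prems(4) and dense = less.prems(5) and noK = less.prems(6)
  have s: "symp E" by (rule ugraph_symp[OF G])
  have finV: "finite V" by (rule ugraph_finite[OF G])
  have n3: "3 < card V" using k by (simp add: k_conn_def)
  show ?case
  proof (cases "k_conn 4 V E")
    case True
    then have co: "cocktail V E" using IH G less.prems(2) dense noK unfolding holds_below_def by blast
    have "torso E V {} = E" using ugraph_in[OF G] by (intro ext) (auto simp: torso_def)
    then have "piece V E V {}" using co by (simp add: piece_def)
    then show ?thesis by blast
  next
    case False
    have "card V \<noteq> 4"
    proof
      assume c4: "card V = 4"
      have "dg E u \<le> 3" if "u \<in> V" for u
      proof -
        have "{y. E u y} \<subseteq> V - {u}" using ugraph_in[OF G] by blast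
        then have "dg E u \<le> card (V - {u})" unfolding dg_def by (rule card_mono[rotated]) (use finV in simp)
        then show ?thesis using that c4 finV by simp
      qed
      then have "(\<Sum>u\<in>V. dg E u) \<le> (\<Sum>u\<in>V. 3)" by (rule sum_mono)
      then show False using dense arcs_eq_sum_dg[OF G, of V] c4 by (simp add: dense_def)
    qed
    then have "4 < card V" using n3 by simp
    then have "\<exists>C. C \<subseteq> V \<and> C \<noteq> {} \<and> C \<union> nbh E C \<noteq> V \<and> \<not> 4 \<le> card (nbh E C)"
      using False unfolding k_conn_def by blast
    then obtain C where C: "C \<subseteq> V" "C \<noteq> {}" "C \<union> nbh E C \<noteq> V" "card (nbh E C) < 4" by (metis linorder_not_le)
    define S where "S = nbh E C"
    define B where "B = V - C - S"
    have cS: "card S = 3" using k_connD[OF k C(1-3)] C(4) by (simp add: S_def)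
    have SV: "S \<subseteq> V" "C \<inter> S = {}" using nbh_subset[OF G] nbh_disjoint[of C E] by (auto simp: S_def)
    have fS: "finite S" "finite C" "finite B" using SV C(1) finV finite_subset by (auto simp: B_def)
    have Bne: "B \<noteq> {}" using C(1,3) SV by (auto simp: B_def S_def)
    have nBs: "nbh E B \<subseteq> S" using nbh_rest[OF G, of C] by (simp add: B_def S_def)
    have BV: "B \<subseteq> V" "B \<inter> S = {}" "C \<inter> B = {}" by (auto simp: B_def)
    have "3 \<le> card (nbh E B)" by (rule k_connD[OF k BV(1) Bne]) (use C(1,2) nBs BV SV in blast)
    then have nB: "nbh E B = S" using card_seteq[OF fS(1) nBs] cS by simp
    have VU: "V = C \<union> S \<union> B" using C(1) SV by (auto simp: B_def)
    have cV: "card V = card C + card S + card B"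
      unfolding VU using fS SV BV by (subst card_Un_disjoint, auto)+
    have arcs: "arcs_between E V V = arcs_between E C C + 2 * arcs_between E C S + arcs_between E B B + 2 * arcs_between E B S + arcs_between E S S"
    proof -
      have "arcs_between E V V = arcs_between E (C \<union> S) (C \<union> S) + 2 * arcs_between E (C \<union> S) B + arcs_between E B B"
        unfolding VU by (rule arcs_between_split[OF s]) (use fS BV in auto)
      moreover have "arcs_between E (C \<union> S) B = arcs_between E C B + arcs_between E S B"
        by (rule arcs_between_Un_left) (use fS SV in auto)
      moreover have "arcs_between E C B = 0" by (rule arcs_between_eq_0) (use BV in \<open>auto simp: B_def S_def nbh_def\<close>)
      moreover have "arcs_between E S B = arcs_between E B S" by (rule arcs_between_sym[OF s])
      moreover have "arcs_between E (C \<union> S) (C \<union> S) = arcs_between E C C + 2 * arcs_between E C S + arcs_between E S S"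
        by (rule arcs_between_split[OF s fS(2,1) SV(2)])
      ultimately show ?thesis by simp
    qed
    have SS: "arcs_between E S S \<le> 6"
    proof -
      have "arcs_between E S S = (\<Sum>u\<in>S. card {y \<in> S. E u y})" by (rule arcs_between_eq_sum_card[OF fS(1)])
      also have "\<dots> \<le> (\<Sum>u\<in>S. 2)"
      proof (rule sum_mono)
        fix u assume u: "u \<in> S"
        have "{y \<in> S. E u y} \<subseteq> S - {u}" using ugraph_in[OF G] by blast
        then have "card {y \<in> S. E u y} \<le> card (S - {u})" by (rule card_mono[rotated]) (use fS in simp)
        then show "card {y \<in> S. E u y} \<le> 2" using u cS fS by simp
      qed
      finally show ?thesis using cS by simp
    qed
    have side: "\<exists>X \<D>. piece V E X \<D>"
      if A: "A \<subseteq> V" "A \<noteq> {}" "nbh E A = S" "V - A - S = A'" "nbh E A' = S" "A' \<noteq> {}"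
        and heavy: "8 * (card A + 3) \<le> arcs_between E A A + 2 * arcs_between E A S + 6 + 16" for A A'
    proof -
      let ?H = "fill S A E"
      have AS: "A \<inter> S = {}" "A \<union> S \<subseteq> V" "finite A"
        using A(1,3) SV(1) nbh_disjoint[of A E] finite_subset[OF A(1) finV] by auto
      have A'V: "A' \<subseteq> V" "A' \<union> S = V - A" "A' \<union> S \<noteq> V" using A AS by auto
      have AV: "A \<union> S \<noteq> V" using A(4,6) by blast
      have cAS: "card (A \<union> S) = card A + 3" using card_Un_disjoint[OF AS(3) fS(1) AS(1)] cS by simp
      have less': "card (A \<union> S) < card V" using AS(2) AV by (intro psubset_card_mono[OF finV]) blast
      obtain L where L: "rooted_clique E (V - A) S L"
        using rooted_triangle[OF G k adm A'V(1) A(6,5) cS A'V(3)] A'V(2) by auto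
      have "\<not> K7v_minor (A \<union> S) ?H"
        using K7v_minor_trans[OF s minor_model_fill[OF G AS(2,1) L]] noK by blast
      moreover have "dense (A \<union> S) ?H"
        using heavy arcs_fill[OF G AS(2,1)] cAS cS by (simp add: dense_def)
      moreover have "admissible ?H"
        unfolding admissible_def
      proof (intro allI impI)
        fix u assume c3: "card {y. ?H u y} = 3"
        then have "{y. ?H u y} \<noteq> {}" by (metis card.empty zero_neq_numeral)
        then have uAS: "u \<in> A \<union> S" by (auto simp: fill_def)
        show "\<exists>x y. ?H u x \<and> ?H u y \<and> ?H x y"
        proof (cases "u \<in> S")
          case True
          then have "card (S - {u}) = 2" using cS fS by simp
          then obtain x y where xy: "S - {u} = {x, y}" "x \<noteq> y" by (auto simp: card_2_iff)
          then have "x \<in> S" "y \<in> S" "x \<noteq> u" "y \<noteq> u" by auto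
          then have "?H u x \<and> ?H u y \<and> ?H x y" using True xy(2) by (auto simp: fill_def)
          then show ?thesis by blast
        next
          case False
          then have uA: "u \<in> A" using uAS by blast
          have nb: "?H u y \<longleftrightarrow> E u y" for y
            using uA False A(3) ugraph_in[OF G, of u y] by (auto simp: fill_def nbh_def)
          then obtain x y where xy: "E u x" "E u y" "E x y" using adm c3 unfolding admissible_def by auto
          moreover have "x \<in> A \<union> S" "y \<in> A \<union> S" using nb[of x] nb[of y] xy by (auto simp: fill_def)
          ultimately have "?H x y" using ugraph_in[OF G xy(3)] by (auto simp: fill_def)
          then show ?thesis using xy nb by blast
        qed
      qed
      moreover have "k_conn 3 (A \<union> S) ?H"
      proof (rule k_conn_fill[OF G k AS(2) AV])
        show "nbh E A \<subseteq> S" using A(3) by simp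
        have "0 < card A" using A(2) AS(3) by (simp add: card_gt_0_iff)
        then show "3 < card (A \<union> S)" using cAS by simp
      qed
      ultimately obtain X \<D> where "piece (A \<union> S) ?H X \<D>"
        using less.hyps[OF less' ugraph_fill[OF G AS(2)]] less' less.prems(2) by fastforce
      then have "\<exists>\<D>'. piece V E X \<D>'" using piece_lift[OF G A(1,3), of X \<D>] A(4,5) cS by simp
      then show ?thesis by blast
    qed
    \<comment> \<open>Together the sides are at most two arcs short of being dense, but by parity a sparse side is at least two arcs short by itself.\<close>
    have "even (arcs_between E C C)" "even (arcs_between E B B)" using even_arcs[OF G] fS by auto
    then obtain c2 b2 where cb: "arcs_between E C C = 2 * c2" "arcs_between E B B = 2 * b2" by (auto elim!: evenE)
    have "8 * (card C + 3) \<le> arcs_between E C C + 2 * arcs_between E C S + 6 + 16 \<or>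
      8 * (card B + 3) \<le> arcs_between E B B + 2 * arcs_between E B S + 6 + 16"
      using dense arcs SS cV cS cb unfolding dense_def by simp presburger
    then show ?thesis
    proof
      assume "8 * (card C + 3) \<le> arcs_between E C C + 2 * arcs_between E C S + 6 + 16"
      then show ?thesis using side[of C B] C(1,2) nB Bne by (simp add: S_def[symmetric] B_def[symmetric])
    next
      assume h: "8 * (card B + 3) \<le> arcs_between E B B + 2 * arcs_between E B S + 6 + 16"
      have "V - B - S = C" using VU SV BV by blast
      then show ?thesis using side[of B C] h nB Bne BV C(2) by (simp add: S_def[symmetric])
    qed
  qed
qed

text \<open>
  A connected set with four attachments on \<open>K\<^sub>2\<^sub>,\<^sub>2\<^sub>,\<^sub>2\<^sub>,\<^sub>2\<close> either joins two nonadjacent vertices or sees one vertex of each pair;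
  in the second case the other four vertices, in two pairs, complete the clique.
\<close>
lemma cocktail_attach:
  assumes G: "ugraph V E" and X: "X \<subseteq> V" and F: "cocktail X F" and FE: "\<And>x y. F x y \<Longrightarrow> E x y"
    and D: "conn_set E D" "D \<subseteq> V - X" and A: "A \<subseteq> X" "4 \<le> card A" "\<And>a. a \<in> A \<Longrightarrow> touches E D {a}"
  shows "K7v_minor V E"
proof -
  have s: "symp E" by (rule ugraph_symp[OF G])
  have GF: "ugraph X F" "card X = 8" using F by (auto simp: cocktail_def)
  have finX: "finite X" by (rule ugraph_finite[OF GF(1)])
  have fs: "F x y \<Longrightarrow> F y x" for x y using ugraph_sym[OF GF(1)] by blast
  obtain mu where mu: "\<And>x. x \<in> X \<Longrightarrow> mu x \<in> X \<and> mu x \<noteq> x \<and> \<not> F x (mu x) \<and> (\<forall>y\<in>X. y \<noteq> x \<longrightarrow> y \<noteq> mu x \<longrightarrow> F x y)"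
    using cocktail_unique_nonneighbour[OF F] by metis
  show ?thesis
  proof (cases "\<exists>a\<in>A. mu a \<in> A")
    case True
    then obtain a where a: "a \<in> A" "mu a \<in> A" by blast
    have aX: "a \<in> X" "mu a \<in> X" "mu a \<noteq> a" "\<not> F a (mu a)" "\<not> F (mu a) a" using a A(1) mu fs by blast+
    define H where "H = (\<lambda>x y. F x y \<or> x = a \<and> y = mu a \<or> x = mu a \<and> y = a)"
    have GH: "ugraph X H" using GF(1) aX by (auto simp: ugraph_def H_def)
    have "minor_model V E X H (\<lambda>u. if u = a then insert a D else {u})"
      unfolding minor_model_def
    proof (intro conjI ballI impI)
      have "conn_set E (insert a D)"
      proof -
        obtain d where "d \<in> D" "E d a" using A(3)[OF a(1)] by (auto simp: touches_def)
        then show ?thesis using conn_set_insert[OF s D(1)] by blast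
      qed
      then show "conn_set E (if u = a then insert a D else {u})" for u by simp
      show "(if u = a then insert a D else {u}) \<subseteq> V" if "u \<in> X" for u using that X D by auto
      show "(if u = a then insert a D else {u}) \<inter> (if w = a then insert a D else {w}) = {}"
        if "u \<in> X" "w \<in> X" "u \<noteq> w" for u w using that D(2) by auto
      have tD: "touches E D {mu a}" "touches E {mu a} D" using A(3)[OF a(2)] touches_sym[OF s] by blast+
      show "touches E (if u = a then insert a D else {u}) (if w = a then insert a D else {w})" if "H u w" for u w
      proof -
        have "E u w \<or> u = a \<and> w = mu a \<or> u = mu a \<and> w = a" "u \<noteq> w" using that FE aX ugraph_in[OF GF(1)] by (auto simp: H_def)
        then show ?thesis using tD by (auto simp: touches_def)
      qed
    qed
    moreover have "K7v_minor X H"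
    proof (rule K7v_eight[OF GH GF(2)])
      have "arcs_between F X X \<le> arcs_between H X X" by (rule arcs_between_mono) (simp add: H_def)
      then show "48 \<le> arcs_between H X X" using cocktail_arcs[OF F] by simp
      have "{y. H a y} = insert (mu a) {y. F a y}" using aX by (auto simp: H_def)
      moreover have "card {y. F a y} = 6" using F aX(1) by (simp add: cocktail_def)
      ultimately have "card {y. H a y} = 7" using aX(4) finite_edges_at[OF GF(1), of a] by simp
      then show "\<exists>u\<in>X. card {y. H u y} \<noteq> 6" using aX(1) by (intro bexI[of _ a]) simp_all
    qed
    ultimately show ?thesis using K7v_minor_trans[OF s] by blast
  next
    case False
    obtain a1 a2 a3 a4 where a: "{a1, a2, a3, a4} \<subseteq> A" "distinct [a1, a2, a3, a4]" using obtain_4_subset[OF A(2)] .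
    have aX: "a1 \<in> X" "a2 \<in> X" "a3 \<in> X" "a4 \<in> X" using a A(1) by auto
    have no: "mu x \<noteq> y" if "x \<in> {a1, a2, a3, a4}" "y \<in> {a1, a2, a3, a4}" for x y
      using False subsetD[OF a(1) that(1)] subsetD[OF a(1) that(2)] by metis
    have inv: "mu (mu x) = x" if "x \<in> X" for x
    proof (rule ccontr)
      assume "mu (mu x) \<noteq> x"
      then have "F (mu x) x" using mu[OF that] mu[of "mu x"] that by metis
      then show False using mu[OF that] fs by blast
    qed
    have dm: "mu x \<noteq> mu y" if "x \<in> X" "y \<in> X" "x \<noteq> y" for x y using inv that by metis
    have e: "E x y" if "x \<in> X" "y \<in> X" "x \<noteq> y" "y \<noteq> mu x" for x y
    proof -
      have "F x y" using mu[OF that(1)] that(2) not_sym[OF that(3)] that(4) by simp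
      then show ?thesis by (rule FE)
    qed
    let ?b = "mu"
    have bX: "mu a1 \<in> X" "mu a2 \<in> X" "mu a3 \<in> X" "mu a4 \<in> X" using mu aX by blast+
    have d: "a1 \<noteq> a2" "a1 \<noteq> a3" "a1 \<noteq> a4" "a2 \<noteq> a3" "a2 \<noteq> a4" "a3 \<noteq> a4" using a(2) by auto
    note bd = dm[OF aX(1,2) d(1)] dm[OF aX(1,3) d(2)] dm[OF aX(1,4) d(3)] dm[OF aX(2,3) d(4)] dm[OF aX(2,4) d(5)] dm[OF aX(3,4) d(6)]
    let ?A = "{a1, a2, a3, a4}"
    have mX: "x \<in> X" "mu x \<in> X" if "x \<in> ?A" for x using that aX bX by auto
    have n: "mu x \<noteq> y" "y \<noteq> mu x" if "x \<in> ?A" "y \<in> ?A" for x y using no[OF that] by auto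
    have ab: "E (mu x) y" if h: "x \<in> ?A" "y \<in> ?A" "x \<noteq> y" for x y
      by (rule e[OF mX(2)[OF h(1)] mX(1)[OF h(2)] n(1)[OF h(1,2)]]) (use inv[OF mX(1)[OF h(1)]] h(3) in simp)
    have aa: "E x y" if h: "x \<in> ?A" "y \<in> ?A" "x \<noteq> y" for x y
      by (rule e[OF mX(1)[OF h(1)] mX(1)[OF h(2)] h(3) n(2)[OF h(1,2)]])
    have bb: "E (mu x) (mu y)" if h: "x \<in> ?A" "y \<in> ?A" "x \<noteq> y" for x y
      by (rule e[OF mX(2)[OF h(1)] mX(2)[OF h(2)] dm[OF mX(1)[OF h(1)] mX(1)[OF h(2)] h(3)]])
        (use inv[OF mX(1)[OF h(1)]] n(1)[OF h(2,1)] in simp)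
    have tD: "touches E D {a1}" "touches E D {a2}" "touches E D {a3}" "touches E D {a4}" using A(3) a(1) by auto
    have DX: "x \<notin> D" if "x \<in> X" for x using D(2) that by blast
    have all: "E (mu a1) a2" "E (mu a1) a3" "E (mu a1) a4" "E (mu a2) a1" "E (mu a3) a1" "E (mu a3) a2" "E (mu a3) a4" "E (mu a4) a3"
      using ab d by simp_all
    have aall: "E a1 a2" "E a1 a3" "E a1 a4" "E a2 a3" "E a2 a4" "E a3 a4" using aa d by simp_all
    have b13: "E (mu a1) (mu a3)" using bb d by simp
    show ?thesis
    proof (rule K7v_minorI[of E D "{mu a1, mu a2}" "{mu a3, mu a4}" "{a1}" "{a2}" "{a3}" "{a4}"])
      show "conn_set E {mu a1, mu a2}" "conn_set E {mu a3, mu a4}" using conn_set_pair[OF s] bb d by simp_all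
      show "D \<union> {mu a1, mu a2} \<union> {mu a3, mu a4} \<union> {a1} \<union> {a2} \<union> {a3} \<union> {a4} \<subseteq> V" using D X aX bX by auto
      show "D \<inter> ({mu a1, mu a2} \<union> {mu a3, mu a4} \<union> {a1} \<union> {a2} \<union> {a3} \<union> {a4}) = {}"
        using DX[OF aX(1)] DX[OF aX(2)] DX[OF aX(3)] DX[OF aX(4)] DX[OF bX(1)] DX[OF bX(2)] DX[OF bX(3)] DX[OF bX(4)] by simp
      show "{mu a1, mu a2} \<inter> ({mu a3, mu a4} \<union> {a1} \<union> {a2} \<union> {a3} \<union> {a4}) = {}"
        "{mu a3, mu a4} \<inter> ({a1} \<union> {a2} \<union> {a3} \<union> {a4}) = {}" using bd n[of a1] n[of a2] n[of a3] n[of a4] by simp_all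
      show "{a1} \<inter> ({a2} \<union> {a3} \<union> {a4}) = {}" "{a2} \<inter> ({a3} \<union> {a4}) = {}" "{a3} \<inter> {a4} = {}" using d by simp_all
      show "touches E {mu a1, mu a2} {mu a3, mu a4}" using b13 by (simp add: touches_def)
      show "touches E {mu a1, mu a2} {a1}" "touches E {mu a1, mu a2} {a2}" "touches E {mu a1, mu a2} {a3}" "touches E {mu a1, mu a2} {a4}"
        "touches E {mu a3, mu a4} {a1}" "touches E {mu a3, mu a4} {a2}" "touches E {mu a3, mu a4} {a3}" "touches E {mu a3, mu a4} {a4}"
        "touches E {a1} {a2}" "touches E {a1} {a3}" "touches E {a1} {a4}" "touches E {a2} {a3}" "touches E {a2} {a4}" "touches E {a3} {a4}"
        using all aall by (simp_all add: touches_def)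
    qed (use s D tD in simp_all)
  qed
qed

section \<open>A vertex of degree four\<close>

lemma nbh_small_set:
  assumes G: "ugraph V E" and k: "k_conn 4 V E" and V: "9 \<le> card V" and C: "C \<subseteq> V" "C \<noteq> {}" "card C \<le> 2"
  shows "4 \<le> card (nbh E C)"
proof (cases "C \<union> nbh E C = V")
  case True
  then have "9 \<le> card C + card (nbh E C)" using V card_Un_le[of C "nbh E C"] by simp
  then show ?thesis using C(3) by simp
next
  case False
  then show ?thesis using k_connD[OF k C(1,2)] by blast
qed

lemma nbh_single: "ugraph V E \<Longrightarrow> nbh E {u} = {y. E u y}"
  using ugraph_in by (fastforce simp: nbh_def)

text \<open>Contraction lowers the degree of a third vertex only if it sees both ends, and then by one.\<close>
lemma degree_three_contract:
  assumes G: "ugraph V E" and k: "k_conn 4 V E" and V: "9 \<le> card V" and vt: "E v t"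
    and c3: "card {y. contract t v E u y} = 3"
  shows "u \<noteq> v \<and> u \<noteq> t \<and> E u v \<and> E u t \<and> dg E u = 4"
proof -
  let ?H = "contract t v E"
  have tv: "E t v" using ugraph_sym[OF G vt] .
  have vtV: "v \<in> V" "t \<in> V" "v \<noteq> t" using ugraph_in[OF G vt] by auto
  have GH: "ugraph (V - {v}) ?H" by (rule ugraph_contract[OF G tv])
  have "{y. ?H u y} \<noteq> {}" using c3 by (metis card.empty zero_neq_numeral)
  then obtain y where "?H u y" by blast
  then have uV: "u \<in> V" "u \<noteq> v" using ugraph_in[OF GH] by blast+
  have d4: "4 \<le> dg E u" using nbh_small_set[OF G k V, of "{u}"] uV by (simp add: nbh_single[OF G] dg_def)
  have ut: "u \<noteq> t"
  proof
    assume "u = t"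
    have "nbh ?H {t} = nbh E (insert v {t})" by (rule nbh_contract_in[OF G tv]) (use vtV in auto)
    moreover have "4 \<le> card (nbh E (insert v {t}))" by (rule nbh_small_set[OF G k V]) (use vtV in auto)
    ultimately have "4 \<le> card {y. ?H t y}" using nbh_single[OF GH, of t] by simp
    then show False using c3 \<open>u = t\<close> by simp
  qed
  have eq: "{y. ?H u y} = (if E u v then insert t ({y. E u y} - {v}) else {y. E u y})"
    using ut uV vtV ugraph_in[OF G] by (auto simp: contract_def)
  have fin: "finite {y. E u y}" by (rule finite_edges_at[OF G])
  have uv: "E u v"
  proof (rule ccontr)
    assume "\<not> E u v"
    then show False using eq c3 d4 by (simp add: dg_def)
  qed
  have c: "card ({y. E u y} - {v}) = dg E u - 1" using uv fin by (simp add: dg_def)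
  have "E u t"
  proof (rule ccontr)
    assume "\<not> E u t"
    then have "card {y. ?H u y} = Suc (dg E u - 1)" using eq uv fin c by simp
    then show False using c3 d4 by simp
  qed
  then have "insert t ({y. E u y} - {v}) = {y. E u y} - {v}" using vtV(3) by blast
  then have "dg E u = 4" using eq uv c c3 d4 by simp
  then show ?thesis using uV ut uv \<open>E u t\<close> by blast
qed

text \<open>
  If the contraction of \<open>v t\<close> leaves a vertex \<open>u\<close> with three pairwise nonadjacent neighbours, then \<open>u\<close> itself has degree four
  and the edge from \<open>u\<close> to one of them is in no triangle, so contracting this edge creates no vertex of degree three.
\<close>
lemma good_contraction:
  assumes G: "ugraph V E" and k: "k_conn 4 V E" and V: "9 \<le> card V" and v0: "dg E v0 = 4"
  shows "\<exists>v t. dg E v = 4 \<and> E v t \<and> admissible (contract t v E)"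
proof -
  have "{y. E v0 y} \<noteq> {}" using v0 unfolding dg_def by (metis card.empty zero_neq_numeral)
  then obtain t0 where vt: "E v0 t0" by blast
  let ?H = "contract t0 v0 E"
  show ?thesis
  proof (cases "admissible ?H")
    case True
    then show ?thesis using v0 vt by blast
  next
    case False
    then obtain u where c3: "card {y. ?H u y} = 3" and no: "\<And>x y. ?H u x \<Longrightarrow> ?H u y \<Longrightarrow> \<not> ?H x y"
      unfolding admissible_def by blast
    have u: "u \<noteq> v0" "u \<noteq> t0" "E u v0" "E u t0" "dg E u = 4" using degree_three_contract[OF G k V vt c3] by auto
    have ne: "v0 \<noteq> t0" using ugraph_in[OF G vt] by blast
    have fin: "finite {y. E u y}" by (rule finite_edges_at[OF G])
    have "card ({y. E u y} - {v0, t0}) = 2" using card_Diff_subset[of "{v0, t0}" "{y. E u y}"] u ne by (simp add: dg_def)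
    then obtain p q where pq: "{y. E u y} - {v0, t0} = {p, q}" "p \<noteq> q" by (auto simp: card_2_iff)
    then have pq': "E u p" "E u q" "p \<notin> {v0, t0}" "q \<notin> {v0, t0}" by blast+
    have N: "w \<in> {v0, t0, p, q}" if "E u w" for w using pq(1) that by blast
    have H: "?H u p" "?H u q" "?H u t0" using u pq' ne ugraph_in[OF G] by (auto simp: contract_def)
    have "\<not> ?H t0 p" "\<not> ?H p q" "\<not> ?H q p" using no H by blast+
    then have n: "\<not> E t0 p" "\<not> E v0 p" "\<not> E q p" using pq' pq(2) ne by (auto simp: contract_def)
    have "admissible (contract p u E)"
      unfolding admissible_def
    proof (intro allI impI)
      fix w assume c: "card {y. contract p u E w y} = 3"
      have w: "E w u" "E w p" "w \<noteq> p" using degree_three_contract[OF G k V pq'(1) c] by auto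
      then have "w \<in> {v0, t0, p, q}" using N ugraph_sym[OF G] by blast
      then have False using w n by blast
      then show "\<exists>x y. contract p u E w x \<and> contract p u E w y \<and> contract p u E x y" ..
    qed
    then show ?thesis using u(5) pq'(1) by blast
  qed
qed

lemma rooted_clique_four:
  assumes s: "symp E" and d: "distinct [a, b, c, d]"
    and m: "a \<in> A" "b \<in> B" "c \<in> C" "d \<in> D" "A \<subseteq> W" "B \<subseteq> W" "C \<subseteq> W" "D \<subseteq> W"
    and conn: "conn_set E A" "conn_set E B" "conn_set E C" "conn_set E D"
    and dis: "A \<inter> B = {}" "A \<inter> C = {}" "A \<inter> D = {}" "B \<inter> C = {}" "B \<inter> D = {}" "C \<inter> D = {}"
    and t: "touches E A B" "touches E A C" "touches E A D" "touches E B C" "touches E B D" "touches E C D"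
  shows "rooted_clique E W {a, b, c, d} (\<lambda>z. if z = a then A else if z = b then B else if z = c then C else D)"
proof -
  have t': "touches E B A" "touches E C A" "touches E D A" "touches E C B" "touches E D B" "touches E D C"
    using t touches_sym[OF s] by blast+
  have dis': "B \<inter> A = {}" "C \<inter> A = {}" "D \<inter> A = {}" "C \<inter> B = {}" "D \<inter> B = {}" "D \<inter> C = {}" using dis by blast+
  have d': "a \<noteq> b" "a \<noteq> c" "a \<noteq> d" "b \<noteq> c" "b \<noteq> d" "c \<noteq> d" "b \<noteq> a" "c \<noteq> a" "d \<noteq> a" "c \<noteq> b" "d \<noteq> b" "d \<noteq> c"
    using d by auto
  show ?thesis unfolding rooted_clique_def using d' m conn dis dis' t t' by simp
qed

locale degree_four =
  fixes V :: "'a set" and E v t X \<D>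
  assumes IH: "holds_below TYPE('a) (card V)"
    and G: "ugraph V E" and k4: "k_conn 4 V E" and dense: "dense V E" and noK: "\<not> K7v_minor V E"
    and V9: "9 \<le> card V" and dv: "dg E v = 4" and vt: "E v t"
    and P: "piece (V - {v}) (contract t v E) X \<D>"
begin

abbreviation "H \<equiv> contract t v E"
abbreviation "F \<equiv> torso H X \<D>"
definition "R = V - X - {v}"
abbreviation "K u \<equiv> component E R u"

lemma s: "symp E" by (rule ugraph_symp[OF G])
lemma es: "E x y \<Longrightarrow> E y x" using ugraph_sym[OF G] by blast
lemma finV: "finite V" by (rule ugraph_finite[OF G])
lemma tv: "E t v" using es[OF vt] .
lemma vtV: "v \<in> V" "t \<in> V" "v \<noteq> t" using ugraph_in[OF G vt] by auto

lemma pieceD: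
  shows XV: "X \<subseteq> V" and vX: "v \<notin> X" and co: "cocktail X F" and DU: "\<Union>\<D> = V - {v} - X"
    and Dn: "D \<in> \<D> \<Longrightarrow> nbh H D \<subseteq> X" "D \<in> \<D> \<Longrightarrow> card (nbh H D) \<le> 3"
  using P by (auto simp: piece_def)

lemma GF: "ugraph X F" and cX: "card X = 8" using co by (auto simp: cocktail_def)
lemma finX: "finite X" by (rule ugraph_finite[OF GF])
lemma RV: "R \<subseteq> V" "R \<inter> X = {}" "v \<notin> R" by (auto simp: R_def)
lemma VU: "V = X \<union> R \<union> {v}" using XV vtV by (auto simp: R_def)
lemma DR: "D \<in> \<D> \<Longrightarrow> D \<subseteq> R" using DU by (auto simp: R_def)

text \<open>If \<open>t\<close> lay beyond the piece, then at most three vertices of \<open>X\<close> would cut it off, together with \<open>v\<close>.\<close>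
lemma tX: "t \<in> X"
proof (rule ccontr)
  assume "t \<notin> X"
  then have "t \<in> \<Union>\<D>" using DU vtV by blast
  then obtain D where D: "D \<in> \<D>" "t \<in> D" by blast
  have vD: "v \<notin> D" using DR[OF D(1)] RV by blast
  have eq: "nbh H D = nbh E (insert v D)" by (rule nbh_contract_in[OF G tv D(2) vD])
  have DV: "insert v D \<subseteq> V" using DR[OF D(1)] RV vtV by blast
  have "insert v D \<union> nbh E (insert v D) \<noteq> V"
  proof
    assume "insert v D \<union> nbh E (insert v D) = V"
    then have "X \<subseteq> nbh H D" using XV vX DR[OF D(1)] RV eq by blast
    then have "card X \<le> card (nbh H D)" using finite_nbh[OF G, of "insert v D"] eq by (intro card_mono) auto
    then show False using Dn(2)[OF D(1)] cX by simp
  qed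
  then have "4 \<le> card (nbh E (insert v D))" using k_connD[OF k4 DV] by blast
  then show False using Dn(2)[OF D(1)] eq by simp
qed

lemma comp_props:
  assumes "u \<in> R"
  shows "conn_set E (K u)" "u \<in> K u" "K u \<subseteq> R" "nbh E (K u) \<inter> R = {}" "nbh E (K u) \<subseteq> insert v X"
  using component_props[OF s assms] nbh_subset[OF G, of "K u"] VU by auto

lemma comp_eq:
  assumes "u \<in> R" "w \<in> K u"
  shows "K w = K u"
proof -
  have w: "w \<in> R" using comp_props[OF assms(1)] assms(2) by blast
  have "K w \<subseteq> K u" using conn_set_absorb[OF comp_props(1,3)[OF w], of "K u"] comp_props[OF w] comp_props[OF assms(1)] assms(2) by blast
  moreover have "K u \<subseteq> K w" using conn_set_absorb[OF comp_props(1,3)[OF assms(1)], of "K w"] comp_props[OF w] assms(2) by blast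
  ultimately show ?thesis by blast
qed

text \<open>By 4-connectivity the contraction must merge two boundary vertices of each component.\<close>
lemma comp_boundary:
  assumes D: "D \<in> \<D>" "u \<in> D"
  shows "nbh E (K u) = insert v (nbh H D)" "t \<in> nbh H D" "card (nbh H D) = 3"
proof -
  have u: "u \<in> R" using DR D by blast
  note C = comp_props[OF u]
  have tD: "t \<notin> D" "v \<notin> D" using DR[OF D(1)] RV tX by blast+
  have eq: "nbh H D = (if v \<in> nbh E D then insert t (nbh E D - {v}) else nbh E D)"
    by (rule nbh_contract_out[OF G tv tD])
  have sub: "nbh E D \<subseteq> insert v (nbh H D)" using eq by auto
  then have nR: "nbh E D \<inter> R = {}" using Dn(1)[OF D(1)] RV by blast
  have KD: "K u \<subseteq> D" by (rule conn_set_absorb[OF C(1,3) _ nR]) (use C(2) D(2) in blast)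
  have KN: "nbh E (K u) \<subseteq> nbh E D"
  proof
    fix y assume y: "y \<in> nbh E (K u)"
    then have "y \<notin> D" using C(4) DR[OF D(1)] by blast
    then show "y \<in> nbh E D" using y KD by (auto simp: nbh_def)
  qed
  have finH: "finite (nbh H D)" using Dn(1)[OF D(1)] finX finite_subset by blast
  have c4: "card (nbh E D) \<le> 4"
  proof -
    have "card (nbh E D) \<le> card (insert v (nbh H D))" by (rule card_mono[OF _ sub]) (use finH in simp)
    also have "\<dots> \<le> Suc (card (nbh H D))" using finH by (simp add: card_insert_if)
    finally show ?thesis using Dn(2)[OF D(1)] by simp
  qed
  have "4 \<le> card (nbh E (K u))"
  proof (rule k_connD[OF k4])
    show "K u \<subseteq> V" "K u \<noteq> {}" using C RV by auto
    have "\<not> X \<subseteq> nbh E (K u)"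
    proof
      assume "X \<subseteq> nbh E (K u)"
      then have "X \<subseteq> nbh E D" using KN by blast
      then have "card X \<le> card (nbh E D)" by (rule card_mono[OF finite_nbh[OF G]])
      then show False using c4 cX by simp
    qed
    then show "K u \<union> nbh E (K u) \<noteq> V" using XV C(3) RV by blast
  qed
  then have Keq: "nbh E (K u) = nbh E D" using card_seteq[OF finite_nbh[OF G] KN] c4 by simp
  then have d4: "card (nbh E D) = 4" using \<open>4 \<le> card (nbh E (K u))\<close> c4 by simp
  have vn: "v \<in> nbh E D"
  proof (rule ccontr)
    assume "v \<notin> nbh E D"
    then show False using eq d4 Dn(2)[OF D(1)] by simp
  qed
  have h: "nbh E D - {v} \<subseteq> nbh H D" using eq vn by auto
  have "card (nbh E D - {v}) = 3" using d4 vn finite_nbh[OF G] by simp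
  then have h': "nbh E D - {v} = nbh H D" using card_seteq[OF finH h] Dn(2)[OF D(1)] by simp
  then show "nbh E (K u) = insert v (nbh H D)" using Keq vn by blast
  show "t \<in> nbh H D" using eq vn by simp
  show "card (nbh H D) = 3" using h' \<open>card (nbh E D - {v}) = 3\<close> by simp
qed

lemma comp_boundary_ex:
  assumes "u \<in> R"
  shows "\<exists>A. nbh E (K u) = insert v A \<and> A \<subseteq> X \<and> t \<in> A \<and> card A = 3 \<and> (\<forall>x\<in>A. \<forall>y\<in>A. x \<noteq> y \<longrightarrow> F x y)"
proof -
  have "u \<in> \<Union>\<D>" using assms DU by (auto simp: R_def)
  then obtain D where D: "D \<in> \<D>" "u \<in> D" by blast
  have "\<forall>x\<in>nbh H D. \<forall>y\<in>nbh H D. x \<noteq> y \<longrightarrow> F x y" using Dn(1)[OF D(1)] D(1) by (auto simp: torso_def)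
  then show ?thesis using comp_boundary[OF D] Dn(1)[OF D(1)] by blast
qed

lemma torso_edge:
  assumes "F x y" "x \<noteq> t" "y \<noteq> t"
  shows "E x y \<or> (\<exists>u\<in>R. x \<in> nbh E (K u) \<and> y \<in> nbh E (K u))"
proof -
  have xy: "x \<in> X" "y \<in> X" "H x y \<or> (\<exists>D\<in>\<D>. x \<in> nbh H D \<and> y \<in> nbh H D)" using assms(1) by (auto simp: torso_def)
  show ?thesis
  proof (cases "H x y")
    case True
    then show ?thesis using assms(2,3) by (auto simp: contract_def)
  next
    case False
    then obtain D where D: "D \<in> \<D>" "x \<in> nbh H D" "y \<in> nbh H D" using xy by blast
    then obtain u where u: "u \<in> D" by (auto simp: nbh_def)
    then show ?thesis using comp_boundary(1)[OF D(1) u] D DR by blast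
  qed
qed

lemma torso_edge_t:
  assumes "F t y"
  shows "E t y \<or> E v y \<or> (\<exists>u\<in>R. y \<in> nbh E (K u))"
proof -
  have y: "H t y \<or> (\<exists>D\<in>\<D>. y \<in> nbh H D)" using assms by (auto simp: torso_def)
  show ?thesis
  proof (cases "H t y")
    case True
    then show ?thesis by (auto simp: contract_def)
  next
    case False
    then obtain D where D: "D \<in> \<D>" "y \<in> nbh H D" using y by blast
    then obtain u where u: "u \<in> D" by (auto simp: nbh_def)
    then show ?thesis using comp_boundary(1)[OF D(1) u] D DR by blast
  qed
qed

lemma E_torso: "E x y \<Longrightarrow> x \<in> X \<Longrightarrow> y \<in> X \<Longrightarrow> F x y"
  using vX ugraph_in[OF G, of x y] by (auto simp: torso_def contract_def)

text \<open>
  If all components were light, then there would be so few edges outside \<open>X\<close> that the torso consists of edges of the graph,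
  and the rest of the graph, which is connected through \<open>v\<close>, would attach to at least four vertices of it.
\<close>
lemma heavy_component:
  "\<exists>u\<in>R. 8 * card (K u) + 1 \<le> arcs_between E (K u) (K u) + 2 * arcs_between E (K u) X"
proof (rule ccontr)
  assume "\<not> ?thesis"
  then have light: "arcs_between E (K u) (K u) + 2 * arcs_between E (K u) X \<le> 8 * card (K u)" if "u \<in> R" for u
    using that by fastforce
  have finR: "finite R" using RV finV finite_subset by blast
  define g where "g = (\<lambda>u. card {y \<in> R. E u y} + 2 * card {y \<in> X. E u y})"
  define \<K> where "\<K> = K ` R"
  have Kf: "\<forall>A\<in>\<K>. finite A" using comp_props(3) finR finite_subset unfolding \<K>_def by blast
  have Kd: "\<forall>A\<in>\<K>. \<forall>B\<in>\<K>. A \<noteq> B \<longrightarrow> A \<inter> B = {}"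
  proof (intro ballI impI, rule ccontr)
    fix A B assume "A \<in> \<K>" "B \<in> \<K>" and ne: "A \<noteq> B" "A \<inter> B \<noteq> {}"
    then obtain u w z where "u \<in> R" "w \<in> R" "A = K u" "B = K w" "z \<in> K u" "z \<in> K w" unfolding \<K>_def by blast
    then show False using comp_eq ne by metis
  qed
  have KU: "\<Union>\<K> = R" using comp_props(2,3) unfolding \<K>_def by blast
  have one: "sum g A \<le> sum (\<lambda>_. 8) A" if AK: "A \<in> \<K>" for A
  proof -
    obtain u where u: "u \<in> R" "A = K u" using AK by (auto simp: \<K>_def)
    note C = comp_props[OF u(1)]
    have "sum g A = arcs_between E A R + 2 * arcs_between E A X"
      using finR finX by (simp add: g_def arcs_between_eq_sum_card sum.distrib sum_distrib_left)
    moreover have "arcs_between E A R = arcs_between E A A + arcs_between E A (R - A)"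
    proof -
      have "A \<union> (R - A) = R" using C(3) u by blast
      then show ?thesis using arcs_between_Un_right[of A "R - A" E A] finR C(3) u finite_subset by fastforce
    qed
    moreover have "arcs_between E A (R - A) = 0"
      by (rule arcs_between_eq_0) (use C(4) u in \<open>auto simp: nbh_def\<close>)
    ultimately show ?thesis using light[OF u(1)] u by simp
  qed
  have "sum g R = sum (sum g) \<K>" using sum.Union_disjoint[OF Kf Kd, of g] KU by simp
  also have "\<dots> \<le> sum (sum (\<lambda>_. 8)) \<K>" by (rule sum_mono) (rule one)
  also have "\<dots> = sum (\<lambda>_. 8) R" using sum.Union_disjoint[OF Kf Kd, of "\<lambda>_. 8::nat"] KU by simp
  finally have "sum g R \<le> 8 * card R" by simp
  moreover have "sum g R = arcs_between E R R + 2 * arcs_between E R X"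
    using finR finX by (simp add: g_def arcs_between_eq_sum_card sum.distrib sum_distrib_left)
  ultimately have RR: "arcs_between E R R + 2 * arcs_between E R X \<le> 8 * card R" by simp
  have "arcs_between E V V = arcs_between E (X \<union> R) (X \<union> R) + 2 * arcs_between E (X \<union> R) {v} + arcs_between E {v} {v}"
    by (subst (1 2) VU, rule arcs_between_split[OF s]) (use finR finX vX RV in auto)
  moreover have "arcs_between E (X \<union> R) (X \<union> R) = arcs_between E X X + 2 * arcs_between E X R + arcs_between E R R"
    by (rule arcs_between_split[OF s finX finR]) (use RV in blast)
  moreover have "arcs_between E X R = arcs_between E R X" by (rule arcs_between_sym[OF s])
  moreover have "arcs_between E {v} {v} = 0" using ugraph_in[OF G, of v v] by (auto simp: arcs_between_def)
  moreover have "arcs_between E (X \<union> R) {v} = 4"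
  proof -
    have "arcs_between E (X \<union> R) {v} = arcs_between E {v} (X \<union> R)" by (rule arcs_between_sym[OF s])
    also have "\<dots> = card {y \<in> X \<union> R. E v y}" using finX finR by (simp add: arcs_between_eq_sum_card)
    also have "{y \<in> X \<union> R. E v y} = {y. E v y}" using VU ugraph_in[OF G] by blast
    finally show ?thesis using dv by (simp add: dg_def)
  qed
  moreover have "card V = card R + 9"
  proof -
    have "card (X \<union> R) = card X + card R" by (rule card_Un_disjoint[OF finX finR]) (use RV in blast)
    then have "card (insert v (X \<union> R)) = card R + 9" using cX finX finR vX RV by simp
    then show ?thesis using VU by simp
  qed
  ultimately have XX: "48 \<le> arcs_between E X X" using RR dense by (simp add: dense_def)
  have FE: "E x y" if "F x y" for x y
  proof -
    let ?P = "\<lambda>E. {(a, b). a \<in> X \<and> b \<in> X \<and> E a b}"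
    have sub: "?P E \<subseteq> ?P F" using E_torso by blast
    have "finite (?P F)" by (rule finite_subset[of _ "X \<times> X"]) (use finX in auto)
    moreover have "card (?P F) = 48" using arcs_between_eq_card[OF finX finX, of F] cocktail_arcs[OF co] by simp
    moreover have "48 \<le> card (?P E)" using arcs_between_eq_card[OF finX finX, of E] XX by simp
    ultimately have "?P E = ?P F" using card_seteq[OF _ sub] by simp
    moreover have "x \<in> X" "y \<in> X" using ugraph_in[OF GF that] by auto
    ultimately show ?thesis using that by blast
  qed
  have vVX: "v \<in> V - X" using vtV vX by blast
  define D where "D = component E (V - X) v"
  note D = component_props[OF s vVX, folded D_def]
  have nX: "nbh E D \<subseteq> X" using nbh_component[OF G vVX] by (simp add: D_def)
  have "4 \<le> card (nbh E D)"
  proof (cases "D \<union> nbh E D = V")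
    case True
    then have "X \<subseteq> nbh E D" using XV D(3) by blast
    then have "card X \<le> card (nbh E D)" by (rule card_mono[OF finite_nbh[OF G]])
    then show ?thesis using cX by simp
  next
    case False
    then show ?thesis using k_connD[OF k4, of D] D(2,3) by blast
  qed
  then show False
    using cocktail_attach[OF G XV co FE D(1,3) nX] touches_nbh[OF s] noK by blast
qed

text \<open>
  For a heavy component with boundary \<open>{v, t, p, q}\<close> the other side supplies a rooted clique: every other component is
  contracted to one of its attachments, after which \<open>t\<close> misses at most two of its neighbours in the torso, because
  each of them is paid by an edge at \<open>v\<close>.
\<close>
lemma clique_supply:
  assumes u0: "u0 \<in> R" and T: "nbh E (K u0) = {v, t, p, q}" and d4: "distinct [v, t, p, q]"
    and pqX: "p \<in> X" "q \<in> X" and tri: "F t p" "F t q" "F p q"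
  shows "\<exists>L. rooted_clique E (V - K u0) {v, t, p, q} L"
proof -
  let ?K = "K u0" and ?T = "{v, t, p, q}"
  note C0 = comp_props[OF u0]
  have ne: "p \<noteq> t" "q \<noteq> t" "p \<noteq> q" "p \<noteq> v" "q \<noteq> v" "t \<noteq> v" using d4 by auto
  have finR: "finite R" using RV finV finite_subset by blast
  obtain mu where mu: "\<And>x. x \<in> X \<Longrightarrow> mu x \<in> X \<and> mu x \<noteq> x \<and> \<not> F x (mu x) \<and> (\<forall>y\<in>X. y \<noteq> x \<longrightarrow> y \<noteq> mu x \<longrightarrow> F x y)"
    using cocktail_unique_nonneighbour[OF co] by metis
  have Fs: "F x y \<Longrightarrow> F y x" for x y using ugraph_sym[OF GF] by blast
  have inv: "mu (mu x) = x" if "x \<in> X" for x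
  proof (rule ccontr)
    assume "mu (mu x) \<noteq> x"
    then have "F (mu x) x" using mu[OF that] mu[of "mu x"] that by metis
    then show False using mu[OF that] Fs by blast
  qed
  have Fe: "F x y" if "x \<in> X" "y \<in> X" "y \<noteq> x" "y \<noteq> mu x" for x y using mu[OF that(1)] that(2-4) by simp
  define R' where "R' = R - ?K"
  have KR': "K z \<subseteq> R'" if z: "z \<in> R'" for z
  proof -
    have zR: "z \<in> R" "z \<notin> ?K" using z by (auto simp: R'_def)
    have "K z \<inter> ?K = {}" using comp_eq[OF zR(1)] comp_eq[OF u0] comp_props(2)[OF zR(1)] zR(2) by blast
    then show ?thesis using comp_props(3)[OF zR(1)] by (auto simp: R'_def)
  qed
  \<comment> \<open>The component \<open>J\<close> will join its attachment \<open>c\<close>, which is chosen outside \<open>{p, q}\<close> if possible.\<close>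
  have "\<forall>J\<in>K ` R'. \<exists>c w. nbh E J = {v, t, c, w} \<and> c \<noteq> w \<and> c \<in> X \<and> w \<in> X \<and> c \<noteq> t \<and> w \<noteq> t \<and> (nbh E J \<noteq> ?T \<longrightarrow> c \<noteq> p \<and> c \<noteq> q)"
  proof
    fix J assume "J \<in> K ` R'"
    then obtain u where u: "u \<in> R" "J = K u" by (auto simp: R'_def)
    obtain A where A: "nbh E J = insert v A" "A \<subseteq> X" "t \<in> A" "card A = 3" using comp_boundary_ex[OF u(1)] u(2) by blast
    have "finite A" using A(2) finX finite_subset by blast
    then have "card (A - {t}) = 2" using A(3,4) by simp
    then obtain c w where cw: "A - {t} = {c, w}" "c \<noteq> w" by (auto simp: card_2_iff)
    then have m: "c \<in> A" "w \<in> A" "c \<noteq> t" "w \<noteq> t" by auto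
    have N: "nbh E J = {v, t, c, w}" "nbh E J = {v, t, w, c}" using A(1,3) cw by auto
    have cX': "c \<in> X" "w \<in> X" using m A(2) by auto
    show "\<exists>c w. nbh E J = {v, t, c, w} \<and> c \<noteq> w \<and> c \<in> X \<and> w \<in> X \<and> c \<noteq> t \<and> w \<noteq> t \<and> (nbh E J \<noteq> ?T \<longrightarrow> c \<noteq> p \<and> c \<noteq> q)"
    proof (cases "nbh E J \<noteq> ?T \<and> (c = p \<or> c = q)")
      case True
      then have "w \<noteq> p \<and> w \<noteq> q" using N cw(2) by auto
      then show ?thesis using N(2) cw(2) m cX' by metis
    next
      case False
      then show ?thesis using N(1) cw(2) m cX' by metis
    qed
  qed
  then obtain cc oo where co': "\<And>J. J \<in> K ` R' \<Longrightarrow> nbh E J = {v, t, cc J, oo J} \<and> cc J \<noteq> oo J \<and> cc J \<in> X \<and> oo J \<in> X \<and>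
      cc J \<noteq> t \<and> oo J \<noteq> t \<and> (nbh E J \<noteq> ?T \<longrightarrow> cc J \<noteq> p \<and> cc J \<noteq> q)" by metis
  have J: "nbh E (K z) = {v, t, cc (K z), oo (K z)}" "cc (K z) \<noteq> oo (K z)" "cc (K z) \<in> X" "oo (K z) \<in> X"
    "cc (K z) \<noteq> t" "oo (K z) \<noteq> t" "nbh E (K z) \<noteq> ?T \<Longrightarrow> cc (K z) \<noteq> p \<and> cc (K z) \<noteq> q" if "z \<in> R'" for z
    using co'[OF imageI[OF that]] by blast+
  define bag where "bag = (\<lambda>x. insert x {z \<in> R'. cc (K z) = x})"
  have R'V: "R' \<subseteq> V" "R' \<inter> X = {}" "R' \<inter> ?K = {}" "v \<notin> R'" "R' \<subseteq> R" using RV by (auto simp: R'_def)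
  have bagK: "K z \<subseteq> bag (cc (K z))" if z: "z \<in> R'" for z
  proof
    fix w assume w: "w \<in> K z"
    then have "w \<in> R'" "K w = K z" using KR'[OF z] comp_eq[OF _ w] z R'V(5) by blast+
    then show "w \<in> bag (cc (K z))" by (simp add: bag_def)
  qed
  have bagV: "bag x \<subseteq> V - ?K" "v \<notin> bag x" if "x \<in> X" for x
    using that XV C0(3) R'V RV vX by (auto simp: bag_def)
  have bagd: "bag x \<inter> bag y = {}" if "x \<in> X" "y \<in> X" "x \<noteq> y" for x y
    using that R'V(2) by (auto simp: bag_def)
  have bagt: "t \<notin> bag x" if "x \<noteq> t" for x using that tX R'V(2) by (auto simp: bag_def)
  have bagi: "x \<in> bag x" for x by (simp add: bag_def)
  have bagc: "conn_set E (bag x)" if x: "x \<in> X" for x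
  proof -
    let ?B = "insert {x} ((\<lambda>z. insert x (K z)) ` {z \<in> R'. cc (K z) = x})"
    have "\<Union>?B = bag x"
    proof
      show "\<Union>?B \<subseteq> bag x" using bagK bagi by fastforce
      show "bag x \<subseteq> \<Union>?B" using comp_props(2) R'V(5) by (fastforce simp: bag_def)
    qed
    moreover have "conn_set E (\<Union>?B)"
    proof (rule conn_set_Union[OF s, of _ x])
      fix S assume "S \<in> ?B"
      then consider "S = {x}" | z where "z \<in> R'" "cc (K z) = x" "S = insert x (K z)" by blast
      then show "conn_set E S \<and> x \<in> S"
      proof cases
        case 2
        have "x \<in> nbh E (K z)" using J(1)[OF 2(1)] 2(2) by simp
        then obtain y where "y \<in> K z" "E y x" by (auto simp: nbh_def)
        then have "conn_set E (insert x (K z))" using conn_set_insert[OF s comp_props(1)] 2(1) R'V(5) by blast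
        then show ?thesis using 2(3) by simp
      qed simp
    qed simp
    ultimately show ?thesis by simp
  qed
  have tK: "touches E (K z) {y}" "touches E {y} (K z)" if "y \<in> nbh E (K z)" for y z using touches_nbh[OF s that] by auto
  have tb: "touches E (bag x) (bag y)" if xy: "F x y" "x \<noteq> t" "y \<noteq> t" "{x, y} \<noteq> {p, q}" for x y
  proof -
    have ne': "x \<noteq> y" "x \<in> X" "y \<in> X" using ugraph_in[OF GF xy(1)] by auto
    from torso_edge[OF xy(1-3)] show ?thesis
    proof
      assume "E x y"
      then show ?thesis using bagi by (auto simp: touches_def)
    next
      assume "\<exists>u\<in>R. x \<in> nbh E (K u) \<and> y \<in> nbh E (K u)"
      then obtain u where u: "u \<in> R" "x \<in> nbh E (K u)" "y \<in> nbh E (K u)" by blast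
      have "u \<notin> ?K"
      proof
        assume "u \<in> ?K"
        then have "x \<in> ?T" "y \<in> ?T" using u(2,3) comp_eq[OF u0] T by auto
        then show False using xy(2-4) ne' vX by auto
      qed
      then have uR: "u \<in> R'" using u(1) by (simp add: R'_def)
      have "{x, y} \<subseteq> {cc (K u), oo (K u)}" using u(2,3) J(1)[OF uR] xy(2,3) ne' vX by auto
      then have "x = cc (K u) \<or> y = cc (K u)" using ne'(1) by auto
      then show ?thesis
      proof
        assume "x = cc (K u)"
        then show ?thesis using touches_mono[OF tK(1)[OF u(3)] bagK[OF uR], of "bag y"] bagi[of y] by simp
      next
        assume "y = cc (K u)"
        then show ?thesis using touches_mono[OF tK(2)[OF u(2)] _ bagK[OF uR], of "bag x"] bagi[of x] by simp
      qed
    qed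
  qed
  \<comment> \<open>The vertex \<open>v\<close> has a neighbour beyond the boundary, else \<open>t, p, q\<close> would be a 3-cut.\<close>
  obtain d where d: "d \<in> X" "d \<noteq> t" "d \<noteq> p" "d \<noteq> q" "touches E {v} (bag d)"
  proof -
    define W where "W = (X - {t, p, q}) \<union> {z \<in> R'. nbh E (K z) \<noteq> ?T}"
    have "\<exists>w\<in>W. E v w"
    proof (rule ccontr)
      assume no: "\<not> ?thesis"
      have sub: "nbh E W \<subseteq> {t, p, q}"
      proof
        fix y assume "y \<in> nbh E W"
        then obtain w where w: "w \<in> W" "E w y" "y \<notin> W" by (auto simp: nbh_def)
        have "y \<in> V" "y \<noteq> v" using ugraph_in[OF G w(2)] no w es by blast+
        moreover have False if yR: "y \<in> R"
        proof (cases "w \<in> X")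
          case True
          then have wT: "w \<notin> ?T" using w(1) vX R'V(2) by (auto simp: W_def)
          have "w \<in> nbh E (K y)" using comp_props(2,3)[OF yR] es[OF w(2)] True RV by (auto simp: nbh_def)
          then have nT: "nbh E (K y) \<noteq> ?T" using wT by auto
          then have "y \<notin> ?K" using comp_eq[OF u0, of y] T by auto
          then show False using nT w(3) yR by (auto simp: W_def R'_def)
        next
          case False
          then have wR: "w \<in> R'" "nbh E (K w) \<noteq> ?T" using w(1) by (auto simp: W_def)
          have "y \<in> K w"
          proof (rule ccontr)
            assume "y \<notin> K w"
            then have "y \<in> nbh E (K w)" using comp_props(2) wR(1) R'V(5) w(2) by (auto simp: nbh_def)
            then show False using comp_props(4)[of w] wR(1) R'V(5) yR by blast
          qed
          then have "y \<in> R'" "K y = K w" using KR'[OF wR(1)] comp_eq[of w y] wR(1) R'V(5) by blast+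
          then show False using w(3) wR(2) by (simp add: W_def)
        qed
        ultimately have "y \<in> X" using VU by blast
        then show "y \<in> {t, p, q}" using w(3) by (auto simp: W_def)
      qed
      have "\<not> X \<subseteq> {t, p, q}"
      proof
        assume "X \<subseteq> {t, p, q}"
        then have "card X \<le> card {t, p, q}" by (rule card_mono[rotated]) simp
        then show False using cX by (simp add: card_insert_if split: if_splits)
      qed
      then have W: "W \<noteq> {}" "W \<subseteq> V" using XV R'V by (auto simp: W_def)
      have "u0 \<notin> W \<union> nbh E W" using sub C0(2) R'V RV u0 pqX tX by (auto simp: W_def)
      then have "W \<union> nbh E W \<noteq> V" using u0 RV by blast
      then have "4 \<le> card (nbh E W)" using k_connD[OF k4 W(2,1)] by blast
      then have "4 \<le> card {t, p, q}" using card_mono[OF _ sub] by simp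
      then show False by (simp add: card_insert_if split: if_splits)
    qed
    then obtain w where w: "w \<in> W" "E v w" by blast
    show thesis
    proof (cases "w \<in> X")
      case True
      then have "w \<in> X - {t, p, q}" using w(1) R'V(2) by (auto simp: W_def)
      then show thesis using that[of w] w(2) bagi[of w] by (auto simp: touches_def)
    next
      case False
      then have wR: "w \<in> R'" "nbh E (K w) \<noteq> ?T" using w(1) by (auto simp: W_def)
      have "w \<in> bag (cc (K w))" using wR(1) by (simp add: bag_def)
      then show thesis using that[of "cc (K w)"] J(3,5,7)[OF wR(1)] wR(2) w(2) by (auto simp: touches_def)
    qed
  qed
  \<comment> \<open>A candidate that \<open>t\<close> fails to touch is a neighbour of \<open>v\<close>, or its component contains one, and only two are left.\<close>
  obtain x where x: "x \<in> X" "x \<noteq> t" "x \<noteq> p" "x \<noteq> q" "x \<noteq> d" "touches E {t} (bag x)"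
  proof -
    define A where "A = X - {t, p, q, mu t, d}"
    have A3: "3 \<le> card A"
    proof -
      have "card {t, p, q, mu t, d} \<le> 5" using card_length[of "[t, p, q, mu t, d]"] by simp
      then show ?thesis using diff_card_le_card_Diff[of "{t, p, q, mu t, d}" X] cX by (simp add: A_def)
    qed
    have finA: "finite A" using finX by (simp add: A_def)
    have "\<exists>x\<in>A. touches E {t} (bag x)"
    proof (rule ccontr)
      assume no: "\<not> ?thesis"
      have "\<forall>x\<in>A. \<exists>n. E v n \<and> n \<noteq> t \<and> n \<notin> ?K \<and> (n = x \<or> n \<in> R' \<and> oo (K n) = x)"
      proof
        fix x assume x: "x \<in> A"
        then have xX: "x \<in> X" "x \<noteq> t" "x \<noteq> p" "x \<noteq> q" "x \<noteq> mu t" by (auto simp: A_def)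
        have "F t x" by (rule Fe[OF tX xX(1,2,5)])
        moreover have "\<not> E t x" using no x bagi[of x] by (auto simp: touches_def)
        ultimately consider "E v x" | u where "u \<in> R" "x \<in> nbh E (K u)" using torso_edge_t by blast
        then show "\<exists>n. E v n \<and> n \<noteq> t \<and> n \<notin> ?K \<and> (n = x \<or> n \<in> R' \<and> oo (K n) = x)"
        proof cases
          case 1
          then show ?thesis using xX C0(3) RV by blast
        next
          case 2
          have "u \<notin> ?K"
          proof
            assume "u \<in> ?K"
            then have "x \<in> ?T" using 2(2) comp_eq[OF u0] T by auto
            then show False using xX vX by auto
          qed
          then have uR: "u \<in> R'" using 2(1) by (simp add: R'_def)
          have "x \<noteq> cc (K u)"
          proof
            assume xc: "x = cc (K u)"
            have "t \<in> nbh E (K u)" using J(1)[OF uR] by simp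
            then have "touches E {t} (K u)" by (rule tK(2))
            then have "touches E {t} (bag x)" using touches_mono[OF _ subset_refl bagK[OF uR]] xc by blast
            then show False using no x by blast
          qed
          then have xo: "oo (K u) = x" using 2(2) J(1)[OF uR] xX vX by auto
          have "v \<in> nbh E (K u)" using J(1)[OF uR] by simp
          then obtain n where n: "n \<in> K u" "E n v" by (auto simp: nbh_def)
          have nR: "n \<in> R'" "K n = K u" using KR'[OF uR] comp_eq[OF 2(1) n(1)] n(1) by auto
          have "E v n \<and> n \<noteq> t \<and> n \<notin> ?K \<and> (n \<in> R' \<and> oo (K n) = x)" using es[OF n(2)] nR xo tX R'V by auto
          then show ?thesis by blast
        qed
      qed
      then obtain f where f: "\<And>x. x \<in> A \<Longrightarrow> E v (f x) \<and> f x \<noteq> t \<and> f x \<notin> ?K \<and> (f x = x \<or> f x \<in> R' \<and> oo (K (f x)) = x)" by metis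
      have inj: "inj_on f A"
      proof
        fix x y assume xy: "x \<in> A" "y \<in> A" "f x = f y"
        have "x \<in> X" "y \<in> X" using xy by (auto simp: A_def)
        then show "x = y" using f[OF xy(1)] f[OF xy(2)] xy(3) R'V(2) by (metis IntI empty_iff)
      qed
      have "v \<in> nbh E ?K" using T by simp
      then obtain k where k: "k \<in> ?K" "E k v" by (auto simp: nbh_def)
      have kt: "k \<noteq> t" using k(1) C0(3) RV tX by blast
      have "f ` A \<subseteq> {y. E v y} - {t, k}" using f k(1) by blast
      moreover have "card ({y. E v y} - {t, k}) = 2"
        using card_Diff_subset[of "{t, k}" "{y. E v y}"] vt es[OF k(2)] kt dv by (simp add: dg_def)
      ultimately have "card (f ` A) \<le> 2" using card_mono[of "{y. E v y} - {t, k}" "f ` A"] finite_edges_at[OF G, of v] by simp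
      then show False using card_image[OF inj] A3 by simp
    qed
    then show thesis using that by (auto simp: A_def)
  qed
  \<comment> \<open>In the torso, the vertices of \<open>Ys\<close> see \<open>p\<close>, \<open>q\<close> and the two vertices that miss \<open>p\<close> or \<open>q\<close>.\<close>
  define Ys where "Ys = X - {t, p, q, mu p, mu q}"
  have Y3: "3 \<le> card Ys"
  proof -
    have "card {t, p, q, mu p, mu q} \<le> 5" using card_length[of "[t, p, q, mu p, mu q]"] by simp
    then show ?thesis using diff_card_le_card_Diff[of "{t, p, q, mu p, mu q}" X] cX by (simp add: Ys_def)
  qed
  have "\<not> Ys \<subseteq> {d, x}"
  proof
    assume "Ys \<subseteq> {d, x}"
    then have "card Ys \<le> card {d, x}" by (rule card_mono[rotated]) simp
    then show False using Y3 by (simp add: card_insert_if split: if_splits)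
  qed
  then obtain y1 where y1: "y1 \<in> Ys" "y1 \<noteq> d" "y1 \<noteq> x" by blast
  have yX: "y \<in> X" "y \<noteq> t" "y \<noteq> p" "y \<noteq> q" "y \<noteq> mu p" "y \<noteq> mu q" if "y \<in> Ys" for y using that by (auto simp: Ys_def)
  have reach: "touches E (bag e) (bag r \<union> bag y)"
    if e: "e \<in> X" "e \<noteq> t" "e \<noteq> p" "e \<noteq> q" "e \<noteq> y" and y: "y \<in> Ys" and r: "r \<in> {p, q}" for e y r
  proof -
    have rX: "r \<in> X" "r \<noteq> t" "e \<noteq> r" "y \<noteq> r" using r pqX ne e yX[OF y] by auto
    show ?thesis
    proof (cases "e = mu r")
      case False
      have "F r e" by (rule Fe) (use rX e False in auto)
      then have "touches E (bag e) (bag r)" using tb[OF Fs] e rX by (auto simp: doubleton_eq_iff)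
      then show ?thesis by (auto simp: touches_def)
    next
      case True
      then have "mu e = r" using inv rX(1) by simp
      then have "F e y" by (intro Fe) (use e yX[OF y] rX in auto)
      then have "touches E (bag e) (bag y)" using tb e yX[OF y] by (auto simp: doubleton_eq_iff)
      then show ?thesis by (auto simp: touches_def)
    qed
  qed
  have yr: "touches E (bag r) (bag y)" if y: "y \<in> Ys" and r: "r \<in> {p, q}" for y r
  proof -
    have "F r y" by (rule Fe) (use r pqX yX[OF y] in auto)
    then show ?thesis using tb r ne yX[OF y] by (auto simp: doubleton_eq_iff)
  qed
  have cu: "conn_set E (bag r \<union> bag y)" if y: "y \<in> Ys" and r: "r \<in> {p, q}" for y r
    by (rule conn_set_Un[OF s]) (use bagc r pqX yX[OF y] yr[OF y r] in auto)
  obtain Q where Q: "bag q \<subseteq> Q" "conn_set E Q" "Q \<subseteq> V - ?K" "v \<notin> Q" "t \<notin> Q"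
    "Q \<inter> bag d = {}" "Q \<inter> bag x = {}" "Q \<inter> bag p = {}" "Q \<inter> bag y1 = {}" "touches E (bag d) Q" "touches E (bag x) Q"
  proof (cases "Ys \<subseteq> {d, x, y1}")
    case True
    have "card {d, x, y1} \<le> 3" using card_length[of "[d, x, y1]"] by simp
    then have "Ys = {d, x, y1}" using card_seteq[OF _ True] Y3 by simp
    then have dx: "d \<in> Ys" "x \<in> Ys" by auto
    have "touches E (bag d) (bag q)" "touches E (bag x) (bag q)" using yr[OF dx(1)] yr[OF dx(2)] touches_sym[OF s] by blast+
    then show thesis
      using that[of "bag q"] bagc bagV bagt bagd pqX ne d x yX[OF y1(1)] by auto
  next
    case False
    then obtain y2 where y2: "y2 \<in> Ys" "y2 \<noteq> d" "y2 \<noteq> x" "y2 \<noteq> y1" by blast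
    show thesis
    proof (rule that[of "bag q \<union> bag y2"])
      show "conn_set E (bag q \<union> bag y2)" by (rule cu[OF y2(1)]) simp
      show "touches E (bag d) (bag q \<union> bag y2)" "touches E (bag x) (bag q \<union> bag y2)"
        using reach[of d y2 q] reach[of x y2 q] d x y2 by auto
      show "bag q \<union> bag y2 \<subseteq> V - ?K" "v \<notin> bag q \<union> bag y2" "t \<notin> bag q \<union> bag y2"
        using bagV bagt pqX ne yX[OF y2(1)] by auto
      have m: "q \<in> X" "y2 \<in> X" "d \<in> X" "x \<in> X" "p \<in> X" "y1 \<in> X" using pqX d x yX y1 y2 by auto
      show "(bag q \<union> bag y2) \<inter> bag d = {}" using bagd[OF m(1,3)] bagd[OF m(2,3)] d y2 by auto
      show "(bag q \<union> bag y2) \<inter> bag x = {}" using bagd[OF m(1,4)] bagd[OF m(2,4)] x y2 by auto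
      show "(bag q \<union> bag y2) \<inter> bag p = {}" using bagd[OF m(1,5)] bagd[OF m(2,5)] ne yX[OF y2(1)] by auto
      show "(bag q \<union> bag y2) \<inter> bag y1 = {}" using bagd[OF m(1,6)] bagd[OF m(2,6)] yX[OF y1(1)] y2 by auto
    qed simp
  qed
  have m: "d \<in> X" "x \<in> X" "p \<in> X" "y1 \<in> X" using pqX d x yX y1 by auto
  define P where "P = bag p \<union> bag y1"
  have Pd: "P \<inter> bag d = {}" using bagd[OF m(3,1)] bagd[OF m(4,1)] d y1 by (auto simp: P_def)
  have Px: "P \<inter> bag x = {}" using bagd[OF m(3,2)] bagd[OF m(4,2)] x y1 by (auto simp: P_def)
  have Pn: "v \<notin> P" "t \<notin> P" "P \<subseteq> V - ?K" using bagV bagt m ne yX[OF y1(1)] by (auto simp: P_def)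
  have Pt: "touches E (bag d) P" "touches E (bag x) P"
    unfolding P_def using reach[of d y1 p] reach[of x y1 p] d x y1 by auto
  have Pc: "conn_set E P" unfolding P_def by (rule cu[OF y1(1)]) simp
  have "touches E P Q"
  proof -
    have "touches E (bag y1) (bag q)" using yr[OF y1(1), of q] touches_sym[OF s] by blast
    then show ?thesis using Q(1) by (auto simp: P_def touches_def)
  qed
  have kk: "v \<notin> ?K" "t \<notin> ?K" using C0(3) RV tX by auto
  have tou: "touches E (insert a B) C'" if "touches E B C'" for a B C' using that by (auto simp: touches_def)
  have cv: "conn_set E (insert v (bag d))"
  proof -
    obtain z where "z \<in> bag d" "E v z" using d(5) by (auto simp: touches_def)
    then show ?thesis using conn_set_insert[OF s bagc[OF d(1)]] by blast
  qed
  have ct: "conn_set E (insert t (bag x))"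
  proof -
    obtain z where "z \<in> bag x" "E t z" using x(6) by (auto simp: touches_def)
    then show ?thesis using conn_set_insert[OF s bagc[OF x(1)]] by blast
  qed
  have "rooted_clique E (V - ?K) {v, t, p, q}
    (\<lambda>z. if z = v then insert v (bag d) else if z = t then insert t (bag x) else if z = p then P else Q)"
  proof (rule rooted_clique_four[OF s d4])
    show "v \<in> insert v (bag d)" "t \<in> insert t (bag x)" "p \<in> P" "q \<in> Q" using bagi Q(1) by (auto simp: P_def)
    show "insert v (bag d) \<subseteq> V - ?K" "insert t (bag x) \<subseteq> V - ?K" using bagV m vtV kk by auto
    show "insert v (bag d) \<inter> insert t (bag x) = {}" using bagd[OF m(1,2)] x(5) bagV[OF m(2)] bagt[OF d(2)] ne(6) by auto
    show "insert v (bag d) \<inter> P = {}" "insert t (bag x) \<inter> P = {}" using Pd Px Pn by auto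
    show "insert v (bag d) \<inter> Q = {}" "insert t (bag x) \<inter> Q = {}" "P \<inter> Q = {}" using Q(4-9) by (auto simp: P_def)
    show "touches E (insert v (bag d)) (insert t (bag x))" using vt by (auto simp: touches_def)
    show "touches E (insert v (bag d)) P" "touches E (insert v (bag d)) Q" "touches E (insert t (bag x)) P" "touches E (insert t (bag x)) Q"
      using tou Pt Q(10,11) by blast+
  qed (use Pn Pc Q cv ct \<open>touches E P Q\<close> in simp_all)
  then show ?thesis by blast
qed

text \<open>
  The heavy component with its boundary made complete is \<open>K\<^sub>2\<^sub>,\<^sub>2\<^sub>,\<^sub>2\<^sub>,\<^sub>2\<close>, so each boundary vertex has three neighbours in it.
  Without the edges at \<open>v\<close> this leaves fewer edges than a heavy component has.
\<close>
theorem contradiction: False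
proof -
  obtain u where u: "u \<in> R" and heavy: "8 * card (K u) + 1 \<le> arcs_between E (K u) (K u) + 2 * arcs_between E (K u) X"
    using heavy_component by blast
  note C = comp_props[OF u]
  have finK: "finite (K u)" by (rule finite_subset[OF subset_trans[OF C(3) RV(1)] finV])
  obtain A where A: "nbh E (K u) = insert v A" "A \<subseteq> X" "t \<in> A" "card A = 3" "\<forall>x\<in>A. \<forall>y\<in>A. x \<noteq> y \<longrightarrow> F x y"
    using comp_boundary_ex[OF u] by blast
  have finA: "finite A" using A(2) finX finite_subset by blast
  have "card (A - {t}) = 2" using A(3,4) finA by simp
  then obtain p q where pq: "A - {t} = {p, q}" "p \<noteq> q" by (auto simp: card_2_iff)
  then have Aeq: "A = {t, p, q}" and ne: "p \<noteq> t" "q \<noteq> t" using A(3) by auto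
  have vA: "v \<notin> A" using A(2) vX by blast
  let ?T = "{v, t, p, q}"
  have T: "nbh E (K u) = ?T" using A(1) Aeq by simp
  have dist: "distinct [v, t, p, q]" using vA Aeq ne pq(2) by auto
  obtain L where L: "rooted_clique E (V - K u) ?T L"
    using clique_supply[OF u T dist] A(2,5) Aeq ne pq(2) by auto
  have c4: "card ?T = 4" using dist by simp
  have KT: "K u \<inter> ?T = {}" using T nbh_disjoint[of "K u" E] by auto
  have KA: "arcs_between E (K u) X = arcs_between E (K u) A"
  proof -
    have "A \<union> (X - A) = X" using A(2) by blast
    then have "arcs_between E (K u) X = arcs_between E (K u) A + arcs_between E (K u) (X - A)"
      using arcs_between_Un_right[of A "X - A" E "K u"] finA finX by simp
    moreover have "arcs_between E (K u) (X - A) = 0"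
    proof (rule arcs_between_eq_0)
      fix a b assume ab: "a \<in> K u" "b \<in> X - A"
      then have "b \<notin> K u" "b \<notin> nbh E (K u)" using C(3) RV A(1) vX by auto
      then show "\<not> E a b" using ab(1) by (auto simp: nbh_def)
    qed
    ultimately show ?thesis by simp
  qed
  have TA: "?T = {v} \<union> A" using Aeq by auto
  have KTs: "arcs_between E (K u) ?T = arcs_between E (K u) {v} + arcs_between E (K u) A"
    unfolding TA by (rule arcs_between_Un_right) (use finA vA in auto)
  have v1: "1 \<le> arcs_between E (K u) {v}"
  proof -
    have "v \<in> nbh E (K u)" using T by simp
    then obtain k where k: "k \<in> K u" "E k v" by (auto simp: nbh_def)
    have "arcs_between E {k} {v} \<le> arcs_between E (K u) {v}"
      unfolding arcs_between_def by (rule sum_mono2[OF finK]) (use k in auto)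
    then show ?thesis using k by (simp add: arcs_between_def)
  qed
  have "even (arcs_between E (K u) (K u))" by (rule even_arcs[OF G finK])
  then obtain m where m: "arcs_between E (K u) (K u) = 2 * m" by (rule evenE)
  have "8 * card (K u) + 4 \<le> arcs_between E (K u) (K u) + 2 * arcs_between E (K u) ?T"
    using heavy KA KTs v1 m by simp presburger
  moreover have "K u \<union> ?T \<noteq> V"
  proof
    assume "K u \<union> ?T = V"
    then have "X \<subseteq> ?T" using XV C(3) RV by blast
    then have "card X \<le> card ?T" by (rule card_mono[rotated]) simp
    then show False using cX c4 by simp
  qed
  moreover have KV: "K u \<subseteq> V" "K u \<noteq> {}" using C RV by auto
  ultimately have co': "cocktail (K u \<union> ?T) (fill ?T (K u) E)"
    using heavy_side[OF IH G k4 noK KV T c4 _ L] by blast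
  have TV: "K u \<union> ?T \<subseteq> V" using KV(1) T nbh_subset[OF G, of "K u"] by blast
  have three: "\<forall>z\<in>?T. card {y \<in> K u. E z y} = 3"
    using cocktail_fill_pairs[OF co' G TV c4 KT] by blast
  have AK: "arcs_between E (K u) A = 9"
  proof -
    have "arcs_between E (K u) A = arcs_between E A (K u)" by (rule arcs_between_sym[OF s])
    also have "\<dots> = (\<Sum>z\<in>A. card {y \<in> K u. E z y})" by (rule arcs_between_eq_sum_card[OF finK])
    also have "\<dots> = (\<Sum>z\<in>A. 3)" by (rule sum.cong) (use three Aeq in auto)
    finally show ?thesis using A(4) by simp
  qed
  have vK: "arcs_between E (K u) {v} = 3"
  proof -
    have "arcs_between E (K u) {v} = arcs_between E {v} (K u)" by (rule arcs_between_sym[OF s])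
    also have "\<dots> = card {y \<in> K u. E v y}" using finK by (simp add: arcs_between_eq_sum_card)
    finally show ?thesis using three by simp
  qed
  have "card (K u \<union> ?T) = 8" using co' by (simp add: cocktail_def)
  then have cK: "card (K u) = 4" using card_Un_disjoint[OF finK _ KT] c4 by simp
  have "arcs_between E (K u) (K u) = 12"
    using cocktail_arcs[OF co'] arcs_fill[OF G TV KT] KTs AK vK c4 by simp
  then show False using heavy KA AK cK by simp
qed

end

section \<open>The theorem for adjacency predicates\<close>

lemma arcs_le_complete:
  assumes G: "ugraph V E"
  shows "arcs_between E V V \<le> card V * (card V - 1)"
proof -
  have "dg E u \<le> card V - 1" if "u \<in> V" for u
  proof -
    have "{y. E u y} \<subseteq> V - {u}" using ugraph_in[OF G] by blast
    then have "dg E u \<le> card (V - {u})" unfolding dg_def by (rule card_mono[rotated]) (use ugraph_finite[OF G] in simp)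
    then show ?thesis using that ugraph_finite[OF G] by simp
  qed
  then have "(\<Sum>u\<in>V. dg E u) \<le> (\<Sum>u\<in>V. card V - 1)" by (rule sum_mono)
  then show ?thesis using arcs_eq_sum_dg[OF G, of V] by simp
qed

lemma K7v_seven_dense:
  assumes G: "ugraph V E" and V: "card V = 7" and arcs: "40 \<le> arcs_between E V V"
  shows "K7v_minor V E"
proof -
  have fin: "finite V" by (rule ugraph_finite[OF G])
  define A where "A = {(a, b). a \<in> V \<and> b \<in> V \<and> E a b}"
  define B where "B = {(a, b). a \<in> V \<and> b \<in> V \<and> a \<noteq> b \<and> \<not> E a b}"
  have cA: "40 \<le> card A" using arcs arcs_between_eq_card[OF fin fin, of E] by (simp add: A_def)
  have finAB: "finite A" "finite B"
    by (rule finite_subset[of _ "V \<times> V"]; use fin in \<open>auto simp: A_def B_def\<close>)+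
  have "A \<inter> B = {}" "(A \<union> B) \<inter> Id_on V = {}" using ugraph_in[OF G] by (auto simp: A_def B_def)
  moreover have "A \<union> B \<union> Id_on V = V \<times> V" by (auto simp: A_def B_def)
  moreover have "card (Id_on V) = 7"
  proof -
    have "Id_on V = (\<lambda>x. (x, x)) ` V" by auto
    then show ?thesis using card_image[of "\<lambda>x. (x, x)" V] V by (simp add: inj_on_def)
  qed
  moreover have "finite (Id_on V)" by (rule finite_subset[of _ "V \<times> V"]) (use fin in auto)
  ultimately have "card A + card B + 7 = 49"
    using card_Un_disjoint[of "A \<union> B" "Id_on V"] card_Un_disjoint[of A B] finAB card_cartesian_product[of V V] V by simp
  then have cB: "card B \<le> 2" using cA by simp
  show ?thesis
  proof (cases "B = {}")
    case True
    then have "E a b" if "a \<in> V" "b \<in> V" "a \<noteq> b" for a b using that by (auto simp: B_def)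
    then show ?thesis using K7v_seven_one[OF ugraph_symp[OF G] V] by blast
  next
    case False
    then obtain p q where pq: "(p, q) \<in> B" by auto
    then have qp: "(q, p) \<in> B" "p \<noteq> q" using ugraph_sym[OF G] by (auto simp: B_def)
    have "{(p, q), (q, p)} \<subseteq> B" "card {(p, q), (q, p)} = 2" using pq qp by auto
    then have Beq: "B = {(p, q), (q, p)}" using card_seteq[OF finAB(2), of "{(p, q), (q, p)}"] cB by simp
    show ?thesis
    proof (rule K7v_seven_one[OF ugraph_symp[OF G] V])
      fix a b assume ab: "a \<in> V" "b \<in> V" "a \<noteq> b" "{a, b} \<noteq> {p, q}"
      then have "(a, b) \<notin> B" unfolding Beq by auto
      then show "E a b" using ab by (auto simp: B_def)
    qed
  qed
qed

text \<open>
  With at most eight vertices the complement has at most four edges. Otherwise the minimum degree is at least four, and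
  the two cases for it are treated above.
\<close>
theorem dense_four_connected:
  fixes V :: "'a set"
  assumes "ugraph V E" "k_conn 4 V E" "dense V E"
  shows "K7v_minor V E \<or> cocktail V E"
  using assms
proof (induction "card V" arbitrary: V E rule: less_induct)
  case less
  note G = less.prems(1) and k = less.prems(2) and dense = less.prems(3)
  have n4: "4 < card V" using k by (simp add: k_conn_def)
  have le: "arcs_between E V V \<le> card V * (card V - 1)" by (rule arcs_le_complete[OF G])
  have d: "8 * card V \<le> arcs_between E V V + 16" using dense by (simp add: dense_def)
  have IH: "holds_below TYPE('a) (card V)" unfolding holds_below_def using less.hyps by blast
  have "card V \<noteq> 5" "card V \<noteq> 6" using d le by auto
  then consider "card V = 7" | "card V = 8" | "9 \<le> card V" using n4 by linarith
  then show ?case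
  proof cases
    case 1
    then show ?thesis using K7v_seven_dense[OF G] d by simp
  next
    case 2
    then show ?thesis using K7v_eight[OF G 2] d G by (auto simp: cocktail_def)
  next
    case 3
    show ?thesis
    proof (rule ccontr)
      assume "\<not> ?thesis"
      then have noK: "\<not> K7v_minor V E" by blast
      have d4: "4 \<le> dg E v" if "v \<in> V" for v
        using nbh_small_set[OF G k 3, of "{v}"] that by (simp add: nbh_single[OF G] dg_def)
      show False
      proof (cases "\<forall>v\<in>V. 5 \<le> dg E v")
        case True
        then interpret min_degree_five V E by unfold_locales (use IH G k dense noK 3 in auto)
        show False by (rule contradiction)
      next
        case False
        then obtain v0 where "v0 \<in> V" "\<not> 5 \<le> dg E v0" by blast
        then have "dg E v0 = 4" using d4[of v0] by simp
        then obtain v t where vt: "dg E v = 4" "E v t" "admissible (contract t v E)" using good_contraction[OF G k 3] by blast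
        have tv: "E t v" using ugraph_sym[OF G vt(2)] .
        have vV: "v \<in> V" "t \<noteq> v" using ugraph_in[OF G vt(2)] by auto
        have fin: "finite V" by (rule ugraph_finite[OF G])
        have cV: "card (V - {v}) = card V - 1" using vV fin by simp
        have "k_conn 3 (V - {v}) (contract t v E)"
        proof (rule k_conn_contract[OF G tv k])
          fix C assume C: "C \<subseteq> V" "C \<noteq> {}" "C \<union> nbh E C \<noteq> V"
          show "3 < card (nbh E C)" using k_connD[OF k C] by simp
        qed (use 3 in auto)
        moreover have "dense (V - {v}) (contract t v E)"
        proof -
          have "{z. E t z \<and> E v z} \<subseteq> {z. E v z} - {t}" using ugraph_in[OF G] by blast
          then have "card {z. E t z \<and> E v z} \<le> card ({z. E v z} - {t})"
            by (rule card_mono[rotated]) (use finite_edges_at[OF G] in simp)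
          also have "\<dots> = 3" using vt(1,2) finite_edges_at[OF G, of v] by (simp add: dg_def)
          finally show ?thesis using arcs_contract[OF G tv] d cV 3 by (simp add: dense_def)
        qed
        moreover have "\<not> K7v_minor (V - {v}) (contract t v E)" using K7v_contract[OF G tv] noK by blast
        ultimately obtain X \<D> where P: "piece (V - {v}) (contract t v E) X \<D>"
          using piece_exists[OF IH ugraph_contract[OF G tv] _ _ vt(3)] cV 3 by auto
        interpret degree_four V E v t X \<D> by unfold_locales (use IH G k dense noK 3 vt P in auto)
        show False by (rule contradiction)
      qed
    qed
  qed
qed

section \<open>Translation to symmetric digraphs\<close>

definition graph_of :: "'a set \<Rightarrow> ('a \<Rightarrow> 'a \<Rightarrow> bool) \<Rightarrow> 'a pair_pre_digraph" where
  "graph_of V E = \<lparr>pverts = V, parcs = {(x, y). E x y}\<rparr>"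

lemma graph_of_simps [simp]: "pverts (graph_of V E) = V" "parcs (graph_of V E) = {(x, y). E x y}"
  by (simp_all add: graph_of_def)

lemma pair_graph_graph_of:
  assumes "ugraph V E"
  shows "pair_graph (graph_of V E)"
proof
  show "finite (parcs (graph_of V E))"
    by (rule finite_subset[of _ "V \<times> V"]) (use assms in \<open>auto simp: ugraph_def\<close>)
  show "symmetric (with_proj (graph_of V E))" using ugraph_sym[OF assms] by (auto simp: symmetric_def sym_def)
qed (use assms in \<open>auto simp: ugraph_def\<close>)

lemma ugraph_of_pair_graph:
  assumes "pair_graph G"
  shows "ugraph (pverts G) (\<lambda>x y. (x, y) \<in> parcs G)"
proof -
  interpret pair_graph G by (rule assms)
  have "sym (parcs G)" using pair_sym_arcs by (simp add: symmetric_def)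
  then show ?thesis
    using pair_finite_verts arc_fst_in_verts arc_snd_in_verts pair_no_loops unfolding ugraph_def sym_def by fastforce
qed

text \<open>
  If the boundary of \<open>C\<close> were small, then a walk that avoids it could not leave \<open>C\<close>.
\<close>
lemma k_conn_of_k_connected:
  assumes G: "pair_graph G" and k: "k_connected k G"
  shows "k_conn k (pverts G) (\<lambda>x y. (x, y) \<in> parcs G)"
  unfolding k_conn_def
proof (intro conjI allI impI)
  let ?V = "pverts G" and ?E = "\<lambda>x y. (x, y) \<in> parcs G"
  note U = ugraph_of_pair_graph[OF G]
  show "k < card ?V" using k by (simp add: k_connected_def)
  fix C assume C: "C \<subseteq> ?V \<and> C \<noteq> {} \<and> C \<union> nbh ?E C \<noteq> ?V"
  let ?S = "nbh ?E C"
  have SV: "?S \<subseteq> ?V" by (rule nbh_subset[OF U])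
  show "k \<le> card ?S"
  proof (rule ccontr)
    assume "\<not> ?thesis"
    then have "Digraph_Component.connected (with_proj G \<restriction> (?V - ?S))" using k SV by (simp add: k_connected_def)
    then have conn: "strongly_connected (mk_symmetric (with_proj G \<restriction> (?V - ?S)))"
      by (simp add: Digraph_Component.connected_def)
    obtain u w where uw: "u \<in> C" "w \<in> ?V" "w \<notin> C" "w \<notin> ?S" using C SV by blast
    have "u \<in> ?V - ?S" using uw C nbh_disjoint[of C ?E] by blast
    then have "u \<rightarrow>\<^sup>*\<^bsub>mk_symmetric (with_proj G \<restriction> (?V - ?S))\<^esub> w"
      using conn uw unfolding strongly_connected_def by simp
    then have "(u, w) \<in> (parcs (mk_symmetric (with_proj G \<restriction> (?V - ?S))))\<^sup>*"
      using reachable_rtranclI by fastforce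
    then have "w \<in> C"
    proof (induction rule: rtrancl_induct)
      case (step y z)
      then have "(y, z) \<in> parcs G \<or> (z, y) \<in> parcs G" "z \<notin> ?S" by (auto simp: parcs_mk_symmetric)
      then have "?E y z" using ugraph_sym[OF U] by blast
      then show ?case using step.IH \<open>z \<notin> ?S\<close> by (auto simp: nbh_def)
    qed (rule uw(1))
    then show False using uw by blast
  qed
qed

text \<open>The arcs \<open>(u, v)\<close> and \<open>(v, u)\<close> are mapped to the same edge.\<close>
lemma card_edges_le:
  assumes "pair_graph G"
  shows "2 * card (edges G) \<le> card (parcs G)"
proof -
  interpret pair_graph G by (rule assms)
  note U = ugraph_of_pair_graph[OF assms]
  let ?f = "\<lambda>(u, v). {u, v}"
  have e: "edges G = ?f ` parcs G" by (auto simp: edges_def)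
  have "2 * card (edges G) = (\<Sum>y\<in>edges G. 2)" by simp
  also have "\<dots> \<le> (\<Sum>y\<in>?f ` parcs G. card {x \<in> parcs G. ?f x = y})"
    unfolding e
  proof (rule sum_mono)
    fix y assume "y \<in> ?f ` parcs G"
    then obtain u v where uv: "(u, v) \<in> parcs G" "y = {u, v}" by auto
    then have "(v, u) \<in> parcs G" "u \<noteq> v" using ugraph_sym[OF U] ugraph_in[OF U] by blast+
    then have "{(u, v), (v, u)} \<subseteq> {x \<in> parcs G. ?f x = y}" "card {(u, v), (v, u)} = 2" using uv by auto
    then show "2 \<le> card {x \<in> parcs G. ?f x = y}"
      using card_mono[of "{x \<in> parcs G. ?f x = y}" "{(u, v), (v, u)}"] pair_finite_arcs by simp
  qed
  also have "\<dots> = card (parcs G)"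
    using sum.image_gen[OF pair_finite_arcs, of "\<lambda>_. 1::nat" ?f] by simp
  finally show ?thesis .
qed

lemma digraph_isoI:
  assumes U: "ugraph V E" and g: "bij_betw g (pverts K) V" and K: "parcs K \<subseteq> pverts K \<times> pverts K"
    and e: "\<And>a b. a \<in> pverts K \<Longrightarrow> b \<in> pverts K \<Longrightarrow> E (g a) (g b) \<longleftrightarrow> (a, b) \<in> parcs K"
  shows "digraph_iso (with_proj (graph_of V E)) (with_proj K)"
proof -
  define h where "h = the_inv_into (pverts K) g"
  have inj: "inj_on g (pverts K)" and im: "g ` pverts K = V" using g by (auto simp: bij_betw_def)
  have hg: "h (g a) = a" if "a \<in> pverts K" for a using that by (simp add: h_def the_inv_into_f_f[OF inj])
  have gh: "g (h x) = x" "h x \<in> pverts K" if x: "x \<in> V" for x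
  proof -
    obtain a where "a \<in> pverts K" "x = g a" using im x by blast
    then show "g (h x) = x" "h x \<in> pverts K" using hg by simp_all
  qed
  have hV: "h ` V = pverts K" unfolding im[symmetric] image_image using hg by simp
  have injh: "inj_on h V" by (rule inj_on_inverseI[of _ g]) (rule gh)
  have arcs: "map_prod h h ` {(x, y). E x y} = parcs K"
  proof
    show "map_prod h h ` {(x, y). E x y} \<subseteq> parcs K"
    proof clarsimp
      fix x y assume xy: "E x y"
      then have "x \<in> V" "y \<in> V" using ugraph_in[OF U] by blast+
      then show "(h x, h y) \<in> parcs K" using e[of "h x" "h y"] gh xy by simp
    qed
    show "parcs K \<subseteq> map_prod h h ` {(x, y). E x y}"
    proof
      fix p assume p: "p \<in> parcs K"
      obtain a b where ab: "p = (a, b)" by (cases p)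
      then have "a \<in> pverts K" "b \<in> pverts K" using p K by auto
      then have "E (g a) (g b)" "p = map_prod h h (g a, g b)" using e p ab hg by simp_all
      then show "p \<in> map_prod h h ` {(x, y). E x y}" by blast
    qed
  qed
  interpret pair_graph "graph_of V E" by (rule pair_graph_graph_of[OF U])
  define f where "f = \<lparr>iso_verts = h, iso_arcs = map_prod h h, iso_head = snd, iso_tail = fst\<rparr>"
  have "inj_on (map_prod h h) {(x, y). E x y}"
  proof (rule inj_onI, clarsimp)
    fix x y x' y' assume "E x y" "E x' y'" "h x = h x'" "h y = h y'"
    then show "x = x' \<and> y = y'" using inj_onD[OF injh] ugraph_in[OF U] by metis
  qed
  moreover have "wf_digraph (with_proj (graph_of V E))" by unfold_locales
  ultimately have "pre_digraph.digraph_isomorphism (with_proj (graph_of V E)) f"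
    unfolding pre_digraph.digraph_isomorphism_def using injh by (auto simp: f_def)
  moreover have "with_proj K = app_iso f (with_proj (graph_of V E))"
    using hV arcs by (simp add: app_iso_def with_proj_def f_def)
  ultimately show ?thesis unfolding digraph_iso_def by blast
qed

text \<open>The labels come from choosing, four times, a vertex outside the pairs chosen before.\<close>
lemma cocktail_iso:
  assumes co: "cocktail V E"
  shows "digraph_iso (with_proj (graph_of V E)) (with_proj K_2222)"
proof -
  have G: "ugraph V E" "card V = 8" using co by (auto simp: cocktail_def)
  have fin: "finite V" by (rule ugraph_finite[OF G(1)])
  obtain mu where mu: "\<And>x. x \<in> V \<Longrightarrow> mu x \<in> V \<and> mu x \<noteq> x \<and> \<not> E x (mu x) \<and> (\<forall>y\<in>V. y \<noteq> x \<longrightarrow> y \<noteq> mu x \<longrightarrow> E x y)"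
    using cocktail_unique_nonneighbour[OF co] by metis
  have es: "E x y \<Longrightarrow> E y x" and nr: "\<not> E x x" for x y using ugraph_sym[OF G(1)] ugraph_in[OF G(1)] by blast+
  have inv: "mu (mu x) = x" if "x \<in> V" for x
  proof (rule ccontr)
    assume "mu (mu x) \<noteq> x"
    then have "E (mu x) x" using mu[OF that] mu[of "mu x"] that by metis
    then show False using mu[OF that] es by blast
  qed
  have pick: "\<exists>a\<in>V. a \<notin> set xs" if "length xs < 8" for xs :: "'a list"
  proof (rule ccontr)
    assume "\<not> ?thesis"
    then have "card V \<le> card (set xs)" by (intro card_mono) auto
    then show False using card_length[of xs] that G(2) by simp
  qed
  obtain a0 where a0: "a0 \<in> V" using pick[of "[]"] by auto
  obtain a1 where a1: "a1 \<in> V" "a1 \<notin> {a0, mu a0}" using pick[of "[a0, mu a0]"] by auto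
  obtain a2 where a2: "a2 \<in> V" "a2 \<notin> {a0, mu a0, a1, mu a1}" using pick[of "[a0, mu a0, a1, mu a1]"] by auto
  obtain a3 where a3: "a3 \<in> V" "a3 \<notin> {a0, mu a0, a1, mu a1, a2, mu a2}"
    using pick[of "[a0, mu a0, a1, mu a1, a2, mu a2]"] by auto
  define a where "a = (\<lambda>i. [a0, a1, a2, a3] ! i)"
  have av: "a 0 = a0" "a 1 = a1" "a (Suc 0) = a1" "a 2 = a2" "a 3 = a3" by (simp_all add: a_def)
  have lt4: "i < 4 \<longleftrightarrow> i = 0 \<or> i = 1 \<or> i = 2 \<or> i = 3" for i :: nat by auto
  have aV: "a i \<in> V" if "i < 4" for i using that a0 a1 a2 a3 unfolding lt4 by (auto simp: av)
  have less: "a j \<noteq> a i \<and> a j \<noteq> mu (a i)" if "i < j" "j < 4" for i j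
  proof -
    have "i = 0 \<and> (j = 1 \<or> j = 2 \<or> j = 3) \<or> i = 1 \<and> (j = 2 \<or> j = 3) \<or> i = 2 \<and> j = 3" using that by arith
    then show ?thesis using a1 a2 a3 by (auto simp: av)
  qed
  have sep: "a i \<noteq> a j \<and> a i \<noteq> mu (a j) \<and> mu (a i) \<noteq> mu (a j)" if "i < 4" "j < 4" "i \<noteq> j" for i j
  proof (cases "i < j")
    case True
    then show ?thesis using less[of i j] that inv[OF aV[OF that(1)]] inv[OF aV[OF that(2)]] by metis
  next
    case False
    then show ?thesis using less[of j i] that inv[OF aV[OF that(1)]] inv[OF aV[OF that(2)]] by (metis linorder_neqE_nat)
  qed
  define g where "g = (\<lambda>(i, j::nat). if j = 0 then a i else mu (a i))"
  have P: "pverts K_2222 = {..<4} \<times> {..<2}" by (simp add: K_2222_def)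
  have gV: "g p \<in> V" if "p \<in> pverts K_2222" for p using that aV mu unfolding P by (auto simp: g_def)
  have E: "E (g p) (g q) \<longleftrightarrow> fst p \<noteq> fst q" if pq: "p \<in> pverts K_2222" "q \<in> pverts K_2222" for p q
  proof -
    obtain i k j l where ijkl: "p = (i, k)" "q = (j, l)" "i < 4" "j < 4" "k < 2" "l < 2" using pq unfolding P by auto
    show ?thesis
    proof (cases "i = j")
      case True
      then show ?thesis using ijkl mu[OF aV[OF ijkl(3)]] nr es by (auto simp: g_def)
    next
      case False
      have d: "g p \<noteq> g q" "g q \<noteq> mu (g p)"
        using sep[OF ijkl(3,4) False] sep[OF ijkl(4,3)] False inv[OF aV[OF ijkl(3)]] ijkl by (auto simp: g_def)
      then show ?thesis using mu[OF gV[OF pq(1)]] gV[OF pq(2)] False ijkl(1,2) by auto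
    qed
  qed
  have inj: "inj_on g (pverts K_2222)"
  proof
    fix p q assume pq: "p \<in> pverts K_2222" "q \<in> pverts K_2222" "g p = g q"
    obtain i k j l where ijkl: "p = (i, k)" "q = (j, l)" "i < 4" "j < 4" "k < 2" "l < 2" using pq unfolding P by auto
    have ij: "i = j" using E[OF pq(1,2)] pq(3) nr ijkl by auto
    then have "k = 0 \<longleftrightarrow> l = 0" using pq(3) ijkl mu[OF aV[OF ijkl(3)]] by (auto simp: g_def split: if_splits)
    then show "p = q" using ij ijkl by auto
  qed
  have "card (pverts K_2222) = 8" by (simp add: P)
  then have "card (g ` pverts K_2222) = card V" using card_image[OF inj] G(2) by simp
  moreover have "g ` pverts K_2222 \<subseteq> V" using gV by blast
  ultimately have "g ` pverts K_2222 = V" using card_subset_eq[OF fin] by blast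
  then have bij: "bij_betw g (pverts K_2222) V" using inj by (simp add: bij_betw_def)
  show ?thesis
  proof (rule digraph_isoI[OF G(1) bij])
    show "parcs K_2222 \<subseteq> pverts K_2222 \<times> pverts K_2222" by (auto simp: K_2222_def)
    show "E (g p) (g q) \<longleftrightarrow> (p, q) \<in> parcs K_2222" if "p \<in> pverts K_2222" "q \<in> pverts K_2222" for p q
      using E[OF that] that by (auto simp: K_2222_def)
  qed
qed

lemma contract_edge_graph_of:
  assumes G: "ugraph V E" and uv: "E u v"
  shows "contract_edge u v (graph_of V E) = graph_of (V - {v}) (contract u v E)"
proof -
  let ?f = "\<lambda>w. if w = v then u else w"
  have uv': "u \<in> V" "v \<in> V" "u \<noteq> v" using ugraph_in[OF G uv] by auto
  have "?f ` V = V - {v}" using uv' by auto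
  moreover have "map_prod ?f ?f ` {(x, y). E x y} - Id = {(x, y). contract u v E x y}"
  proof
    show "map_prod ?f ?f ` {(x, y). E x y} - Id \<subseteq> {(x, y). contract u v E x y}"
      using uv' by (auto simp: contract_def split: if_splits)
    show "{(x, y). contract u v E x y} \<subseteq> map_prod ?f ?f ` {(x, y). E x y} - Id"
    proof clarify
      fix x y assume c: "contract u v E x y"
      then have n: "x \<noteq> v" "y \<noteq> v" "x \<noteq> y" "E x y \<or> x = u \<and> E v y \<or> y = u \<and> E x v" by (auto simp: contract_def)
      then consider "E x y" | "x = u" "E v y" | "y = u" "E x v" by blast
      then have "(x, y) \<in> map_prod ?f ?f ` {(x, y). E x y}"
      proof cases
        case 1
        then show ?thesis using n by (intro image_eqI[of _ _ "(x, y)"]) auto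
      next
        case 2
        then show ?thesis using n by (intro image_eqI[of _ _ "(v, y)"]) auto
      next
        case 3
        then show ?thesis using n by (intro image_eqI[of _ _ "(x, v)"]) auto
      qed
      then show "(x, y) \<in> map_prod ?f ?f ` {(x, y). E x y} - Id" using n by simp
    qed
  qed
  ultimately show ?thesis by (simp add: contract_edge_def Let_def graph_of_def)
qed

lemma K7_vee_simps: "pverts K7_vee = {..<7}" "(i, j) \<in> parcs K7_vee \<longleftrightarrow> vee_adj i j"
  by (auto simp: K7_vee_def delete_edges_def complete_graph_def vee_adj_def)

lemma vee_adj_sym: "vee_adj i j \<Longrightarrow> vee_adj j i"
  by (auto simp: vee_adj_def insert_commute)

text \<open>Contracting an edge inside a branch set keeps the model, so the branch sets can be contracted to single vertices.\<close>
lemma contract_branch_sets: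
  assumes "ugraph V E" "V = (\<Union>i<7. B i)" "\<forall>i<7. conn_set E (B i)" "\<forall>i<7. \<forall>j<7. i \<noteq> j \<longrightarrow> B i \<inter> B j = {}"
    "\<forall>i<7. \<forall>j<7. i \<noteq> j \<longrightarrow> (vee_adj i j \<longleftrightarrow> touches E (B i) (B j))"
  shows "\<exists>L. contraction_step\<^sup>*\<^sup>* (graph_of V E) L \<and> digraph_iso (with_proj L) (with_proj K7_vee)"
  using assms
proof (induction "card V" arbitrary: V E B rule: less_induct)
  case less
  note G = less.prems(1) and V = less.prems(2) and c = less.prems(3) and dis = less.prems(4) and t = less.prems(5)
  show ?case
  proof (cases "\<forall>i<7. \<exists>b. B i = {b}")
    case True
    then obtain b where b: "\<And>i. i < 7 \<Longrightarrow> B i = {b i}" by metis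
    have "inj_on b {..<7}"
    proof
      fix i j assume ij: "i \<in> {..<7}" "j \<in> {..<7}" "b i = b j"
      then show "i = j" using dis b by fastforce
    qed
    moreover have "b ` {..<7} = V" unfolding V using b by auto
    ultimately have bij: "bij_betw b (pverts K7_vee) V" by (simp add: bij_betw_def K7_vee_simps)
    have "digraph_iso (with_proj (graph_of V E)) (with_proj K7_vee)"
    proof (rule digraph_isoI[OF G bij])
      show "parcs K7_vee \<subseteq> pverts K7_vee \<times> pverts K7_vee"
        using K7_vee_simps(2) by (auto simp: K7_vee_simps(1) vee_adj_def)
      fix i j assume "i \<in> pverts K7_vee" "j \<in> pverts K7_vee"
      then have ij: "i < 7" "j < 7" by (simp_all add: K7_vee_simps)
      show "E (b i) (b j) \<longleftrightarrow> (i, j) \<in> parcs K7_vee"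
      proof (cases "i = j")
        case True
        then show ?thesis using ugraph_in[OF G, of "b i" "b i"] by (auto simp: K7_vee_simps vee_adj_def)
      next
        case False
        then show ?thesis using t ij b[OF ij(1)] b[OF ij(2)] by (simp add: K7_vee_simps touches_def)
      qed
    qed
    then show ?thesis by blast
  next
    case False
    then obtain k where k: "k < 7" "\<And>b. B k \<noteq> {b}" by blast
    obtain u where u: "u \<in> B k" using c k(1) conn_set_nonempty by blast
    have "{u} \<subseteq> B k \<and> {u} \<noteq> {} \<and> {u} \<noteq> B k" using u k(2) by auto
    then have "touches E {u} (B k - {u})" using c k(1) unfolding conn_set_def by blast
    then obtain v where v: "E u v" "v \<in> B k" "v \<noteq> u" by (auto simp: touches_def)
    let ?E = "contract u v E"
    define f where "f = (\<lambda>w. if w = v then u else w)"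
    define B' where "B' = B(k := B k - {v})"
    have only: "i = k" if "i < 7" "w \<in> B i" "w \<in> B k" for i w using dis that k(1) by blast
    have fB: "f w \<in> B' i \<longleftrightarrow> w \<in> B i" if "i < 7" for i w
    proof (cases "i = k")
      case True
      then show ?thesis using u v by (simp add: f_def B'_def)
    next
      case False
      then have "u \<notin> B i" "v \<notin> B i" using only[OF that] u v(2) by blast+
      then show ?thesis using False by (simp add: f_def B'_def)
    qed
    have Bf: "w \<in> B' i \<Longrightarrow> f w = w" if "i < 7" for i w
      using only[OF that, of v] v by (auto simp: f_def B'_def split: if_splits)
    have fE: "?E (f x) (f y)" if "E x y" "f x \<noteq> f y" for x y
      using that v(3) by (auto simp: contract_def f_def split: if_splits)
    have Ef: "\<exists>a b. f a = x \<and> f b = y \<and> E a b" if "?E x y" for x y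
      using that unfolding contract_def f_def by metis
    have tt: "touches ?E X Y \<longleftrightarrow> touches E {w. f w \<in> X} {w. f w \<in> Y}" if "X \<inter> Y = {}" for X Y
    proof
      assume "touches ?E X Y"
      then obtain x y where "x \<in> X" "y \<in> Y" "?E x y" by (auto simp: touches_def)
      then show "touches E {w. f w \<in> X} {w. f w \<in> Y}" using Ef[of x y] by (auto simp: touches_def)
    next
      assume "touches E {w. f w \<in> X} {w. f w \<in> Y}"
      then obtain x y where xy: "f x \<in> X" "f y \<in> Y" "E x y" by (auto simp: touches_def)
      have "f x \<noteq> f y" using xy(1,2) that by (metis IntI empty_iff)
      then have "?E (f x) (f y)" by (rule fE[OF xy(3)])
      then show "touches ?E X Y" using xy by (auto simp: touches_def)
    qed
    have B'eq: "{w. f w \<in> B' i} = B i" if "i < 7" for i using fB[OF that] by blast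
    have dis': "B' i \<inter> B' j = {}" if "i < 7" "j < 7" "i \<noteq> j" for i j using dis that by (auto simp: B'_def)
    have "\<exists>L. contraction_step\<^sup>*\<^sup>* (graph_of (V - {v}) ?E) L \<and> digraph_iso (with_proj L) (with_proj K7_vee)"
    proof (rule less.hyps)
      have "v \<in> V" using ugraph_in[OF G v(1)] by blast
      then show "card (V - {v}) < card V" using ugraph_finite[OF G] by (meson card_Diff1_less)
      show "ugraph (V - {v}) ?E" by (rule ugraph_contract[OF G v(1)])
      show "V - {v} = (\<Union>i<7. B' i)"
      proof
        show "V - {v} \<subseteq> (\<Union>i<7. B' i)" unfolding V by (auto simp: B'_def)
        show "(\<Union>i<7. B' i) \<subseteq> V - {v}"
        proof
          fix w assume "w \<in> (\<Union>i<7. B' i)"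
          then obtain i where i: "i < 7" "w \<in> B' i" by auto
          have "f w = w" by (rule Bf[OF i])
          then have "w \<noteq> v" "w \<in> B i" using v(3) fB[OF i(1), of w] i(2) by (auto simp: f_def)
          then show "w \<in> V - {v}" unfolding V using i(1) by auto
        qed
      qed
      show "\<forall>i<7. \<forall>j<7. i \<noteq> j \<longrightarrow> B' i \<inter> B' j = {}" using dis' by blast
      show "\<forall>i<7. \<forall>j<7. i \<noteq> j \<longrightarrow> (vee_adj i j \<longleftrightarrow> touches ?E (B' i) (B' j))"
        using t tt dis' B'eq by simp
      show "\<forall>i<7. conn_set ?E (B' i)"
        unfolding conn_set_def
      proof (intro allI impI conjI)
        fix i :: nat assume i: "i < 7"
        show "B' i \<noteq> {}"
        proof -
          obtain w where "w \<in> B i" using c i conn_set_nonempty by blast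
          then have "f w \<in> B' i" using fB[OF i] by blast
          then show ?thesis by blast
        qed
        fix A assume A: "A \<subseteq> B' i \<and> A \<noteq> {} \<and> A \<noteq> B' i"
        let ?A = "{w. f w \<in> A}"
        have sub: "?A \<subseteq> B i" using A fB[OF i] by blast
        have ne: "?A \<noteq> {}" using A Bf[OF i] by (metis (mono_tags, lifting) empty_Collect_eq ex_in_conv subset_eq)
        obtain w where w: "w \<in> B' i" "w \<notin> A" using A by blast
        have "w \<in> B i" "w \<notin> ?A" using w Bf[OF i w(1)] fB[OF i, of w] by auto
        then have "touches E ?A (B i - ?A)" using c i sub ne unfolding conn_set_def by blast
        moreover have "B i - ?A = {w. f w \<in> B' i - A}" using B'eq[OF i] by blast
        ultimately show "touches ?E A (B' i - A)" using tt[of A "B' i - A"] by simp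
      qed
    qed
    then obtain L where L: "contraction_step\<^sup>*\<^sup>* (graph_of (V - {v}) ?E) L" "digraph_iso (with_proj L) (with_proj K7_vee)" by blast
    have "contraction_step (graph_of V E) (graph_of (V - {v}) ?E)"
      unfolding contraction_step_def using v(1) contract_edge_graph_of[OF G v(1)]
      by (intro exI[of _ u] exI[of _ v]) simp
    then show ?thesis using L by (meson converse_rtranclp_into_rtranclp)
  qed
qed

text \<open>
  The subgraph keeps the edges inside the branch sets and those between branch sets that are adjacent in the target, because
  contraction cannot delete superfluous edges.
\<close>
lemma has_minor_K7_vee:
  assumes G: "pair_graph G" and K: "K7v_minor (pverts G) (\<lambda>x y. (x, y) \<in> parcs G)"
  shows "has_minor G K7_vee"
proof -
  let ?V = "pverts G" and ?E = "\<lambda>x y. (x, y) \<in> parcs G"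
  note U = ugraph_of_pair_graph[OF G]
  obtain B where B0: "minor_model ?V ?E {..<7} vee_adj B" using K unfolding K7v_minor_def by blast
  have B: "\<And>i. i < 7 \<Longrightarrow> B i \<subseteq> ?V \<and> conn_set ?E (B i)" "\<And>i j. i < 7 \<Longrightarrow> j < 7 \<Longrightarrow> i \<noteq> j \<Longrightarrow> B i \<inter> B j = {}"
    and t: "\<And>i j. i < 7 \<Longrightarrow> j < 7 \<Longrightarrow> vee_adj i j \<Longrightarrow> touches ?E (B i) (B j)"
    using B0 by (simp_all add: minor_model_def)
  define W where "W = (\<Union>i<7. B i)"
  define F where "F = (\<lambda>x y. ?E x y \<and> (\<exists>i<7. \<exists>j<7. (i = j \<or> vee_adj i j) \<and> x \<in> B i \<and> y \<in> B j))"
  have WV: "W \<subseteq> ?V" using B(1) by (auto simp: W_def)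
  have UF: "ugraph W F"
    unfolding ugraph_def
  proof (intro conjI allI impI)
    show "finite W" using WV ugraph_finite[OF U] finite_subset by blast
    fix x y assume "F x y"
    then obtain i j where ij: "?E x y" "i < 7" "j < 7" "i = j \<or> vee_adj i j" "x \<in> B i" "y \<in> B j" unfolding F_def by blast
    show "x \<in> W" "y \<in> W" "x \<noteq> y" using ij ugraph_in[OF U ij(1)] by (auto simp: W_def)
    have "j = i \<or> vee_adj j i" using ij(4) vee_adj_sym by blast
    then show "F y x" using ij ugraph_sym[OF U ij(1)] unfolding F_def by blast
  qed
  have idx: "i = j" if "i < 7" "j < 7" "x \<in> B i" "x \<in> B j" for i j x using B(2)[OF that(1,2)] that(3,4) by blast
  have conn: "conn_set F (B i)" if i: "i < 7" for i
  proof -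
    have "touches F A (B i - A)" if A: "A \<subseteq> B i \<and> A \<noteq> {} \<and> A \<noteq> B i" for A
    proof -
      have "touches ?E A (B i - A)" using B(1)[OF i] A unfolding conn_set_def by blast
      then obtain x y where "x \<in> A" "y \<in> B i - A" "?E x y" by (auto simp: touches_def)
      moreover from this have "F x y" using A i unfolding F_def by blast
      ultimately show ?thesis by (auto simp: touches_def)
    qed
    then show ?thesis using conn_set_nonempty[of ?E "B i"] B(1)[OF i] unfolding conn_set_def[of F] by blast
  qed
  have tF: "vee_adj i j \<longleftrightarrow> touches F (B i) (B j)" if ij: "i < 7" "j < 7" "i \<noteq> j" for i j
  proof
    assume a: "vee_adj i j"
    obtain x y where xy: "x \<in> B i" "y \<in> B j" "?E x y" using t[OF ij(1,2) a] by (auto simp: touches_def)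
    then have "F x y" unfolding F_def using ij a by blast
    then show "touches F (B i) (B j)" using xy by (auto simp: touches_def)
  next
    assume "touches F (B i) (B j)"
    then obtain x y where xy: "x \<in> B i" "y \<in> B j" "F x y" by (auto simp: touches_def)
    then obtain k l where kl: "k < 7" "l < 7" "k = l \<or> vee_adj k l" "x \<in> B k" "y \<in> B l" unfolding F_def by blast
    have "k = i" "l = j" using idx[OF kl(1) ij(1) kl(4) xy(1)] idx[OF kl(2) ij(2) kl(5) xy(2)] by auto
    then show "vee_adj i j" using kl(3) ij(3) by blast
  qed
  obtain L where L: "contraction_step\<^sup>*\<^sup>* (graph_of W F) L" "digraph_iso (with_proj L) (with_proj K7_vee)"
    using contract_branch_sets[OF UF W_def] conn B(2) tF by blast
  have pg: "pair_graph (graph_of W F)" by (rule pair_graph_graph_of[OF UF])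
  have "subgraph (with_proj (graph_of W F)) (with_proj G)"
  proof -
    interpret H: pair_graph "graph_of W F" by (rule pg)
    interpret G: pair_graph G by (rule G)
    show ?thesis
      unfolding subgraph_def compatible_def
      using WV H.wf_digraph_axioms G.wf_digraph_axioms by (auto simp: F_def)
  qed
  then show ?thesis unfolding has_minor_def using pg L by blast
qed

theorem theorem6:
  fixes G :: "'a pair_pre_digraph"
  assumes "pair_graph G"
    and "k_connected 4 G"
    and "int (card (edges G)) \<ge> 4 * int (card (pverts G)) - 8"
    and "\<not> digraph_iso (with_proj G) (with_proj K_2222)"
  shows "has_minor G K7_vee"
proof -
  let ?V = "pverts G" and ?E = "\<lambda>x y. (x, y) \<in> parcs G"
  note U = ugraph_of_pair_graph[OF assms(1)]
  have fin: "finite ?V" by (rule ugraph_finite[OF U])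
  have "{(a, b). a \<in> ?V \<and> b \<in> ?V \<and> (a, b) \<in> parcs G} = parcs G" using ugraph_in[OF U] by auto
  then have "arcs_between ?E ?V ?V = card (parcs G)" using arcs_between_eq_card[OF fin fin, of ?E] by simp
  then have "dense ?V ?E" using card_edges_le[OF assms(1)] assms(3) by (simp add: dense_def)
  then have "K7v_minor ?V ?E \<or> cocktail ?V ?E"
    by (rule dense_four_connected[OF U k_conn_of_k_connected[OF assms(1,2)]])
  moreover have "\<not> cocktail ?V ?E"
  proof
    assume "cocktail ?V ?E"
    then have "digraph_iso (with_proj (graph_of ?V ?E)) (with_proj K_2222)" by (rule cocktail_iso)
    moreover have "graph_of ?V ?E = G" by (simp add: graph_of_def)
    ultimately show False using assms(4) by simp
  qed
  ultimately show ?thesis using has_minor_K7_vee[OF assms(1)] by blast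
qed

end
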